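(* Let $g=\begin{pmatrix}a_0+a_1\pi&b_0+b_1\pi\\c_0+c_1\pi&d_0+d_1\pi\end{pmatrix}\in G_2^F$ with $a_m,b_m,c_m,d_m\in\mu_{q-1}(\mathcal O_F)\cup\{0\}$ ($m=0,1$), and put $\det(\bar g)=a_0d_0-b_0c_0$. Let $$\bar g(x,y)=\{(\bar a_0x+\bar c_0y)(\bar b_1x+\bar d_1y)^q-(\bar a_1x+\bar c_1y)^q(\bar b_0x+\bar d_0y)\}^q\in\mathbb F_q[x,y],$$ and, for $a,b\in\mathcal O_F$, $$f_{a,b}(x,y)=\frac{ax^{q^2}+by^{q^2}-(ax+by)^{q^2}}{\pi},\qquad G_0(x,y)=(a_0x+c_0y)^qf_{b_0,d_0}(x,y)-(b_0x+d_0y)^qf_{a_0,c_0}(x,y),$$ polynomials with coefficients in $\mathcal O_F$. Let $i\in(\mathcal O_F/\pi^2)^\times$, $ig=\det(g)\,i$, $j=(x_0,y_0)\in\mathcal S^i_{00}$, $jg=(\bar a_0x_0+\bar c_0y_0,\ \bar b_0x_0+\bar d_0y_0)\in\mathcal S^{ig}_{00}$, and $$f(j,g)=\bar g(x_0,y_0)+\overline G_0(x_0,y_0).$$ Then the right action of $g$ on $\mathcal X(\pi^2)$ induces the morphism $$g:X^i_j\to X^{ig}_{jg},\qquad(a,z_1)\mapsto\bigl(\overline{\det(\bar g)}\,a+f(j,g),\ z_1\bigr).$$ In particular, $\overline G_0(x,y)=0$ if ${\rm char}\,F>0$, or if ${\rm char}\,F=0$ and $e_{F/\mathbb Q_p}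\ge2$.
   Context: **Lubin–Tate space.** $F$ is a non-archimedean local field with ring of integers $\mathcal O_F$, uniformizer $\pi$, residue field $\mathbb F_q$ of characteristic $p\ne2$; $\mathbf C$ is the completion of an algebraic closure of $F$, with ring of integers $\mathcal O_{\mathbf C}$, residue field $k^{\rm ac}$ and valuation $v$, $v(\pi)=1$; $e_{F/\mathbb Q_p}=v(p)$ if ${\rm char}\,F=0$; a bar denotes reduction. If ${\rm char}\,F=0$ let $f(X)=\sum_{k\ge 0}b_kX^{q^k}\in F[[u,X]]$ with $b_0=1$, $b_{-1}=0$, $\pi b_k=b_{k-1}u^{q^{k-1}}+b_{k-2}$ ($k\ge1$), and $X+_uY=f^{-1}(f(X)+f(Y))$, $[a]_u(X)=f^{-1}(af(X))$ (coefficients in $\mathcal O_F[[u]]$). If ${\rm char}\,F=p$, $F=\mathbb F_q((\pi))$, let $X+_uY=X+Y$, $[\zeta]_u(X)=\zeta X$ ($\zeta\in\mathbb F_q$), $[\pi]_u(X)=\pi X+uX^q+X^{q^2}$. For $u\in\mathbf C$, $v(u)>0$, this gives a formal $\mathcal O_F$-module $\mathcal F_u$ over $\mathcal O_{\mathbf C}$. $\mathcal X(\pi^2)$ is the Lubin–Tate curve whose $\mathbf C$-points are triples $(X_2,Y_2,u)$ with $v(u)>0$ and $(X_2,Y_2)$ a basis of the free $\mathcal O_F/\pi^2$-module $\mathcal F_u[\pi^2]$. The reduction of an affinoid over $\mathbf C$ is ${\rm Spec}$ of power-bounded functions modulo topologically nilpotent ones. $G_2^F={\rm GL}_2(\mathcal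 O_F/\pi^2)$ acts on the right: $\begin{pmatrix}a&b\\c&d\end{pmatrix}$ acts by $(X_2,Y_2,u)\mapsto([a]_uX_2+_u[c]_uY_2,\,[b]_uX_2+_u[d]_uY_2,\,u)$. **The curves $X^i_j$.** $\mathbf Y_{2,2}=\{v(u)\ge q/(q+1)\}$. Fix $\kappa_1$ with $\kappa_1^{q^3(q^2-1)}=\pi$; put $\kappa=\kappa_1^q$, $\gamma=\kappa^{(q-1)(q^2-1)}$ (fractional powers of $\gamma$ being the corresponding powers of $\kappa_1$), $x=X_2/\kappa$, $y=Y_2/\kappa$. Fix $\gamma_0,\tilde\gamma_0,\tilde\gamma_1$ with $\gamma_0^q-\gamma^q\gamma_0=1$, $\tilde\gamma_0^q=\gamma_0$, $\tilde\gamma_1^q+\tilde\gamma_0+\gamma^{1/q}\tilde\gamma_1=0$. Identify $(\mathcal O_F/\pi^2)^\times\simeq\mathbb F_q^\times\times\mathbb F_q$ by $a_0+a_1\pi\mapsto(\bar a_0,\bar a_1/\bar a_0)$, $a_0\in\mu_{q-1}(\mathcal O_F)$, $a_1\in\mu_{q-1}(\mathcal O_F)\cup\{0\}$. For $i=(\zeta,\tilde\mu)$ write $[\zeta]\in\mu_{q-1}(\mathcal O_F)$ for the Teichmüller lift. The geometric connected component $\mathbf Y^i_{2,2}$ is the one on which $x^qy-xy^q$ reduces to $\zeta$ and, with $\mathcal Z=(x^qy-xy^q)^q-\gamma(x^{q^3}y-xy^{q^3})$ and $f_1(X,Y)=(X^q-Y^q-(X-Y)^q)/\pi$, the function $\gamma^{-q/(q-1)}([\zeta]\gamma_0-\mathcal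 Z)+f_1(x^{q^2}y^q,x^qy^{q^2})$ reduces to $\tilde\mu\zeta$. $\mathcal S^i_{00}=\{(x_0,y_0)\in((k^{\rm ac})^\times)^2:x_0^qy_0-x_0y_0^q=\zeta,\ x_0^{q^2-1}=y_0^{q^2-1}=-1\}$. For $j=(x_0,y_0)\in\mathcal S^i_{00}$ let $\hat y_0$ be the lift of $y_0$ with $\hat y_0^{q^2-1}=-\tilde\gamma_0^{q-1}$, $w=\gamma^{1/(q(q-1))}$, $w_1=\hat y_0^q\gamma^{1/(q^2-1)}$, and let $\mathbf X^i_j$ be the affinoid of points of $\mathbf Y^i_{2,2}$ with $(\bar x,\bar y)=j$ and $v(y-\hat y_0)\ge v(w_1)=\frac1{q^2(q+1)}$. On it define functions $Z_1,a,z_1$ by $x^qy-xy^q=[\zeta]\tilde\gamma_0+\gamma^{1/q}Z_1$, $Z_1=[\zeta]\tilde\gamma_1+wa$, $y=\hat y_0+w_1z_1$. $X^i_j$ is the reduction of $\mathbf X^i_j$; it is the curve with coordinates (the reductions of) $a,z_1$ and equation $a^q+a=\zeta z_1^{q+1}-c_0$ with $c_0=\tilde\mu\zeta-\bar f_1(x_0^{q^2}y_0^q,x_0^qy_0^{q^2})$. The same conventions define coordinates on $X^{ig}_{jg}$. *)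

theory Defs
  imports "HOL-Analysis.Analysis" "HOL-Computational_Algebra.Computational_Algebra"
    "HOL-Algebra.QuotRing"
begin

section \<open>The base field, its completed algebraic closure, and the fixed choices\<close>

text \<open>
  The field \<open>C\<close> is the whole type \<open>'c\<close>, with absolute value \<open>\<bar>x\<bar> = dist x 0\<close>; \<open>F\<close> is a subset of it.
  The residue field of \<open>C\<close> is the type \<open>'k\<close>, together with the reduction map
  \<open>redu\<close>, which is only meaningful on the ring of integers of \<open>C\<close>.
  The remaining fields are the auxiliary constants
  \<open>\<kappa>\<^sub>1\<close>, \<open>\<gamma>\<^sub>0\<close>, \<open>\<gamma>\<^sub>0\<close>-tilde, \<open>\<gamma>\<^sub>1\<close>-tilde.
\<close>

record ('c, 'k) lt_data =
  base :: "'c set"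
  unif :: 'c
  redu :: "'c \<Rightarrow> 'k"
  kappa1 :: 'c
  gamma0 :: 'c
  gammat0 :: 'c
  gammat1 :: 'c

definition val :: "('c::{field,complete_space}, 'k::field) lt_data \<Rightarrow> 'c \<Rightarrow> ereal" where
  "val D x = (if x = 0 then \<infinity> else ereal (ln (dist x 0) / ln (dist (unif D) 0)))"

definition OC :: "('c::{field,complete_space}, 'k::field) lt_data \<Rightarrow> 'c set" where
  "OC D = {x. 0 \<le> val D x}"

definition OF :: "('c::{field,complete_space}, 'k::field) lt_data \<Rightarrow> 'c set" where
  "OF D = base D \<inter> OC D"

definition resq :: "('c::{field,complete_space}, 'k::field) lt_data \<Rightarrow> nat" where
  "resq D = card (redu D ` OF D)"

definition reduces_to :: "('c::{field,complete_space}, 'k::field) lt_data \<Rightarrow> 'c \<Rightarrow> 'k \<Rightarrow> bool" where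
  "reduces_to D x \<xi> \<longleftrightarrow> x \<in> OC D \<and> redu D x = \<xi>"

definition algebraic_over :: "'c::field set \<Rightarrow> 'c set" where
  "algebraic_over K = {x. \<exists>P. P \<noteq> 0 \<and> (\<forall>n. coeff P n \<in> K) \<and> poly P x = 0}"

definition kappa :: "('c::{field,complete_space}, 'k::field) lt_data \<Rightarrow> 'c" where
  "kappa D = kappa1 D ^ resq D"

definition gamma :: "('c::{field,complete_space}, 'k::field) lt_data \<Rightarrow> 'c" where
  "gamma D = kappa D ^ ((resq D - 1) * (resq D ^ 2 - 1))"

text \<open>
  Since \<open>\<gamma> = \<kappa>\<^sub>1\<close> to the power \<open>q (q - 1) (q\<^sup>2 - 1)\<close>, the fractional powers of \<open>\<gamma>\<close> with exponents
  \<open>1/q\<close>, \<open>q/(q-1)\<close>, \<open>1/(q(q-1))\<close> and \<open>1/(q\<^sup>2-1)\<close> are the following powers of \<open>\<kappa>\<^sub>1\<close>.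
\<close>

definition gamma_root_q :: "('c::{field,complete_space}, 'k::field) lt_data \<Rightarrow> 'c" where
  "gamma_root_q D = kappa1 D ^ ((resq D - 1) * (resq D ^ 2 - 1))"

definition gamma_q_over_q1 :: "('c::{field,complete_space}, 'k::field) lt_data \<Rightarrow> 'c" where
  "gamma_q_over_q1 D = kappa1 D ^ (resq D ^ 2 * (resq D ^ 2 - 1))"

definition w_const :: "('c::{field,complete_space}, 'k::field) lt_data \<Rightarrow> 'c" where
  "w_const D = kappa1 D ^ (resq D ^ 2 - 1)"

definition gamma_root_qq1 :: "('c::{field,complete_space}, 'k::field) lt_data \<Rightarrow> 'c" where
  "gamma_root_qq1 D = kappa1 D ^ (resq D * (resq D - 1))"

locale lubin_tate =
  fixes D :: "('c::{field,complete_space}, 'k::field) lt_data"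
  assumes dist_translation: "dist x y = dist (x - y) (0::'c)"
    and abs_mult: "dist (x * y) 0 = dist x 0 * dist y (0::'c)"
    and ultrametric: "dist (x + y) 0 \<le> max (dist x 0) (dist y (0::'c))"
    \<comment> \<open>\<open>F\<close> is a non-archimedean local field with uniformizer \<open>\<pi>\<close>\<close>
    and base_0: "0 \<in> base D" and base_1: "1 \<in> base D"
    and base_diff: "x \<in> base D \<Longrightarrow> y \<in> base D \<Longrightarrow> x - y \<in> base D"
    and base_mult: "x \<in> base D \<Longrightarrow> y \<in> base D \<Longrightarrow> x * y \<in> base D"
    and base_inverse: "x \<in> base D \<Longrightarrow> inverse x \<in> base D"
    and base_complete: "complete (base D)"
    and unif_base: "unif D \<in> base D"
    and unif_abs: "0 < dist (unif D) 0" "dist (unif D) 0 < 1"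
    and base_discrete: "x \<in> base D \<Longrightarrow> x \<noteq> 0 \<Longrightarrow> \<exists>n::int. dist x 0 = dist (unif D) 0 powi n"
    and finite_residue: "finite (redu D ` OF D)"
    \<comment> \<open>the elements algebraic over \<open>F\<close> form an algebraic closure of \<open>F\<close>, and \<open>C\<close> is its completion\<close>
    and alg_closed: "(\<And>n. coeff P n \<in> algebraic_over (base D)) \<Longrightarrow> degree P > 0 \<Longrightarrow>
      \<exists>x\<in>algebraic_over (base D). poly P x = 0"
    and alg_dense: "closure (algebraic_over (base D)) = UNIV"
    \<comment> \<open>\<open>'k\<close> is the quotient of the ring of integers by the maximal ideal\<close>
    and redu_1: "redu D 1 = 1"
    and redu_add: "x \<in> OC D \<Longrightarrow> y \<in> OC D \<Longrightarrow> redu D (x + y) = redu D x + redu D y"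
    and redu_mult: "x \<in> OC D \<Longrightarrow> y \<in> OC D \<Longrightarrow> redu D (x * y) = redu D x * redu D y"
    and redu_eq_0_iff: "x \<in> OC D \<Longrightarrow> redu D x = 0 \<longleftrightarrow> 0 < val D x"
    and redu_surj: "redu D ` OC D = UNIV"
    and residue_char: "CHAR('k) \<noteq> 2"
    and kappa1_power: "kappa1 D ^ (resq D ^ 3 * (resq D ^ 2 - 1)) = unif D"
    and gamma0_eq: "gamma0 D ^ resq D - gamma D ^ resq D * gamma0 D = 1"
    and gammat0_eq: "gammat0 D ^ resq D = gamma0 D"
    and gammat1_eq: "gammat1 D ^ resq D + gammat0 D + gamma_root_q D * gammat1 D = 0"


section \<open>Teichmueller representatives and units modulo \<open>\<pi>\<^sup>2\<close>\<close>

definition mu0 :: "('c::{field,complete_space}, 'k::field) lt_data \<Rightarrow> 'c set" where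
  "mu0 D = {t \<in> OF D. t ^ (resq D - 1) = 1} \<union> {0}"

definition teich :: "('c::{field,complete_space}, 'k::field) lt_data \<Rightarrow> 'k \<Rightarrow> 'c" where
  "teich D \<xi> = (THE t. t \<in> mu0 D \<and> redu D t = \<xi>)"

text \<open>The digits of \<open>a = a\<^sub>0 + a\<^sub>1\<pi> + a\<^sub>2\<pi>\<^sup>2 + \<dots>\<close>, and the tails \<open>a\<^sub>n + a\<^sub>n\<^sub>+\<^sub>1\<pi> + \<dots>\<close>.\<close>

primrec digit_tail :: "('c::{field,complete_space}, 'k::field) lt_data \<Rightarrow> 'c \<Rightarrow> nat \<Rightarrow> 'c" where
  "digit_tail D a 0 = a"
| "digit_tail D a (Suc n) =
    (digit_tail D a n - teich D (redu D (digit_tail D a n))) / unif D"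

definition digit :: "('c::{field,complete_space}, 'k::field) lt_data \<Rightarrow> 'c \<Rightarrow> nat \<Rightarrow> 'c" where
  "digit D a n = teich D (redu D (digit_tail D a n))"

text \<open>
  Elements of \<open>\<O>\<^sub>F/\<pi>\<^sup>2\<close> are represented by elements of \<open>\<O>\<^sub>F\<close>; everything below depends only on
  the class modulo \<open>\<pi>\<^sup>2\<close>. The next predicate says that the class of \<open>a\<close> is a unit.
\<close>

definition unit_mod_pi2 :: "('c::{field,complete_space}, 'k::field) lt_data \<Rightarrow> 'c \<Rightarrow> bool" where
  "unit_mod_pi2 D a \<longleftrightarrow> a \<in> OF D \<and> (\<exists>b\<in>OF D. 2 \<le> val D (a * b - 1))"

definition zeta_of :: "('c::{field,complete_space}, 'k::field) lt_data \<Rightarrow> 'c \<Rightarrow> 'k" where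
  "zeta_of D i = redu D (digit D i 0)"

definition mu_of :: "('c::{field,complete_space}, 'k::field) lt_data \<Rightarrow> 'c \<Rightarrow> 'k" where
  "mu_of D i = redu D (digit D i 1) / redu D (digit D i 0)"

definition GL2 :: "('c::{field,complete_space}, 'k::field) lt_data \<Rightarrow> ('c^2^2) set" where
  "GL2 D = {g. (\<forall>m n. g $ m $ n \<in> OF D) \<and> unit_mod_pi2 D (det g)}"


section \<open>The formal modules and the Lubin--Tate curve\<close>

text \<open>
  In characteristic 0 each \<open>b\<^sub>k\<close> is a polynomial in \<open>u\<close>, and so is each coefficient of
  \<open>X +\<^sub>u Y\<close> and \<open>[a]\<^sub>u(X)\<close>; hence \<open>u\<close> may be specialised before forming the inverse series.
\<close>

fun lt_b :: "('c::{field,complete_space}, 'k::field) lt_data \<Rightarrow> 'c \<Rightarrow> nat \<Rightarrow> 'c" where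
  "lt_b D u 0 = 1"
| "lt_b D u (Suc 0) = u / unif D"
| "lt_b D u (Suc (Suc k)) = (lt_b D u (Suc k) * u ^ (resq D ^ Suc k) + lt_b D u k) / unif D"

definition lt_log :: "('c::{field,complete_space}, 'k::field) lt_data \<Rightarrow> 'c \<Rightarrow> 'c fps" where
  "lt_log D u = Abs_fps (\<lambda>n. \<Sum>k | k \<le> n \<and> resq D ^ k = n. lt_b D u k)"

text \<open>
  The value of the two-variable series \<open>X +\<^sub>u Y\<close> at \<open>(X, Y)\<close> is computed by summing its homogeneous
  parts: the homogeneous part of degree \<open>n\<close>, evaluated at \<open>(X, Y)\<close>, is the coefficient of \<open>T\<^sup>n\<close> in
  the one-variable series \<open>f\<^sup>-\<^sup>1(f(X T) + f(Y T))\<close>.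
\<close>

definition lt_add :: "('c::{field,complete_space}, 'k::field) lt_data \<Rightarrow> 'c \<Rightarrow> 'c \<Rightarrow> 'c \<Rightarrow> 'c" where
  "lt_add D u X Y =
    (if CHAR('c) = 0 then
       (\<Sum>n. fps_nth (fps_inv (lt_log D u) oo
          ((lt_log D u oo (fps_const X * fps_X)) + (lt_log D u oo (fps_const Y * fps_X)))) n)
     else X + Y)"

definition lt_pi_poly :: "('c::{field,complete_space}, 'k::field) lt_data \<Rightarrow> 'c \<Rightarrow> 'c \<Rightarrow> 'c" where
  "lt_pi_poly D u X = unif D * X + u * X ^ resq D + X ^ (resq D ^ 2)"

text \<open>
  In positive characteristic, \<open>[a]\<^sub>u = \<Sum>\<^sub>n [a\<^sub>n]\<^sub>u \<circ> [\<pi>]\<^sub>u\<^sup>n\<close> for \<open>a = \<Sum>\<^sub>n a\<^sub>n\<pi>\<^sup>n\<close> with \<open>a\<^sub>n\<close> in the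
  finite field of constants.
\<close>

definition lt_mult :: "('c::{field,complete_space}, 'k::field) lt_data \<Rightarrow> 'c \<Rightarrow> 'c \<Rightarrow> 'c \<Rightarrow> 'c" where
  "lt_mult D u a X =
    (if CHAR('c) = 0 then
       (\<Sum>n. fps_nth (fps_inv (lt_log D u) oo (fps_const a * lt_log D u)) n * X ^ n)
     else (\<Sum>n. digit D a n * (lt_pi_poly D u ^^ n) X))"

definition torsion2 :: "('c::{field,complete_space}, 'k::field) lt_data \<Rightarrow> 'c \<Rightarrow> 'c set" where
  "torsion2 D u = {X. 0 < val D X \<and> lt_mult D u (unif D ^ 2) X = 0}"

definition is_level2_basis ::
  "('c::{field,complete_space}, 'k::field) lt_data \<Rightarrow> 'c \<Rightarrow> 'c \<Rightarrow> 'c \<Rightarrow> bool" where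
  "is_level2_basis D u X Y \<longleftrightarrow> X \<in> torsion2 D u \<and> Y \<in> torsion2 D u \<and>
    (\<forall>Z\<in>torsion2 D u. \<exists>a\<in>OF D. \<exists>c\<in>OF D. Z = lt_add D u (lt_mult D u a X) (lt_mult D u c Y)) \<and>
    (\<forall>a\<in>OF D. \<forall>c\<in>OF D. lt_add D u (lt_mult D u a X) (lt_mult D u c Y) = 0 \<longrightarrow>
       2 \<le> val D a \<and> 2 \<le> val D c)"

definition LT_curve :: "('c::{field,complete_space}, 'k::field) lt_data \<Rightarrow> ('c \<times> 'c \<times> 'c) set" where
  "LT_curve D = {(X, Y, u). 0 < val D u \<and> is_level2_basis D u X Y}"

definition act ::
  "('c::{field,complete_space}, 'k::field) lt_data \<Rightarrow> 'c^2^2 \<Rightarrow> 'c \<times> 'c \<times> 'c \<Rightarrow> 'c \<times> 'c \<times> 'c" where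
  "act D g = (\<lambda>(X, Y, u).
     (lt_add D u (lt_mult D u (g $ 1 $ 1) X) (lt_mult D u (g $ 2 $ 1) Y),
      lt_add D u (lt_mult D u (g $ 1 $ 2) X) (lt_mult D u (g $ 2 $ 2) Y), u))"


section \<open>Polynomials in two variables\<close>

text \<open>\<open>'a poly poly\<close> is viewed as \<open>'a[x][y]\<close>: the inner variable is \<open>x\<close>, the outer one \<open>y\<close>.\<close>

definition pX :: "'a::comm_ring_1 poly poly" where "pX = [:[:0, 1:]:]"
definition pY :: "'a::comm_ring_1 poly poly" where "pY = [:0, 1:]"
definition pC :: "'a::comm_ring_1 \<Rightarrow> 'a poly poly" where "pC c = [:[:c:]:]"

definition eval2 :: "'a::comm_ring_1 poly poly \<Rightarrow> 'a \<Rightarrow> 'a \<Rightarrow> 'a" where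
  "eval2 P x y = poly (poly P [:y:]) x"

definition redu_poly2 ::
  "('c::{field,complete_space}, 'k::field) lt_data \<Rightarrow> 'c poly poly \<Rightarrow> 'k poly poly" where
  "redu_poly2 D P = map_poly (map_poly (redu D)) P"

definition f1_poly :: "('c::{field,complete_space}, 'k::field) lt_data \<Rightarrow> 'c poly poly" where
  "f1_poly D = pC (1 / unif D) * (pX ^ resq D - pY ^ resq D - (pX - pY) ^ resq D)"

definition fab_poly ::
  "('c::{field,complete_space}, 'k::field) lt_data \<Rightarrow> 'c \<Rightarrow> 'c \<Rightarrow> 'c poly poly" where
  "fab_poly D a b = pC (1 / unif D) *
    (pC a * pX ^ (resq D ^ 2) + pC b * pY ^ (resq D ^ 2) - (pC a * pX + pC b * pY) ^ (resq D ^ 2))"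

definition G0_poly ::
  "('c::{field,complete_space}, 'k::field) lt_data \<Rightarrow> 'c \<Rightarrow> 'c \<Rightarrow> 'c \<Rightarrow> 'c \<Rightarrow> 'c poly poly" where
  "G0_poly D a0 b0 c0 d0 =
    (pC a0 * pX + pC c0 * pY) ^ resq D * fab_poly D b0 d0
    - (pC b0 * pX + pC d0 * pY) ^ resq D * fab_poly D a0 c0"

definition gbar_poly ::
  "('c::{field,complete_space}, 'k::field) lt_data \<Rightarrow>
   'c \<Rightarrow> 'c \<Rightarrow> 'c \<Rightarrow> 'c \<Rightarrow> 'c \<Rightarrow> 'c \<Rightarrow> 'c \<Rightarrow> 'c \<Rightarrow> 'k poly poly" where
  "gbar_poly D a0 a1 b0 b1 c0 c1 d0 d1 =
    (let r = (\<lambda>t. pC (redu D t)) in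
     ((r a0 * pX + r c0 * pY) * (r b1 * pX + r d1 * pY) ^ resq D
      - (r a1 * pX + r c1 * pY) ^ resq D * (r b0 * pX + r d0 * pY)) ^ resq D)"


section \<open>The affinoids and their coordinate functions\<close>

definition x_fn :: "('c::{field,complete_space}, 'k::field) lt_data \<Rightarrow> 'c \<times> 'c \<times> 'c \<Rightarrow> 'c" where
  "x_fn D = (\<lambda>(X, Y, u). X / kappa D)"

definition y_fn :: "('c::{field,complete_space}, 'k::field) lt_data \<Rightarrow> 'c \<times> 'c \<times> 'c \<Rightarrow> 'c" where
  "y_fn D = (\<lambda>(X, Y, u). Y / kappa D)"

definition moore_fn :: "('c::{field,complete_space}, 'k::field) lt_data \<Rightarrow> 'c \<times> 'c \<times> 'c \<Rightarrow> 'c" where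
  "moore_fn D s = x_fn D s ^ resq D * y_fn D s - x_fn D s * y_fn D s ^ resq D"

definition calZ_fn :: "('c::{field,complete_space}, 'k::field) lt_data \<Rightarrow> 'c \<times> 'c \<times> 'c \<Rightarrow> 'c" where
  "calZ_fn D s = moore_fn D s ^ resq D
    - gamma D * (x_fn D s ^ (resq D ^ 3) * y_fn D s - x_fn D s * y_fn D s ^ (resq D ^ 3))"

definition Y22 :: "('c::{field,complete_space}, 'k::field) lt_data \<Rightarrow> ('c \<times> 'c \<times> 'c) set" where
  "Y22 D = {(X, Y, u) \<in> LT_curve D. ereal (real (resq D) / (real (resq D) + 1)) \<le> val D u}"

text \<open>
  The two reductions below are constant on each geometric connected component and separate the
  components, so the component with invariants \<open>(\<zeta>, \<mu>)\<close> is the set of points where they take the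
  prescribed values.
\<close>

definition Y22_component ::
  "('c::{field,complete_space}, 'k::field) lt_data \<Rightarrow> 'c \<Rightarrow> ('c \<times> 'c \<times> 'c) set" where
  "Y22_component D i = {s \<in> Y22 D.
     reduces_to D (moore_fn D s) (zeta_of D i) \<and>
     reduces_to D
       ((teich D (zeta_of D i) * gamma0 D - calZ_fn D s) / gamma_q_over_q1 D
        + eval2 (f1_poly D) (x_fn D s ^ (resq D ^ 2) * y_fn D s ^ resq D)
            (x_fn D s ^ resq D * y_fn D s ^ (resq D ^ 2)))
       (mu_of D i * zeta_of D i)}"

definition S00 :: "('c::{field,complete_space}, 'k::field) lt_data \<Rightarrow> 'c \<Rightarrow> ('k \<times> 'k) set" where
  "S00 D i = {(x0, y0). x0 \<noteq> 0 \<and> y0 \<noteq> 0 \<and>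
     x0 ^ resq D * y0 - x0 * y0 ^ resq D = zeta_of D i \<and>
     x0 ^ (resq D ^ 2 - 1) = - 1 \<and> y0 ^ (resq D ^ 2 - 1) = - 1}"

definition yhat :: "('c::{field,complete_space}, 'k::field) lt_data \<Rightarrow> 'k \<Rightarrow> 'c" where
  "yhat D y0 = (THE t. reduces_to D t y0 \<and> t ^ (resq D ^ 2 - 1) = - (gammat0 D ^ (resq D - 1)))"

definition w1_const :: "('c::{field,complete_space}, 'k::field) lt_data \<Rightarrow> 'k \<Rightarrow> 'c" where
  "w1_const D y0 = yhat D y0 ^ resq D * gamma_root_qq1 D"

definition affinoid ::
  "('c::{field,complete_space}, 'k::field) lt_data \<Rightarrow> 'c \<Rightarrow> 'k \<times> 'k \<Rightarrow> ('c \<times> 'c \<times> 'c) set" where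
  "affinoid D i j = {s \<in> Y22_component D i.
     reduces_to D (x_fn D s) (fst j) \<and> reduces_to D (y_fn D s) (snd j) \<and>
     val D (w1_const D (snd j)) \<le> val D (y_fn D s - yhat D (snd j))}"

definition Z1_fn ::
  "('c::{field,complete_space}, 'k::field) lt_data \<Rightarrow> 'c \<Rightarrow> 'c \<times> 'c \<times> 'c \<Rightarrow> 'c" where
  "Z1_fn D i s = (moore_fn D s - teich D (zeta_of D i) * gammat0 D) / gamma_root_q D"

definition a_fn ::
  "('c::{field,complete_space}, 'k::field) lt_data \<Rightarrow> 'c \<Rightarrow> 'k \<times> 'k \<Rightarrow> 'c \<times> 'c \<times> 'c \<Rightarrow> 'c" where
  "a_fn D i j = (\<lambda>s\<in>affinoid D i j. (Z1_fn D i s - teich D (zeta_of D i) * gammat1 D) / w_const D)"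

definition z1_fn ::
  "('c::{field,complete_space}, 'k::field) lt_data \<Rightarrow> 'c \<Rightarrow> 'k \<times> 'k \<Rightarrow> 'c \<times> 'c \<times> 'c \<Rightarrow> 'c" where
  "z1_fn D i j = (\<lambda>s\<in>affinoid D i j. (y_fn D s - yhat D (snd j)) / w1_const D (snd j))"

definition c0_const ::
  "('c::{field,complete_space}, 'k::field) lt_data \<Rightarrow> 'c \<Rightarrow> 'k \<times> 'k \<Rightarrow> 'k" where
  "c0_const D i j = mu_of D i * zeta_of D i
     - eval2 (redu_poly2 D (f1_poly D)) (fst j ^ (resq D ^ 2) * snd j ^ resq D)
         (fst j ^ resq D * snd j ^ (resq D ^ 2))"

definition plane_curve ::
  "('c::{field,complete_space}, 'k::field) lt_data \<Rightarrow> 'c \<Rightarrow> 'k \<times> 'k \<Rightarrow> ('k \<times> 'k) set" where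
  "plane_curve D i j =
    {(a, z). a ^ resq D + a = zeta_of D i * z ^ (resq D + 1) - c0_const D i j}"


section \<open>Functions on an affinoid and its reduction\<close>

text \<open>
  The rigid analytic functions on an affinoid \<open>S\<close> in affine 3-space are, by Runge approximation, the
  uniform limits on \<open>S\<close> of rational functions in the coordinates whose denominators are bounded
  away from 0 on \<open>S\<close>. They are taken to be \<open>undefined\<close> outside \<open>S\<close>.
\<close>

definition eval3 :: "'c::field poly poly poly \<Rightarrow> 'c \<times> 'c \<times> 'c \<Rightarrow> 'c" where
  "eval3 P = (\<lambda>(X, Y, u). poly (poly (poly P [:[:X:]:]) [:Y:]) u)"

definition analytic_functions ::
  "('c \<times> 'c \<times> 'c) set \<Rightarrow> ('c \<times> 'c \<times> 'c \<Rightarrow> 'c::{field,complete_space}) set" where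
  "analytic_functions S = {h \<in> extensional S. \<forall>\<epsilon>>0. \<exists>P Q. \<exists>\<delta>>0.
     \<forall>s\<in>S. \<delta> \<le> dist (eval3 Q s) 0 \<and> dist (h s) (eval3 P s / eval3 Q s) < \<epsilon>}"

definition power_bounded ::
  "('c \<times> 'c \<times> 'c) set \<Rightarrow> ('c \<times> 'c \<times> 'c \<Rightarrow> 'c::{field,complete_space}) set" where
  "power_bounded S = {h \<in> analytic_functions S. \<exists>M. \<forall>n. \<forall>s\<in>S. dist (h s ^ n) 0 \<le> M}"

definition top_nilpotent ::
  "('c \<times> 'c \<times> 'c) set \<Rightarrow> ('c \<times> 'c \<times> 'c \<Rightarrow> 'c::{field,complete_space}) set" where
  "top_nilpotent S =
    {h \<in> analytic_functions S. \<forall>\<epsilon>>0. \<exists>N. \<forall>n\<ge>N. \<forall>s\<in>S. dist (h s ^ n) 0 < \<epsilon>}"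

definition power_bounded_ring ::
  "('c \<times> 'c \<times> 'c) set \<Rightarrow> ('c \<times> 'c \<times> 'c \<Rightarrow> 'c::{field,complete_space}) ring" where
  "power_bounded_ring S =
    \<lparr>carrier = power_bounded S,
     monoid.mult = (\<lambda>h k. \<lambda>s\<in>S. h s * k s), one = (\<lambda>s\<in>S. 1),
     zero = (\<lambda>s\<in>S. 0), add = (\<lambda>h k. \<lambda>s\<in>S. h s + k s)\<rparr>"

text \<open>
  The coordinate ring of the reduction of \<open>S\<close>. A morphism between reductions of affinoids is given
  by the homomorphism of coordinate rings in the opposite direction.
\<close>

definition reduction ::
  "('c \<times> 'c \<times> 'c) set \<Rightarrow> ('c \<times> 'c \<times> 'c \<Rightarrow> 'c::{field,complete_space}) set ring" where
  "reduction S = power_bounded_ring S Quot top_nilpotent S"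

definition red_class ::
  "('c \<times> 'c \<times> 'c) set \<Rightarrow> ('c \<times> 'c \<times> 'c \<Rightarrow> 'c) \<Rightarrow> ('c \<times> 'c \<times> 'c \<Rightarrow> 'c::{field,complete_space}) set"
  where "red_class S h = top_nilpotent S +>\<^bsub>power_bounded_ring S\<^esub> h"

text \<open>The structure map of the coordinate ring as an algebra over the residue field.\<close>

definition red_scalar ::
  "('c::{field,complete_space}, 'k::field) lt_data \<Rightarrow> ('c \<times> 'c \<times> 'c) set \<Rightarrow> 'k \<Rightarrow>
   ('c \<times> 'c \<times> 'c \<Rightarrow> 'c) set" where
  "red_scalar D S \<xi> = red_class S (\<lambda>s\<in>S. SOME t. reduces_to D t \<xi>)"

definition induces_on_reductions ::
  "('c \<times> 'c \<times> 'c) set \<Rightarrow> ('c \<times> 'c \<times> 'c) set \<Rightarrow> ('c \<times> 'c \<times> 'c \<Rightarrow> 'c \<times> 'c \<times> 'c) \<Rightarrow>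
   (('c \<times> 'c \<times> 'c \<Rightarrow> 'c::{field,complete_space}) set \<Rightarrow> ('c \<times> 'c \<times> 'c \<Rightarrow> 'c) set) \<Rightarrow> bool" where
  "induces_on_reductions S S' G \<phi> \<longleftrightarrow>
     G \<in> S \<rightarrow> S' \<and>
     (\<forall>h\<in>analytic_functions S'. compose S h G \<in> analytic_functions S) \<and>
     \<phi> \<in> ring_hom (reduction S') (reduction S) \<and>
     (\<forall>h\<in>power_bounded S'. \<phi> (red_class S' h) = red_class S (compose S h G))"

end

theory Submission
  imports Defs
begin

text \<open>
  All constants have absolute values that are powers of \<open>\<theta> = \<bar>\<kappa>\<^sub>1\<bar>\<close>, and errors are measured in powers
  of \<open>\<theta>\<close>. By Hazewinkel's functional equation lemma the formal group law and the series \<open>[a]\<^sub>u\<close> are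
  integral, and their leading terms give the action to first order: \<open>x' = L\<^sub>a + w\<^sup>q K\<^sub>a\<close> up to smaller
  terms, where \<open>L\<^sub>a = a\<^sub>0 x + c\<^sub>0 y\<close> and \<open>K\<^sub>a = f\<^bsub>a\<^sub>0,c\<^sub>0\<^esub>(x, y) + a\<^sub>1 x\<^bsup>q\<^sup>2\<^esup> + c\<^sub>1 y\<^bsup>q\<^sup>2\<^esup>\<close>, and
  likewise \<open>y' = L\<^sub>b + w\<^sup>q K\<^sub>b\<close>. Hence \<open>x'\<^sup>q y' - x' y'\<^sup>q = \<Delta> (x\<^sup>q y - x y\<^sup>q) + w\<^sup>q H\<close> with
  \<open>\<Delta> = a\<^sub>0 d\<^sub>0 - b\<^sub>0 c\<^sub>0\<close> and \<open>H = L\<^sub>a\<^sup>q K\<^sub>b - K\<^sub>a L\<^sub>b\<^sup>q\<close>, and \<open>H\<close> reduces to \<open>f(j, g)\<close>. On the affinoid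
  \<open>x\<close> and \<open>y\<close> move in the direction of their \<open>q\<close>-th powers, which the linear forms \<open>L\<^sub>a\<close>, \<open>L\<^sub>b\<close> preserve;
  this is why \<open>z\<^sub>1\<close> is unchanged.

  The equation of the curve comes from an identity between \<open>x\<^bsup>q\<^sup>3\<^esup> y - x y\<^bsup>q\<^sup>3\<^esup>\<close> and the Frobenius twists
  of \<open>x\<^sup>q y - x y\<^sup>q\<close>. That the image lies on the component \<open>ig\<close> amounts to the relation
  \<open>c\<^sub>0' = \<Delta> c\<^sub>0 - (h\<^sup>q + h)\<close> for \<open>h = f(j, g)\<close> in the residue field, which follows by lifting \<open>x\<^sub>0\<close>, \<open>y\<^sub>0\<close>
  to roots of \<open>t\<^bsup>q\<^sup>2\<^esup> = -t\<close> and computing modulo \<open>\<pi>\<^sup>2\<close>.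
\<close>

text \<open>On the affinoid X and Y have absolute value \<open>\<theta> ^ q\<close>, and v(u) >=
  q/(q+1) makes all contributions of u to the module structure negligible next to X^(q^2), whose
  size is that of X times |w^q|. So u may be replaced by 0, where the logarithm begins X +
  X^(q^2)/\<pi>; comparing coefficients up to degree q^2 is what produces the polynomials f_{a,b}.
  In characteristic p there is no logarithm, but on the \<pi>^2-torsion [a]_u is a finite sum and
  f_{a,b} vanishes. The two cases meet in the module laws and in the leading terms.

  The module laws cannot be read off from logarithms of points, since torsion points lie in the
  kernel. They are obtained for formal curves, whose values at 1 are the points.

  The constants \<open>gammat0\<close> and \<open>gammat1\<close> give successive approximations to
  x^q y - x y^q on a component; the coordinate a is what remains, at order w^q, exactly the order of
  the first correction to the linear action. This is why a is shifted by f(j, g). The precision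
  needed comes from q-th powers, which turn an error d < 1 into at most max(|\<pi>| d, d^q).\<close>

context lubin_tate
begin

text \<open>The real absolute value is used instead of \<open>val\<close>, whose values are extended
  reals; \<open>val_ge_iff\<close> and its variants translate the conditions in the
  definitions.\<close>

definition nm :: "'c \<Rightarrow> real" where
  "nm x = dist x 0"

abbreviation uni :: 'c ("\<varpi>") where "\<varpi> \<equiv> unif D"
abbreviation qq :: nat ("q") where "q \<equiv> resq D"

subsection \<open>The absolute value\<close>

lemma nm_ge_0 [simp]: "0 \<le> nm (x::'c)"
  by (simp add: nm_def)

lemma nm_0 [simp]: "nm (0::'c) = 0"
  by (simp add: nm_def)

lemma nm_eq_0_iff [simp]: "nm (x::'c) = 0 \<longleftrightarrow> x = 0"
  by (simp add: nm_def)

lemma nm_gt_0_iff [simp]: "0 < nm (x::'c) \<longleftrightarrow> x \<noteq> 0"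
  by (simp add: nm_def)

lemma nm_le_0_iff [simp]: "nm x \<le> 0 \<longleftrightarrow> x = 0"
  by (simp add: nm_def)

lemma nm_mult: "nm (x * y :: 'c) = nm x * nm y"
  by (simp add: nm_def abs_mult)

lemma nm_add_le: "nm (x + y :: 'c) \<le> max (nm x) (nm y)"
  by (simp add: nm_def ultrametric)

lemma nm_1 [simp]: "nm (1::'c) = 1"
proof -
  have "nm (1::'c) * nm (1::'c) = nm (1::'c)"
    by (metis nm_mult mult_1)
  then show ?thesis by (metis mult_cancel_left2 nm_eq_0_iff zero_neq_one)
qed

lemma nm_minus [simp]: "nm (- x :: 'c) = nm x"
proof -
  have "nm (-1::'c) * nm (-1::'c) = 1"
    by (metis nm_mult nm_1 minus_mult_minus mult_1)
  then have "nm (-1::'c) = 1"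
    by (metis abs_of_nonneg nm_ge_0 power2_eq_1_iff power2_eq_square abs_minus abs_one)
  then show ?thesis using nm_mult[of "-1" x] by simp
qed

lemma nm_diff_le: "nm (x - y :: 'c) \<le> max (nm x) (nm y)"
  using nm_add_le[of x "-y"] by simp

lemma nm_diff_commute: "nm (x - y :: 'c) = nm (y - x)"
  using nm_minus[of "x - y"] by simp

lemma dist_eq_nm: "dist x (y::'c) = nm (x - y)"
  by (metis dist_translation nm_def)

lemma nm_power: "nm (x ^ n :: 'c) = nm x ^ n"
  by (induction n) (simp_all add: nm_mult)

lemma nm_inverse: "nm (inverse x :: 'c) = inverse (nm x)"
proof (cases "x = 0")
  case False
  then have "nm x * nm (inverse x) = 1" using nm_mult[of x "inverse x"] by simp
  then show ?thesis by (metis inverse_unique)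
qed simp

lemma nm_divide: "nm (x / y :: 'c) = nm x / nm y"
  by (simp add: divide_inverse nm_mult nm_inverse)

lemma nm_add_leI: "nm x \<le> B \<Longrightarrow> nm y \<le> B \<Longrightarrow> nm (x + y :: 'c) \<le> B"
  using nm_add_le[of x y] by linarith

lemma nm_diff_leI: "nm x \<le> B \<Longrightarrow> nm y \<le> B \<Longrightarrow> nm (x - y :: 'c) \<le> B"
  using nm_diff_le[of x y] by linarith

lemma nm_add_lessI: "nm x < B \<Longrightarrow> nm y < B \<Longrightarrow> nm (x + y :: 'c) < B"
  using nm_add_le[of x y] by linarith

lemma nm_diff_lessI: "nm x < B \<Longrightarrow> nm y < B \<Longrightarrow> nm (x - y :: 'c) < B"
  using nm_diff_le[of x y] by linarith

lemma nm_sum_le: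
  assumes "0 \<le> B" "\<And>i. i \<in> A \<Longrightarrow> nm (f i :: 'c) \<le> B"
  shows "nm (sum f A) \<le> B"
  using assms(2)
proof (induction A rule: infinite_finite_induct)
  case (insert x F)
  then show ?case by (simp add: nm_add_leI)
qed (use assms(1) in auto)

lemma nm_mult_le: "nm x \<le> a \<Longrightarrow> nm y \<le> b \<Longrightarrow> nm (x * y :: 'c) \<le> a * b"
  by (simp add: nm_mult mult_mono' )

lemma nm_mult_le_1: "nm x \<le> 1 \<Longrightarrow> nm y \<le> 1 \<Longrightarrow> nm (x * y :: 'c) \<le> 1"
  using nm_mult_le[of x 1 y 1] by simp

lemma nm_mult_le_left: "nm x \<le> a \<Longrightarrow> nm y \<le> 1 \<Longrightarrow> nm (x * y :: 'c) \<le> a"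
  using nm_mult_le[of x a y 1] by simp

lemma nm_mult_le_right: "nm x \<le> 1 \<Longrightarrow> nm y \<le> a \<Longrightarrow> nm (x * y :: 'c) \<le> a"
  using nm_mult_le[of x 1 y a] by simp

lemma nm_power_le_1: "nm x \<le> 1 \<Longrightarrow> nm (x ^ n :: 'c) \<le> 1"
  by (simp add: nm_power power_le_one)

lemma nm_of_nat_le_1: "nm (of_nat n :: 'c) \<le> 1"
  by (induction n) (auto intro: nm_add_leI)

text \<open>In an ultrametric triangle the two longest sides are equal: changing x by less than its
  own size cannot change that size.\<close>

lemma nm_eqI: "nm (x - y :: 'c) < nm x \<Longrightarrow> nm y = nm x"
proof -
  assume a: "nm (x - y) < nm x"
  have "nm x \<le> max (nm (x - y)) (nm y)" using nm_add_le[of "x - y" y] by simp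
  moreover have "nm y \<le> max (nm x) (nm (x - y))" using nm_diff_le[of x "x - y"] by simp
  ultimately show ?thesis using a by linarith
qed

subsection \<open>The ring of integers and the residue field\<close>

lemma nm_uni: "0 < nm \<varpi>" "nm \<varpi> < 1"
  using unif_abs by (auto simp: nm_def)

lemma uni_nz [simp]: "\<varpi> \<noteq> 0"
  using nm_uni(1) by auto

lemma ln_nm_uni: "ln (nm \<varpi>) < 0"
  using nm_uni by simp

lemma val_ge_iff: "ereal r \<le> val D x \<longleftrightarrow> nm x \<le> nm \<varpi> powr r"
proof (cases "x = 0")
  case False
  then have x: "0 < nm x" by simp
  have "ereal r \<le> val D x \<longleftrightarrow> ln (nm x) \<le> r * ln (nm \<varpi>)"
    using False ln_nm_uni by (simp add: val_def nm_def[symmetric] neg_le_divide_eq)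
  also have "\<dots> \<longleftrightarrow> nm x \<le> nm \<varpi> powr r"
    using x nm_uni(1) by (metis ln_le_cancel_iff ln_powr powr_gt_zero less_irrefl)
  finally show ?thesis .
qed (simp add: val_def)

lemma val_ge_0_iff: "0 \<le> val D x \<longleftrightarrow> nm x \<le> 1"
  using val_ge_iff[of 0 x] nm_uni by (simp add: zero_ereal_def)

lemma val_ge_2_iff: "2 \<le> val D x \<longleftrightarrow> nm x \<le> nm \<varpi> ^ 2"
proof -
  have "(2::ereal) = ereal 2" by simp
  then show ?thesis using val_ge_iff[of 2 x] nm_uni by (simp add: powr_numeral)
qed

lemma val_gt_0_iff: "0 < val D x \<longleftrightarrow> nm x < 1"
proof (cases "x = 0")
  case False
  then show ?thesis using ln_nm_uni
    by (simp add: val_def nm_def[symmetric] zero_less_divide_iff)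
qed (simp add: val_def)

lemma val_le_iff: "val D x \<le> val D y \<longleftrightarrow> nm y \<le> nm x"
proof (cases "x = 0 \<or> y = 0")
  case True
  then show ?thesis by (auto simp: val_def)
next
  case False
  then show ?thesis using ln_nm_uni
    by (simp add: val_def nm_def[symmetric] divide_le_cancel)
qed

lemma OC_iff: "x \<in> OC D \<longleftrightarrow> nm x \<le> 1"
  by (simp add: OC_def val_ge_0_iff)

lemma OF_iff: "x \<in> OF D \<longleftrightarrow> x \<in> base D \<and> nm x \<le> 1"
  by (simp add: OF_def OC_iff)

lemma OF_nm: "x \<in> OF D \<Longrightarrow> nm x \<le> 1"
  by (simp add: OF_iff)

lemma base_minus: "x \<in> base D \<Longrightarrow> - x \<in> base D"
  using base_diff[OF base_0, of x] by simp

lemma base_add: "x \<in> base D \<Longrightarrow> y \<in> base D \<Longrightarrow> x + y \<in> base D"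
  using base_diff[of x "-y"] base_minus[of y] by simp

lemma OF_0 [simp]: "0 \<in> OF D" and OF_1 [simp]: "1 \<in> OF D" and OF_uni [simp]: "\<varpi> \<in> OF D"
  using base_0 base_1 unif_base nm_uni by (auto simp: OF_iff)

lemma OF_add: "x \<in> OF D \<Longrightarrow> y \<in> OF D \<Longrightarrow> x + y \<in> OF D"
  by (simp add: OF_iff base_add nm_add_leI)

lemma OF_diff: "x \<in> OF D \<Longrightarrow> y \<in> OF D \<Longrightarrow> x - y \<in> OF D"
  by (simp add: OF_iff base_diff nm_diff_leI)

lemma OF_minus: "x \<in> OF D \<Longrightarrow> - x \<in> OF D"
  by (simp add: OF_iff base_minus)

lemma OF_mult: "x \<in> OF D \<Longrightarrow> y \<in> OF D \<Longrightarrow> x * y \<in> OF D"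
  by (simp add: OF_iff base_mult nm_mult_le_1)

lemma OF_power: "x \<in> OF D \<Longrightarrow> x ^ n \<in> OF D"
  by (induction n) (auto intro: OF_mult)

lemma OF_of_nat: "of_nat n \<in> OF D"
  by (induction n) (auto intro: OF_add)

lemma OF_sum: "(\<And>i. i \<in> A \<Longrightarrow> f i \<in> OF D) \<Longrightarrow> sum f A \<in> OF D"
  by (induction A rule: infinite_finite_induct) (auto intro: OF_add)

text \<open>Nonzero absolute values on F are integral powers of |\<pi>|, so none lies strictly
  between |\<pi>| and 1.\<close>

lemma OF_div_uni:
  assumes "x \<in> OF D" "nm x < 1"
  shows "nm x \<le> nm \<varpi>" "x / \<varpi> \<in> OF D"
proof -
  show 1: "nm x \<le> nm \<varpi>"
  proof (cases "x = 0")
    case True then show ?thesis using nm_uni by simp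
  next
    case False
    then obtain n :: int where n: "nm x = nm \<varpi> powi n"
      using base_discrete[of x] assms by (auto simp: OF_iff nm_def)
    have "n > 0"
    proof (rule ccontr)
      assume "\<not> n > 0"
      then have "nm \<varpi> powi n \<ge> 1"
        using nm_uni by (simp add: power_int_def one_le_inverse power_le_one)
      then show False using assms n by simp
    qed
    then have "nm \<varpi> powi n = nm \<varpi> ^ nat n" by (simp add: power_int_def)
    also have "\<dots> \<le> nm \<varpi> ^ 1" using nm_uni \<open>n > 0\<close> by (intro power_decreasing) auto
    finally show ?thesis using n by simp
  qed
  have "x / \<varpi> \<in> base D"
    using assms base_mult[OF _ base_inverse[OF unif_base]] by (simp add: OF_iff divide_inverse)
  then show "x / \<varpi> \<in> OF D" using 1 nm_uni by (simp add: OF_iff nm_divide)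
qed

lemma redu_0 [simp]: "redu D 0 = 0"
  using redu_eq_0_iff[of 0] by (simp add: OC_iff val_gt_0_iff)

lemma redu_plus: "nm x \<le> 1 \<Longrightarrow> nm y \<le> 1 \<Longrightarrow> redu D (x + y) = redu D x + redu D y"
  by (rule redu_add) (auto simp: OC_iff)

lemma redu_times: "nm x \<le> 1 \<Longrightarrow> nm y \<le> 1 \<Longrightarrow> redu D (x * y) = redu D x * redu D y"
  by (rule redu_mult) (auto simp: OC_iff)

lemma redu_minus: "nm x \<le> 1 \<Longrightarrow> redu D (- x) = - redu D x"
  using redu_plus[of x "-x"] by (simp add: eq_neg_iff_add_eq_0 add.commute)

lemma redu_diff: "nm x \<le> 1 \<Longrightarrow> nm y \<le> 1 \<Longrightarrow> redu D (x - y) = redu D x - redu D y"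
  using redu_plus[of x "-y"] redu_minus[of y] by simp

lemma redu_power: "nm x \<le> 1 \<Longrightarrow> redu D (x ^ n) = redu D x ^ n"
  by (induction n) (simp_all add: redu_1 redu_times nm_power_le_1)

lemma redu_of_nat: "redu D (of_nat n) = of_nat n"
  by (induction n) (simp_all add: redu_1 redu_plus nm_of_nat_le_1)

lemma redu_sum: "(\<And>i. i \<in> A \<Longrightarrow> nm (f i) \<le> 1) \<Longrightarrow> redu D (sum f A) = (\<Sum>i\<in>A. redu D (f i))"
  by (induction A rule: infinite_finite_induct) (simp_all add: redu_plus nm_sum_le)

lemma redu_0_iff: "nm x \<le> 1 \<Longrightarrow> redu D x = 0 \<longleftrightarrow> nm x < 1"
  using redu_eq_0_iff[of x] by (simp add: OC_iff val_gt_0_iff)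

lemma redu_eq_iff: "nm x \<le> 1 \<Longrightarrow> nm y \<le> 1 \<Longrightarrow> redu D x = redu D y \<longleftrightarrow> nm (x - y) < 1"
  using redu_0_iff[of "x - y"] redu_diff[of x y] by (simp add: nm_diff_leI)

lemma redu_eqI: "nm x \<le> 1 \<Longrightarrow> nm (y - x) < 1 \<Longrightarrow> redu D y = redu D x"
  using nm_add_leI[of "y - x" 1 x] redu_eq_iff[of y x] by simp

lemma redu_nz_iff: "nm x \<le> 1 \<Longrightarrow> redu D x \<noteq> 0 \<longleftrightarrow> nm x = 1"
  using redu_0_iff[of x] by auto

lemma reduces_to_iff: "reduces_to D x \<xi> \<longleftrightarrow> nm x \<le> 1 \<and> redu D x = \<xi>"
  by (simp add: reduces_to_def OC_iff)

lemma ex_reduces_to: "\<exists>x. nm x \<le> 1 \<and> redu D x = \<xi>"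
  using redu_surj by (metis OC_iff UNIV_I imageE)

definition Fq :: "'k set" where "Fq = redu D ` OF D"

lemma finite_Fq: "finite Fq" and card_Fq: "card Fq = q"
  using finite_residue by (auto simp: Fq_def resq_def)

lemma Fq_0 [simp]: "0 \<in> Fq" and Fq_1 [simp]: "1 \<in> Fq"
  unfolding Fq_def using redu_0 redu_1 OF_0 OF_1 by (metis image_eqI)+

lemma Fq_mult: "x \<in> Fq \<Longrightarrow> y \<in> Fq \<Longrightarrow> x * y \<in> Fq"
  unfolding Fq_def by (auto simp: redu_times[symmetric] OF_nm intro!: imageI OF_mult)

lemma Fq_add: "x \<in> Fq \<Longrightarrow> y \<in> Fq \<Longrightarrow> x + y \<in> Fq"
  unfolding Fq_def by (auto simp: redu_plus[symmetric] OF_nm intro!: imageI OF_add)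

lemma Fq_minus: "x \<in> Fq \<Longrightarrow> - x \<in> Fq"
  unfolding Fq_def by (auto simp: redu_minus[symmetric] OF_nm intro!: imageI OF_minus)

lemma Fq_redu: "x \<in> OF D \<Longrightarrow> redu D x \<in> Fq"
  by (simp add: Fq_def)

lemma q_ge_2: "2 \<le> q"
proof -
  have "card {0, 1::'k} \<le> card Fq" by (intro card_mono finite_Fq) auto
  then show ?thesis by (simp add: card_Fq)
qed

lemma Fq_power_q:
  assumes "x \<in> Fq" shows "x ^ q = x"
proof (cases "x = 0")
  case True then show ?thesis using q_ge_2 by simp
next
  case False
  let ?K = "Fq - {0}"
  have fin: "finite ?K" using finite_Fq by simp
  have inj: "inj_on ((*) x) ?K" using False by (auto intro: inj_onI)
  have "(*) x ` ?K = ?K"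
    using fin inj False assms by (intro endo_inj_surj) (auto intro: Fq_mult)
  then have "\<Prod>?K = (\<Prod>y\<in>?K. x * y)"
    using prod.reindex[OF inj, of "\<lambda>y. y"] by simp
  also have "\<dots> = x ^ card ?K * \<Prod>?K" by (simp add: prod.distrib)
  finally have "x ^ card ?K = 1" using fin by (simp add: prod_zero_iff)
  moreover have "q = Suc (card ?K)" using finite_Fq card_Fq q_ge_2 by (simp add: card_Diff_singleton)
  ultimately show ?thesis by simp
qed

lemma neg_1_neq_1: "(-1::'k) \<noteq> 1"
proof
  assume "(-1::'k) = 1"
  then have "of_nat 2 = (0::'k)" by (metis add.right_inverse of_nat_numeral one_add_one)
  then have "CHAR('k) dvd 2" by (simp add: of_nat_eq_0_iff_char_dvd del: of_nat_numeral)
  moreover have "CHAR('k) \<noteq> 1" by simp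
  ultimately show False using residue_char two_is_prime_nat by (auto simp: prime_nat_iff)
qed

text \<open>The element -1 lies in \<open>Fq\<close> and is therefore fixed by the q-th power; an
  even q would give -1 = 1.\<close>

lemma odd_q: "odd q"
proof
  assume "even q"
  then have "(-1::'k) ^ q = 1" by simp
  then show False using Fq_power_q[of "-1"] Fq_minus[OF Fq_1] neg_1_neq_1 by simp
qed

lemma q_ge_3: "3 \<le> q"
  using q_ge_2 odd_q by (cases "q = 2") auto

text \<open>At this point q is only the number of elements of \<open>Fq\<close>, so roots are
  counted: (1 + T)^q - T^q - 1 has degree less than q but vanishes at the q elements of
  \<open>Fq\<close>.\<close>

lemma choose_q_redu:
  assumes "0 < k" "k < q" shows "of_nat (q choose k) = (0::'k)"
proof -
  let ?P = "[:1, 1:] ^ q - monom 1 q - 1 :: 'k poly"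
  have c: "coeff ([:1, 1:] ^ q) i = (of_nat (q choose i) :: 'k)" for i
    using coeff_linear_poly_power[of 1 1 q i]
    by (cases "i \<le> q") (auto simp: coeff_linear_poly_power binomial_eq_0 coeff_eq_0 degree_linear_power)
  have "?P = 0"
  proof (rule ccontr)
    assume nz: "?P \<noteq> 0"
    have deg: "degree ?P < q"
    proof -
      have "coeff ?P i = 0" if "i \<ge> q" for i
        using that q_ge_2 by (cases "i = q") (auto simp: c coeff_1 binomial_eq_0)
      then show ?thesis using q_ge_2 by (metis le_degree not_le_imp_less leading_coeff_0_iff nz)
    qed
    have "Fq \<subseteq> {x. poly ?P x = 0}"
      using Fq_power_q Fq_add[OF Fq_1] by (auto simp: poly_monom)
    then have "card Fq \<le> card {x. poly ?P x = 0}"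
      using poly_roots_finite[OF nz] by (intro card_mono) auto
    also have "\<dots> \<le> degree ?P" by (rule card_poly_roots_bound[OF nz])
    finally show False using deg card_Fq by simp
  qed
  then have "coeff ?P k = 0" by simp
  then show ?thesis using assms by (simp add: c coeff_1)
qed

lemma pcompose_power': "pcompose (p ^ n) r = pcompose p r ^ n"
  for p r :: "'a::comm_ring_1 poly"
  by (induction n) (simp_all add: pcompose_mult pcompose_1)

text \<open>Substituting T^q for T in (1 + T)^q = 1 + T^q gives (1 + T)^(q^2) = (1 + T^q)^q = 1 +
  T^(q^2).\<close>

lemma choose_q2_redu:
  assumes "0 < k" "k < q ^ 2" shows "of_nat (q ^ 2 choose k) = (0::'k)"
proof -
  have c: "coeff ([:1, 1:] ^ m) i = (of_nat (m choose i) :: 'k)" for i m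
    by (cases "i \<le> m") (auto simp: coeff_linear_poly_power binomial_eq_0 coeff_eq_0 degree_linear_power)
  have 1: "([:1, 1:] :: 'k poly) ^ q = monom 1 q + 1"
  proof (rule poly_eqI)
    fix i show "coeff ([:1, 1:] ^ q) i = coeff (monom 1 q + 1 :: 'k poly) i"
    proof (cases "i = 0 \<or> i = q")
      case True then show ?thesis using q_ge_2 by (auto simp: c coeff_1)
    next
      case False
      then show ?thesis using choose_q_redu[of i]
        by (cases "i < q") (auto simp: c coeff_1 binomial_eq_0)
    qed
  qed
  have "([:1, 1:] :: 'k poly) ^ (q ^ 2) = (monom 1 q + 1) ^ q"
    by (simp add: power_mult power2_eq_square 1)
  also have "\<dots> = pcompose ([:1, 1:] ^ q) (monom 1 q)"
    by (simp add: pcompose_power' pcompose_pCons add.commute one_pCons)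
  also have "\<dots> = monom 1 (q ^ 2) + 1"
  proof -
    have "[:1, 1:] ^ q = [:0,1:] ^ q + (1::'k poly)" unfolding 1 by (simp add: monom_altdef)
    then show ?thesis by (simp add: pcompose_add pcompose_power' pcompose_pCons monom_power power2_eq_square pcompose_1)
  qed
  finally have "coeff ([:1, 1:] ^ (q ^ 2)) k = coeff (monom 1 (q ^ 2) + 1 :: 'k poly) k" by simp
  then show ?thesis using assms by (simp add: c coeff_1)
qed

lemma nm_of_nat_le_uni:
  assumes "of_nat n = (0::'k)" shows "nm (of_nat n :: 'c) \<le> nm \<varpi>" "(of_nat n :: 'c) / \<varpi> \<in> OF D"
proof -
  have "nm (of_nat n :: 'c) < 1"
    using assms redu_0_iff[of "of_nat n"] nm_of_nat_le_1[of n] by (simp add: redu_of_nat)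
  then show "nm (of_nat n :: 'c) \<le> nm \<varpi>" "(of_nat n :: 'c) / \<varpi> \<in> OF D"
    using OF_div_uni OF_of_nat by blast+
qed

lemma nm_choose_q: "0 < k \<Longrightarrow> k < q \<Longrightarrow> nm (of_nat (q choose k) :: 'c) \<le> nm \<varpi>"
  by (rule nm_of_nat_le_uni choose_q_redu)+

lemma binomial_middle:
  fixes x y :: "'a::comm_ring_1"
  assumes "0 < n"
  shows "(x + y) ^ n = x ^ n + y ^ n + (\<Sum>k\<in>{0<..<n}. of_nat (n choose k) * x ^ k * y ^ (n - k))"
proof -
  have *: "{..n} = insert 0 (insert n {0<..<n})" using assms by auto
  show ?thesis unfolding binomial_ring * using assms by (simp add: algebra_simps)
qed

lemma nm_frob:
  assumes "nm x \<le> 1" "nm y \<le> 1"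
  shows "nm ((x + y) ^ q - x ^ q - y ^ q) \<le> nm \<varpi>"
proof -
  have "(x + y) ^ q - x ^ q - y ^ q = (\<Sum>k\<in>{0<..<q}. of_nat (q choose k) * x ^ k * y ^ (q - k))"
    using binomial_middle[of q x y] q_ge_2 by simp
  also have "nm \<dots> \<le> nm \<varpi>"
    using assms nm_uni
    by (intro nm_sum_le nm_mult_le_left nm_choose_q nm_power_le_1) auto
  finally show ?thesis .
qed

text \<open>In the expansion of ((x - y) + y)^q the middle coefficients contribute a factor \<pi>,
  and the remaining term is a full q-th power. This gain of precision is the mechanism behind most
  later estimates.\<close>

lemma nm_power_q_diff:
  assumes "nm x \<le> 1" "nm y \<le> 1" "nm (x - y) \<le> d" "d \<le> 1"
  shows "nm (x ^ q - y ^ q) \<le> max (nm \<varpi> * d) (d ^ q)"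
proof -
  have d0: "0 \<le> d" by (rule order_trans[OF nm_ge_0 assms(3)])
  have "x ^ q - y ^ q = (x - y) ^ q + (\<Sum>k\<in>{0<..<q}. of_nat (q choose k) * (x - y) ^ k * y ^ (q - k))"
    using binomial_middle[of q "x - y" y] q_ge_2 by simp
  also have "nm \<dots> \<le> max (nm \<varpi> * d) (d ^ q)"
  proof (rule nm_add_leI)
    show "nm ((x - y) ^ q) \<le> max (nm \<varpi> * d) (d ^ q)"
      using power_mono[OF assms(3), of q] by (simp add: nm_power)
    have "nm (\<Sum>k\<in>{0<..<q}. of_nat (q choose k) * (x - y) ^ k * y ^ (q - k)) \<le> nm \<varpi> * d"
    proof (rule nm_sum_le)
      fix k assume k: "k \<in> {0<..<q}"
      have "nm (x - y) ^ k \<le> d ^ k" using assms by (simp add: power_mono)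
      also have "d ^ k \<le> d ^ 1" using k d0 assms(4) by (intro power_decreasing) auto
      finally have "nm ((x - y) ^ k) \<le> d" by (simp add: nm_power)
      then show "nm (of_nat (q choose k) * (x - y) ^ k * y ^ (q - k)) \<le> nm \<varpi> * d"
        using k assms by (intro nm_mult_le_left nm_mult_le nm_choose_q nm_power_le_1) auto
    qed (use nm_uni d0 in auto)
    then show "nm (\<Sum>k\<in>{0<..<q}. of_nat (q choose k) * (x - y) ^ k * y ^ (q - k)) \<le> max (nm \<varpi> * d) (d ^ q)" by simp
  qed
  finally show ?thesis .
qed

lemma nm_power_diff:
  assumes "nm x \<le> 1" "nm y \<le> 1" "nm (x - y) \<le> d"
  shows "nm (x ^ n - y ^ n) \<le> d"
proof (induction n)
  case 0 then show ?case using order_trans[OF nm_ge_0 assms(3)] by simp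
next
  case (Suc n)
  have "x ^ Suc n - y ^ Suc n = x * (x ^ n - y ^ n) + (x - y) * y ^ n" by (simp add: algebra_simps)
  also have "nm \<dots> \<le> d"
    using Suc assms by (intro nm_add_leI nm_mult_le_right nm_mult_le_left nm_power_le_1) auto
  finally show ?case .
qed

subsection \<open>Roots by successive approximation\<close>

lemma complete_OF: "complete (OF D)"
proof -
  have "OF D = base D \<inter> cball 0 1"
    by (auto simp: OF_iff nm_def dist_commute)
  then show ?thesis using base_complete by (simp add: complete_Int_closed)
qed

text \<open>Near \<open>t0\<close> the map sending x to x^Q / c contracts, because q-th powers bring
  close points closer. The complete set \<open>S\<close> is a parameter: the ring of integers of F
  yields Teichmueller representatives, all of C yields roots of t^(q^2) = c t.\<close>

lemma frobenius_fixpoint: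
  assumes S: "complete S" "\<And>x. x \<in> S \<Longrightarrow> x ^ Q / c \<in> S" "t0 \<in> S"
    and Q: "Q = q * m" and c: "nm c = 1" and t0: "nm t0 \<le> 1" "nm (t0 ^ Q - c * t0) < 1"
  obtains t where "t \<in> S" "t ^ Q = c * t" "nm t \<le> 1" "nm (t - t0) < 1"
proof -
  define T where "T n = ((\<lambda>x. x ^ Q / c) ^^ n) t0" for n
  have T0: "T 0 = t0" and TS: "T (Suc n) = T n ^ Q / c" for n by (simp_all add: T_def)
  have cnz: "c \<noteq> 0" using c by auto
  have T1: "nm (T n) \<le> 1" for n
    by (induction n) (auto simp: T0 TS t0 nm_divide c nm_power_le_1)
  have TinS: "T n \<in> S" for n by (induction n) (auto simp: T0 TS S)
  define d where "d = nm (T 1 - T 0)"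
  have d: "0 \<le> d" "d < 1"
  proof -
    have "T 1 - T 0 = (t0 ^ Q - c * t0) / c" using cnz by (simp add: T_def field_simps)
    then show "d < 1" using t0 c by (simp add: d_def nm_divide)
  qed (simp add: d_def)
  \<comment> \<open>Ratio of the geometric bound: a q-th power shrinks a distance e by |\<pi>| or,
    as e^q <= e^2 and e <= d, by d.\<close>
  define l where "l = max (nm \<varpi>) d"
  have l: "0 < l" "l < 1" using nm_uni d by (auto simp: l_def less_max_iff_disj)
  have step: "nm (T (Suc n) - T n) \<le> d * l ^ n" for n
  proof (induction n)
    case 0 then show ?case by (simp add: d_def)
  next
    case (Suc n)
    define e where "e = d * l ^ n"
    have e: "0 \<le> e" "e \<le> d" using d l by (auto simp: e_def power_le_one mult_left_le)
    have "e ^ q \<le> e ^ 2" using e d q_ge_2 by (intro power_decreasing) auto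
    also have "\<dots> \<le> e * l" using e by (auto simp: power2_eq_square l_def intro!: mult_left_mono)
    finally have 1: "max (nm \<varpi> * e) (e ^ q) \<le> e * l"
      using e by (auto simp: l_def mult.commute intro: mult_left_mono)
    have "nm (T (Suc n) ^ q - T n ^ q) \<le> e * l"
      using nm_power_q_diff[of "T (Suc n)" "T n" e] T1 Suc e d 1 by (auto simp: e_def)
    then have "nm ((T (Suc n) ^ q) ^ m - (T n ^ q) ^ m) \<le> e * l"
      by (rule nm_power_diff[rotated -1]) (intro nm_power_le_1 T1)+
    moreover have "T (Suc (Suc n)) - T (Suc n) = ((T (Suc n) ^ q) ^ m - (T n ^ q) ^ m) / c"
      by (simp add: TS[of "Suc n"] diff_divide_distrib power_mult[symmetric] Q[symmetric]) (simp add: TS)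
    ultimately show ?case using c by (simp add: nm_divide e_def mult.assoc mult.commute mult.left_commute)
  qed
  have far: "nm (T (n + k) - T n) \<le> d * l ^ n" for n k
  proof (induction k)
    case 0 then show ?case using d l by simp
  next
    case (Suc k)
    have "d * l ^ (n + k) \<le> d * l ^ n"
      using d l by (intro mult_left_mono power_decreasing) auto
    then have "nm (T (n + Suc k) - T (n + k)) \<le> d * l ^ n" using step[of "n + k"] by simp
    moreover have "T (n + Suc k) - T n = (T (n + Suc k) - T (n + k)) + (T (n + k) - T n)" by simp
    ultimately show ?case using Suc by (metis nm_add_leI)
  qed
  have lim0: "(\<lambda>n. d * l ^ n) \<longlonglongrightarrow> 0"
    using l by (intro tendsto_mult_right_zero LIMSEQ_power_zero) auto
  have "Cauchy T"
  proof (rule metric_CauchyI)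
    fix e :: real assume "0 < e"
    then obtain M where M: "\<And>n. n \<ge> M \<Longrightarrow> d * l ^ n < e"
      using order_tendstoD(2)[OF lim0] by (auto simp: eventually_sequentially)
    have "nm (T a - T b) < e" if "a \<ge> M" "b \<ge> M" for a b
    proof -
      have *: "nm (T a' - T M) < e" if "a' \<ge> M" for a'
        using far[of M "a' - M"] M[of M] that by simp
      have "nm ((T a - T M) - (T b - T M)) < e"
        by (rule nm_diff_lessI) (use that * in auto)
      then show ?thesis by simp
    qed
    then show "\<exists>M. \<forall>m\<ge>M. \<forall>n\<ge>M. dist (T m) (T n) < e" by (auto simp: dist_eq_nm)
  qed
  then obtain t where t: "t \<in> S" "T \<longlonglongrightarrow> t" using S(1) TinS by (auto simp: complete_def)
  have ev: "\<exists>n. \<forall>k\<ge>n. nm (T k - t) < e" if "e > 0" for e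
    using t(2) that by (auto simp: lim_sequentially dist_eq_nm)
  obtain n where n: "nm (T n - t) < 1" using ev[of 1] by auto
  have t1: "nm t \<le> 1"
    using nm_diff_leI[of "T n" 1 "T n - t"] n T1[of n] by simp
  have "nm (T n - T 0) \<le> d" using far[of 0 n] by simp
  then have "nm (T n - T 0) < 1" using d by simp
  then have "nm ((T n - T 0) - (T n - t)) < 1" using n by (rule nm_diff_lessI)
  then have n0: "nm (t - t0) < 1" by (simp add: T0)
  have "nm (t ^ Q - c * t) < e" if e: "e > 0" for e
  proof -
    obtain n where n: "\<And>k. k \<ge> n \<Longrightarrow> nm (T k - t) < e" using ev[OF e] by auto
    have "nm (t ^ Q - T n ^ Q) < e"
      using nm_power_diff[of t "T n" "nm (T n - t)" Q] t1 T1 n[of n] by (simp add: nm_diff_commute)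
    moreover have "nm (c * (T (Suc n) - t)) < e" using n[of "Suc n"] c by (simp add: nm_mult)
    ultimately have "nm ((t ^ Q - T n ^ Q) + c * (T (Suc n) - t)) < e" by (rule nm_add_lessI)
    also have "(t ^ Q - T n ^ Q) + c * (T (Suc n) - t) = t ^ Q - c * t"
      using cnz by (simp add: TS field_simps)
    finally show ?thesis .
  qed
  then have "t ^ Q = c * t" by (metis less_irrefl nm_gt_0_iff right_minus_eq)
  then show ?thesis using that t(1) t1 n0 by blast
qed

lemma q2_ge_9: "9 \<le> q ^ 2"
  using mult_le_mono[OF q_ge_3 q_ge_3] by (simp add: power2_eq_square)

lemma of_nat_q_k: "of_nat q = (0::'k)"
  using choose_q_redu[of 1] q_ge_2 by simp

text \<open>x^n - y^n is x - y times a sum that reduces to n times a power of the reduction of x,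
  hence a unit. So the distance of congruent units can be read off from their n-th powers; this is
  applied with n = q - 1 and n = q^2 - 1.\<close>

lemma power_diff_unit:
  assumes "of_nat n \<noteq> (0::'k)" "nm x = 1" "nm y \<le> 1" "nm (x - y) < 1"
  shows "nm (x ^ n - y ^ n) = nm (x - y)"
proof -
  have r: "redu D y = redu D x" using redu_eq_iff[of x y] assms by simp
  have "redu D (\<Sum>i<n. y ^ (n - Suc i) * x ^ i) = (\<Sum>i<n. redu D (y ^ (n - Suc i) * x ^ i))"
    using assms(2,3) by (intro redu_sum nm_mult_le_1 nm_power_le_1) auto
  also have "\<dots> = (\<Sum>i<n. redu D x ^ (n - 1))"
  proof (rule sum.cong[OF refl])
    fix i assume "i \<in> {..<n}"
    then have "n - Suc i + i = n - 1" by auto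
    moreover have "redu D (y ^ (n - Suc i) * x ^ i) = redu D x ^ (n - Suc i + i)"
      using assms(2,3) r by (subst power_add) (simp add: redu_times redu_power nm_power_le_1)
    ultimately show "redu D (y ^ (n - Suc i) * x ^ i) = redu D x ^ (n - 1)" by metis
  qed
  also have "\<dots> \<noteq> 0" using assms redu_0_iff[of x] by simp
  finally have "nm (\<Sum>i<n. y ^ (n - Suc i) * x ^ i) = 1"
    using assms by (subst redu_nz_iff[symmetric]) (auto intro!: nm_sum_le nm_mult_le_1 nm_power_le_1)
  then show ?thesis by (simp add: power_diff_sumr2 nm_mult)
qed

lemma of_nat_q1_k: "of_nat (q - 1) \<noteq> (0::'k)"
  using of_nat_q_k q_ge_2 by (simp add: of_nat_diff)

lemma of_nat_q21_k: "of_nat (q ^ 2 - 1) \<noteq> (0::'k)"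
  using of_nat_q_k q_ge_2 by (simp add: of_nat_diff power_le_one)

text \<open>The root is found as a nonzero solution of t^(q^2) = c t, because for the exponent q^2
  the iteration of \<open>frobenius_fixpoint\<close> contracts.\<close>

lemma root_q21_exists:
  assumes "nm c = 1" "\<xi> ^ (q ^ 2 - 1) = redu D c"
  obtains t where "nm t = 1" "redu D t = \<xi>" "t ^ (q ^ 2 - 1) = c"
proof -
  have q2: "0 < q ^ 2" using q_ge_2 by simp
  obtain t0 where t0: "nm t0 \<le> 1" "redu D t0 = \<xi>" using ex_reduces_to by blast
  have "redu D (t0 ^ (q ^ 2)) = redu D (c * t0)"
    using t0 assms power_minus_mult[OF q2, of \<xi>] by (simp add: redu_times redu_power)
  then have "nm (t0 ^ (q ^ 2) - c * t0) < 1"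
    using t0 assms by (subst redu_eq_iff[symmetric]) (auto intro: nm_mult_le_1 nm_power_le_1)
  then obtain t where t: "t ^ (q ^ 2) = c * t" "nm t \<le> 1" "nm (t - t0) < 1"
    using frobenius_fixpoint[of UNIV "q ^ 2" c t0 q] t0 assms complete_UNIV
    by (auto simp: power2_eq_square)
  have "redu D t = \<xi>" using redu_eqI[of t0 t] t t0 by simp
  moreover have "\<xi> \<noteq> 0"
  proof
    assume "\<xi> = 0"
    moreover have "0 < q ^ 2 - 1" using q2_ge_9 by simp
    ultimately have "redu D c = 0" using assms(2) by (simp add: zero_power)
    then show False using redu_0_iff[of c] assms by simp
  qed
  ultimately have "nm t = 1" using redu_nz_iff[of t] t by simp
  moreover have "t ^ (q ^ 2 - 1) = c" using t(1) \<open>nm t = 1\<close> power_minus_mult[OF q2, of t] by auto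
  ultimately show ?thesis using that \<open>redu D t = \<xi>\<close> by blast
qed

subsection \<open>Teichmueller representatives\<close>

lemma mu0_iff: "t \<in> mu0 D \<longleftrightarrow> t \<in> OF D \<and> t ^ q = t"
proof -
  have "t ^ q = t ^ (q - 1) * t" using q_ge_2 power_minus_mult[of q t] by simp
  then show ?thesis using q_ge_2 by (auto simp: mu0_def)
qed

lemma mu0_OF: "t \<in> mu0 D \<Longrightarrow> t \<in> OF D" and mu0_power: "t \<in> mu0 D \<Longrightarrow> t ^ q = t"
  by (auto simp: mu0_iff)

lemma mu0_nm: "t \<in> mu0 D \<Longrightarrow> nm t \<le> 1"
  by (simp add: mu0_OF OF_nm)

text \<open>Nonzero elements are (q-1)-st roots of unity, and \<open>power_diff_unit\<close> with n
  = q - 1 separates those with different values; an element reducing to 0 must be 0.\<close>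

lemma mu0_eqI:
  assumes "s \<in> mu0 D" "t \<in> mu0 D" "redu D s = redu D t" shows "s = t"
proof (cases "nm t = 1")
  case True
  have st: "nm (t - s) < 1" using assms redu_eq_iff[of t s] mu0_nm by auto
  then have "nm s = 1" using nm_eqI[of t s] True by simp
  then have "s ^ (q - 1) = t ^ (q - 1)" using assms True by (auto simp: mu0_def)
  then show ?thesis
    using power_diff_unit[OF of_nat_q1_k True _ st] \<open>nm s = 1\<close> by simp
next
  case False
  have z: "u = 0" if "u \<in> mu0 D" "redu D u = 0" for u
  proof (rule ccontr)
    assume "u \<noteq> 0"
    then have "nm u ^ (q - 1) = 1" using that by (auto simp: mu0_def nm_power[symmetric])
    then have "nm u = 1" using q_ge_2 power_eq_imp_eq_base[of "nm u" "q - 1" 1] by simp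
    then show False using redu_0_iff[of u] that by simp
  qed
  have "redu D t = 0" using False redu_nz_iff[of t] mu0_nm assms by auto
  then show ?thesis using z assms by metis
qed

lemma teich_props:
  assumes "\<xi> \<in> Fq" shows "teich D \<xi> \<in> mu0 D" "redu D (teich D \<xi>) = \<xi>"
proof -
  obtain t0 where t0: "t0 \<in> OF D" "redu D t0 = \<xi>" using assms by (auto simp: Fq_def)
  have "redu D (t0 ^ q) = redu D t0"
    using t0 assms by (simp add: redu_power OF_nm Fq_power_q)
  then have "nm (t0 ^ q - t0) < 1"
    using t0 by (subst redu_eq_iff[symmetric]) (auto intro: OF_nm nm_power_le_1)
  then obtain t where t: "t \<in> OF D" "t ^ q = t" "nm (t - t0) < 1"
    using frobenius_fixpoint[of "OF D" q 1 t0 1] complete_OF t0 OF_nm OF_power by auto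
  have "redu D t = \<xi>" using redu_eqI[of t0 t] t t0 OF_nm by simp
  then have "\<exists>!t. t \<in> mu0 D \<and> redu D t = \<xi>"
    using t mu0_eqI by (intro ex1I[of _ t]) (auto simp: mu0_iff)
  from theI'[OF this] show "teich D \<xi> \<in> mu0 D" "redu D (teich D \<xi>) = \<xi>"
    by (auto simp: teich_def)
qed

lemma teich_redu: "t \<in> mu0 D \<Longrightarrow> teich D (redu D t) = t"
  using teich_props[of "redu D t"] mu0_eqI by (metis Fq_redu mu0_OF)

lemma teich_near:
  assumes "x \<in> OF D"
  shows "nm (x - teich D (redu D x)) \<le> nm \<varpi>" "(x - teich D (redu D x)) / \<varpi> \<in> OF D"
proof -
  note t = teich_props[OF Fq_redu[OF assms]]
  have "nm (x - teich D (redu D x)) < 1"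
    using t assms by (subst redu_eq_iff[symmetric]) (auto simp: OF_nm mu0_nm)
  moreover have "x - teich D (redu D x) \<in> OF D" using t mu0_OF OF_diff assms by blast
  ultimately show "nm (x - teich D (redu D x)) \<le> nm \<varpi>" "(x - teich D (redu D x)) / \<varpi> \<in> OF D"
    using OF_div_uni by blast+
qed

text \<open>The Teichmueller representative is fixed by the q-th power, which squares the precision
  of the approximation.\<close>

lemma teich_near_power:
  assumes "x \<in> OF D" shows "nm (x ^ q - teich D (redu D x)) \<le> nm \<varpi> ^ 2"
proof -
  note t = teich_props[OF Fq_redu[OF assms]]
  have "nm (x ^ q - teich D (redu D x) ^ q) \<le> max (nm \<varpi> * nm \<varpi>) (nm \<varpi> ^ q)"
    using nm_uni t assms by (intro nm_power_q_diff teich_near(1)) (auto simp: OF_nm mu0_nm)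
  moreover have "nm \<varpi> ^ q \<le> nm \<varpi> ^ 2" using nm_uni q_ge_2 by (intro power_decreasing) auto
  ultimately show ?thesis using mu0_power[OF t(1)] by (auto simp: power2_eq_square)
qed

subsection \<open>The constants\<close>

definition th ("\<theta>") where "\<theta> = nm (kappa1 D)"

text \<open>Exponent of \<theta> in |w^q|, the relative size of the first correction to the linear
  action; \<open>\<theta> ^ (q ^ 2 * eW)\<close> is |\<pi>|.\<close>

definition eW :: nat where "eW = q * (q ^ 2 - 1)"

lemma th_uni: "\<theta> ^ (q ^ 2 * eW) = nm \<varpi>"
proof -
  have "q ^ 2 * eW = q ^ 3 * (q ^ 2 - 1)" by (simp add: eW_def power2_eq_square power3_eq_cube)
  then show ?thesis using kappa1_power by (metis th_def nm_power)
qed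

lemma th: "0 < \<theta>" "\<theta> < 1"
proof -
  have ge: "0 \<le> \<theta>" by (simp add: th_def)
  have "eW > 0" using q_ge_2 q2_ge_9 by (simp add: eW_def)
  then show "0 < \<theta>" using th_uni nm_uni ge q_ge_2
    by (metis less_eq_real_def power_0_left power_eq_0_iff less_irrefl)
  show "\<theta> < 1"
    using th_uni nm_uni ge by (metis not_less one_le_power)
qed

lemma th_mono: "m \<le> n \<Longrightarrow> \<theta> ^ n \<le> \<theta> ^ m"
  using th by (intro power_decreasing) auto

lemma pos_exps: "0 < (q - 1) * (q ^ 2 - 1)" "0 < q * ((q - 1) * (q ^ 2 - 1))" "0 < eW"
  using q_ge_3 q2_ge_9 by (auto simp: eW_def)

lemma th_less_1_power: "0 < n \<Longrightarrow> \<theta> ^ n < 1"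
  using th power_strict_decreasing[of 0 n \<theta>] by simp

lemma th_le_1: "\<theta> ^ n \<le> 1"
  using th by (simp add: power_le_one)

lemma kappa1_nz: "kappa1 D \<noteq> 0"
  using th by (auto simp: th_def)

text \<open>Recording precision as a natural exponent of \<theta> turns every error estimate into an
  inequality between polynomials in q.\<close>

definition cg :: "nat \<Rightarrow> 'c \<Rightarrow> 'c \<Rightarrow> bool" where
  "cg n x y \<longleftrightarrow> nm (x - y) \<le> \<theta> ^ n"

lemma cg_refl [simp]: "cg n x x"
  using th by (simp add: cg_def)

lemma cg_sym: "cg n x y \<Longrightarrow> cg n y x"
  by (simp add: cg_def nm_diff_commute)

lemma cg_trans [trans]: "cg n x y \<Longrightarrow> cg n y z \<Longrightarrow> cg n x z"
  using nm_add_leI[of "x - y" "\<theta> ^ n" "y - z"] by (simp add: cg_def)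

lemma cg_eq_trans [trans]: "cg n x y \<Longrightarrow> y = z \<Longrightarrow> cg n x z"
  and eq_cg_trans [trans]: "x = y \<Longrightarrow> cg n y z \<Longrightarrow> cg n x z"
  by auto

lemma cg_mono: "cg n x y \<Longrightarrow> m \<le> n \<Longrightarrow> cg m x y"
  using th_mono[of m n] by (auto simp: cg_def)

lemma cg_add: "cg n x y \<Longrightarrow> cg n x' y' \<Longrightarrow> cg n (x + x') (y + y')"
  using nm_add_leI[of "x - y" "\<theta> ^ n" "x' - y'"] by (simp add: cg_def algebra_simps)

lemma cg_minus: "cg n x y \<Longrightarrow> cg n (- x) (- y)"
  using nm_diff_commute[of x y] by (simp add: cg_def)

lemma cg_diff: "cg n x y \<Longrightarrow> cg n x' y' \<Longrightarrow> cg n (x - x') (y - y')"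
  using cg_add[of n x y "-x'" "-y'"] cg_minus[of n x' y'] by simp

lemma cg_mult: "cg n x y \<Longrightarrow> cg n x' y' \<Longrightarrow> nm x' \<le> 1 \<Longrightarrow> nm y \<le> 1 \<Longrightarrow> cg n (x * x') (y * y')"
proof -
  assume a: "cg n x y" "cg n x' y'" "nm x' \<le> 1" "nm y \<le> 1"
  have "x * x' - y * y' = (x - y) * x' + y * (x' - y')" by (simp add: algebra_simps)
  also have "nm \<dots> \<le> \<theta> ^ n"
  proof (rule nm_add_leI)
    show "nm ((x - y) * x') \<le> \<theta> ^ n" using a by (simp add: cg_def nm_mult_le_left)
    show "nm (y * (x' - y')) \<le> \<theta> ^ n" using a by (simp add: cg_def nm_mult_le_right)
  qed
  finally show ?thesis by (simp add: cg_def)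
qed

lemma cg_scale: "nm c \<le> \<theta> ^ m \<Longrightarrow> cg n x y \<Longrightarrow> cg (m + n) (c * x) (c * y)"
  using nm_mult_le[of c "\<theta> ^ m" "x - y" "\<theta> ^ n"] by (simp add: cg_def power_add right_diff_distrib)

lemma cg_cancel: "nm c = \<theta> ^ m \<Longrightarrow> cg (m + n) (c * x) (c * y) \<Longrightarrow> cg n x y"
  using th by (simp add: cg_def nm_mult right_diff_distrib[symmetric] power_add)

lemma cg_mult_left: "nm c \<le> 1 \<Longrightarrow> cg n x y \<Longrightarrow> cg n (c * x) (c * y)"
  using cg_scale[of c 0 n x y] by simp

lemma cg_mult_right: "nm c \<le> 1 \<Longrightarrow> cg n x y \<Longrightarrow> cg n (x * c) (y * c)"
  using cg_mult_left[of c n x y] by (simp add: mult.commute)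

lemma cg_power: "cg n x y \<Longrightarrow> nm x \<le> 1 \<Longrightarrow> nm y \<le> 1 \<Longrightarrow> cg n (x ^ k) (y ^ k)"
  unfolding cg_def by (rule nm_power_diff)

lemma cg_0_iff: "cg n x 0 \<longleftrightarrow> nm x \<le> \<theta> ^ n"
  by (simp add: cg_def)

lemma cg_0_add: "nm z \<le> \<theta> ^ n \<Longrightarrow> cg n (x + z) x"
  by (simp add: cg_def)

lemma cg_nm_le: "cg n x y \<Longrightarrow> nm y \<le> \<theta> ^ m \<Longrightarrow> m \<le> n \<Longrightarrow> nm x \<le> \<theta> ^ m"
  using nm_add_leI[of "x - y" "\<theta> ^ m" y] th_mono[of m n] by (simp add: cg_def)

lemma cg_nm_le_1: "cg n x y \<Longrightarrow> nm y \<le> 1 \<Longrightarrow> nm x \<le> 1"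
  using cg_nm_le[of n x y 0] by simp

lemma cg_redu: "cg n x y \<Longrightarrow> 0 < n \<Longrightarrow> nm y \<le> 1 \<Longrightarrow> redu D x = redu D y"
proof -
  assume a: "cg n x y" "0 < n" "nm y \<le> 1"
  have "\<theta> ^ n < 1" using th_less_1_power a(2) by blast
  then show ?thesis using a redu_eqI[of y x] by (simp add: cg_def)
qed

lemma cg_uni: "nm (x - y) \<le> nm \<varpi> \<Longrightarrow> n \<le> q ^ 2 * eW \<Longrightarrow> cg n x y"
  using th_uni th_mono[of n "q ^ 2 * eW"] by (simp add: cg_def)

lemma nm_root_q: "nm (x ^ q) \<le> \<theta> ^ (q * n) \<Longrightarrow> nm x \<le> \<theta> ^ n"
  using power_mono_iff[of "nm x" "\<theta> ^ n" q] th q_ge_2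
  by (simp add: nm_power power_mult mult.commute[of q n])

lemma cg_frob: "nm x \<le> 1 \<Longrightarrow> nm y \<le> 1 \<Longrightarrow> n \<le> q ^ 2 * eW \<Longrightarrow> cg n ((x + y) ^ q) (x ^ q + y ^ q)"
  by (rule cg_uni) (use nm_frob[of x y] in \<open>auto simp: diff_diff_eq\<close>)

lemma cg_frob_diff: "nm x \<le> 1 \<Longrightarrow> nm y \<le> 1 \<Longrightarrow> n \<le> q ^ 2 * eW \<Longrightarrow> cg n ((x - y) ^ q) (x ^ q - y ^ q)"
  using cg_frob[of x "-y" n] odd_q by simp

text \<open>A q-th power multiplies the precision by q, capped at that of \<pi>, where the middle
  binomial terms take over.\<close>

lemma cg_power_q:
  assumes "cg n x y" "nm x \<le> 1" "nm y \<le> 1" "m \<le> q * n" "m \<le> q ^ 2 * eW"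
  shows "cg m (x ^ q) (y ^ q)"
proof -
  have "nm (x ^ q - y ^ q) \<le> max (nm \<varpi> * \<theta> ^ n) ((\<theta> ^ n) ^ q)"
    using assms th_le_1 by (intro nm_power_q_diff) (auto simp: cg_def)
  moreover have "(\<theta> ^ n) ^ q \<le> \<theta> ^ m" using th_mono[OF assms(4)] by (simp add: power_mult[symmetric] mult.commute)
  moreover have "nm \<varpi> * \<theta> ^ n \<le> \<theta> ^ m"
    using th_mono[OF assms(5)] th_uni th_le_1[of n] nm_uni by (metis mult_left_le less_imp_le order_trans)
  ultimately show ?thesis by (simp add: cg_def)
qed

lemma nm_kappa: "nm (kappa D) = \<theta> ^ q"
  by (simp add: kappa_def nm_power th_def)

lemma nm_gamma: "nm (gamma D) = \<theta> ^ (q * ((q - 1) * (q ^ 2 - 1)))"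
  by (simp add: gamma_def nm_power nm_kappa power_mult)

lemma nm_gamma_root_q: "nm (gamma_root_q D) = \<theta> ^ ((q - 1) * (q ^ 2 - 1))"
  by (simp add: gamma_root_q_def nm_power th_def)

lemma nm_w: "nm (w_const D) = \<theta> ^ (q ^ 2 - 1)"
  by (simp add: w_const_def nm_power th_def)

lemma nm_g: "nm (gamma_root_qq1 D) = \<theta> ^ (q * (q - 1))"
  by (simp add: gamma_root_qq1_def nm_power th_def)

lemma gamma_eq: "gamma D = gamma_root_q D ^ q"
  by (simp add: gamma_def gamma_root_q_def kappa_def power_mult[symmetric] ac_simps)

lemma gamma_root_q_eq: "gamma_root_q D = w_const D ^ (q - 1)"
  by (simp add: gamma_root_q_def w_const_def power_mult[symmetric] ac_simps)

lemma kappa_w: "kappa D ^ (q ^ 2 - 1) = w_const D ^ q"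
  by (simp add: kappa_def w_const_def power_mult[symmetric] ac_simps)

lemma gamma_root_q_w: "gamma_root_q D * w_const D = w_const D ^ q"
  using q_ge_2 by (simp add: gamma_root_q_eq power_Suc2[symmetric])

lemma gamma_w: "gamma D * w_const D ^ q = gamma_q_over_q1 D"
proof -
  have "gamma D * w_const D ^ q = (w_const D ^ q) ^ q"
    by (simp add: gamma_eq power_mult_distrib[symmetric] gamma_root_q_w)
  then show ?thesis by (simp add: gamma_q_over_q1_def w_const_def power_mult[symmetric] power2_eq_square ac_simps)
qed

lemma g_w: "gamma_root_qq1 D ^ (q + 1) = w_const D ^ q"
proof -
  have "(q - 1) * (q + 1) = q ^ 2 - 1" by (simp add: power2_eq_square algebra_simps)
  then have "q * (q - 1) * (q + 1) = (q ^ 2 - 1) * q" by (metis mult.commute mult.assoc)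
  then show ?thesis by (simp only: gamma_root_qq1_def w_const_def power_mult[symmetric])
qed

lemma nm_wq: "nm (w_const D ^ q) = \<theta> ^ eW"
  by (simp add: nm_power nm_w power_mult[symmetric] eW_def mult.commute)

text \<open>The defining equation says \<open>gamma0\<close>^q - 1 = gamma^q \<open>gamma0\<close>,
  and the left-hand side is (\<open>gamma0\<close> - 1)^q up to \<pi>. Taking a q-th root leaves
  |gamma| as the bound.\<close>

lemma gamma0_near: "cg (q * ((q - 1) * (q ^ 2 - 1))) (gamma0 D) 1"
proof -
  let ?e = "q * ((q - 1) * (q ^ 2 - 1))"
  have g: "nm (gamma D) ^ q < 1"
  proof -
    have "0 < ?e * q" using pos_exps q_ge_3 by simp
    then have "\<theta> ^ (?e * q) < 1" using th using th_less_1_power by blast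
    then show ?thesis by (simp add: nm_gamma power_mult)
  qed
  \<comment> \<open>Otherwise gamma0^q would be strictly larger than gamma^q gamma0 in the defining
    equation and would have to have the size of 1.\<close>
  have le: "nm (gamma0 D) \<le> 1"
  proof (rule ccontr)
    assume a: "\<not> nm (gamma0 D) \<le> 1"
    have "nm (gamma0 D ^ q - 1) = nm (gamma D) ^ q * nm (gamma0 D)"
      using gamma0_eq by (metis add_diff_cancel_right' diff_add_cancel diff_diff_eq2 nm_mult nm_power diff_eq_eq add.commute)
    also have "\<dots> < 1 * nm (gamma0 D)" using g a by (intro mult_strict_right_mono) linarith+
    also have "1 * nm (gamma0 D) = nm (gamma0 D)" by simp
    also have "\<dots> \<le> nm (gamma0 D ^ q)" using a q_ge_2 by (simp add: nm_power self_le_power)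
    finally have "nm (gamma0 D ^ q - 1) < nm (gamma0 D ^ q)" .
    then have "nm (gamma0 D ^ q) = 1" using nm_eqI[of "gamma0 D ^ q" 1] by simp
    then show False using a q_ge_2 one_less_power[of "nm (gamma0 D)" q] by (simp add: nm_power)
  qed
  have e: "q * ?e \<le> q ^ 2 * eW"
  proof -
    have "(q - 1) * (q ^ 2 - 1) \<le> q * (q ^ 2 - 1)" by (rule mult_right_mono) auto
    then show ?thesis by (simp add: eW_def power2_eq_square mult.assoc)
  qed
  have "cg (q * ?e) ((gamma0 D - 1) ^ q) (gamma0 D ^ q - 1 ^ q)"
    by (rule cg_frob_diff) (use le e in auto)
  moreover have "gamma0 D ^ q - 1 ^ q = gamma D ^ q * gamma0 D" using gamma0_eq by (simp add: algebra_simps)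
  moreover have "nm (gamma D ^ q * gamma0 D) \<le> \<theta> ^ (q * ?e)"
    using le by (intro nm_mult_le_left) (auto simp: nm_power nm_gamma power_mult[symmetric] mult.commute)
  ultimately have "nm ((gamma0 D - 1) ^ q) \<le> \<theta> ^ (q * ?e)"
    using cg_nm_le by (metis order_refl)
  then show ?thesis unfolding cg_def by (rule nm_root_q)
qed

text \<open>The same argument for \<open>gammat0\<close>^q = \<open>gamma0\<close>; the further q-th
  root divides the exponent by q, leaving that of |gamma^(1/q)|.\<close>

lemma gammat0_near: "cg ((q - 1) * (q ^ 2 - 1)) (gammat0 D) 1"
proof -
  let ?e = "(q - 1) * (q ^ 2 - 1)"
  have 0: "cg (q * ?e) (gammat0 D ^ q) 1" using gamma0_near by (simp add: gammat0_eq)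
  then have "nm (gammat0 D ^ q) \<le> 1" by (rule cg_nm_le_1) simp
  then have le: "nm (gammat0 D) \<le> 1" using nm_root_q[of "gammat0 D" 0] by simp
  have e: "q * ?e \<le> q ^ 2 * eW"
  proof -
    have "(q - 1) * (q ^ 2 - 1) \<le> (q * q) * (q ^ 2 - 1)" using le_square[of q] by (intro mult_right_mono) linarith+
    then show ?thesis by (simp add: eW_def power2_eq_square mult.assoc)
  qed
  have "cg (q * ?e) ((gammat0 D - 1) ^ q) (gammat0 D ^ q - 1 ^ q)"
    by (rule cg_frob_diff) (use le e in auto)
  then have "nm ((gammat0 D - 1) ^ q) \<le> \<theta> ^ (q * ?e)"
    using 0 cg_nm_le[of "q * ?e"] by (auto simp: cg_def)
  then show ?thesis unfolding cg_def by (rule nm_root_q)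
qed

lemma nm_gammat0 [simp]: "nm (gammat0 D) = 1" and redu_gammat0: "redu D (gammat0 D) = 1"
proof -
  have le: "nm (gammat0 D) \<le> 1" using gammat0_near by (rule cg_nm_le_1) simp
  show r: "redu D (gammat0 D) = 1" using cg_redu[OF gammat0_near pos_exps(1)] redu_1 by simp
  show "nm (gammat0 D) = 1" using redu_nz_iff[OF le] r by simp
qed

lemma nm_gamma0_le: "nm (gamma0 D) \<le> 1" and nm_gammat1_le: "nm (gammat1 D) \<le> 1"
proof -
  show "nm (gamma0 D) \<le> 1" using gamma0_near by (rule cg_nm_le_1) simp
  show "nm (gammat1 D) \<le> 1"
  proof (rule ccontr)
    assume a: "\<not> nm (gammat1 D) \<le> 1"
    have "gammat1 D ^ q = - (gammat0 D + gamma_root_q D * gammat1 D)"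
      using gammat1_eq unfolding eq_neg_iff_add_eq_0 by (simp only: add.assoc)
    then have "nm (gammat1 D ^ q) = nm (gammat0 D + gamma_root_q D * gammat1 D)" by (simp only: nm_minus)
    also have "\<dots> \<le> nm (gammat1 D)"
    proof (rule nm_add_leI)
      show "nm (gammat0 D) \<le> nm (gammat1 D)" using a by simp
      show "nm (gamma_root_q D * gammat1 D) \<le> nm (gammat1 D)"
        using th_le_1 by (intro nm_mult_le_right) (auto simp: nm_gamma_root_q)
    qed
    finally have "nm (gammat1 D) ^ q \<le> nm (gammat1 D) ^ 1" by (simp add: nm_power)
    then show False using a q_ge_2 power_strict_increasing[of 1 q "nm (gammat1 D)"] by simp
  qed
qed

text \<open>As \<open>gammat0\<close> reduces to 1, the equation defining \<open>yhat\<close>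
  reduces to the one satisfied by \<xi>; the lift is unique because q^2 - 1 is nonzero in the
  residue field.\<close>

lemma yhat_props:
  assumes "\<xi> ^ (q ^ 2 - 1) = -1"
  shows "nm (yhat D \<xi>) = 1" "redu D (yhat D \<xi>) = \<xi>"
    "yhat D \<xi> ^ (q ^ 2 - 1) = - (gammat0 D ^ (q - 1))"
proof -
  let ?c = "- (gammat0 D ^ (q - 1))"
  have c: "nm ?c = 1" "redu D ?c = -1"
    by (simp_all add: nm_power redu_minus redu_power redu_gammat0)
  obtain t where t: "nm t = 1" "redu D t = \<xi>" "t ^ (q ^ 2 - 1) = ?c"
    using root_q21_exists[OF c(1)] c(2) assms by metis
  have "\<exists>!t. reduces_to D t \<xi> \<and> t ^ (q ^ 2 - 1) = ?c"
  proof (rule ex1I[of _ t])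
    show "reduces_to D t \<xi> \<and> t ^ (q ^ 2 - 1) = ?c" using t by (simp add: reduces_to_iff)
    fix s assume s: "reduces_to D s \<xi> \<and> s ^ (q ^ 2 - 1) = ?c"
    then have "nm (t - s) < 1" using t redu_eq_iff[of t s] by (simp add: reduces_to_iff)
    moreover have "nm s \<le> 1" using s by (simp add: reduces_to_iff)
    ultimately have "nm (t - s) = nm (t ^ (q ^ 2 - 1) - s ^ (q ^ 2 - 1))"
      using power_diff_unit[OF of_nat_q21_k t(1)] by metis
    moreover have "s ^ (q ^ 2 - 1) = t ^ (q ^ 2 - 1)" using s t by metis
    ultimately show "s = t" by simp
  qed
  from theI'[OF this] have y: "reduces_to D (yhat D \<xi>) \<xi>" "yhat D \<xi> ^ (q ^ 2 - 1) = ?c"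
    by (auto simp: yhat_def)
  show "redu D (yhat D \<xi>) = \<xi>" "yhat D \<xi> ^ (q ^ 2 - 1) = ?c" using y by (auto simp: reduces_to_iff)
  have "0 < q ^ 2 - 1" using q2_ge_9 by simp
  then have "\<xi> \<noteq> 0" using assms by (auto simp: zero_power)
  then show "nm (yhat D \<xi>) = 1" using y redu_nz_iff[of "yhat D \<xi>"] by (auto simp: reduces_to_iff)
qed

end

lemma pC_mult: "pC a * pC b = pC (a * b)"
  by (simp add: pC_def)

lemma pC_1: "pC 1 = 1"
  by (simp add: pC_def one_pCons)

lemma pC_power: "pC a ^ n = pC (a ^ n)"
  by (induction n) (simp_all add: pC_1 pC_mult)

lemma pC_of_nat: "of_nat n = pC (of_nat n)"
  by (simp add: pC_def of_nat_poly)

lemma eval2_simps [simp]: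
  "eval2 (P + Q) x y = eval2 P x y + eval2 Q x y"
  "eval2 (P - Q) x y = eval2 P x y - eval2 Q x y"
  "eval2 (P * Q) x y = eval2 P x y * eval2 Q x y"
  "eval2 (P ^ n) x y = eval2 P x y ^ n"
  "eval2 (pC c) x y = c" "eval2 pX x y = x" "eval2 pY x y = y"
  by (simp_all add: eval2_def pC_def pX_def pY_def)

lemma eval2_pCons: "eval2 (pCons p P) x y = poly p x + y * eval2 P x y"
  by (simp add: eval2_def)

lemma eval2_0 [simp]: "eval2 0 x y = 0"
  by (simp add: eval2_def)

context lubin_tate
begin

subsection \<open>Polynomials with integral coefficients\<close>

definition OFpoly :: "'c poly \<Rightarrow> bool" where
  "OFpoly p \<longleftrightarrow> (\<forall>n. coeff p n \<in> OF D)"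

definition OFpoly2 :: "'c poly poly \<Rightarrow> bool" where
  "OFpoly2 P \<longleftrightarrow> (\<forall>m. OFpoly (coeff P m))"

lemma OFpoly_add: "OFpoly p \<Longrightarrow> OFpoly r \<Longrightarrow> OFpoly (p + r)"
  and OFpoly_diff: "OFpoly p \<Longrightarrow> OFpoly r \<Longrightarrow> OFpoly (p - r)"
  and OFpoly_minus: "OFpoly p \<Longrightarrow> OFpoly (- p)"
  and OFpoly_mult: "OFpoly p \<Longrightarrow> OFpoly r \<Longrightarrow> OFpoly (p * r)"
  by (auto simp: OFpoly_def coeff_mult intro!: OF_add OF_diff OF_minus OF_sum OF_mult)

lemma OFpoly_0 [simp]: "OFpoly 0"
  by (simp add: OFpoly_def)

lemma OFpoly_sum: "(\<And>i. i \<in> A \<Longrightarrow> OFpoly (f i)) \<Longrightarrow> OFpoly (sum f A)"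
  by (induction A rule: infinite_finite_induct) (auto intro: OFpoly_add)

lemma OFpoly2_add: "OFpoly2 p \<Longrightarrow> OFpoly2 r \<Longrightarrow> OFpoly2 (p + r)"
  and OFpoly2_diff: "OFpoly2 p \<Longrightarrow> OFpoly2 r \<Longrightarrow> OFpoly2 (p - r)"
  and OFpoly2_minus: "OFpoly2 p \<Longrightarrow> OFpoly2 (- p)"
  and OFpoly2_mult: "OFpoly2 p \<Longrightarrow> OFpoly2 r \<Longrightarrow> OFpoly2 (p * r)"
  by (auto simp: OFpoly2_def coeff_mult
      intro!: OFpoly_add OFpoly_diff OFpoly_minus OFpoly_sum OFpoly_mult)

lemma OFpoly2_pC: "c \<in> OF D \<Longrightarrow> OFpoly2 (pC c)"
  by (auto simp: OFpoly2_def OFpoly_def pC_def coeff_pCons split: nat.split)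

lemma OFpoly2_pX: "OFpoly2 pX" and OFpoly2_pY: "OFpoly2 pY"
  by (auto simp: OFpoly2_def OFpoly_def pX_def pY_def coeff_pCons one_pCons split: nat.split)

lemma OFpoly2_power: "OFpoly2 P \<Longrightarrow> OFpoly2 (P ^ n)"
  using OFpoly2_pC[of 1] by (induction n) (auto simp: pC_1 intro: OFpoly2_mult)

lemma OFpoly2_sum: "(\<And>i. i \<in> A \<Longrightarrow> OFpoly2 (f i)) \<Longrightarrow> OFpoly2 (sum f A)"
  using OFpoly2_pC[of 0]
  by (induction A rule: infinite_finite_induct) (auto simp: pC_def intro: OFpoly2_add)

lemmas OFpoly2_intros = OFpoly2_add OFpoly2_diff OFpoly2_minus OFpoly2_mult OFpoly2_pC OFpoly2_pX
  OFpoly2_pY OFpoly2_power OFpoly2_sum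

lemma OFpoly_pCons: "OFpoly (pCons a p) \<longleftrightarrow> a \<in> OF D \<and> OFpoly p"
  by (auto simp: OFpoly_def coeff_pCons split: nat.splits)

lemma OFpoly2_pCons: "OFpoly2 (pCons a p) \<longleftrightarrow> OFpoly a \<and> OFpoly2 p"
  by (auto simp: OFpoly2_def coeff_pCons split: nat.splits)

lemma OFpoly_eval:
  assumes "OFpoly p" "nm x \<le> 1"
  shows "nm (poly p x) \<le> 1"
  using assms by (induction p) (auto simp: OFpoly_pCons OF_nm intro!: nm_add_leI nm_mult_le_1)

lemma OFpoly_eval_redu:
  assumes "OFpoly p" "nm x \<le> 1"
  shows "redu D (poly p x) = poly (map_poly (redu D) p) (redu D x)"
  using assms
  by (induction p)
    (auto simp: OFpoly_pCons OF_nm OFpoly_eval map_poly_pCons redu_plus redu_times nm_mult_le_1)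

lemma OFpoly_eval_cg:
  assumes "OFpoly p" "nm x \<le> 1" "nm x' \<le> 1" "cg n x x'"
  shows "cg n (poly p x) (poly p x')"
  using assms
  by (induction p) (auto simp: OFpoly_pCons OF_nm OFpoly_eval intro!: cg_add cg_mult)

lemma OFpoly2_eval:
  assumes "OFpoly2 P" "nm x \<le> 1" "nm y \<le> 1"
  shows "nm (eval2 P x y) \<le> 1"
  using assms
  by (induction P) (auto simp: OFpoly2_pCons eval2_pCons OFpoly_eval intro!: nm_add_leI nm_mult_le_1)

lemma OFpoly2_eval_redu:
  assumes "OFpoly2 P" "nm x \<le> 1" "nm y \<le> 1"
  shows "redu D (eval2 P x y) = eval2 (redu_poly2 D P) (redu D x) (redu D y)"
  using assms
  by (induction P)
    (auto simp: OFpoly2_pCons eval2_pCons OFpoly_eval OFpoly2_eval redu_poly2_def map_poly_pCons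
      redu_plus redu_times nm_mult_le_1 OFpoly_eval_redu)

lemma OFpoly2_eval_cg:
  assumes "OFpoly2 P" "nm x \<le> 1" "nm y \<le> 1" "nm x' \<le> 1" "nm y' \<le> 1" "cg n x x'" "cg n y y'"
  shows "cg n (eval2 P x y) (eval2 P x' y')"
  using assms
  by (induction P)
    (auto simp: OFpoly2_pCons eval2_pCons OFpoly2_eval intro!: cg_add cg_mult OFpoly_eval_cg)

text \<open>Common form of three polynomials: exponent q^2 gives f_{a,b}, exponent q with
  coefficients 1 and -1 gives f_1, and exponent q in general gives \<open>psi\<close>.\<close>

definition gfab_poly :: "nat \<Rightarrow> 'c \<Rightarrow> 'c \<Rightarrow> 'c poly poly" where
  "gfab_poly Q a b = pC (1 / \<varpi>) * (pC a * pX ^ Q + pC b * pY ^ Q - (pC a * pX + pC b * pY) ^ Q)"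

lemma fab_poly_eq: "fab_poly D a b = gfab_poly (q ^ 2) a b"
  by (simp add: fab_poly_def gfab_poly_def)

lemma f1_poly_eq: "f1_poly D = gfab_poly q 1 (- 1)"
proof -
  have "pC (- 1) = - (1 :: 'c poly poly)" by (simp add: pC_def one_pCons)
  then show ?thesis by (simp add: f1_poly_def gfab_poly_def pC_1)
qed

lemma gfab_expand:
  assumes "a ^ Q = a" "b ^ Q = b" "0 < Q"
  shows "gfab_poly Q a b = - (\<Sum>k\<in>{0<..<Q}. pC (of_nat (Q choose k) / \<varpi>)
    * (pC a * pX) ^ k * (pC b * pY) ^ (Q - k))"
proof -
  have "(pC a * pX + pC b * pY) ^ Q = pC a * pX ^ Q + pC b * pY ^ Q
      + (\<Sum>k\<in>{0<..<Q}. of_nat (Q choose k) * (pC a * pX) ^ k * (pC b * pY) ^ (Q - k))"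
    using binomial_middle[of Q "pC a * pX" "pC b * pY"] assms
    by (simp add: power_mult_distrib pC_power)
  then show ?thesis
    by (simp add: gfab_poly_def sum_distrib_left mult.assoc[symmetric] pC_of_nat pC_mult)
qed

lemma mu0_power_q2: "a \<in> mu0 D \<Longrightarrow> a ^ q ^ 2 = a"
  using mu0_power[of a] by (simp add: power2_eq_square power_mult)

lemma OFpoly2_gfab:
  assumes "a ^ Q = a" "b ^ Q = b" "0 < Q" "a \<in> OF D" "b \<in> OF D"
    "\<And>k. 0 < k \<Longrightarrow> k < Q \<Longrightarrow> of_nat (Q choose k) = (0::'k)"
  shows "OFpoly2 (gfab_poly Q a b)"
  unfolding gfab_expand[OF assms(1-3)] using assms
  by (intro OFpoly2_intros nm_of_nat_le_uni assms(6)) auto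

lemma OFpoly2_gfab_q: "a \<in> mu0 D \<Longrightarrow> b \<in> mu0 D \<Longrightarrow> OFpoly2 (gfab_poly q a b)"
  using q_ge_2 by (intro OFpoly2_gfab choose_q_redu) (auto simp: mu0_iff)

lemma OFpoly2_f1: "OFpoly2 (f1_poly D)"
  unfolding f1_poly_eq using odd_q by (intro OFpoly2_gfab_q) (auto simp: mu0_iff OF_minus)

lemma OFpoly2_fab: "a \<in> mu0 D \<Longrightarrow> b \<in> mu0 D \<Longrightarrow> OFpoly2 (fab_poly D a b)"
  unfolding fab_poly_eq using q_ge_2
  by (intro OFpoly2_gfab choose_q2_redu) (auto simp: mu0_power_q2 mu0_OF)

lemma OFpoly2_G0:
  assumes "a0 \<in> mu0 D" "b0 \<in> mu0 D" "c0 \<in> mu0 D" "d0 \<in> mu0 D"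
  shows "OFpoly2 (G0_poly D a0 b0 c0 d0)"
  unfolding G0_poly_def using assms by (intro OFpoly2_intros OFpoly2_fab) (auto simp: mu0_OF)

text \<open>The middle binomial coefficients are multiples of the residue characteristic, which is
  assumed divisible by \<pi>^2; one factor \<pi> survives the division in
  \<open>fab_poly\<close>.\<close>

lemma fab_divisible:
  assumes "nm (of_nat CHAR('k) :: 'c) \<le> nm \<varpi> ^ 2" "a \<in> mu0 D" "b \<in> mu0 D"
  obtains P where "OFpoly2 P" "fab_poly D a b = pC \<varpi> * P"
proof -
  have p2: "(of_nat n :: 'c) / \<varpi> / \<varpi> \<in> OF D" if "of_nat n = (0::'k)" for n
  proof -
    obtain m where m: "n = CHAR('k) * m" using \<open>of_nat n = (0::'k)\<close> by (auto simp: of_nat_eq_0_iff_char_dvd)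
    have "nm (of_nat n :: 'c) \<le> nm \<varpi> ^ 2"
      using assms(1) by (simp add: m nm_mult_le_left nm_of_nat_le_1)
    then have 1: "nm ((of_nat n :: 'c) / \<varpi>) \<le> nm \<varpi>"
      using nm_uni by (simp add: nm_divide divide_le_eq power2_eq_square)
    have "(of_nat n :: 'c) / \<varpi> \<in> OF D" by (rule nm_of_nat_le_uni) fact
    then show ?thesis by (rule OF_div_uni) (use 1 nm_uni in linarith)
  qed
  define P where "P = - (\<Sum>k\<in>{0<..<q ^ 2}. pC (of_nat (q ^ 2 choose k) / \<varpi> / \<varpi>)
    * (pC a * pX) ^ k * (pC b * pY) ^ (q ^ 2 - k))"
  have "OFpoly2 P"
    unfolding P_def using assms by (intro OFpoly2_intros p2 choose_q2_redu) (auto simp: mu0_OF)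
  moreover have "fab_poly D a b = pC \<varpi> * P"
    using q_ge_2 assms unfolding P_def fab_poly_eq
    by (subst gfab_expand) (simp_all add: mu0_power_q2 sum_distrib_left mult.assoc[symmetric] pC_mult)
  ultimately show ?thesis using that by blast
qed

lemma redu_poly2_pC_uni: "OFpoly2 P \<Longrightarrow> redu_poly2 D (pC \<varpi> * P) = 0"
  using nm_uni
  by (intro poly_eqI) (auto simp: redu_poly2_def coeff_map_poly pC_def OFpoly2_def OFpoly_def
      redu_times OF_nm redu_0_iff)

lemma char_c_nm:
  assumes "0 < CHAR('c)" shows "(of_nat CHAR('k) :: 'c) = 0"
proof -
  have "redu D (of_nat CHAR('c)) = 0" by simp
  then have "CHAR('k) dvd CHAR('c)" unfolding redu_of_nat by (simp add: of_nat_eq_0_iff_char_dvd)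
  moreover have "prime CHAR('c)" using assms by (rule prime_CHAR_semidom)
  moreover have "CHAR('k) \<noteq> 1" by simp
  ultimately have "CHAR('k) = CHAR('c)" by (auto simp: prime_nat_iff)
  then show ?thesis by simp
qed

lemma G0_reduction_0:
  assumes "0 < CHAR('c) \<or> (CHAR('c) = 0 \<and> 2 \<le> val D (of_nat CHAR('k)))"
    and "a0 \<in> mu0 D" "b0 \<in> mu0 D" "c0 \<in> mu0 D" "d0 \<in> mu0 D"
  shows "redu_poly2 D (G0_poly D a0 b0 c0 d0) = 0"
proof -
  have nm: "nm (of_nat CHAR('k) :: 'c) \<le> nm \<varpi> ^ 2"
    using assms(1) char_c_nm nm_uni unfolding val_ge_2_iff by auto
  obtain P where P: "OFpoly2 P" "fab_poly D b0 d0 = pC \<varpi> * P" using fab_divisible[OF nm] assms by metis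
  obtain Q where Q: "OFpoly2 Q" "fab_poly D a0 c0 = pC \<varpi> * Q" using fab_divisible[OF nm] assms by metis
  have "G0_poly D a0 b0 c0 d0 = pC \<varpi> * ((pC a0 * pX + pC c0 * pY) ^ q * P - (pC b0 * pX + pC d0 * pY) ^ q * Q)"
    by (simp add: G0_poly_def P Q algebra_simps)
  then show ?thesis using P(1) Q(1) assms
    by (auto intro!: redu_poly2_pC_uni OFpoly2_intros simp: mu0_OF)
qed

definition fab :: "'c \<Rightarrow> 'c \<Rightarrow> 'c \<Rightarrow> 'c \<Rightarrow> 'c" where
  "fab a b x y = eval2 (fab_poly D a b) x y"

lemma fab_eq: "fab a b x y = (a * x ^ (q ^ 2) + b * y ^ (q ^ 2) - (a * x + b * y) ^ (q ^ 2)) / \<varpi>"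
  by (simp add: fab_def fab_poly_def)

lemma nm_fab: "a \<in> mu0 D \<Longrightarrow> b \<in> mu0 D \<Longrightarrow> nm x \<le> 1 \<Longrightarrow> nm y \<le> 1 \<Longrightarrow> nm (fab a b x y) \<le> 1"
  unfolding fab_def by (intro OFpoly2_eval OFpoly2_fab)

lemma eval2_G0: "eval2 (G0_poly D a0 b0 c0 d0) x y =
    (a0 * x + c0 * y) ^ q * fab b0 d0 x y - (b0 * x + d0 * y) ^ q * fab a0 c0 x y"
  by (simp add: G0_poly_def fab_def)

lemma eval2_f1: "eval2 (f1_poly D) x y = (x ^ q - y ^ q - (x - y) ^ q) / \<varpi>"
  by (simp add: f1_poly_def)

subsection \<open>Units modulo the square of the uniformizer\<close>

lemma unit_mod_pi2_iff: "unit_mod_pi2 D a \<longleftrightarrow> a \<in> OF D \<and> nm a = 1"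
proof
  assume "unit_mod_pi2 D a"
  then obtain b where b: "a \<in> OF D" "b \<in> OF D" "nm (a * b - 1) \<le> nm \<varpi> ^ 2"
    unfolding unit_mod_pi2_def val_ge_2_iff by blast
  have "nm \<varpi> ^ 2 < 1" using nm_uni by (simp add: power_less_one_iff)
  then have "nm (1 - a * b) < nm (1::'c)" using b by (simp add: nm_diff_commute)
  then have "nm a * nm b = 1" using nm_eqI[of 1 "a * b"] by (simp add: nm_mult)
  moreover have "nm a * nm b \<le> nm a * 1" using b by (intro mult_left_mono) (auto simp: OF_nm)
  ultimately show "a \<in> OF D \<and> nm a = 1" using b OF_nm[of a] by auto
next
  assume a: "a \<in> OF D \<and> nm a = 1"
  then have "inverse a \<in> OF D" by (auto simp: OF_iff nm_inverse base_inverse)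
  moreover have "a \<noteq> 0" using a by auto
  then have "a * inverse a - 1 = 0" by simp
  ultimately show "unit_mod_pi2 D a"
    using a by (auto simp: unit_mod_pi2_def val_def intro!: bexI[of _ "inverse a"])
qed

text \<open>Its reduction is the second digit of \<open>a\<close>, which for a unit is the invariant
  \<open>mu_of D a * zeta_of D a\<close> of a component.\<close>

definition tdelta :: "'c \<Rightarrow> 'c" where
  "tdelta a = (a - teich D (redu D a)) / \<varpi>"

lemma tdelta_OF: "a \<in> OF D \<Longrightarrow> tdelta a \<in> OF D"
  unfolding tdelta_def by (rule teich_near)

lemma tdelta_eq: "a = teich D (redu D a) + \<varpi> * tdelta a"
  by (simp add: tdelta_def)

lemma zeta_of_eq: "a \<in> OF D \<Longrightarrow> zeta_of D a = redu D a"
  by (simp add: zeta_of_def digit_def teich_props Fq_redu)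

lemma mu_zeta_eq:
  assumes "a \<in> OF D" "nm a = 1" shows "mu_of D a * zeta_of D a = redu D (tdelta a)"
proof -
  have "redu D a \<noteq> 0" using redu_nz_iff[of a] assms by simp
  moreover have "(a - teich D (redu D a)) / \<varpi> \<in> OF D" using tdelta_OF[OF assms(1)] by (simp add: tdelta_def)
  ultimately show ?thesis using assms
    by (simp add: mu_of_def zeta_of_def digit_def teich_props Fq_redu tdelta_def)
qed

lemma mu0_mult: "s \<in> mu0 D \<Longrightarrow> t \<in> mu0 D \<Longrightarrow> s * t \<in> mu0 D"
  by (auto simp: mu0_iff OF_mult power_mult_distrib)

lemma teich_OF: "a \<in> OF D \<Longrightarrow> teich D (redu D a) \<in> OF D"
  and teich_mu0: "a \<in> OF D \<Longrightarrow> teich D (redu D a) \<in> mu0 D"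
  and redu_teich: "a \<in> OF D \<Longrightarrow> redu D (teich D (redu D a)) = redu D a"
  by (simp_all add: teich_props Fq_redu mu0_OF)

lemma teich_mult:
  assumes "a \<in> OF D" "b \<in> OF D"
  shows "teich D (redu D (a * b)) = teich D (redu D a) * teich D (redu D b)"
  using assms by (intro mu0_eqI)
    (auto simp: teich_mu0 OF_mult mu0_mult redu_teich OF_nm teich_OF redu_times[of "teich D r" for r],
     simp add: redu_times OF_nm)

lemma redu_uni [simp]: "redu D \<varpi> = 0"
  using redu_0_iff[of \<varpi>] nm_uni by simp

text \<open>A Leibniz rule: Teichmueller representatives multiply exactly, and the product of the
  two tails carries a further \<pi>.\<close>

lemma redu_tdelta_mult:
  assumes "a \<in> OF D" "b \<in> OF D"
  shows "redu D (tdelta (a * b)) = redu D a * redu D (tdelta b) + redu D (tdelta a) * redu D b"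
proof -
  let ?s = "teich D (redu D a)" and ?t = "teich D (redu D b)"
  have "a * b = (?s + \<varpi> * tdelta a) * (?t + \<varpi> * tdelta b)"
    using tdelta_eq by metis
  then have "tdelta (a * b) = ?s * tdelta b + tdelta a * ?t + \<varpi> * (tdelta a * tdelta b)"
    using assms unfolding tdelta_def[of "a * b"] teich_mult[OF assms] by (simp add: field_simps)
  also have "redu D \<dots> = redu D ?s * redu D (tdelta b) + redu D (tdelta a) * redu D ?t"
    using assms OF_uni
    by (simp add: redu_plus redu_times OF_nm OF_mult OF_add tdelta_OF teich_OF)
  finally show ?thesis using assms by (simp add: redu_teich)
qed

lemma redu_tdelta_add_uni:
  assumes "a \<in> OF D" "b \<in> OF D"
  shows "redu D (a + \<varpi> * b) = redu D a" "redu D (tdelta (a + \<varpi> * b)) = redu D (tdelta a) + redu D b"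
proof -
  show 1: "redu D (a + \<varpi> * b) = redu D a"
    using assms by (simp add: redu_plus redu_times OF_nm OF_mult)
  have "tdelta (a + \<varpi> * b) = tdelta a + b" by (simp add: tdelta_def 1 add_divide_distrib diff_divide_distrib)
  then show "redu D (tdelta (a + \<varpi> * b)) = redu D (tdelta a) + redu D b"
    using assms by (simp add: redu_plus OF_nm tdelta_OF)
qed

section \<open>Frobenius on the residue field, and lifts satisfying
  \<open>t^(q^2) = -t\<close>\<close>

lemma frob_k_add: "(x + y) ^ q = x ^ q + (y::'k) ^ q"
  using binomial_middle[of q x y] choose_q_redu q_ge_2 by simp

lemma frob_k_minus: "(- x) ^ q = - ((x::'k) ^ q)"
  using odd_q by simp

lemma frob_k_diff: "(x - y) ^ q = x ^ q - (y::'k) ^ q"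
  using frob_k_add[of x "- y"] by (simp add: frob_k_minus)

text \<open>The coefficients reduce into \<open>Fq\<close>, where the q-th power is the
  identity.\<close>

lemma poly_redu_frob:
  assumes "OFpoly p"
  shows "poly (map_poly (redu D) p) x ^ q = poly (map_poly (redu D) p) (x ^ q)"
  using assms q_ge_2
  by (induction p) (auto simp: OFpoly_pCons map_poly_pCons frob_k_add power_mult_distrib Fq_power_q Fq_redu)

lemma eval2_redu_frob:
  assumes "OFpoly2 P"
  shows "eval2 (redu_poly2 D P) x y ^ q = eval2 (redu_poly2 D P) (x ^ q) (y ^ q)"
  using assms q_ge_2
  by (induction P)
    (auto simp: OFpoly2_pCons redu_poly2_def map_poly_pCons eval2_pCons frob_k_add
      power_mult_distrib poly_redu_frob)

lemma power_q2: "x ^ q ^ 2 = ((x::'a::monoid_mult) ^ q) ^ q"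
  by (simp add: power_mult power2_eq_square)

text \<open>With x^(q^2) = -x and y^(q^2) = -y, the two arguments of f_1 differ by the Moore
  determinant x^q y - x y^q, and their q-th powers are its two terms. So f_1 measures how far this
  determinant is from being fixed by the q-th power.\<close>

lemma moore_f1:
  assumes "x ^ q ^ 2 = - x" "y ^ q ^ 2 = - y"
  shows "\<varpi> * eval2 (f1_poly D) (x ^ q ^ 2 * y ^ q) (x ^ q * y ^ q ^ 2)
    = (x ^ q * y - x * y ^ q) - (x ^ q * y - x * y ^ q) ^ q"
proof -
  have xq: "(x ^ q) ^ q = - x" "(y ^ q) ^ q = - y" using assms by (simp_all add: power_q2)
  have "(x ^ q ^ 2 * y ^ q - x ^ q * y ^ q ^ 2) = x ^ q * y - x * y ^ q"
    using assms by simp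
  moreover have "(x ^ q ^ 2 * y ^ q) ^ q = x ^ q * y" "(x ^ q * y ^ q ^ 2) ^ q = x * y ^ q"
    using assms odd_q by (simp_all add: power_mult_distrib xq)
  ultimately show ?thesis by (simp add: eval2_f1)
qed

text \<open>The analogue of f_{a,b} for the exponent q. It arises from replacing the q-th power of a
  linear form by the form in the q-th powers, whereas \<open>fab\<close> comes from the group law;
  Frobenius relates the two.\<close>

definition psi :: "'c \<Rightarrow> 'c \<Rightarrow> 'c \<Rightarrow> 'c \<Rightarrow> 'c" where
  "psi a b x y = eval2 (gfab_poly q a b) x y"

lemma psi_eq: "psi a b x y = (a * x ^ q + b * y ^ q - (a * x + b * y) ^ q) / \<varpi>"
  by (simp add: psi_def gfab_poly_def)

lemma nm_psi: "a \<in> mu0 D \<Longrightarrow> b \<in> mu0 D \<Longrightarrow> nm x \<le> 1 \<Longrightarrow> nm y \<le> 1 \<Longrightarrow> nm (psi a b x y) \<le> 1"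
  unfolding psi_def by (intro OFpoly2_eval OFpoly2_gfab_q)

lemma nm_lin: "a \<in> mu0 D \<Longrightarrow> b \<in> mu0 D \<Longrightarrow> nm x \<le> 1 \<Longrightarrow> nm y \<le> 1 \<Longrightarrow> nm (a * x + b * y) \<le> 1"
  by (intro nm_add_leI nm_mult_le_1) (auto intro: mu0_nm)

lemma uni_power_le: "nm \<varpi> ^ q \<le> nm \<varpi> ^ 2"
  using nm_uni q_ge_2 by (intro power_decreasing) auto

lemma nm_power_q_diff_uni:
  assumes "nm x \<le> 1" "nm y \<le> 1" "nm (x - y) \<le> nm \<varpi>"
  shows "nm (x ^ q - y ^ q) \<le> nm \<varpi> ^ 2"
  using nm_power_q_diff[OF assms] nm_uni uni_power_le by (simp add: power2_eq_square)

text \<open>Over F_q Frobenius moves into the arguments of \<open>psi\<close>. The difference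
  between \<open>psi\<close> at (x^q, y^q) and \<open>fab\<close> at (x, y) is 1/\<pi> times a
  difference of q-th powers of elements congruent modulo \<pi>, hence divisible by \<pi>.\<close>

lemma redu_fab_psi:
  assumes ab: "a \<in> mu0 D" "b \<in> mu0 D" and xy: "nm x \<le> 1" "nm y \<le> 1"
  shows "redu D (fab a b x y) = redu D (psi a b x y) ^ q"
proof -
  have "redu D (psi a b x y) ^ q = redu D (psi a b (x ^ q) (y ^ q))"
    using ab xy by (simp add: psi_def OFpoly2_eval_redu OFpoly2_gfab_q eval2_redu_frob
        nm_power_le_1 redu_power)
  also have "\<dots> = redu D (fab a b x y)"
  proof (rule redu_eqI)
    have "\<varpi> * (psi a b (x ^ q) (y ^ q) - fab a b x y) = ((a * x + b * y) ^ q) ^ q - (a * x ^ q + b * y ^ q) ^ q"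
      by (simp add: psi_eq fab_eq power_q2 field_simps)
    also have "nm \<dots> \<le> nm \<varpi> ^ 2"
    proof (rule nm_power_q_diff_uni)
      have "nm ((a * x + b * y) ^ q - (a * x) ^ q - (b * y) ^ q) \<le> nm \<varpi>"
        using ab xy by (intro nm_frob nm_mult_le_1) (auto intro: mu0_nm)
      then show "nm ((a * x + b * y) ^ q - (a * x ^ q + b * y ^ q)) \<le> nm \<varpi>"
        using ab by (simp add: power_mult_distrib mu0_power diff_diff_eq)
    qed (use ab xy in \<open>auto intro!: nm_power_le_1 nm_lin\<close>)
    finally have "nm (psi a b (x ^ q) (y ^ q) - fab a b x y) \<le> nm \<varpi>"
      using nm_uni by (simp add: nm_mult power2_eq_square)
    then show "nm (psi a b (x ^ q) (y ^ q) - fab a b x y) < 1" using nm_uni by simp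
  qed (use ab xy in \<open>auto intro: nm_fab\<close>)
  finally show ?thesis ..
qed

text \<open>A second Frobenius brings \<open>psi\<close> to the arguments -x and -y, and
  \<open>psi\<close> is odd.\<close>

lemma redu_fab_power:
  assumes ab: "a \<in> mu0 D" "b \<in> mu0 D" and xy: "nm x \<le> 1" "nm y \<le> 1"
    and x2: "x ^ q ^ 2 = - x" "y ^ q ^ 2 = - y"
  shows "redu D (fab a b x y) ^ q = - redu D (psi a b x y)"
proof -
  have "redu D (fab a b x y) ^ q = (redu D (psi a b x y) ^ q) ^ q"
    using redu_fab_psi[OF ab xy] by simp
  also have "\<dots> = redu D (psi a b (x ^ q ^ 2) (y ^ q ^ 2))"
    using ab xy by (simp add: psi_def OFpoly2_eval_redu OFpoly2_gfab_q eval2_redu_frob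
        nm_power_le_1 redu_power power_q2)
  also have "psi a b (x ^ q ^ 2) (y ^ q ^ 2) = - psi a b x y"
  proof -
    have "a * (- x) + b * (- y) = - (a * x + b * y)" by simp
    then have "(a * (- x) + b * (- y)) ^ q = - ((a * x + b * y) ^ q)"
      using odd_q by (metis power_minus_odd)
    then show ?thesis unfolding x2 psi_eq using odd_q by (simp add: field_simps)
  qed
  finally show ?thesis using nm_psi[OF ab xy] by (simp add: redu_minus)
qed

text \<open>By the definition of \<open>fab\<close>, L = a x + b y satisfies L^(q^2) = -(L + \<pi>
  fab) exactly. As L and L + \<pi> fab agree modulo \<pi>, their q^2-th powers agree modulo \<pi>^2;
  so L + \<pi> fab solves t^(q^2) = -t to that order and is equally close to the true root.\<close>

lemma root_shift:
  assumes ab: "a \<in> mu0 D" "b \<in> mu0 D" and xy: "nm x \<le> 1" "nm y \<le> 1"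
    and x2: "x ^ q ^ 2 = - x" "y ^ q ^ 2 = - y"
    and t: "nm t = 1" "redu D t = redu D (a * x + b * y)" "t ^ (q ^ 2 - 1) = - 1"
  shows "nm (t - (a * x + b * y + \<varpi> * fab a b x y)) \<le> nm \<varpi> ^ 2"
proof -
  define L where "L = a * x + b * y"
  define z where "z = L + \<varpi> * fab a b x y"
  have L1: "nm L \<le> 1" unfolding L_def using ab xy by (rule nm_lin)
  have F1: "nm (fab a b x y) \<le> 1" using ab xy by (rule nm_fab)
  have zL: "nm (z - L) \<le> nm \<varpi>" using F1 nm_uni by (simp add: z_def nm_mult_le_left)
  have z1: "nm z \<le> 1" using nm_add_leI[of L 1 "z - L"] L1 zL nm_uni by simp
  have Lz: "L ^ q ^ 2 = - z" by (simp add: z_def L_def fab_eq x2)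
  have rz: "redu D z = redu D t" using redu_eqI[of L z] zL L1 nm_uni t by (simp add: L_def)
  then have z_unit: "nm z = 1" using redu_nz_iff[OF z1] redu_nz_iff[of t] t by simp
  have "nm ((z ^ q) ^ q - (L ^ q) ^ q) \<le> nm \<varpi> ^ 2"
    by (rule nm_power_diff) (use nm_power_q_diff_uni[OF z1 L1 zL] z1 L1 in \<open>auto intro: nm_power_le_1\<close>)
  then have "nm (z ^ q ^ 2 + z) \<le> nm \<varpi> ^ 2" by (simp add: power_q2[symmetric] Lz)
  also have "z ^ q ^ 2 + z = z * (z ^ (q ^ 2 - 1) - t ^ (q ^ 2 - 1))"
    using power_minus_mult[of "q ^ 2" z] q_ge_2 t(3) by (simp add: algebra_simps)
  finally have "nm (z ^ (q ^ 2 - 1) - t ^ (q ^ 2 - 1)) \<le> nm \<varpi> ^ 2"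
    using z_unit by (simp add: nm_mult)
  moreover have "nm (z - t) < 1" using rz redu_eq_iff[OF z1, of t] t by simp
  ultimately have "nm (z - t) \<le> nm \<varpi> ^ 2"
    using power_diff_unit[OF of_nat_q21_k z_unit, of t] t by simp
  then show ?thesis by (simp add: z_def L_def nm_diff_commute)
qed

end

section \<open>The action of \<open>g\<close> on components, on residue points and on
  \<open>c_0\<close>\<close>

locale lt_action = lubin_tate D
  for D :: "('c::{field,complete_space}, 'k::field) lt_data" +
  fixes a0 a1 b0 b1 c0 c1 d0 d1 i :: 'c and x0 y0 :: 'k and g :: "'c^2^2"
  assumes mu0: "a0 \<in> mu0 D" "a1 \<in> mu0 D" "b0 \<in> mu0 D" "b1 \<in> mu0 D"
      "c0 \<in> mu0 D" "c1 \<in> mu0 D" "d0 \<in> mu0 D" "d1 \<in> mu0 D"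
    and g_eq: "g = vector [vector [a0 + a1 * unif D, b0 + b1 * unif D],
                        vector [c0 + c1 * unif D, d0 + d1 * unif D]]"
    and g_GL2: "g \<in> GL2 D"
    and i_unit: "unit_mod_pi2 D i"
    and S00_xy: "(x0, y0) \<in> S00 D i"
begin

abbreviation (input) "ra0 \<equiv> redu D a0"
abbreviation (input) "ra1 \<equiv> redu D a1"
abbreviation (input) "rb0 \<equiv> redu D b0"
abbreviation (input) "rb1 \<equiv> redu D b1"
abbreviation (input) "rc0 \<equiv> redu D c0"
abbreviation (input) "rc1 \<equiv> redu D c1"
abbreviation (input) "rd0 \<equiv> redu D d0"
abbreviation (input) "rd1 \<equiv> redu D d1"

definition ig where "ig = det g * i"
definition x0' where "x0' = redu D a0 * x0 + redu D c0 * y0"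
definition y0' where "y0' = redu D b0 * x0 + redu D d0 * y0"
definition \<Delta> where "\<Delta> = a0 * d0 - b0 * c0"
definition fjg where "fjg = eval2 (gbar_poly D a0 a1 b0 b1 c0 c1 d0 d1) x0 y0
               + eval2 (redu_poly2 D (G0_poly D a0 b0 c0 d0)) x0 y0"

lemmas mu0' = mu0[THEN mu0_OF] mu0[THEN mu0_OF, THEN OF_nm]
lemmas redu_Fq = mu0[THEN mu0_OF, THEN Fq_redu]
lemmas redu_frob = redu_Fq[THEN Fq_power_q]

lemma i_OF: "i \<in> OF D" "nm i = 1" and det_OF: "det g \<in> OF D" "nm (det g) = 1"
  using i_unit g_GL2 by (auto simp: unit_mod_pi2_iff GL2_def)

lemma g_entries: "g $ 1 $ 1 = a0 + a1 * \<varpi>" "g $ 1 $ 2 = b0 + b1 * \<varpi>"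
  "g $ 2 $ 1 = c0 + c1 * \<varpi>" "g $ 2 $ 2 = d0 + d1 * \<varpi>"
  by (simp_all add: g_eq)

text \<open>The coefficient of \<pi> in \<open>det g\<close>; it is what the second digit of
  \<open>det g\<close> has beyond that of \<open>\<Delta>\<close>.\<close>

definition \<delta>1 where "\<delta>1 = a0 * d1 + a1 * d0 - b0 * c1 - b1 * c0"

lemma det_eq: "det g = \<Delta> + \<varpi> * (\<delta>1 + \<varpi> * (a1 * d1 - b1 * c1))"
  by (simp add: det_2 g_entries \<Delta>_def \<delta>1_def algebra_simps)

lemma \<Delta>_OF: "\<Delta> \<in> OF D" and \<delta>1_OF: "\<delta>1 \<in> OF D"
  unfolding \<Delta>_def \<delta>1_def using mu0' by (auto intro!: OF_add OF_diff OF_mult)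

lemma redu_det: "redu D (det g) = redu D \<Delta>"
  and redu_tdelta_det: "redu D (tdelta (det g)) = redu D (tdelta \<Delta>) + redu D \<delta>1"
proof -
  have O: "a1 * d1 - b1 * c1 \<in> OF D" "\<delta>1 + \<varpi> * (a1 * d1 - b1 * c1) \<in> OF D"
    using mu0' \<delta>1_OF by (auto intro!: OF_add OF_diff OF_mult)
  show "redu D (det g) = redu D \<Delta>" unfolding det_eq by (rule redu_tdelta_add_uni[OF \<Delta>_OF O(2)])
  show "redu D (tdelta (det g)) = redu D (tdelta \<Delta>) + redu D \<delta>1"
    unfolding det_eq redu_tdelta_add_uni(2)[OF \<Delta>_OF O(2)] redu_tdelta_add_uni(1)[OF \<delta>1_OF O(1)] ..
qed

lemma nm_\<Delta>: "nm \<Delta> = 1"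
  using redu_nz_iff[of \<Delta>] redu_nz_iff[of "det g"] det_OF \<Delta>_OF OF_nm redu_det by auto

lemma redu_\<Delta>: "redu D \<Delta> = redu D a0 * redu D d0 - redu D b0 * redu D c0"
  by (simp add: \<Delta>_def redu_diff redu_times mu0' nm_mult_le_1)

lemma redu_\<delta>1: "redu D \<delta>1 = redu D a0 * redu D d1 + redu D a1 * redu D d0
    - redu D b0 * redu D c1 - redu D b1 * redu D c0"
  by (simp add: \<delta>1_def redu_diff redu_plus redu_times mu0' nm_mult_le_1 nm_add_leI nm_diff_leI)

lemma ig_OF: "ig \<in> OF D" "nm ig = 1"
  using i_OF det_OF by (auto simp: ig_def OF_mult nm_mult)

lemma ig_unit: "unit_mod_pi2 D ig"
  using ig_OF by (simp add: unit_mod_pi2_iff)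

abbreviation "\<zeta> \<equiv> redu D i"

lemma zeta_i: "zeta_of D i = \<zeta>" and zeta_ig: "zeta_of D ig = redu D \<Delta> * \<zeta>"
proof -
  show "zeta_of D i = \<zeta>" by (rule zeta_of_eq[OF i_OF(1)])
  have "redu D ig = redu D \<Delta> * \<zeta>" using i_OF det_OF by (simp add: ig_def redu_times redu_det)
  then show "zeta_of D ig = redu D \<Delta> * \<zeta>" using zeta_of_eq[OF ig_OF(1)] by simp
qed

lemma zeta_nz: "\<zeta> \<noteq> 0" using i_OF redu_nz_iff[of i] by simp

lemma zeta_frob: "\<zeta> ^ q = \<zeta>" by (rule Fq_power_q[OF Fq_redu[OF i_OF(1)]])

lemma xy0: "x0 \<noteq> 0" "y0 \<noteq> 0" "x0 ^ q * y0 - x0 * y0 ^ q = \<zeta>"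
  "x0 ^ (q ^ 2 - 1) = - 1" "y0 ^ (q ^ 2 - 1) = - 1"
  using S00_xy by (auto simp: S00_def zeta_i)

lemma xy0_q2: "(x0 ^ q) ^ q = - x0" "(y0 ^ q) ^ q = - y0"
  using power_minus_mult[of "q ^ 2" x0] power_minus_mult[of "q ^ 2" y0] xy0 q_ge_2
  by (simp_all add: power_q2)

lemma moore_xy0': "x0' ^ q * y0' - x0' * y0' ^ q = redu D \<Delta> * \<zeta>"
  unfolding x0'_def y0'_def redu_\<Delta> frob_k_add power_mult_distrib redu_frob xy0(3)[symmetric]
  by (simp add: algebra_simps)

lemma jg_S00: "(x0', y0') \<in> S00 D ig"
proof -
  have nz: "redu D \<Delta> * \<zeta> \<noteq> 0" using zeta_nz redu_nz_iff[of \<Delta>] nm_\<Delta> by simp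
  have x: "x0' \<noteq> 0" and y: "y0' \<noteq> 0"
    using moore_xy0' nz q_ge_2 by (auto simp: power_0_left)
  have "(x0' ^ q) ^ q = - x0'" "(y0' ^ q) ^ q = - y0'"
    unfolding x0'_def y0'_def frob_k_add power_mult_distrib redu_frob xy0_q2
    by simp_all
  then have "x0' ^ (q ^ 2 - 1) * x0' = (- 1) * x0'" "y0' ^ (q ^ 2 - 1) * y0' = (- 1) * y0'"
    using power_minus_mult[of "q ^ 2" x0'] power_minus_mult[of "q ^ 2" y0'] q_ge_2
    by (simp_all add: power_q2)
  then have "x0' ^ (q ^ 2 - 1) = - 1" "y0' ^ (q ^ 2 - 1) = - 1" using x y unfolding mult_cancel_right by simp_all
  then show ?thesis using x y moore_xy0' by (simp add: S00_def zeta_ig)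
qed

text \<open>Because x0^(q^2) = -x0 and y0^(q^2) = -y0, two Frobenius twists only change the sign of
  a linear form over F_q. Then N^q + N splits into Moore determinants of two pairs of such forms,
  each a 2 by 2 determinant times x0^q y0 - x0 y0^q.\<close>

lemma gbar_trace:
  defines "N \<equiv> eval2 (gbar_poly D a0 a1 b0 b1 c0 c1 d0 d1) x0 y0"
  shows "N ^ q + N = - (redu D \<delta>1 * \<zeta>)"
proof -
  have N: "N = ((ra0 * x0 + rc0 * y0) * (rb1 * x0 + rd1 * y0) ^ q
      - (ra1 * x0 + rc1 * y0) ^ q * (rb0 * x0 + rd0 * y0)) ^ q"
    by (simp add: N_def gbar_poly_def Let_def)
  show ?thesis
    unfolding N redu_\<delta>1 xy0(3)[symmetric] frob_k_diff frob_k_add power_mult_distrib redu_frob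
      xy0_q2 frob_k_minus
    by (simp add: algebra_simps frob_k_minus)
qed

text \<open>By \<open>moore_f1\<close> the f_1 term is (m - m^q)/\<pi> for the Moore determinant m
  of the lifts, so it suffices to know the transformed determinant modulo \<pi>^2. Its corrections
  are the second digit of \<open>\<Delta>\<close>, the term G from moving the roots
  (\<open>root_shift\<close>), and a term in \<open>psi\<close> from twisting the linear forms.
  Frobenius takes the reduction of G to that last term, which is how h^q + h appears.\<close>

lemma c0_transform:
  "c0_const D ig (x0', y0') = redu D \<Delta> * c0_const D i (x0, y0) - (fjg ^ q + fjg)"
proof -
  have m1: "nm (- 1 :: 'c) = 1" "redu D (- 1) = - 1" by (simp_all add: redu_minus redu_1)
  obtain x where x: "nm x = 1" "redu D x = x0" "x ^ (q ^ 2 - 1) = - 1"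
    using root_q21_exists[OF m1(1)] xy0(4) m1(2) by metis
  obtain y where y: "nm y = 1" "redu D y = y0" "y ^ (q ^ 2 - 1) = - 1"
    using root_q21_exists[OF m1(1)] xy0(5) m1(2) by metis
  have S': "x0' ^ (q ^ 2 - 1) = - 1" "y0' ^ (q ^ 2 - 1) = - 1" using jg_S00 by (auto simp: S00_def)
  obtain x' where x': "nm x' = 1" "redu D x' = x0'" "x' ^ (q ^ 2 - 1) = - 1"
    using root_q21_exists[OF m1(1)] S'(1) m1(2) by metis
  obtain y' where y': "nm y' = 1" "redu D y' = y0'" "y' ^ (q ^ 2 - 1) = - 1"
    using root_q21_exists[OF m1(1)] S'(2) m1(2) by metis
  have q2: "t ^ q ^ 2 = - t" if "t ^ (q ^ 2 - 1) = - 1" for t :: 'c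
    using power_minus_mult[of "q ^ 2" t] q_ge_2 that by simp
  note sq = q2[OF x(3)] q2[OF y(3)] q2[OF x'(3)] q2[OF y'(3)]
  define m where "m = x ^ q * y - x * y ^ q"
  define m' where "m' = x' ^ q * y' - x' * y' ^ q"
  define F where "F = eval2 (f1_poly D) (x ^ q ^ 2 * y ^ q) (x ^ q * y ^ q ^ 2)"
  define F' where "F' = eval2 (f1_poly D) (x' ^ q ^ 2 * y' ^ q) (x' ^ q * y' ^ q ^ 2)"
  have F: "\<varpi> * F = m - m ^ q" and F': "\<varpi> * F' = m' - m' ^ q"
    unfolding F_def F'_def m_def m'_def by (rule moore_f1; fact sq)+
  have nF: "nm F \<le> 1" "nm F' \<le> 1"
    unfolding F_def F'_def using x y x' y'
    by (auto intro!: OFpoly2_eval OFpoly2_f1 nm_mult_le_1 nm_power_le_1)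
  have rF: "redu D F = eval2 (redu_poly2 D (f1_poly D)) (x0 ^ q ^ 2 * y0 ^ q) (x0 ^ q * y0 ^ q ^ 2)"
    and rF': "redu D F' = eval2 (redu_poly2 D (f1_poly D)) (x0' ^ q ^ 2 * y0' ^ q) (x0' ^ q * y0' ^ q ^ 2)"
    unfolding F_def F'_def using x y x' y'
    by (simp_all add: OFpoly2_eval_redu OFpoly2_f1 nm_mult_le_1 nm_power_le_1 redu_times redu_power)
  define La where "La = a0 * x + c0 * y"
  define Lb where "Lb = b0 * x + d0 * y"
  define \<phi>a where "\<phi>a = fab a0 c0 x y"
  define \<phi>b where "\<phi>b = fab b0 d0 x y"
  define \<psi>a where "\<psi>a = psi a0 c0 x y"
  define \<psi>b where "\<psi>b = psi b0 d0 x y"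
  have nL: "nm La \<le> 1" "nm Lb \<le> 1" unfolding La_def Lb_def using x y mu0 by (auto intro!: nm_lin)
  have n\<phi>: "nm \<phi>a \<le> 1" "nm \<phi>b \<le> 1" unfolding \<phi>a_def \<phi>b_def using x y mu0 by (auto intro!: nm_fab)
  have n\<psi>: "nm \<psi>a \<le> 1" "nm \<psi>b \<le> 1" unfolding \<psi>a_def \<psi>b_def using x y mu0 by (auto intro!: nm_psi)
  have rL: "redu D La = x0'" "redu D Lb = y0'"
    unfolding La_def Lb_def x0'_def y0'_def using x y mu0'
    by (simp_all add: redu_plus redu_times nm_mult_le_1)
  let ?N = "q ^ 2 * eW"
  have N2: "nm \<varpi> ^ 2 = \<theta> ^ (?N + ?N)" by (simp add: th_uni[symmetric] power_add power2_eq_square)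
  \<comment> \<open>A single q-th power lifts congruence modulo \<pi> to congruence modulo
    \<pi>^2.\<close>
  have cgq: "cg (?N + ?N) (s ^ q) (t ^ q)" if "nm s \<le> 1" "nm t \<le> 1" "cg ?N s t" for s t
    using nm_power_q_diff_uni[OF that(1,2)] that(3) by (simp add: cg_def th_uni N2)
  have cx: "cg (?N + ?N) x' (La + \<varpi> * \<phi>a)" and cy: "cg (?N + ?N) y' (Lb + \<varpi> * \<phi>b)"
    unfolding cg_def N2[symmetric] La_def Lb_def \<phi>a_def \<phi>b_def
    using x y x' y' mu0 sq rL by (auto intro!: root_shift simp: La_def Lb_def)
  have c\<phi>: "cg ?N (L + \<varpi> * \<phi>) L" if "nm \<phi> \<le> 1" for L \<phi>
    using that by (intro cg_0_add) (simp add: th_uni nm_mult_le_left)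
  have cxN: "cg ?N x' La" and cyN: "cg ?N y' Lb"
    using cg_trans[OF cg_mono[OF cx] c\<phi>] cg_trans[OF cg_mono[OF cy] c\<phi>] n\<phi> by auto
  define G where "G = La ^ q * \<phi>b - Lb ^ q * \<phi>a"
  define M where "M = La ^ q * Lb - La * Lb ^ q"
  have nG: "nm G \<le> 1" unfolding G_def using nL n\<phi> by (intro nm_diff_leI nm_mult_le_1 nm_power_le_1)
  have nM: "nm M \<le> 1" unfolding M_def using nL by (intro nm_diff_leI nm_mult_le_1 nm_power_le_1)
  have nm1: "nm m \<le> 1" "nm m' \<le> 1"
    unfolding m_def m'_def using x y x' y' by (auto intro!: nm_diff_leI nm_mult_le_1 nm_power_le_1)
  have nL\<phi>: "nm (La + \<varpi> * \<phi>a) \<le> 1" "nm (Lb + \<varpi> * \<phi>b) \<le> 1"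
    using cg_nm_le_1[OF cg_sym[OF cx]] cg_nm_le_1[OF cg_sym[OF cy]] x' y' by auto
  have "cg (?N + ?N) m' (La ^ q * (Lb + \<varpi> * \<phi>b) - (La + \<varpi> * \<phi>a) * Lb ^ q)"
    unfolding m'_def using cx cy cxN cyN x' y' nL nL\<phi>
    by (intro cg_diff cg_mult cgq) (auto intro: nm_power_le_1)
  also have "La ^ q * (Lb + \<varpi> * \<phi>b) - (La + \<varpi> * \<phi>a) * Lb ^ q = M + \<varpi> * G"
    by (simp add: M_def G_def algebra_simps)
  finally have cm': "cg (?N + ?N) m' (M + \<varpi> * G)" .
  have "cg ?N m' M" using cg_trans[OF cg_mono[OF cm'] c\<phi>] nG by auto
  then have cm'q: "cg (?N + ?N) (m' ^ q) (M ^ q)" using cgq nm1 nM by blast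
  \<comment> \<open>Replacing La^q and Lb^q by the forms in x^q and y^q costs \<pi> times
    \<open>psi\<close>.\<close>
  have M: "M = \<Delta> * m + \<varpi> * (La * \<psi>b - \<psi>a * Lb)"
  proof -
    have "La ^ q = a0 * x ^ q + c0 * y ^ q - \<varpi> * \<psi>a" "Lb ^ q = b0 * x ^ q + d0 * y ^ q - \<varpi> * \<psi>b"
      by (simp_all add: La_def Lb_def \<psi>a_def \<psi>b_def psi_eq)
    then show ?thesis unfolding M_def by (simp add: m_def \<Delta>_def) (simp add: La_def Lb_def algebra_simps)
  qed
  have n\<Psi>: "nm (La * \<psi>b - \<psi>a * Lb) \<le> 1" using nL n\<psi> by (intro nm_diff_leI nm_mult_le_1)
  have "cg ?N M (\<Delta> * m)" unfolding M by (rule c\<phi>[OF n\<Psi>])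
  then have "cg (?N + ?N) (M ^ q) ((\<Delta> * m) ^ q)"
    using cgq nM nm_\<Delta> nm1 by (simp add: nm_mult)
  moreover have "cg (?N + ?N) ((\<Delta> * m) ^ q) (teich D (redu D \<Delta>) * m ^ q)"
    unfolding power_mult_distrib using teich_near_power[OF \<Delta>_OF] nm1
    by (intro cg_mult_right nm_power_le_1) (auto simp: cg_def N2)
  ultimately have cm'q2: "cg (?N + ?N) (m' ^ q) (teich D (redu D \<Delta>) * m ^ q)"
    using cm'q cg_trans by blast
  have "cg (?N + ?N) (\<varpi> * F') (M + \<varpi> * G - teich D (redu D \<Delta>) * m ^ q)"
    unfolding F' by (rule cg_diff[OF cm' cm'q2])
  also have "M + \<varpi> * G - teich D (redu D \<Delta>) * m ^ q
      = \<varpi> * (\<Delta> * F + tdelta \<Delta> * m ^ q + G + (La * \<psi>b - \<psi>a * Lb))"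
  proof -
    have t: "teich D (redu D \<Delta>) = \<Delta> - \<varpi> * tdelta \<Delta>" by (simp add: tdelta_def)
    have m: "m = \<varpi> * F + m ^ q" using F by simp
    have "\<Delta> * m = \<Delta> * (\<varpi> * F) + \<Delta> * m ^ q" using m by (metis distrib_left)
    then show ?thesis unfolding M t by (simp add: algebra_simps)
  qed
  finally have cF': "cg ?N F' (\<Delta> * F + tdelta \<Delta> * m ^ q + G + (La * \<psi>b - \<psi>a * Lb))"
    by (rule cg_cancel[rotated]) (simp add: th_uni)
  have N0: "0 < ?N" using pos_exps q_ge_2 by simp
  have nt: "nm (tdelta \<Delta>) \<le> 1" using OF_nm[OF tdelta_OF[OF \<Delta>_OF]] .
  have nD: "nm \<Delta> \<le> 1" using nm_\<Delta> by simp
  have "redu D F' = redu D (\<Delta> * F + tdelta \<Delta> * m ^ q + G + (La * \<psi>b - \<psi>a * Lb))"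
    by (rule cg_redu[OF cF' N0])
      (intro nm_add_leI n\<Psi> nG nm_mult_le_1 nF nt nm1 nm_power_le_1 nD)
  also have "\<dots> = redu D \<Delta> * redu D F + redu D (tdelta \<Delta>) * redu D m ^ q + redu D G
      + (redu D La * redu D \<psi>b - redu D \<psi>a * redu D Lb)"
    using nF nt nm1 nG n\<psi> nL nD
    by (simp add: redu_plus redu_diff redu_times redu_power nm_add_leI nm_diff_leI nm_mult_le_1 nm_power_le_1)
  also have "redu D m = \<zeta>"
    using x y by (simp add: m_def redu_diff redu_times redu_power nm_mult_le_1 nm_power_le_1 xy0(3))
  finally have rF'_eq: "redu D F' = redu D \<Delta> * redu D F + redu D (tdelta \<Delta>) * \<zeta> + redu D G
      + (x0' * redu D \<psi>b - redu D \<psi>a * y0')" by (simp add: zeta_frob rL)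
  have "redu D G = x0' ^ q * redu D \<phi>b - y0' ^ q * redu D \<phi>a"
    using nL n\<phi> by (simp add: G_def redu_diff redu_times redu_power nm_mult_le_1 nm_power_le_1 rL)
  moreover have "(x0' ^ q) ^ q = - x0'" "(y0' ^ q) ^ q = - y0'"
    unfolding x0'_def y0'_def frob_k_add power_mult_distrib redu_frob xy0_q2 by simp_all
  moreover have "redu D \<phi>a ^ q = - redu D \<psi>a" "redu D \<phi>b ^ q = - redu D \<psi>b"
    unfolding \<phi>a_def \<phi>b_def \<psi>a_def \<psi>b_def using x y mu0 sq by (auto intro!: redu_fab_power)
  \<comment> \<open>Thus the two corrections in \<open>rF'_eq\<close> are the reduction of G and its
    q-th power.\<close>
  ultimately have Gq: "redu D G ^ q = x0' * redu D \<psi>b - redu D \<psi>a * y0'"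
    by (simp add: frob_k_diff power_mult_distrib mult.commute)
  have rG: "redu D G = eval2 (redu_poly2 D (G0_poly D a0 b0 c0 d0)) x0 y0"
  proof -
    have "G = eval2 (G0_poly D a0 b0 c0 d0) x y"
      by (simp add: eval2_G0 G_def La_def Lb_def \<phi>a_def \<phi>b_def)
    then show ?thesis using x y mu0 by (simp add: OFpoly2_eval_redu OFpoly2_G0)
  qed
  define N where "N = eval2 (gbar_poly D a0 a1 b0 b1 c0 c1 d0 d1) x0 y0"
  have fjg: "fjg = N + redu D G" by (simp add: fjg_def N_def rG)
  \<comment> \<open>This accounts for the contribution of \<open>\<delta>1\<close> to the second
    digit of \<open>ig\<close>.\<close>
  have NN: "N ^ q + N = - (redu D \<delta>1 * \<zeta>)" unfolding N_def by (rule gbar_trace)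
  have Nq: "N ^ q = - (redu D \<delta>1 * \<zeta>) - N" unfolding NN[symmetric] by simp
  have c: "c0_const D i (x0, y0) = redu D (tdelta i) - redu D F"
    using mu_zeta_eq[OF i_OF] by (simp add: c0_const_def rF)
  have "c0_const D ig (x0', y0') = redu D (tdelta ig) - redu D F'"
    using mu_zeta_eq[OF ig_OF] by (simp add: c0_const_def rF')
  also have "redu D (tdelta ig) = redu D \<Delta> * redu D (tdelta i) + (redu D (tdelta \<Delta>) + redu D \<delta>1) * \<zeta>"
    unfolding ig_def redu_tdelta_mult[OF det_OF(1) i_OF(1)] redu_det redu_tdelta_det ..
  finally show ?thesis
    unfolding c rF'_eq fjg frob_k_add Gq Nq by (simp add: algebra_simps)
qed

text \<open>Frobenius fixes the reduction of \<open>\<Delta>\<close>, so a^q + a is scaled by it and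
  shifted by fjg^q + fjg, precisely the shift of c_0 in \<open>c0_transform\<close>.\<close>

lemma plane_curve_map:
  assumes "(a, z) \<in> plane_curve D i (x0, y0)"
  shows "(redu D \<Delta> * a + fjg, z) \<in> plane_curve D ig (x0', y0')"
proof -
  have "redu D \<Delta> ^ q = redu D \<Delta>" by (rule Fq_power_q[OF Fq_redu[OF \<Delta>_OF]])
  moreover have "a ^ q + a = \<zeta> * z ^ (q + 1) - c0_const D i (x0, y0)"
    using assms by (simp add: plane_curve_def zeta_i)
  then have c0: "c0_const D i (x0, y0) = \<zeta> * z ^ (q + 1) - (a ^ q + a)" by (simp add: algebra_simps)
  ultimately show ?thesis
    unfolding plane_curve_def zeta_ig c0_transform c0
    by (simp add: frob_k_add power_mult_distrib algebra_simps)
qed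

end

section \<open>Sizes of the constants, and an identity between Moore determinants\<close>

context lubin_tate
begin

text \<open>Exponents of \<theta>: \<open>e1\<close> belongs to gamma^(1/q), and \<open>eG\<close>
  below to w_1.\<close>

definition e1 :: nat where "e1 = (q - 1) * (q ^ 2 - 1)"
definition eG :: nat where "eG = q * (q - 1)"

text \<open>All of these rest on q >= 3; writing q = k + 3 removes the truncated subtractions and
  leaves polynomials in k.\<close>

lemma exps:
  "q * e1 \<ge> eW + 1" "e1 \<ge> 1" "e1 + q * eG \<ge> eW + 1" "q ^ 2 * eG \<ge> eW + 1" "q * eW \<ge> q * e1"
  "q ^ 2 * eW \<ge> q * e1 + (eW + 1)" "e1 \<ge> eG + 1" "q * eG \<ge> eG + 1" "eG \<ge> 1" "q ^ 2 * eW \<ge> eW + 1"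
  "q ^ 2 * eW \<ge> e1" "q ^ 2 * eW \<ge> eG + 1" "eW \<ge> eG + 1"
proof -
  obtain k where k: "q = k + 3" using q_ge_3 by (metis add.commute le_Suc_ex)
  show "q * e1 \<ge> eW + 1" "e1 \<ge> 1" "e1 + q * eG \<ge> eW + 1" "q ^ 2 * eG \<ge> eW + 1" "q * eW \<ge> q * e1"
  "q ^ 2 * eW \<ge> q * e1 + (eW + 1)" "e1 \<ge> eG + 1" "q * eG \<ge> eG + 1" "eG \<ge> 1" "q ^ 2 * eW \<ge> eW + 1"
  "q ^ 2 * eW \<ge> e1" "q ^ 2 * eW \<ge> eG + 1" "eW \<ge> eG + 1"
    unfolding e1_def eG_def eW_def k by (simp_all add: power2_eq_square algebra_simps)
qed

lemma nm_consts: "nm (gamma_root_q D) = \<theta> ^ e1" "nm (gamma D) = \<theta> ^ (q * e1)"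
  "nm (gamma_root_qq1 D) = \<theta> ^ eG" "nm (gamma_q_over_q1 D) = \<theta> ^ (q * eW)"
proof -
  show "nm (gamma_root_q D) = \<theta> ^ e1" "nm (gamma D) = \<theta> ^ (q * e1)" "nm (gamma_root_qq1 D) = \<theta> ^ eG"
    by (simp_all add: nm_gamma_root_q nm_gamma nm_g e1_def eG_def)
  have "q ^ 2 * (q ^ 2 - 1) = q * eW" by (simp add: eW_def power2_eq_square)
  then show "nm (gamma_q_over_q1 D) = \<theta> ^ (q * eW)"
    by (simp add: gamma_q_over_q1_def nm_power th_def)
qed

lemma consts_nz: "gamma_root_q D \<noteq> 0" "gamma D \<noteq> 0" "gamma_root_qq1 D \<noteq> 0" "gamma_q_over_q1 D \<noteq> 0"
  "w_const D \<noteq> 0" "kappa D \<noteq> 0"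
  using kappa1_nz by (simp_all add: gamma_root_q_def gamma_def kappa_def gamma_root_qq1_def
      gamma_q_over_q1_def w_const_def)

text \<open>For \<open>A\<^sub>k\<close>, \<open>B\<^sub>k\<close> the \<open>q\<^sup>k\<close>-th powers of \<open>x\<close>, \<open>y\<close> this expresses \<open>x\<^bsup>q\<^sup>3\<^esup> y - x y\<^bsup>q\<^sup>3\<^esup>\<close>
  through \<open>x\<^sup>q y - x y\<^sup>q\<close> and its Frobenius twists, cleared of denominators.\<close>

lemma moore_identity:
  fixes A0 A1 A2 A3 B0 B1 B2 B3 :: "'a::comm_ring_1"
  shows "((A3 * B0 - A0 * B3) + (A1 * B0 - A0 * B1)) * (B1 * B2) =
    (A3 * B2 - A2 * B3) * B0 * B1 + (A2 * B1 - A1 * B2) * B0 * B3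
      + (A1 * B0 - A0 * B1) * (B2 * (B3 + B1))"
  by (simp add: algebra_simps)

end

section \<open>Points of the affinoid and the equation of its reduction\<close>

locale lt_affinoid = lubin_tate D
  for D :: "('c::{field,complete_space}, 'k::field) lt_data" +
  fixes i :: 'c and x0 y0 :: 'k
  assumes i_unit: "unit_mod_pi2 D i" and S00_xy: "(x0, y0) \<in> S00 D i"
begin

lemma i_OF: "i \<in> OF D" "nm i = 1" using i_unit by (auto simp: unit_mod_pi2_iff)

abbreviation "\<zeta> \<equiv> redu D i"
definition \<tau> where "\<tau> = teich D (redu D i)"
definition xh where "xh = yhat D x0"
definition yh where "yh = yhat D y0"

lemma zeta_i: "zeta_of D i = \<zeta>" by (rule zeta_of_eq[OF i_OF(1)])

lemma zeta_nz: "\<zeta> \<noteq> 0" using i_OF redu_nz_iff[of i] by simp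

lemma tau: "\<tau> \<in> mu0 D" "redu D \<tau> = \<zeta>" "nm \<tau> = 1" "\<tau> ^ q = \<tau>"
proof -
  show 1: "\<tau> \<in> mu0 D" "redu D \<tau> = \<zeta>" unfolding \<tau>_def using teich_mu0 redu_teich i_OF by auto
  then show "nm \<tau> = 1" using redu_nz_iff[of \<tau>] zeta_nz mu0_nm by auto
  show "\<tau> ^ q = \<tau>" using 1 by (simp add: mu0_power)
qed

lemma xy0: "x0 \<noteq> 0" "y0 \<noteq> 0" "x0 ^ q * y0 - x0 * y0 ^ q = \<zeta>"
  "x0 ^ (q ^ 2 - 1) = - 1" "y0 ^ (q ^ 2 - 1) = - 1"
  using S00_xy by (auto simp: S00_def zeta_i)

text \<open>The factor by which \<open>xh\<close> and \<open>yh\<close> miss the equation t^(q^2) =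
  -t; it differs from 1 by at most |gamma^(1/q)|.\<close>

abbreviation "T \<equiv> gammat0 D ^ (q - 1)"

lemma T: "nm T = 1" "cg e1 T 1" "T * gammat0 D = gamma0 D" "T ^ q = gamma0 D ^ (q - 1)" "cg (q * e1) (T ^ q) 1"
proof -
  show "nm T = 1" by (simp add: nm_power)
  show "cg e1 T 1" using cg_power[OF gammat0_near, of "q - 1"] by (simp add: e1_def)
  show "T * gammat0 D = gamma0 D" using power_minus_mult[of q "gammat0 D"] q_ge_2 by (simp add: gammat0_eq)
  show *: "T ^ q = gamma0 D ^ (q - 1)"
    by (metis power_mult mult.commute gammat0_eq)
  show "cg (q * e1) (T ^ q) 1" unfolding *
    using cg_power[OF gamma0_near, of "q - 1"] nm_gamma0_le by (simp add: e1_def)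
qed

lemma hat: "nm xh = 1" "nm yh = 1" "redu D xh = x0" "redu D yh = y0"
  "xh ^ q ^ 2 = - (T * xh)" "yh ^ q ^ 2 = - (T * yh)"
proof -
  note x = yhat_props[OF xy0(4)] and y = yhat_props[OF xy0(5)]
  show "nm xh = 1" "nm yh = 1" "redu D xh = x0" "redu D yh = y0" using x y by (auto simp: xh_def yh_def)
  show "xh ^ q ^ 2 = - (T * xh)" "yh ^ q ^ 2 = - (T * yh)"
    using x(3) y(3) power_minus_mult[of "q ^ 2" xh] power_minus_mult[of "q ^ 2" yh] q_ge_2
    by (auto simp: xh_def yh_def)
qed

lemma hat_q2: "(xh ^ q) ^ q = - (T * xh)" "(yh ^ q) ^ q = - (T * yh)"
  using hat by (simp_all add: power_q2)

text \<open>The Moore determinant u of the lifts satisfies u^q = T u up to \<pi>, and \<tau>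
  \<open>gammat0\<close> satisfies this exactly. Both reduce to \<zeta>, so
  \<open>power_diff_unit\<close> with n = q - 1 compares them.\<close>

lemma moore_hat: "cg (q ^ 2 * eW) (xh ^ q * yh - xh * yh ^ q) (\<tau> * gammat0 D)"
proof -
  define u where "u = xh ^ q * yh - xh * yh ^ q"
  define v where "v = \<tau> * gammat0 D"
  have nh: "nm xh \<le> 1" "nm yh \<le> 1" using hat by auto
  have nu: "nm u \<le> 1" unfolding u_def using nh by (intro nm_diff_leI nm_mult_le_1 nm_power_le_1)
  have ru: "redu D u = \<zeta>"
    using nh xy0(3) by (simp add: u_def redu_diff redu_times redu_power nm_mult_le_1 nm_power_le_1 hat)
  have u1: "nm u = 1" using redu_nz_iff[OF nu] ru zeta_nz by simp
  have v1: "nm v = 1" "redu D v = \<zeta>" by (simp_all add: v_def nm_mult tau redu_times redu_gammat0)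
  have vT: "v ^ (q - 1) = T"
  proof -
    have "\<tau> ^ (q - 1) * \<tau> = 1 * \<tau>" using power_minus_mult[of q \<tau>] q_ge_2 tau(4) by simp
    moreover have "\<tau> \<noteq> 0" using tau(3) by auto
    ultimately have "\<tau> ^ (q - 1) = 1" unfolding mult_cancel_right by simp
    then show ?thesis by (simp add: v_def power_mult_distrib)
  qed
  have "cg (q ^ 2 * eW) (u ^ q) ((xh ^ q * yh) ^ q - (xh * yh ^ q) ^ q)"
    unfolding u_def using nh by (intro cg_frob_diff nm_mult_le_1 nm_power_le_1) auto
  also have "(xh ^ q * yh) ^ q - (xh * yh ^ q) ^ q = T * u"
    by (simp add: power_mult_distrib hat_q2 u_def algebra_simps)
  finally have "cg (q ^ 2 * eW) (u ^ q) (u * T)" by (simp add: mult.commute)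
  also have "u ^ q = u * u ^ (q - 1)" using power_minus_mult[of q u] q_ge_2 by (simp add: mult.commute)
  finally have "cg (0 + q ^ 2 * eW) (u * u ^ (q - 1)) (u * T)" by simp
  then have "cg (q ^ 2 * eW) (u ^ (q - 1)) (v ^ (q - 1))"
    unfolding vT by (rule cg_cancel[rotated]) (simp add: u1)
  moreover have "nm (u - v) < 1" using redu_eq_iff[of u v] u1 v1 ru by simp
  ultimately show ?thesis
    using power_diff_unit[OF of_nat_q1_k u1, of v] v1 by (simp add: cg_def u_def v_def)
qed

text \<open>The fractions defining the coordinates are cleared of denominators; gamma^(1/q) w = w^q
  places a at order w^q in the Moore determinant.\<close>

lemma affinoid_basic:
  assumes "s \<in> affinoid D i (x0, y0)"
  shows "nm (x_fn D s) = 1" "nm (y_fn D s) = 1" "redu D (x_fn D s) = x0" "redu D (y_fn D s) = y0"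
    "nm (z1_fn D i (x0, y0) s) \<le> 1"
    "y_fn D s = yh + yh ^ q * gamma_root_qq1 D * z1_fn D i (x0, y0) s"
    "w_const D ^ q * a_fn D i (x0, y0) s = moore_fn D s - \<tau> * gammat0 D - gamma_root_q D * \<tau> * gammat1 D"
proof -
  have x: "nm (x_fn D s) \<le> 1" "redu D (x_fn D s) = x0" and y: "nm (y_fn D s) \<le> 1" "redu D (y_fn D s) = y0"
    and v: "val D (w1_const D y0) \<le> val D (y_fn D s - yhat D y0)"
    using assms by (auto simp: affinoid_def reduces_to_iff)
  show "nm (x_fn D s) = 1" "nm (y_fn D s) = 1" using x y redu_nz_iff xy0 by auto
  show "redu D (x_fn D s) = x0" "redu D (y_fn D s) = y0" by fact+
  have w1: "w1_const D y0 \<noteq> 0" using hat consts_nz by (auto simp: w1_const_def yh_def)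
  have z: "z1_fn D i (x0, y0) s = (y_fn D s - yhat D y0) / w1_const D y0"
    using assms by (simp add: z1_fn_def)
  show "nm (z1_fn D i (x0, y0) s) \<le> 1"
    using v w1 unfolding z val_le_iff by (simp add: nm_divide divide_le_eq)
  show "y_fn D s = yh + yh ^ q * gamma_root_qq1 D * z1_fn D i (x0, y0) s"
    using w1 unfolding z by (simp add: w1_const_def yh_def)
  have "w_const D * a_fn D i (x0, y0) s = Z1_fn D i s - \<tau> * gammat1 D"
    using assms consts_nz by (simp add: a_fn_def zeta_i \<tau>_def)
  then have "gamma_root_q D * (w_const D * a_fn D i (x0, y0) s) = gamma_root_q D * Z1_fn D i s - gamma_root_q D * (\<tau> * gammat1 D)"
    by (simp add: right_diff_distrib)
  also have "gamma_root_q D * Z1_fn D i s = moore_fn D s - \<tau> * gammat0 D"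
    using consts_nz by (simp add: Z1_fn_def zeta_i \<tau>_def)
  finally show "w_const D ^ q * a_fn D i (x0, y0) s = moore_fn D s - \<tau> * gammat0 D - gamma_root_q D * \<tau> * gammat1 D"
    by (simp add: gamma_root_q_w[symmetric] mult.assoc)
qed

text \<open>\<tau> \<open>gamma0\<close> is the q-th power of \<tau> \<open>gammat0\<close>, so
  integrality of the second invariant of a component controls (m - \<tau> gammat0)^q. A q-th root
  then gives the size |gamma^(1/q)|, which is what makes \<open>Z1_fn\<close> integral.\<close>

lemma component_near:
  assumes "nm x \<le> 1" "nm y \<le> 1"
    and m: "m = x ^ q * y - x * y ^ q"
    and E: "nm ((\<tau> * gamma0 D - (m ^ q - gamma D * m3)) / gamma_q_over_q1 D) \<le> 1" and m3: "nm m3 \<le> 1"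
  shows "nm (m - \<tau> * gammat0 D) \<le> \<theta> ^ e1"
    "cg (q ^ 2 * eW) ((m - \<tau> * gammat0 D) ^ q)
       (gamma D * m3 - gamma_q_over_q1 D * ((\<tau> * gamma0 D - (m ^ q - gamma D * m3)) / gamma_q_over_q1 D))"
proof -
  let ?E = "(\<tau> * gamma0 D - (m ^ q - gamma D * m3)) / gamma_q_over_q1 D"
  have nm: "nm m \<le> 1" unfolding m using assms(1,2) by (intro nm_diff_leI nm_mult_le_1 nm_power_le_1)
  have "cg (q ^ 2 * eW) ((m - \<tau> * gammat0 D) ^ q) (m ^ q - (\<tau> * gammat0 D) ^ q)"
    using nm tau by (intro cg_frob_diff nm_mult_le_1) auto
  also have "m ^ q - (\<tau> * gammat0 D) ^ q = gamma D * m3 - gamma_q_over_q1 D * ?E"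
    using consts_nz by (simp add: power_mult_distrib tau gammat0_eq)
  finally show c: "cg (q ^ 2 * eW) ((m - \<tau> * gammat0 D) ^ q) (gamma D * m3 - gamma_q_over_q1 D * ?E)" .
  have "nm (gamma D * m3 - gamma_q_over_q1 D * ?E) \<le> \<theta> ^ (q * e1)"
  proof (rule nm_diff_leI)
    show "nm (gamma D * m3) \<le> \<theta> ^ (q * e1)" using m3 by (intro nm_mult_le_left) (simp_all add: nm_consts)
    have "nm (gamma_q_over_q1 D * ?E) \<le> \<theta> ^ (q * eW)" using E by (intro nm_mult_le_left) (simp_all only: nm_consts order_refl)
    also have "\<dots> \<le> \<theta> ^ (q * e1)" by (intro th_mono exps)
    finally show "nm (gamma_q_over_q1 D * ?E) \<le> \<theta> ^ (q * e1)" .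
  qed
  then have "nm ((m - \<tau> * gammat0 D) ^ q) \<le> \<theta> ^ (q * e1)"
    by (rule cg_nm_le[OF c]) (use exps(6) in linarith)
  then show "nm (m - \<tau> * gammat0 D) \<le> \<theta> ^ e1" by (rule nm_root_q)
qed

text \<open>Since \<open>y\<^bsup>q\<^sup>2\<^esup>\<close> is nearly \<open>-y\<close> on the affinoid, the left-hand side, which vanishes
  to first order, is of size \<open>w\<^sup>q\<close>.\<close>

lemma moore3_near:
  assumes x: "nm x \<le> 1" and z: "nm z \<le> 1"
    and y: "y = yh + yh ^ q * gamma_root_qq1 D * z"
    and m: "m = x ^ q * y - x * y ^ q" and mt: "nm (m - \<tau> * gammat0 D) \<le> \<theta> ^ e1"
  shows "cg (eW + 1) (x ^ q ^ 3 * y - x * y ^ q ^ 3 + m) (w_const D ^ q * (\<tau> * z ^ (q + 1)))"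
proof -
  define \<eta> where "\<eta> = yh ^ q * gamma_root_qq1 D * z"
  \<comment> \<open>One more than the exponent of w^q: this precision keeps exactly what survives
    reduction after division by w^q.\<close>
  define K where "K = eW + 1"
  note ex = exps[folded K_def]
  have n\<eta>: "nm \<eta> \<le> \<theta> ^ eG"
    unfolding \<eta>_def using z hat by (intro nm_mult_le_left nm_mult_le_right nm_power_le_1) (simp_all add: nm_consts)
  then have n\<eta>1: "nm \<eta> \<le> 1" using th_le_1[of eG] by linarith
  have yy: "y = yh + \<eta>" using y by (simp add: \<eta>_def)
  have nyh: "nm yh \<le> 1" using hat by simp
  have ny: "nm y \<le> 1" unfolding yy using nyh n\<eta>1 by (rule nm_add_leI)
  have p3: "t ^ q ^ 3 = ((t ^ q) ^ q) ^ q" for t :: 'c by (simp add: power_mult power3_eq_cube mult.assoc)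
  define A1 where "A1 = x ^ q"
  define A2 where "A2 = A1 ^ q"
  define A3 where "A3 = A2 ^ q"
  define B1 where "B1 = y ^ q"
  define B2 where "B2 = B1 ^ q"
  define B3 where "B3 = B2 ^ q"
  have nAB: "nm A1 \<le> 1" "nm A2 \<le> 1" "nm A3 \<le> 1" "nm B1 \<le> 1" "nm B2 \<le> 1" "nm B3 \<le> 1"
    using x ny by (auto simp: A1_def A2_def A3_def B1_def B2_def B3_def intro!: nm_power_le_1)
  have mA: "m = A1 * y - x * B1" by (simp add: m A1_def B1_def)
  have nm: "nm m \<le> 1" unfolding mA using nAB x ny by (intro nm_diff_leI nm_mult_le_1)
  have m3: "x ^ q ^ 3 * y - x * y ^ q ^ 3 = A3 * y - x * B3"
    by (simp add: p3 A1_def A2_def A3_def B1_def B2_def B3_def)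
  have NK: "K \<le> q ^ 2 * eW" using ex by simp
  have mq: "cg K (m ^ q) \<tau>"
  proof -
    have "cg K (m ^ q) ((\<tau> * gammat0 D) ^ q)"
      by (rule cg_power_q[of e1]) (use mt nm ex NK tau in \<open>auto simp: cg_def nm_mult\<close>)
    also have "(\<tau> * gammat0 D) ^ q = \<tau> * gamma0 D" by (simp add: power_mult_distrib tau gammat0_eq)
    also have "cg K (\<tau> * gamma0 D) (\<tau> * 1)"
      using tau cg_mono[OF gamma0_near, of K] ex by (intro cg_mult_left) (auto simp: e1_def)
    finally show ?thesis by simp
  qed
  have m1: "cg K (A2 * B1 - A1 * B2) \<tau>"
  proof -
    have "cg K (m ^ q) (A2 * B1 - A1 * B2)"
      using cg_frob_diff[of "A1 * y" "x * B1" K] nAB x ny NK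
      by (simp add: mA nm_mult_le_1 power_mult_distrib A2_def B2_def A1_def[symmetric] B1_def[symmetric])
    then show ?thesis using cg_trans[OF cg_sym mq] by blast
  qed
  have m2: "cg K (A3 * B2 - A2 * B3) \<tau>"
  proof -
    have "cg K ((A2 * B1 - A1 * B2) ^ q) (A3 * B2 - A2 * B3)"
      using cg_frob_diff[of "A2 * B1" "A1 * B2" K] nAB x ny NK
      by (simp add: nm_mult_le_1 power_mult_distrib A3_def B3_def A2_def[symmetric] B2_def[symmetric])
    moreover have "cg K ((A2 * B1 - A1 * B2) ^ q) (\<tau> ^ q)"
      using nAB tau by (intro cg_power m1) (auto intro!: nm_diff_leI nm_mult_le_1)
    ultimately show ?thesis using cg_trans[OF cg_sym] tau(4) by metis
  qed
  have b1: "cg K B1 (yh ^ q + \<eta> ^ q)"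
    unfolding B1_def yy by (rule cg_frob) (use nyh n\<eta>1 NK in auto)
  have n\<eta>q: "nm (\<eta> ^ q) \<le> \<theta> ^ (q * eG)"
    using power_mono[OF n\<eta>, of q] by (simp add: nm_power power_mult[symmetric] mult.commute)
  \<comment> \<open>Two q-th powers push the displacement of y below w^q, so y^(q^2) is determined
    by \<open>yh\<close> alone.\<close>
  have n\<eta>q2: "nm ((\<eta> ^ q) ^ q) \<le> \<theta> ^ K"
    using power_mono[OF n\<eta>q, of q] th_mono[of K "q ^ 2 * eG"] ex
    by (simp add: nm_power power_mult[symmetric] power2_eq_square ac_simps)
  have b2: "cg K B2 (- (T * yh))"
  proof -
    have "cg K B2 ((yh ^ q + \<eta> ^ q) ^ q)"
      unfolding B2_def using nAB nyh n\<eta>1 by (intro cg_power b1 nm_add_leI nm_power_le_1)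
    also have "cg K ((yh ^ q + \<eta> ^ q) ^ q) ((yh ^ q) ^ q + (\<eta> ^ q) ^ q)"
      using nyh n\<eta>1 NK by (intro cg_frob nm_power_le_1)
    also have "cg K ((yh ^ q) ^ q + (\<eta> ^ q) ^ q) ((yh ^ q) ^ q)" by (rule cg_0_add[OF n\<eta>q2])
    also have "(yh ^ q) ^ q = - (T * yh)" by (rule hat_q2)
    finally show ?thesis .
  qed
  have b2': "cg e1 B2 (- yh)"
  proof (cases "e1 \<le> K")
    case True
    have "cg e1 (- (T * yh)) (- (1 * yh))" using nyh T by (intro cg_minus cg_mult_right)
    then show ?thesis using cg_trans[OF cg_mono[OF b2 True]] by simp
  next
    case False
    have "e1 \<le> K" by (simp add: K_def e1_def eW_def)
      (metis diff_le_self le_SucI mult_le_mono1)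
    with False show ?thesis by simp
  qed
  have b3: "cg K B3 (- (yh ^ q))"
  proof -
    have "cg K B3 ((- (T * yh)) ^ q)"
      unfolding B3_def using nAB nyh T by (intro cg_power b2) (auto simp: nm_mult)
    also have "(- (T * yh)) ^ q = - (T ^ q * yh ^ q)" using odd_q by (simp add: power_mult_distrib)
    also have "cg K (- (T ^ q * yh ^ q)) (- (1 * yh ^ q))"
      using nyh cg_mono[OF T(5), of K] ex by (intro cg_minus cg_mult_right nm_power_le_1)
    finally show ?thesis by simp
  qed
  \<comment> \<open>The leading terms yh^q and -yh^q cancel; only the q-th power of the displacement
    remains.\<close>
  have b13: "cg K (B3 + B1) (\<eta> ^ q)" using cg_add[OF b3 b1] by simp
  have nB13: "nm (B3 + B1) \<le> 1" using nAB by (intro nm_add_leI)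
  have n\<eta>q1: "nm (\<eta> ^ q) \<le> 1" using n\<eta>1 by (rule nm_power_le_1)
  have t0: "cg e1 m \<tau>"
  proof -
    have "cg e1 (\<tau> * gammat0 D) (\<tau> * 1)" using tau gammat0_near by (intro cg_mult_left) (auto simp: e1_def)
    then show ?thesis using mt cg_trans[of e1 m "\<tau> * gammat0 D" \<tau>] by (simp add: cg_def)
  qed
  have t1: "cg K (m * (B2 * (B3 + B1))) (\<tau> * (- yh * \<eta> ^ q))"
  proof -
    have "cg K (m * (B2 * (B3 + B1))) (m * (B2 * \<eta> ^ q))"
      using nm nAB by (intro cg_mult_left b13)
    also have "m * (B2 * \<eta> ^ q) = \<eta> ^ q * (m * B2)" by simp
    also have "cg K \<dots> (\<eta> ^ q * (\<tau> * (- yh)))"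
      by (rule cg_mono[OF cg_scale[OF n\<eta>q cg_mult[OF t0 b2']]]) (use nAB tau ex in auto)
    finally show ?thesis by (simp add: ac_simps)
  qed
  have t2: "cg K ((A2 * B1 - A1 * B2) * y * B3) (\<tau> * y * B3)"
    using nAB ny by (intro cg_mult_right m1)
  have t3: "cg K ((A3 * B2 - A2 * B3) * y * B1) (\<tau> * y * B1)"
    using nAB ny by (intro cg_mult_right m2)
  have t4: "cg K (\<tau> * y * (B3 + B1)) (\<tau> * y * \<eta> ^ q)"
    using tau ny by (intro cg_mult_left b13 nm_mult_le_1) auto
  have "cg K ((x ^ q ^ 3 * y - x * y ^ q ^ 3 + m) * (B1 * B2))
     (\<tau> * y * B1 + \<tau> * y * B3 + \<tau> * (- yh * \<eta> ^ q))"
  proof -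
    have "(x ^ q ^ 3 * y - x * y ^ q ^ 3 + m) * (B1 * B2)
        = (A3 * B2 - A2 * B3) * y * B1 + (A2 * B1 - A1 * B2) * y * B3 + m * (B2 * (B3 + B1))"
      unfolding m3 mA by (rule moore_identity)
    then show ?thesis using t1 t2 t3 by (simp only: cg_add)
  qed
  also have "\<tau> * y * B1 + \<tau> * y * B3 + \<tau> * (- yh * \<eta> ^ q) = \<tau> * y * (B3 + B1) + \<tau> * (- yh * \<eta> ^ q)"
    by (simp add: algebra_simps)
  also have "cg K \<dots> (\<tau> * y * \<eta> ^ q + \<tau> * (- yh * \<eta> ^ q))"
    by (intro cg_add t4 cg_refl)
  also have "\<dots> = \<tau> * \<eta> ^ (q + 1)" by (simp add: yy algebra_simps)
  \<comment> \<open>gamma^(1/(q^2-1)) to the power q + 1 is w^q, and the other factor, in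
    \<open>yh\<close>, is congruent to the unit \<open>B1 * B2\<close> by which the identity is
    divided at the end.\<close>
  also have "\<tau> * \<eta> ^ (q + 1) = w_const D ^ q * ((\<tau> * z ^ (q + 1)) * (yh ^ q * (yh ^ q) ^ q))"
  proof -
    have "\<eta> ^ (q + 1) = (yh ^ q) ^ (q + 1) * gamma_root_qq1 D ^ (q + 1) * z ^ (q + 1)"
      by (simp only: \<eta>_def power_mult_distrib)
    also have "\<dots> = (yh ^ q) ^ (q + 1) * w_const D ^ q * z ^ (q + 1)" by (simp only: g_w)
    finally show ?thesis by (simp add: ac_simps)
  qed
  also have "cg K \<dots> (w_const D ^ q * ((\<tau> * z ^ (q + 1)) * (B1 * B2)))"
    unfolding K_def
  proof (intro cg_scale cg_mult_left)
    show "nm (w_const D ^ q) \<le> \<theta> ^ eW" by (simp add: nm_wq)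
    show "nm (\<tau> * z ^ (q + 1)) \<le> 1" using tau z by (intro nm_mult_le_1 nm_power_le_1) auto
    have "cg 1 B1 (yh ^ q)"
    proof -
      have "cg (q * eG) (yh ^ q + \<eta> ^ q) (yh ^ q)" by (rule cg_0_add[OF n\<eta>q])
      then have "cg 1 (yh ^ q + \<eta> ^ q) (yh ^ q)" by (rule cg_mono) (use ex in linarith)
      then show ?thesis using cg_trans[OF cg_mono[OF b1]] by (simp add: K_def)
    qed
    moreover have "cg 1 B2 ((yh ^ q) ^ q)" using cg_mono[OF b2, of 1] by (simp add: hat_q2 K_def)
    ultimately show "cg 1 (yh ^ q * (yh ^ q) ^ q) (B1 * B2)"
      using nAB nyh by (intro cg_sym[OF cg_mult] nm_power_le_1)
  qed
  finally have f: "cg (0 + K) ((B1 * B2) * (x ^ q ^ 3 * y - x * y ^ q ^ 3 + m)) ((B1 * B2) * (w_const D ^ q * (\<tau> * z ^ (q + 1))))"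
    by (simp add: ac_simps)
  have "nm y = 1"
  proof -
    have "nm \<eta> < 1" using n\<eta> th_less_1_power[of eG] ex by linarith
    then have "nm (yh - y) < nm yh" using hat by (simp add: yy)
    then show ?thesis using nm_eqI[of yh y] hat by simp
  qed
  then have "nm (B1 * B2) = \<theta> ^ 0" by (simp add: B1_def B2_def nm_mult nm_power)
  from cg_cancel[OF this f] show ?thesis by (simp add: K_def)
qed

text \<open>Dividing the congruence of \<open>component_near\<close> by gamma expresses Z_1^q
  through m_3 and E. The equation of \<open>gammat1\<close> is made so that subtracting (\<tau>
  gammat1)^q turns this into w^q (a^q + a) = m_3 + m - w^q E up to smaller terms, and
  \<open>moore3_near\<close> evaluates m_3 + m.\<close>

lemma affinoid_a:
  assumes s: "s \<in> affinoid D i (x0, y0)"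
  defines "m \<equiv> moore_fn D s" and "a \<equiv> a_fn D i (x0, y0) s" and "z \<equiv> z1_fn D i (x0, y0) s"
  shows "nm (m - \<tau> * gammat0 D) \<le> \<theta> ^ e1" "nm a \<le> 1" "(redu D a, redu D z) \<in> plane_curve D i (x0, y0)"
proof -
  note b = affinoid_basic[OF s, folded m_def a_def z_def]
  define x where "x = x_fn D s"
  define y where "y = y_fn D s"
  have nx: "nm x \<le> 1" "nm y \<le> 1" using b by (simp_all add: x_def y_def)
  define m3 where "m3 = x ^ q ^ 3 * y - x * y ^ q ^ 3"
  have nm3: "nm m3 \<le> 1" unfolding m3_def using nx by (intro nm_diff_leI nm_mult_le_1 nm_power_le_1)
  have m: "m = x ^ q * y - x * y ^ q" by (simp add: m_def moore_fn_def x_def y_def)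
  define E where "E = (\<tau> * gamma0 D - calZ_fn D s) / gamma_q_over_q1 D"
  define F where "F = eval2 (f1_poly D) (x ^ q ^ 2 * y ^ q) (x ^ q * y ^ q ^ 2)"
  have EF: "nm (E + F) \<le> 1" "redu D (E + F) = mu_of D i * \<zeta>"
    using s by (auto simp: affinoid_def Y22_component_def reduces_to_iff zeta_i \<tau>_def[symmetric]
        E_def F_def x_def y_def)
  have nF: "nm F \<le> 1" unfolding F_def using nx by (intro OFpoly2_eval OFpoly2_f1 nm_mult_le_1 nm_power_le_1)
  have nE: "nm E \<le> 1" using nm_diff_leI[OF EF(1) nF] by simp
  have cZ: "calZ_fn D s = m ^ q - gamma D * m3"
    by (simp add: calZ_fn_def m_def m3_def x_def y_def)
  note near = component_near[OF nx m, of m3, folded cZ, folded E_def, OF nE nm3]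
  show mt: "nm (m - \<tau> * gammat0 D) \<le> \<theta> ^ e1" by (rule near)
  define Z where "Z = Z1_fn D i s"
  have Z: "gamma_root_q D * Z = m - \<tau> * gammat0 D"
    using consts_nz by (simp add: Z_def Z1_fn_def zeta_i \<tau>_def m_def)
  have nZ: "nm Z \<le> 1"
  proof -
    have "\<theta> ^ e1 * nm Z \<le> \<theta> ^ e1 * 1" using mt Z by (simp add: nm_mult[symmetric] nm_consts(1)[symmetric])
    then show ?thesis using th by simp
  qed
  have wq: "w_const D * a = Z - \<tau> * gammat1 D"
    using s consts_nz by (simp add: a_def a_fn_def zeta_i \<tau>_def Z_def)
  have c1: "cg (eW + 1) (Z ^ q) (m3 - w_const D ^ q * E)"
  proof (rule cg_cancel[OF nm_consts(2)])
    have "gamma D * Z ^ q = (m - \<tau> * gammat0 D) ^ q"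
      by (simp add: gamma_eq power_mult_distrib[symmetric] Z)
    moreover have "gamma D * (m3 - w_const D ^ q * E) = gamma D * m3 - gamma_q_over_q1 D * E"
      by (simp add: right_diff_distrib gamma_w mult.assoc[symmetric])
    ultimately show "cg (q * e1 + (eW + 1)) (gamma D * Z ^ q) (gamma D * (m3 - w_const D ^ q * E))"
      using cg_mono[OF near(2)] exps by simp
  qed
  have "cg (eW + 1) ((w_const D * a) ^ q) (Z ^ q - (\<tau> * gammat1 D) ^ q)"
    unfolding wq using nZ tau nm_gammat1_le exps by (intro cg_frob_diff nm_mult_le_1) auto
  also have "cg (eW + 1) (Z ^ q - (\<tau> * gammat1 D) ^ q) ((m3 - w_const D ^ q * E) - (\<tau> * gammat1 D) ^ q)"
    by (intro cg_diff c1 cg_refl)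
  also have "(m3 - w_const D ^ q * E) - (\<tau> * gammat1 D) ^ q = (m3 + m) - gamma_root_q D * (w_const D * a) - w_const D ^ q * E"
  proof -
    have "gammat1 D ^ q = - gammat0 D - gamma_root_q D * gammat1 D"
      using gammat1_eq by (simp add: algebra_simps eq_neg_iff_add_eq_0)
    then have "(\<tau> * gammat1 D) ^ q = - (\<tau> * gammat0 D) - gamma_root_q D * (\<tau> * gammat1 D)"
      by (simp add: power_mult_distrib tau right_diff_distrib ac_simps)
    moreover have "m = gamma_root_q D * Z + \<tau> * gammat0 D" by (simp add: Z)
    moreover have "gamma_root_q D * (w_const D * a) = gamma_root_q D * Z - gamma_root_q D * (\<tau> * gammat1 D)"
      by (simp only: wq right_diff_distrib)
    ultimately show ?thesis by simp
  qed
  also have "gamma_root_q D * (w_const D * a) = w_const D ^ q * a" by (simp add: gamma_root_q_w[symmetric])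
  finally have c2: "cg (eW + 1) (w_const D ^ q * a ^ q) (m3 + m - w_const D ^ q * a - w_const D ^ q * E)"
    by (simp add: power_mult_distrib)
  have c3: "cg (eW + 1) (m3 + m) (w_const D ^ q * (\<tau> * z ^ (q + 1)))"
    unfolding m3_def using nx(1) b(5) b(6)[folded y_def] m mt by (rule moore3_near)
  have "cg (eW + 1) (w_const D ^ q * a ^ q + w_const D ^ q * a)
      ((m3 + m - w_const D ^ q * a - w_const D ^ q * E) + w_const D ^ q * a)"
    by (intro cg_add c2 cg_refl)
  also have "(m3 + m - w_const D ^ q * a - w_const D ^ q * E) + w_const D ^ q * a = (m3 + m) - w_const D ^ q * E" by simp
  also have "cg (eW + 1) \<dots> (w_const D ^ q * (\<tau> * z ^ (q + 1)) - w_const D ^ q * E)"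
    by (intro cg_diff c3 cg_refl)
  finally have "cg (eW + 1) (w_const D ^ q * (a ^ q + a)) (w_const D ^ q * (\<tau> * z ^ (q + 1) - E))"
    by (simp add: algebra_simps)
  then have c: "cg 1 (a ^ q + a) (\<tau> * z ^ (q + 1) - E)" by (rule cg_cancel[OF nm_wq])
  have nr: "nm (\<tau> * z ^ (q + 1) - E) \<le> 1"
    using tau b(5) nE by (intro nm_diff_leI nm_mult_le_1 nm_power_le_1) auto
  \<comment> \<open>If a were not integral, a^q would dominate a^q + a, which is integral by the
    congruence just obtained.\<close>
  show na: "nm a \<le> 1"
  proof (rule ccontr)
    assume a: "\<not> nm a \<le> 1"
    have "nm a ^ 1 < nm a ^ q" using a q_ge_2 by (intro power_strict_increasing) auto
    then have "nm (a ^ q - (a ^ q + a)) < nm (a ^ q)" by (simp add: nm_power)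
    then have "nm (a ^ q + a) = nm (a ^ q)" by (rule nm_eqI)
    moreover have "nm (a ^ q + a) \<le> 1" by (rule cg_nm_le_1[OF c nr])
    moreover have "1 < nm (a ^ q)" using a q_ge_2 by (simp add: nm_power one_less_power)
    ultimately show False by simp
  qed
  have "redu D a ^ q + redu D a = redu D (a ^ q + a)"
    using na by (simp add: redu_plus redu_power nm_power_le_1)
  also have "\<dots> = redu D (\<tau> * z ^ (q + 1) - E)" by (rule cg_redu[OF c _ nr]) simp
  also have "\<dots> = \<zeta> * redu D z ^ (q + 1) - redu D E"
    using tau b(5) nE by (simp add: redu_diff redu_times redu_power nm_mult_le_1 nm_power_le_1)
  also have "redu D E = c0_const D i (x0, y0)"
  proof -
    have "redu D F = eval2 (redu_poly2 D (f1_poly D)) (x0 ^ q ^ 2 * y0 ^ q) (x0 ^ q * y0 ^ q ^ 2)"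
      unfolding F_def using nx b by (simp add: OFpoly2_eval_redu OFpoly2_f1 nm_mult_le_1
          nm_power_le_1 redu_times redu_power x_def y_def)
    moreover have "redu D E = redu D (E + F) - redu D F" using nE nF by (simp add: redu_plus)
    ultimately show ?thesis using EF by (simp add: c0_const_def zeta_i)
  qed
  finally show "(redu D a, redu D z) \<in> plane_curve D i (x0, y0)" by (simp add: plane_curve_def zeta_i)
qed

text \<open>The Moore determinants of (x, y) and (xh, yh) agree up to \<theta>^(\<open>eG\<close> +
  1). Expanding around the lifts leaves a linear relation between the displacements of x and y,
  apart from a term \<xi>^q y of higher order.\<close>

lemma affinoid_x:
  assumes s: "s \<in> affinoid D i (x0, y0)"
  shows "cg (eG + 1) (x_fn D s) (xh + xh ^ q * gamma_root_qq1 D * z1_fn D i (x0, y0) s)"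
    "cg eG (x_fn D s) xh" "cg eG (y_fn D s) yh"
proof -
  define z where "z = z1_fn D i (x0, y0) s"
  define m where "m = moore_fn D s"
  note b = affinoid_basic[OF s, folded m_def z_def]
  note a = affinoid_a[OF s, folded m_def z_def]
  define x where "x = x_fn D s"
  define y where "y = y_fn D s"
  have nx: "nm x \<le> 1" "nm y \<le> 1" using b by (simp_all add: x_def y_def)
  have m: "m = x ^ q * y - x * y ^ q" by (simp add: m_def moore_fn_def x_def y_def)
  define \<xi> where "\<xi> = x - xh"
  define \<eta> where "\<eta> = yh ^ q * gamma_root_qq1 D * z"
  define K where "K = eG + 1"
  note ex = exps[folded K_def]
  have NK: "K \<le> q ^ 2 * eW" using ex by simp
  have nh: "nm xh \<le> 1" "nm yh \<le> 1" using hat by auto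
  have n\<eta>: "nm \<eta> \<le> \<theta> ^ eG"
    unfolding \<eta>_def using b(5) hat by (intro nm_mult_le_left nm_mult_le_right nm_power_le_1) (simp_all add: nm_consts)
  then have n\<eta>1: "nm \<eta> \<le> 1" using th_le_1[of eG] by linarith
  have yy: "y = yh + \<eta>" and xx: "x = xh + \<xi>" using b(6) by (simp_all add: \<eta>_def \<xi>_def y_def)
  have n\<xi>: "nm \<xi> < 1" unfolding \<xi>_def using redu_eq_iff[OF nx(1) nh(1)] b hat by (simp add: x_def)
  then have n\<xi>1: "nm \<xi> \<le> 1" by simp
  have n\<eta>q: "nm (\<eta> ^ q) \<le> \<theta> ^ K"
    using power_mono[OF n\<eta>, of q] th_mono[of K "q * eG"] ex
    by (simp add: nm_power power_mult[symmetric] mult.commute)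
  have "cg K m (xh ^ q * yh - xh * yh ^ q)"
  proof -
    have "cg K m (\<tau> * gammat0 D)" using a(1) th_mono[of K e1] ex by (simp add: cg_def)
    then show ?thesis using cg_trans cg_sym[OF cg_mono[OF moore_hat NK]] by blast
  qed
  moreover have "cg K m ((xh ^ q + \<xi> ^ q) * y - x * yh ^ q)"
  proof -
    have 1: "cg K (y ^ q) (yh ^ q)"
      unfolding yy using cg_frob[OF nh(2) n\<eta>1 NK] cg_0_add[OF n\<eta>q] cg_trans by blast
    have 2: "cg K (x ^ q) (xh ^ q + \<xi> ^ q)"
      unfolding xx using nh(1) n\<xi>1 NK by (rule cg_frob)
    show ?thesis unfolding m using 1 2 nx by (intro cg_diff cg_mult_right cg_mult_left)
  qed
  ultimately have "cg K ((xh ^ q + \<xi> ^ q) * y - x * yh ^ q) (xh ^ q * yh - xh * yh ^ q)"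
    using cg_trans cg_sym by blast
  then have "nm (xh ^ q * \<eta> - (\<xi> * yh ^ q - \<xi> ^ q * y)) \<le> \<theta> ^ K"
    by (simp add: cg_def xx yy algebra_simps)
  then have c: "cg K (\<xi> * yh ^ q - \<xi> ^ q * y) (xh ^ q * \<eta>)" by (simp add: cg_def nm_diff_commute)
  have nr: "nm (xh ^ q * \<eta>) \<le> \<theta> ^ eG" using nh n\<eta> by (intro nm_mult_le_right nm_power_le_1)
  have nl: "nm (\<xi> * yh ^ q - \<xi> ^ q * y) \<le> \<theta> ^ eG" by (rule cg_nm_le[OF c nr]) (simp add: K_def)
  \<comment> \<open>As |\<xi>| < 1, the linear term outweighs \<xi>^q, so \<xi> has the size of the
    left-hand side of \<open>c\<close>.\<close>
  have n\<xi>G: "nm \<xi> \<le> \<theta> ^ eG"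
  proof (cases "\<xi> = 0")
    case True then show ?thesis using th by simp
  next
    case False
    have e: "nm (\<xi> * yh ^ q) = nm \<xi>" using hat by (simp add: nm_mult nm_power)
    have "nm (\<xi> ^ q * y) \<le> nm (\<xi> ^ q)" using nx by (intro nm_mult_le_left) auto
    also have "\<dots> < nm \<xi> ^ 1"
      unfolding nm_power using False n\<xi> q_ge_2 by (intro power_strict_decreasing) auto
    finally have "nm (\<xi> * yh ^ q - (\<xi> * yh ^ q - \<xi> ^ q * y)) < nm (\<xi> * yh ^ q)" using e by simp
    then have "nm (\<xi> * yh ^ q - \<xi> ^ q * y) = nm \<xi>" using nm_eqI e by metis
    then show ?thesis using nl by simp
  qed
  have "nm (\<xi> ^ q * y) \<le> \<theta> ^ K"
  proof (rule nm_mult_le_left[OF _ nx(2)])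
    show "nm (\<xi> ^ q) \<le> \<theta> ^ K"
      using power_mono[OF n\<xi>G, of q] th_mono[of K "q * eG"] ex
      by (simp add: nm_power power_mult[symmetric] mult.commute)
  qed
  then have "cg K (\<xi> * yh ^ q - \<xi> ^ q * y + \<xi> ^ q * y) (xh ^ q * \<eta>)"
    using cg_trans[OF cg_0_add c] by blast
  then have "cg (0 + K) (yh ^ q * \<xi>) (yh ^ q * (xh ^ q * gamma_root_qq1 D * z))"
    by (simp add: \<eta>_def ac_simps)
  then have "cg K \<xi> (xh ^ q * gamma_root_qq1 D * z)"
    by (rule cg_cancel[rotated]) (simp add: nm_power hat)
  then show "cg (eG + 1) (x_fn D s) (xh + xh ^ q * gamma_root_qq1 D * z1_fn D i (x0, y0) s)"
    using cg_add[of K xh xh] by (simp add: \<xi>_def x_def z_def K_def cg_def algebra_simps)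
  show "cg eG (x_fn D s) xh" "cg eG (y_fn D s) yh"
    using n\<xi>G n\<eta> yy by (simp_all add: cg_def \<xi>_def x_def y_def)
qed

end

unbundle no vec_syntax

subsection \<open>Power series agreeing to a given order\<close>

lemma fps_power_nth_cong:
  fixes f g :: "'a::comm_ring_1 fps"
  assumes "\<And>i. i \<le> n \<Longrightarrow> f $ i = g $ i" and "m \<le> n"
  shows "(f ^ k) $ m = (g ^ k) $ m"
  using assms(2)
proof (induction k arbitrary: m)
  case (Suc k)
  then show ?case using assms(1) by (auto simp: fps_mult_nth intro!: sum.cong)
qed simp

text \<open>Without constant terms, a product of at least two factors reaches degree n only through
  coefficients of lower degree. This drives the coefficientwise induction in the functional equation
  lemma.\<close>

lemma fps_power_nth_cong_less:
  fixes f g :: "'a::comm_ring_1 fps"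
  assumes "\<And>i. i < n \<Longrightarrow> f $ i = g $ i" "f $ 0 = 0" "g $ 0 = 0" "m \<le> n" "2 \<le> k"
  shows "(f ^ k) $ m = (g ^ k) $ m"
proof -
  obtain k' where k: "k = Suc (Suc k')" using assms(5) by (metis add_2_eq_Suc le_Suc_ex)
  have "f $ i * (f ^ Suc k') $ (m - i) = g $ i * (g ^ Suc k') $ (m - i)" if "i \<le> m" for i
  proof (cases "i = 0 \<or> i = m")
    case True
    then show ?thesis using assms(2,3) by (auto simp: fps_power_zeroth)
  next
    case False
    then have "i < n" "m - i < n" using that assms(4) by auto
    moreover have "(f ^ Suc k') $ (m - i) = (g ^ Suc k') $ (m - i)"
      by (rule fps_power_nth_cong[of "m - i"]) (use assms(1) \<open>m - i < n\<close> in auto)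
    ultimately show ?thesis using assms(1) by simp
  qed
  then show ?thesis unfolding k by (subst (1 2) power_Suc) (simp add: fps_mult_nth)
qed

lemma fps_compose_X_power_nth:
  fixes f :: "'a::comm_ring_1 fps"
  assumes "0 < d"
  shows "(f oo fps_X ^ d) $ n = (if d dvd n then f $ (n div d) else 0)"
proof -
  have "(f oo fps_X ^ d) $ n = (\<Sum>i\<in>{0..n}. f $ i * (if n = d * i then 1 else 0))"
    by (simp add: fps_compose_nth power_mult[symmetric] fps_X_power_nth)
  also have "\<dots> = (\<Sum>i\<in>{0..n}. if i = n div d \<and> d dvd n then f $ i else 0)"
    using assms by (intro sum.cong) auto
  also have "\<dots> = (if d dvd n then f $ (n div d) else 0)" by (auto simp: if_distrib sum.delta)
  finally show ?thesis .
qed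

context lubin_tate
begin

subsection \<open>Integral polynomials in the parameter \<open>u\<close>\<close>

text \<open>Polynomials in u over the ring of integers of F, taken as an inductive class of
  functions: rule induction yields integrality, a Lipschitz bound and the Frobenius congruence, and
  specialising u is mere application.\<close>

inductive Au :: "('c \<Rightarrow> 'c) \<Rightarrow> bool" where
  Au_const: "c \<in> OF D \<Longrightarrow> Au (\<lambda>u. c)"
| Au_id: "Au (\<lambda>u. u)"
| Au_add: "Au \<phi> \<Longrightarrow> Au \<psi> \<Longrightarrow> Au (\<lambda>u. \<phi> u + \<psi> u)"
| Au_mult: "Au \<phi> \<Longrightarrow> Au \<psi> \<Longrightarrow> Au (\<lambda>u. \<phi> u * \<psi> u)"

lemma Au_minus: "Au \<phi> \<Longrightarrow> Au (\<lambda>u. - \<phi> u)"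
  using Au_mult[OF Au_const[of "-1"], of \<phi>] by (simp add: OF_minus)

lemma Au_diff: "Au \<phi> \<Longrightarrow> Au \<psi> \<Longrightarrow> Au (\<lambda>u. \<phi> u - \<psi> u)"
  using Au_add[of \<phi> "\<lambda>u. - \<psi> u"] Au_minus by simp

lemma Au_power: "Au \<phi> \<Longrightarrow> Au (\<lambda>u. \<phi> u ^ n)"
  by (induction n) (auto intro: Au_const Au_mult)

lemma Au_sum: "(\<And>i. i \<in> I \<Longrightarrow> Au (\<phi> i)) \<Longrightarrow> Au (\<lambda>u. \<Sum>i\<in>I. \<phi> i u)"
  by (induction I rule: infinite_finite_induct) (auto intro: Au_const Au_add)

lemma Au_comp: "Au \<phi> \<Longrightarrow> Au \<psi> \<Longrightarrow> Au (\<lambda>u. \<phi> (\<psi> u))"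
  by (induction rule: Au.induct) (auto intro: Au.intros)

lemma Au_twist: "Au \<phi> \<Longrightarrow> Au (\<lambda>u. \<phi> (u ^ q))"
  by (rule Au_comp) (auto intro: Au_power Au_id)

lemma Au_bound: "Au \<phi> \<Longrightarrow> nm u \<le> 1 \<Longrightarrow> nm (\<phi> u) \<le> 1"
  by (induction rule: Au.induct) (auto intro: nm_add_leI nm_mult_le_1 OF_nm)

text \<open>Used with v = 0 to replace the coefficients of the module structure by those at u = 0,
  at the cost of |u|.\<close>

lemma Au_lipschitz: "Au \<phi> \<Longrightarrow> nm u \<le> 1 \<Longrightarrow> nm v \<le> 1 \<Longrightarrow> nm (\<phi> u - \<phi> v) \<le> nm (u - v)"
proof (induction rule: Au.induct)
  case (Au_add \<phi> \<psi>)
  have "nm ((\<phi> u - \<phi> v) + (\<psi> u - \<psi> v)) \<le> nm (u - v)" using Au_add by (intro nm_add_leI) auto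
  then show ?case by (simp add: algebra_simps)
next
  case (Au_mult \<phi> \<psi>)
  have "nm ((\<phi> u - \<phi> v) * \<psi> u + \<phi> v * (\<psi> u - \<psi> v)) \<le> nm (u - v)"
    using Au_mult by (intro nm_add_leI nm_mult_le_left[OF _ Au_bound] nm_mult_le_right[OF Au_bound]) auto
  then show ?case by (simp add: algebra_simps)
qed auto

lemma Au_frob_add:
  assumes "Au \<phi>" "Au \<psi>" shows "Au (\<lambda>u. ((\<phi> u + \<psi> u) ^ q - \<phi> u ^ q - \<psi> u ^ q) / \<varpi>)"
proof -
  have "((\<phi> u + \<psi> u) ^ q - \<phi> u ^ q - \<psi> u ^ q) / \<varpi>
    = (\<Sum>k\<in>{0<..<q}. (of_nat (q choose k) / \<varpi>) * \<phi> u ^ k * \<psi> u ^ (q - k))" for u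
    using binomial_middle[of q "\<phi> u" "\<psi> u"] q_ge_2 by (simp add: sum_divide_distrib)
  moreover have "Au (\<lambda>u. \<Sum>k\<in>{0<..<q}. (of_nat (q choose k) / \<varpi>) * \<phi> u ^ k * \<psi> u ^ (q - k))"
    using assms by (intro Au_sum Au_mult Au_const Au_power nm_of_nat_le_uni choose_q_redu) auto
  ultimately show ?thesis by simp
qed

text \<open>The substitution of u^q for u lifts Frobenius. Divisibility by \<pi> holds inside the
  class and not merely for values, so the quotients can enter further constructions.\<close>

lemma Au_frob: "Au \<phi> \<Longrightarrow> Au (\<lambda>u. (\<phi> (u ^ q) - \<phi> u ^ q) / \<varpi>)"
proof (induction rule: Au.induct)
  case (Au_const c)
  have "redu D (c ^ q) = redu D c" using Au_const by (simp add: redu_power OF_nm Fq_power_q Fq_redu)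
  then have "nm (c - c ^ q) < 1" using Au_const by (subst redu_eq_iff[symmetric]) (auto intro: OF_nm nm_power_le_1)
  then have "(c - c ^ q) / \<varpi> \<in> OF D" by (intro OF_div_uni OF_diff OF_power Au_const)
  then show ?case by (rule Au.Au_const)
next
  case Au_id
  then show ?case using Au.Au_const[of 0] by simp
next
  case (Au_add \<phi> \<psi>)
  have "Au (\<lambda>u. (\<phi> (u ^ q) - \<phi> u ^ q) / \<varpi> + (\<psi> (u ^ q) - \<psi> u ^ q) / \<varpi> - ((\<phi> u + \<psi> u) ^ q - \<phi> u ^ q - \<psi> u ^ q) / \<varpi>)"
    using Au_add by (intro Au_diff Au.Au_add Au_frob_add)
  then show ?case by (simp add: diff_divide_distrib add_divide_distrib algebra_simps)
next
  case (Au_mult \<phi> \<psi>)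
  have "Au (\<lambda>u. ((\<phi> (u ^ q) - \<phi> u ^ q) / \<varpi>) * \<psi> (u ^ q) + \<phi> u ^ q * ((\<psi> (u ^ q) - \<psi> u ^ q) / \<varpi>))"
    using Au_mult by (intro Au.Au_add Au.Au_mult Au_power Au_twist)
  moreover have "((\<phi> (u ^ q) - \<phi> u ^ q) / \<varpi>) * \<psi> (u ^ q) + \<phi> u ^ q * ((\<psi> (u ^ q) - \<psi> u ^ q) / \<varpi>)
     = (\<phi> (u ^ q) * \<psi> (u ^ q) - (\<phi> u * \<psi> u) ^ q) / \<varpi>" for u
    by (simp add: power_mult_distrib diff_divide_distrib algebra_simps)
  ultimately show ?case by simp
qed

definition AD :: "nat \<Rightarrow> ('c \<Rightarrow> 'c fps) \<Rightarrow> bool" where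
  "AD r P \<longleftrightarrow> (\<forall>n. Au (\<lambda>u. P u $ n / \<varpi> ^ r))"

lemma AD_0_iff: "AD 0 P \<longleftrightarrow> (\<forall>n. Au (\<lambda>u. P u $ n))"
  by (simp add: AD_def)

lemma AD_add: "AD r P \<Longrightarrow> AD r Q \<Longrightarrow> AD r (\<lambda>u. P u + Q u)"
  and AD_diff: "AD r P \<Longrightarrow> AD r Q \<Longrightarrow> AD r (\<lambda>u. P u - Q u)"
  by (auto simp: AD_def add_divide_distrib diff_divide_distrib intro: Au_add Au_diff)

lemma AD_mult:
  assumes "AD r P" "AD s Q" shows "AD (r + s) (\<lambda>u. P u * Q u)"
proof -
  have "(P u * Q u) $ n / \<varpi> ^ (r + s) = (\<Sum>i\<in>{0..n}. (P u $ i / \<varpi> ^ r) * (Q u $ (n - i) / \<varpi> ^ s))" for u n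
    by (simp add: fps_mult_nth sum_divide_distrib power_add)
  moreover have "Au (\<lambda>u. \<Sum>i\<in>{0..n}. (P u $ i / \<varpi> ^ r) * (Q u $ (n - i) / \<varpi> ^ s))" for n
    using assms unfolding AD_def by (intro Au_sum Au_mult) auto
  ultimately show ?thesis by (simp only: AD_def) simp
qed

lemma AD_mono:
  assumes "AD r P" "s \<le> r" shows "AD s P"
proof -
  have "P u $ n / \<varpi> ^ s = \<varpi> ^ (r - s) * (P u $ n / \<varpi> ^ r)" for u n
    using assms(2) by (simp add: field_simps power_add[symmetric])
  moreover have "Au (\<lambda>u. \<varpi> ^ (r - s) * (P u $ n / \<varpi> ^ r))" for n
    using assms(1) unfolding AD_def by (intro Au_mult Au_const OF_power) auto
  ultimately show ?thesis by (simp only: AD_def) simp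
qed

lemma AD_one: "AD 0 (\<lambda>u. 1)"
  by (auto simp: AD_def intro: Au_const)

lemma AD_power: "AD r P \<Longrightarrow> AD (r * k) (\<lambda>u. P u ^ k)"
  using AD_mult[of r P] by (induction k) (auto simp: AD_one)

lemma AD_sum: "(\<And>i. i \<in> I \<Longrightarrow> AD r (P i)) \<Longrightarrow> AD r (\<lambda>u. \<Sum>i\<in>I. P i u)"
  by (auto simp: AD_def fps_sum_nth sum_divide_distrib intro!: Au_sum)

lemma AD_const: "Au (\<lambda>u. c u / \<varpi> ^ r) \<Longrightarrow> AD r (\<lambda>u. fps_const (c u))"
  unfolding AD_def
proof
  fix n assume "Au (\<lambda>u. c u / \<varpi> ^ r)"
  then show "Au (\<lambda>u. fps_const (c u) $ n / \<varpi> ^ r)" using Au_const[of 0] by (cases "n = 0") auto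
qed

lemma AD_choose: "0 < k \<Longrightarrow> k < q \<Longrightarrow> AD 1 (\<lambda>u. of_nat (q choose k))"
  unfolding fps_of_nat[symmetric]
  by (intro AD_const) (auto intro!: Au_const nm_of_nat_le_uni choose_q_redu)

text \<open>The middle binomial coefficients supply the extra \<pi>, and r q >= r + 1 takes care of
  the last term. Iterated, this offsets the denominators of the logarithm.\<close>

lemma AD_power_q_diff:
  assumes "AD 0 P" "AD 0 Q" "AD r (\<lambda>u. P u - Q u)" "1 \<le> r"
  shows "AD (r + 1) (\<lambda>u. P u ^ q - Q u ^ q)"
proof -
  have "AD (r + 1) (\<lambda>u. (P u - Q u) ^ q
     + (\<Sum>k\<in>{0<..<q}. of_nat (q choose k) * (P u - Q u) ^ k * Q u ^ (q - k)))"
  proof (intro AD_add AD_sum)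
    have "r + 1 \<le> r * q" using assms(4) mult_le_mono2[OF q_ge_2, of r] by linarith
    then show "AD (r + 1) (\<lambda>u. (P u - Q u) ^ q)" using AD_mono AD_power[OF assms(3)] by blast
    fix k assume k: "k \<in> {0<..<q}"
    have "r \<le> r * k" using k by simp
    then have "AD r (\<lambda>u. (P u - Q u) ^ k)" using AD_mono AD_power[OF assms(3)] by blast
    moreover have "AD 0 (\<lambda>u. Q u ^ (q - k))" using AD_power[OF assms(2)] by simp
    ultimately have "AD ((1 + r) + 0) (\<lambda>u. of_nat (q choose k) * (P u - Q u) ^ k * Q u ^ (q - k))"
      using k by (intro AD_mult AD_choose) auto
    then show "AD (r + 1) (\<lambda>u. of_nat (q choose k) * (P u - Q u) ^ k * Q u ^ (q - k))" by simp
  qed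
  moreover have "(P u - Q u) ^ q
     + (\<Sum>k\<in>{0<..<q}. of_nat (q choose k) * (P u - Q u) ^ k * Q u ^ (q - k)) = P u ^ q - Q u ^ q" for u
    using binomial_middle[of q "P u - Q u" "Q u"] q_ge_2 by simp
  ultimately show ?thesis by simp
qed

lemma AD_power_qk_diff:
  assumes "AD 0 P" "AD 0 Q" "AD 1 (\<lambda>u. P u - Q u)"
  shows "AD (k + 1) (\<lambda>u. P u ^ q ^ k - Q u ^ q ^ k)"
proof (induction k)
  case 0 then show ?case using assms by simp
next
  case (Suc k)
  have "AD 0 (\<lambda>u. P u ^ q ^ k)" "AD 0 (\<lambda>u. Q u ^ q ^ k)"
    using AD_power[OF assms(1)] AD_power[OF assms(2)] by auto
  then have "AD (k + 1 + 1) (\<lambda>u. (P u ^ q ^ k) ^ q - (Q u ^ q ^ k) ^ q)"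
    using Suc by (intro AD_power_q_diff) auto
  then show ?case by (simp add: power_mult[symmetric] mult.commute)
qed

definition frobs :: "('c \<Rightarrow> 'c fps) \<Rightarrow> 'c \<Rightarrow> 'c fps" where
  "frobs P u = P (u ^ q) oo fps_X ^ q"

lemma q_pos: "0 < q" using q_ge_2 by simp

lemma frobs_nth: "frobs P u $ n = (if q dvd n then P (u ^ q) $ (n div q) else 0)"
  unfolding frobs_def by (rule fps_compose_X_power_nth[OF q_pos])

lemma AD_frobs: "AD 0 P \<Longrightarrow> AD 0 (frobs P)"
  unfolding AD_0_iff frobs_nth
proof
  fix n assume "\<forall>n. Au (\<lambda>u. P u $ n)"
  then show "Au (\<lambda>u. if q dvd n then P (u ^ q) $ (n div q) else 0)"
    using Au_const[of 0] Au_twist[of "\<lambda>u. P u $ (n div q)"] by (cases "q dvd n") auto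
qed

lemma AD_frob_add:
  assumes "AD 0 P" "AD 0 Q" shows "AD 1 (\<lambda>u. (P u + Q u) ^ q - P u ^ q - Q u ^ q)"
proof -
  have "(P u + Q u) ^ q - P u ^ q - Q u ^ q
    = (\<Sum>k\<in>{0<..<q}. of_nat (q choose k) * P u ^ k * Q u ^ (q - k))" for u
    using binomial_middle[of q "P u" "Q u"] q_ge_2 by simp
  moreover have "AD 1 (\<lambda>u. \<Sum>k\<in>{0<..<q}. of_nat (q choose k) * P u ^ k * Q u ^ (q - k))"
  proof (rule AD_sum)
    fix k assume k: "k \<in> {0<..<q}"
    have "AD 0 (\<lambda>u. P u ^ k)" "AD 0 (\<lambda>u. Q u ^ (q - k))" using AD_power assms by force+
    then have "AD (1 + 0 + 0) (\<lambda>u. of_nat (q choose k) * P u ^ k * Q u ^ (q - k))"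
      using k by (intro AD_mult AD_choose) auto
    then show "AD 1 (\<lambda>u. of_nat (q choose k) * P u ^ k * Q u ^ (q - k))" by simp
  qed
  ultimately show ?thesis by simp
qed

text \<open>For a monomial this is \<open>Au_frob\<close>. Terms are added one at a time, the q-th
  power being additive modulo \<pi>, and a fixed coefficient sees only a truncation.\<close>

lemma AD_frobs_diff:
  assumes P: "AD 0 P" shows "AD 1 (\<lambda>u. frobs P u - P u ^ q)"
proof -
  have X: "AD 0 (\<lambda>u. fps_X ^ i)" for i
    by (auto simp: AD_0_iff fps_X_power_nth intro: Au_const)
  define Q where "Q m u = (\<Sum>i<m. fps_const (P u $ i) * fps_X ^ i)" for m u
  define R where "R m u = (\<Sum>i<m. fps_const (P (u ^ q) $ i) * fps_X ^ (q * i))" for m u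
  have c: "AD 0 (\<lambda>u. fps_const (P u $ i))" for i using P by (intro AD_const) (simp add: AD_0_iff)
  have cX: "AD 0 (\<lambda>u. fps_const (P u $ i) * fps_X ^ i)" for i using AD_mult[OF c X] by simp
  have Q: "AD 0 (Q m)" for m unfolding Q_def by (intro AD_sum cX)
  have "AD 1 (\<lambda>u. R m u - Q m u ^ q)" for m
  proof (induction m)
    case 0
    then show ?case using Au_const[of 0] q_pos by (simp add: R_def Q_def AD_def zero_power)
  next
    case (Suc m)
    let ?t = "\<lambda>u. fps_const (P u $ m) * fps_X ^ m"
    have "Au (\<lambda>u. (P (u ^ q) $ m - (P u $ m) ^ q) / \<varpi>)" using P Au_frob[of "\<lambda>u. P u $ m"] by (simp add: AD_0_iff)
    then have "AD 1 (\<lambda>u. fps_const (P (u ^ q) $ m - (P u $ m) ^ q))"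
      by (intro AD_const) simp
    then have "AD (1 + 0) (\<lambda>u. fps_const (P (u ^ q) $ m - (P u $ m) ^ q) * fps_X ^ (q * m))"
      by (intro AD_mult X)
    then have 1: "AD 1 (\<lambda>u. fps_const (P (u ^ q) $ m - (P u $ m) ^ q) * fps_X ^ (q * m))" by simp
    have "AD 1 (\<lambda>u. (R m u - Q m u ^ q) + fps_const (P (u ^ q) $ m - (P u $ m) ^ q) * fps_X ^ (q * m)
       - ((Q m u + ?t u) ^ q - Q m u ^ q - ?t u ^ q))"
      by (intro AD_diff AD_add Suc 1 AD_frob_add Q cX)
    moreover have "(R m u - Q m u ^ q) + fps_const (P (u ^ q) $ m - (P u $ m) ^ q) * fps_X ^ (q * m)
       - ((Q m u + ?t u) ^ q - Q m u ^ q - ?t u ^ q) = R (Suc m) u - Q (Suc m) u ^ q" for u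
    proof -
      have "?t u ^ q = fps_const ((P u $ m) ^ q) * fps_X ^ (q * m)"
        by (simp add: power_mult_distrib fps_const_power power_mult[symmetric] mult.commute)
      then show ?thesis
        by (simp add: R_def Q_def fps_const_sub[symmetric] algebra_simps del: fps_const_sub)
    qed
    ultimately show ?case by simp
  qed
  then have 1: "Au (\<lambda>u. (R (Suc n) u - Q (Suc n) u ^ q) $ n / \<varpi> ^ 1)" for n by (simp add: AD_def)
  have "(R (Suc n) u - Q (Suc n) u ^ q) $ n = (frobs P u - P u ^ q) $ n" for n u
  proof -
    have "Q (Suc n) u $ i = P u $ i" if "i \<le> n" for i
    proof -
      have "Q (Suc n) u $ i = (\<Sum>j<Suc n. if j = i then P u $ j else 0)"
        unfolding Q_def fps_sum_nth by (intro sum.cong) (auto simp: fps_X_power_nth)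
      then show ?thesis using that by (simp add: sum.delta)
    qed
    then have "(Q (Suc n) u ^ q) $ n = (P u ^ q) $ n" by (intro fps_power_nth_cong[of n]) auto
    moreover have "R (Suc n) u $ n = frobs P u $ n"
    proof -
      have "R (Suc n) u $ n = (\<Sum>j<Suc n. if j = n div q \<and> q dvd n then P (u ^ q) $ j else 0)"
        unfolding R_def fps_sum_nth using q_pos by (intro sum.cong) (auto simp: fps_X_power_nth)
      also have "\<dots> = (if q dvd n then P (u ^ q) $ (n div q) else 0)"
        using div_le_dividend[of n q] by (cases "q dvd n") (auto simp: sum.delta simp flip: less_Suc_eq_le)
      finally show ?thesis by (simp add: frobs_nth)
    qed
    ultimately show ?thesis by simp
  qed
  then show ?thesis using 1 by (simp add: AD_def)
qed

subsection \<open>The logarithm\<close>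

text \<open>Each step of the recurrence divides by \<pi> once, so \<pi>^k clears the denominator of
  b_k.\<close>

lemma Au_lt_b: "Au (\<lambda>u. \<varpi> ^ k * lt_b D u k)"
proof (induction k rule: induct_nat_012)
  case 0 then show ?case using Au_const[of 1] by simp
next
  case 1 then show ?case using Au_id by simp
next
  case (ge2 k)
  have "Au (\<lambda>u. (\<varpi> ^ Suc k * lt_b D u (Suc k)) * u ^ q ^ Suc k + \<varpi> * (\<varpi> ^ k * lt_b D u k))"
    by (intro Au_add Au_mult[OF ge2(2) Au_power[OF Au_id]] Au_mult[OF Au_const[OF OF_uni] ge2(1)])
  moreover have "(\<varpi> ^ Suc k * lt_b D u (Suc k)) * u ^ q ^ Suc k + \<varpi> * (\<varpi> ^ k * lt_b D u k)
      = \<varpi> ^ Suc (Suc k) * lt_b D u (Suc (Suc k))" for u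
  proof -
    have r: "\<varpi> * lt_b D u (Suc (Suc k)) = lt_b D u (Suc k) * u ^ q ^ Suc k + lt_b D u k" by simp
    have "\<varpi> ^ Suc (Suc k) * lt_b D u (Suc (Suc k)) = \<varpi> ^ Suc k * (\<varpi> * lt_b D u (Suc (Suc k)))"
      by (simp only: power_Suc2 mult.assoc)
    then show ?thesis unfolding r by (simp add: algebra_simps del: lt_b.simps)
  qed
  ultimately show ?case by simp
qed

text \<open>The defining recurrence attaches new powers of u with growing exponents at the top; this
  mirror image splits off the lowest one, so that the shift of the index becomes a Frobenius twist
  of u. In this form it sums to a functional equation.\<close>

lemma lt_b_twist: "\<varpi> * lt_b D u (Suc (Suc k)) = u * lt_b D (u ^ q) (Suc k) + lt_b D (u ^ q ^ 2) k"
proof (induction k rule: induct_nat_012)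
  case 0 show ?case by simp
next
  case 1
  show ?case by (simp add: field_simps power_mult[symmetric] power2_eq_square)
next
  case (ge2 k)
  have e: "u ^ q ^ Suc (Suc (Suc k)) = (u ^ q) ^ q ^ Suc (Suc k)" "(u ^ q) ^ q ^ Suc (Suc k) = (u ^ q ^ 2) ^ q ^ Suc k"
    by (simp_all add: power_mult[symmetric] power2_eq_square ac_simps)
  have r: "\<varpi> * lt_b D v (Suc (Suc m)) = lt_b D v (Suc m) * v ^ q ^ Suc m + lt_b D v m" for v m by simp
  have "\<varpi> * (\<varpi> * lt_b D u (Suc (Suc (Suc (Suc k)))))
     = (\<varpi> * lt_b D u (Suc (Suc (Suc k)))) * u ^ q ^ Suc (Suc (Suc k)) + \<varpi> * lt_b D u (Suc (Suc k))"
    unfolding r[of u "Suc (Suc k)"] by (simp only: distrib_left mult.assoc)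
  also have "\<dots> = (u * lt_b D (u ^ q) (Suc (Suc k)) + lt_b D (u ^ q ^ 2) (Suc k)) * u ^ q ^ Suc (Suc (Suc k))
     + (u * lt_b D (u ^ q) (Suc k) + lt_b D (u ^ q ^ 2) k)"
    unfolding ge2.IH ..
  also have "\<dots> = u * (lt_b D (u ^ q) (Suc (Suc k)) * (u ^ q) ^ q ^ Suc (Suc k) + lt_b D (u ^ q) (Suc k))
     + (lt_b D (u ^ q ^ 2) (Suc k) * (u ^ q ^ 2) ^ q ^ Suc k + lt_b D (u ^ q ^ 2) k)"
    unfolding e(1) by (simp only: e(2)[symmetric] distrib_left distrib_right mult.assoc add.assoc add.left_commute)
  also have "\<dots> = \<varpi> * (u * lt_b D (u ^ q) (Suc (Suc (Suc k))) + lt_b D (u ^ q ^ 2) (Suc (Suc k)))"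
    unfolding r[symmetric] by (simp only: distrib_left mult.left_commute)
  finally show ?case unfolding mult_cancel_left by simp
qed

lemma lt_log_nth: "lt_log D u $ n = (\<Sum>k | k \<le> n \<and> q ^ k = n. lt_b D u k)"
  by (simp add: lt_log_def)

lemma lt_log_0 [simp]: "lt_log D u $ 0 = 0"
  using q_pos by (simp add: lt_log_nth)

lemma less_q_power: "k < q ^ k"
  using q_ge_2 by (intro power_gt_expt) auto

lemma lt_log_1 [simp]: "lt_log D u $ Suc 0 = 1"
proof -
  have "{k. k \<le> Suc 0 \<and> q ^ k = Suc 0} = {0}"
    using q_ge_2 by (auto simp: power_eq_1_iff)
  then show ?thesis by (simp add: lt_log_nth)
qed

lemma fps_power_nth_0: "P $ 0 = 0 \<Longrightarrow> n < k \<Longrightarrow> (P ^ k) $ n = (0::'c)"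
  using startsby_zero_power_prefix by blast

lemma log_compose_nth:
  assumes "P $ 0 = 0" "n \<le> K"
  shows "(lt_log D u oo P) $ n = (\<Sum>k\<le>K. lt_b D u k * (P ^ q ^ k) $ n)"
proof -
  let ?g = "\<lambda>k. lt_b D u k * (P ^ q ^ k) $ n"
  have "(lt_log D u oo P) $ n = (\<Sum>i\<in>{0..n}. \<Sum>k\<in>{k \<in> {k \<in> {..K}. q ^ k \<le> n}. q ^ k = i}. ?g k)"
    unfolding fps_compose_nth
  proof (intro sum.cong refl)
    fix i assume i: "i \<in> {0..n}"
    have "{k. k \<le> i \<and> q ^ k = i} = {k \<in> {k \<in> {..K}. q ^ k \<le> n}. q ^ k = i}"
      using i assms(2) less_q_power less_imp_le by fastforce
    then show "lt_log D u $ i * (P ^ i) $ n = (\<Sum>k\<in>{k \<in> {k \<in> {..K}. q ^ k \<le> n}. q ^ k = i}. ?g k)"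
      unfolding lt_log_nth sum_distrib_right by (intro sum.cong) auto
  qed
  also have "\<dots> = (\<Sum>k\<in>{k \<in> {..K}. q ^ k \<le> n}. ?g k)"
    by (intro sum.group) auto
  also have "\<dots> = (\<Sum>k\<le>K. ?g k)"
    using fps_power_nth_0[OF assms(1)] by (intro sum.mono_neutral_left) (auto simp: not_le[symmetric])
  finally show ?thesis .
qed

text \<open>The terms with k >= 2 are split by \<open>lt_b_twist\<close>, and the term k = 1 becomes
  the lowest term of the twisted logarithm.\<close>

lemma log_functional:
  assumes "P $ 0 = 0"
  shows "lt_log D u oo P = P + fps_const (u / \<varpi>) * (lt_log D (u ^ q) oo P ^ q)
     + fps_const (1 / \<varpi>) * (lt_log D (u ^ q ^ 2) oo P ^ q ^ 2)"
proof (rule fps_ext)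
  fix n :: nat
  have P0: "(P ^ q) $ 0 = 0" "(P ^ q ^ 2) $ 0 = 0" using assms q_pos by (simp_all add: fps_power_zeroth)
  define K where "K = n"
  have "(lt_log D u oo P) $ n = (\<Sum>k\<le>Suc (Suc K). lt_b D u k * (P ^ q ^ k) $ n)"
    by (rule log_compose_nth) (use assms in \<open>auto simp: K_def\<close>)
  also have "\<dots> = P $ n + (u / \<varpi>) * (P ^ q) $ n + (\<Sum>k\<le>K. lt_b D u (Suc (Suc k)) * (P ^ q ^ Suc (Suc k)) $ n)"
    by (simp only: sum.atMost_Suc_shift) simp
  also have "(\<Sum>k\<le>K. lt_b D u (Suc (Suc k)) * (P ^ q ^ Suc (Suc k)) $ n)
     = (\<Sum>k\<le>K. (u / \<varpi>) * (lt_b D (u ^ q) (Suc k) * ((P ^ q) ^ q ^ Suc k) $ n)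
         + (1 / \<varpi>) * (lt_b D (u ^ q ^ 2) k * ((P ^ q ^ 2) ^ q ^ k) $ n))"
  proof (intro sum.cong refl)
    fix k
    have "lt_b D u (Suc (Suc k)) = (u * lt_b D (u ^ q) (Suc k) + lt_b D (u ^ q ^ 2) k) / \<varpi>"
      using lt_b_twist[of u k] by (metis nonzero_mult_div_cancel_left uni_nz)
    moreover have "(P ^ q) ^ q ^ Suc k = P ^ q ^ Suc (Suc k)" "(P ^ q ^ 2) ^ q ^ k = P ^ q ^ Suc (Suc k)"
      by (simp_all add: power_mult[symmetric] power2_eq_square ac_simps)
    ultimately show "lt_b D u (Suc (Suc k)) * (P ^ q ^ Suc (Suc k)) $ n =
       (u / \<varpi>) * (lt_b D (u ^ q) (Suc k) * ((P ^ q) ^ q ^ Suc k) $ n)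
         + (1 / \<varpi>) * (lt_b D (u ^ q ^ 2) k * ((P ^ q ^ 2) ^ q ^ k) $ n)"
      by (simp only:) (simp add: add_divide_distrib distrib_right mult.assoc)
  qed
  also have "\<dots> = (u / \<varpi>) * (\<Sum>k\<le>K. lt_b D (u ^ q) (Suc k) * ((P ^ q) ^ q ^ Suc k) $ n)
      + (1 / \<varpi>) * (\<Sum>k\<le>K. lt_b D (u ^ q ^ 2) k * ((P ^ q ^ 2) ^ q ^ k) $ n)"
    by (simp only: sum.distrib sum_distrib_left)
  also have "(\<Sum>k\<le>K. lt_b D (u ^ q ^ 2) k * ((P ^ q ^ 2) ^ q ^ k) $ n) = (lt_log D (u ^ q ^ 2) oo P ^ q ^ 2) $ n"
    by (rule log_compose_nth[symmetric]) (use P0 in \<open>auto simp: K_def\<close>)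
  also have "P $ n + (u / \<varpi>) * (P ^ q) $ n + ((u / \<varpi>) * (\<Sum>k\<le>K. lt_b D (u ^ q) (Suc k) * ((P ^ q) ^ q ^ Suc k) $ n)
       + (1 / \<varpi>) * (lt_log D (u ^ q ^ 2) oo P ^ q ^ 2) $ n)
     = P $ n + (u / \<varpi>) * (\<Sum>k\<le>Suc K. lt_b D (u ^ q) k * ((P ^ q) ^ q ^ k) $ n)
       + (1 / \<varpi>) * (lt_log D (u ^ q ^ 2) oo P ^ q ^ 2) $ n"
    by (simp only: sum.atMost_Suc_shift) (simp add: distrib_left)
  also have "(\<Sum>k\<le>Suc K. lt_b D (u ^ q) k * ((P ^ q) ^ q ^ k) $ n) = (lt_log D (u ^ q) oo P ^ q) $ n"
    by (rule log_compose_nth[symmetric]) (use P0 in \<open>auto simp: K_def\<close>)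
  finally show "(lt_log D u oo P) $ n = (P + fps_const (u / \<varpi>) * (lt_log D (u ^ q) oo P ^ q)
     + fps_const (1 / \<varpi>) * (lt_log D (u ^ q ^ 2) oo P ^ q ^ 2)) $ n" by simp
qed

definition lt_exp :: "'c \<Rightarrow> 'c fps" where "lt_exp u = fps_inv (lt_log D u)"

lemma lt_exp_0 [simp]: "lt_exp u $ 0 = 0"
  by (simp add: lt_exp_def fps_inv_def)

lemma lt_exp_log: "P $ 0 = 0 \<Longrightarrow> lt_exp u oo (lt_log D u oo P) = P"
  by (simp add: lt_exp_def fps_compose_assoc fps_inv)

lemma lt_log_exp: "P $ 0 = 0 \<Longrightarrow> lt_log D u oo (lt_exp u oo P) = P"
  using fps_compose_assoc[of P "lt_exp u" "lt_log D u"] lt_exp_0[of u]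
  by (simp add: lt_exp_def fps_inv_right)

lemma frobs_log_compose:
  assumes "\<And>u. P u $ 0 = 0"
  shows "frobs (\<lambda>u. lt_log D u oo P u) u = lt_log D (u ^ q) oo frobs P u"
  unfolding frobs_def using assms q_pos
  by (subst fps_compose_assoc) (auto simp: fps_X_power_nth)

text \<open>Hazewinkel's functional equation lemma for the Frobenius lift \<open>u \<mapsto> u\<^sup>q\<close>, \<open>T \<mapsto> T\<^sup>q\<close>.\<close>

lemma functional_equation_lemma:
  assumes L0: "\<And>u. L u $ 0 = 0"
    and G: "AD 0 (\<lambda>u. L u - fps_const (u / \<varpi>) * frobs L u - fps_const (1 / \<varpi>) * frobs (frobs L) u)"
  shows "AD 0 (\<lambda>u. lt_exp u oo L u)"
proof -
  define P where "P u = lt_exp u oo L u" for u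
  have P0: "P u $ 0 = 0" for u by (simp add: P_def)
  have LP: "L = (\<lambda>u. lt_log D u oo P u)" using L0 by (simp add: P_def lt_log_exp)
  have f1: "frobs L u = lt_log D (u ^ q) oo frobs P u" for u
    unfolding LP by (rule frobs_log_compose[OF P0])
  have fP0: "frobs P u $ 0 = 0" for u by (simp add: frobs_nth P0)
  have f2: "frobs (frobs L) u = lt_log D (u ^ q ^ 2) oo frobs (frobs P) u" for u
  proof -
    have "frobs (frobs L) u = frobs (\<lambda>v. lt_log D (v ^ q) oo frobs P v) u" unfolding f1 ..
    also have "\<dots> = lt_log D ((u ^ q) ^ q) oo frobs (frobs P) u"
      unfolding frobs_def[of "\<lambda>v. lt_log D (v ^ q) oo frobs P v"] frobs_def[of "frobs P"]
      using fP0 q_pos by (subst fps_compose_assoc) (auto simp: fps_X_power_nth)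
    finally show ?thesis by (simp add: power_q2)
  qed
  have ffP0: "frobs (frobs P) u $ 0 = 0" for u by (simp add: frobs_nth P0)
  have "Au (\<lambda>u. P u $ n)" for n
  proof (induction n rule: less_induct)
    case (less n)
    show ?case
    proof (cases "n = 0")
      case True
      then show ?thesis using Au_const[of 0] by (simp add: P0)
    next
      case False
      \<comment> \<open>Integrality is known only below degree n, so P is truncated. Degree n is
        unaffected: the lifts spread degrees by the factor q, and powers with exponent at least 2
        involve lower coefficients only.\<close>
      define Q where "Q u = fps_cutoff n (P u)" for u
      have Q: "AD 0 Q" unfolding AD_0_iff
      proof
        fix m show "Au (\<lambda>u. Q u $ m)" using less Au_const[of 0] by (cases "m < n") (auto simp: Q_def)
      qed
      have Qn: "Q u $ m = P u $ m" if "m < n" for u m using that by (simp add: Q_def)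
      have Q0: "Q u $ 0 = 0" for u using Qn P0 False by simp
      have QfP: "frobs Q u $ m = frobs P u $ m" if "m \<le> n" for u m
      proof -
        have "m div q < n" using that False q_ge_2 by (metis div_less_dividend le_eq_less_or_eq
              less_le_trans not_gr_zero one_less_numeral_iff semiring_norm(76) div_0 less_trans le_less_trans)
        then show ?thesis by (simp add: frobs_nth Qn)
      qed
      have QffP: "frobs (frobs Q) u $ m = frobs (frobs P) u $ m" if "m \<le> n" for u m
        using that QfP[of "m div q"] by (simp add: frobs_nth[of "frobs Q"] frobs_nth[of "frobs P"] order_trans[OF div_le_dividend])
      have D1: "AD 1 (\<lambda>u. frobs Q u - Q u ^ q)" by (rule AD_frobs_diff[OF Q])
      have Qq: "AD 0 (\<lambda>u. Q u ^ q)" using AD_power[OF Q] by simp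
      have D2: "AD 1 (\<lambda>u. frobs (frobs Q) u - Q u ^ q ^ 2)"
      proof -
        have a: "AD 1 (\<lambda>u. frobs (frobs Q) u - frobs Q u ^ q)" by (rule AD_frobs_diff[OF AD_frobs[OF Q]])
        have b: "AD 1 (\<lambda>u. frobs Q u ^ q - (Q u ^ q) ^ q)"
          using AD_mono[OF AD_power_q_diff[OF AD_frobs[OF Q] Qq D1]] by simp
        show ?thesis using AD_add[OF a b] by (simp add: power_q2)
      qed
      have Qq2: "AD 0 (\<lambda>u. Q u ^ q ^ 2)" using AD_power[OF Q, of "q ^ 2"] by simp
      define E1 where "E1 k u = (frobs Q u ^ q ^ k - (Q u ^ q) ^ q ^ k) $ n" for k u
      define E2 where "E2 k u = (frobs (frobs Q) u ^ q ^ k - (Q u ^ q ^ 2) ^ q ^ k) $ n" for k u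
      \<comment> \<open>Divisibility by \<pi>^(k+1) pays for the denominator \<pi>^k of b_k and for
        the factor 1/\<pi> of the functional equation.\<close>
      have E1: "Au (\<lambda>u. E1 k u / \<varpi> ^ (k + 1))" for k
        using AD_power_qk_diff[OF AD_frobs[OF Q] Qq D1, of k] unfolding AD_def E1_def by blast
      have E2: "Au (\<lambda>u. E2 k u / \<varpi> ^ (k + 1))" for k
        using AD_power_qk_diff[OF AD_frobs[OF AD_frobs[OF Q]] Qq2 D2, of k] unfolding AD_def E2_def by blast
      define Gn where "Gn u = (L u - fps_const (u / \<varpi>) * frobs L u - fps_const (1 / \<varpi>) * frobs (frobs L) u) $ n" for u
      have Gn: "Au Gn" using G unfolding AD_0_iff Gn_def by blast
      have "P u $ n = Gn u + (\<Sum>k\<le>n. u * (\<varpi> ^ k * lt_b D (u ^ q) k) * (E1 k u / \<varpi> ^ (k + 1)))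
          + (\<Sum>k\<le>n. (\<varpi> ^ k * lt_b D (u ^ q ^ 2) k) * (E2 k u / \<varpi> ^ (k + 1)))" for u
      proof -
        have Pq0: "(P u ^ q) $ 0 = 0" "(P u ^ q ^ 2) $ 0 = 0" using P0 q_pos by (simp_all add: fps_power_zeroth)
        have "L u $ n = (P u + fps_const (u / \<varpi>) * (lt_log D (u ^ q) oo P u ^ q)
            + fps_const (1 / \<varpi>) * (lt_log D (u ^ q ^ 2) oo P u ^ q ^ 2)) $ n"
          unfolding LP log_functional[OF P0[of u], of u] ..
        then have "P u $ n = Gn u + (u / \<varpi>) * ((lt_log D (u ^ q) oo frobs P u) $ n - (lt_log D (u ^ q) oo P u ^ q) $ n)
           + (1 / \<varpi>) * ((lt_log D (u ^ q ^ 2) oo frobs (frobs P) u) $ n - (lt_log D (u ^ q ^ 2) oo P u ^ q ^ 2) $ n)"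
          unfolding Gn_def f1 f2 by (simp add: algebra_simps)
        also have "(lt_log D (u ^ q) oo frobs P u) $ n - (lt_log D (u ^ q) oo P u ^ q) $ n
            = (\<Sum>k\<le>n. lt_b D (u ^ q) k * E1 k u)"
        proof -
          have "(frobs P u ^ q ^ k) $ n - ((P u ^ q) ^ q ^ k) $ n = E1 k u" for k
          proof -
            have "(frobs P u ^ q ^ k) $ n = (frobs Q u ^ q ^ k) $ n"
              using QfP by (intro fps_power_nth_cong[of n]) auto
            moreover have "((P u ^ q) ^ q ^ k) $ n = ((Q u ^ q) ^ q ^ k) $ n"
              using Qn P0 Q0 q_ge_2 by (intro fps_power_nth_cong[of n] fps_power_nth_cong_less[of n]) auto
            ultimately show ?thesis by (simp add: E1_def)
          qed
          then show ?thesis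
            unfolding log_compose_nth[OF fP0 order_refl] log_compose_nth[OF Pq0(1) order_refl]
            by (simp only: sum_subtractf[symmetric] right_diff_distrib[symmetric])
        qed
        also have "(lt_log D (u ^ q ^ 2) oo frobs (frobs P) u) $ n - (lt_log D (u ^ q ^ 2) oo P u ^ q ^ 2) $ n
            = (\<Sum>k\<le>n. lt_b D (u ^ q ^ 2) k * E2 k u)"
        proof -
          have "(frobs (frobs P) u ^ q ^ k) $ n - ((P u ^ q ^ 2) ^ q ^ k) $ n = E2 k u" for k
          proof -
            have "(frobs (frobs P) u ^ q ^ k) $ n = (frobs (frobs Q) u ^ q ^ k) $ n"
              using QffP by (intro fps_power_nth_cong[of n]) auto
            moreover have "((P u ^ q ^ 2) ^ q ^ k) $ n = ((Q u ^ q ^ 2) ^ q ^ k) $ n"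
              using Qn P0 Q0 q2_ge_9 by (intro fps_power_nth_cong[of n] fps_power_nth_cong_less[of n]) auto
            ultimately show ?thesis by (simp add: E2_def)
          qed
          then show ?thesis
            unfolding log_compose_nth[OF ffP0 order_refl] log_compose_nth[OF Pq0(2) order_refl]
            by (simp only: sum_subtractf[symmetric] right_diff_distrib[symmetric])
        qed
        finally show ?thesis by (simp add: sum_distrib_left mult.assoc)
      qed
      moreover have "Au (\<lambda>u. Gn u + (\<Sum>k\<le>n. u * (\<varpi> ^ k * lt_b D (u ^ q) k) * (E1 k u / \<varpi> ^ (k + 1)))
          + (\<Sum>k\<le>n. (\<varpi> ^ k * lt_b D (u ^ q ^ 2) k) * (E2 k u / \<varpi> ^ (k + 1))))"
        by (intro Au_add Au_sum Au_mult E1 E2 Gn Au_id Au_comp[OF Au_lt_b Au_power[OF Au_id]])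
      ultimately show ?thesis by simp
    qed
  qed
  then show ?thesis by (simp add: AD_0_iff P_def)
qed

subsection \<open>The coefficients of the formal group law\<close>

definition fg :: "'c \<Rightarrow> 'c fps \<Rightarrow> 'c fps \<Rightarrow> 'c fps" where
  "fg u P Q = lt_exp u oo ((lt_log D u oo P) + (lt_log D u oo Q))"

text \<open>The coefficient of X^i Y^j in the group law, from expanding (f(X) + f(Y))^k; powers with
  k > i + j do not reach this degree.\<close>

definition fgc :: "'c \<Rightarrow> nat \<Rightarrow> nat \<Rightarrow> 'c" where
  "fgc u i j = (\<Sum>k\<le>i + j. lt_exp u $ k * (\<Sum>r\<le>k. of_nat (k choose r)
      * (lt_log D u ^ r) $ i * (lt_log D u ^ (k - r)) $ j))"

lemma fgc_sum:
  assumes "i + j \<le> N"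
  shows "fgc u i j = (\<Sum>k\<le>N. lt_exp u $ k * (\<Sum>r\<le>k. of_nat (k choose r)
      * (lt_log D u ^ r) $ i * (lt_log D u ^ (k - r)) $ j))"
  unfolding fgc_def
proof (rule sum.mono_neutral_left)
  show "\<forall>k\<in>{..N} - {..i + j}. lt_exp u $ k * (\<Sum>r\<le>k. of_nat (k choose r)
      * (lt_log D u ^ r) $ i * (lt_log D u ^ (k - r)) $ j) = 0"
  proof
    fix k assume k: "k \<in> {..N} - {..i + j}"
    have "of_nat (k choose r) * (lt_log D u ^ r) $ i * (lt_log D u ^ (k - r)) $ j = 0" if "r \<le> k" for r
    proof (cases "i < r")
      case True then show ?thesis by (simp add: fps_power_nth_0)
    next
      case False
      then have "j < k - r" using k that by auto
      then show ?thesis by (simp add: fps_power_nth_0)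
    qed
    then have "(\<Sum>r\<le>k. of_nat (k choose r) * (lt_log D u ^ r) $ i * (lt_log D u ^ (k - r)) $ j) = 0"
      by (intro sum.neutral) auto
    then show "lt_exp u $ k * (\<Sum>r\<le>k. of_nat (k choose r)
      * (lt_log D u ^ r) $ i * (lt_log D u ^ (k - r)) $ j) = 0" by simp
  qed
qed (use assms in auto)

lemma fg_nth:
  assumes P: "P $ 0 = 0" and Q: "Q $ 0 = 0"
  shows "fg u P Q $ N = (\<Sum>(i, j)\<in>{(i, j). i + j \<le> N}. fgc u i j * (P ^ i * Q ^ j) $ N)"
proof -
  let ?f = "lt_log D u" and ?S = "{(i, j). i + j \<le> N}"
  define c where "c k i j = (\<Sum>r\<le>k. of_nat (k choose r) * (?f ^ r) $ i * (?f ^ (k - r)) $ j)" for k i j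
  let ?d = "\<lambda>k i j. lt_exp u $ k * c k i j"
  have "fg u P Q $ N = (\<Sum>k\<le>N. lt_exp u $ k * ((?f oo P) + (?f oo Q)) ^ k $ N)"
    by (simp add: fg_def fps_compose_nth atLeast0AtMost)
  also have "\<dots> = (\<Sum>k\<le>N. \<Sum>(i, j)\<in>?S. ?d k i j * (P ^ i * Q ^ j) $ N)"
  proof (intro sum.cong refl)
    fix k
    have "((?f oo P) + (?f oo Q)) ^ k $ N
        = (\<Sum>r\<le>k. of_nat (k choose r) * ((?f ^ r oo P) * (?f ^ (k - r) oo Q)) $ N)"
      unfolding binomial_ring fps_sum_nth
      by (simp add: fps_compose_power[OF P] fps_compose_power[OF Q] mult.assoc flip: fps_of_nat)
    also have "\<dots> = (\<Sum>r\<le>k. \<Sum>(i, j)\<in>?S. of_nat (k choose r) * (?f ^ r) $ i * (?f ^ (k - r)) $ j * (P ^ i * Q ^ j) $ N)"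
      unfolding product_composition_lemma[OF P Q] sum_distrib_left
      by (intro sum.cong) (auto simp: mult.assoc)
    also have "\<dots> = (\<Sum>(i, j)\<in>?S. c k i j * (P ^ i * Q ^ j) $ N)"
      unfolding c_def by (subst sum.swap) (simp add: case_prod_unfold sum_distrib_right)
    finally show "lt_exp u $ k * ((?f oo P) + (?f oo Q)) ^ k $ N = (\<Sum>(i, j)\<in>?S. ?d k i j * (P ^ i * Q ^ j) $ N)"
      by (simp add: sum_distrib_left case_prod_unfold mult.assoc)
  qed
  also have "\<dots> = (\<Sum>(i, j)\<in>?S. (\<Sum>k\<le>N. ?d k i j) * (P ^ i * Q ^ j) $ N)"
    by (subst sum.swap) (simp add: case_prod_unfold sum_distrib_right)
  also have "\<dots> = (\<Sum>(i, j)\<in>?S. fgc u i j * (P ^ i * Q ^ j) $ N)"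
    by (intro sum.cong refl) (auto simp: fgc_sum c_def)
  finally show ?thesis .
qed

lemma functional_log_X:
  assumes "0 < a"
  shows "lt_log D u oo fps_X ^ a = fps_X ^ a + fps_const (u / \<varpi>) * frobs (\<lambda>u. lt_log D u oo fps_X ^ a) u
    + fps_const (1 / \<varpi>) * frobs (frobs (\<lambda>u. lt_log D u oo fps_X ^ a)) u"
proof -
  have X0: "(fps_X ^ a) $ 0 = (0::'c)" using assms by simp
  have comp: "(lt_log D v oo fps_X ^ b) oo fps_X ^ q = lt_log D v oo (fps_X ^ b) ^ q" if "0 < b" for v b
  proof -
    have "fps_X ^ b oo fps_X ^ q = ((fps_X ^ b) ^ q :: 'c fps)"
      using q_pos by (simp add: fps_compose_power[symmetric] power_mult[symmetric] mult.commute)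
    then show ?thesis using that q_pos by (subst fps_compose_assoc[symmetric]) auto
  qed
  have 1: "frobs (\<lambda>u. lt_log D u oo fps_X ^ a) v = lt_log D (v ^ q) oo (fps_X ^ a) ^ q" for v
    unfolding frobs_def by (rule comp[OF assms])
  have "frobs (frobs (\<lambda>u. lt_log D u oo fps_X ^ a)) u = (lt_log D ((u ^ q) ^ q) oo fps_X ^ (a * q)) oo fps_X ^ q"
    unfolding frobs_def[of "frobs _"] 1 by (simp add: power_mult)
  also have "\<dots> = lt_log D ((u ^ q) ^ q) oo (fps_X ^ (a * q)) ^ q"
    using assms q_pos by (intro comp) simp
  finally have 2: "frobs (frobs (\<lambda>u. lt_log D u oo fps_X ^ a)) u = lt_log D (u ^ q ^ 2) oo (fps_X ^ a) ^ q ^ 2"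
    by (simp add: power_q2 power_mult)
  show ?thesis unfolding 1 2 by (rule log_functional[OF X0])
qed

lemma frobs_add: "frobs (\<lambda>u. P u + Q u) u = frobs P u + frobs Q u"
  by (simp add: frobs_def fps_compose_add_distrib)

lemma frobs_scale: "frobs (\<lambda>u. fps_const c * P u) u = fps_const c * frobs P u"
  unfolding frobs_def using q_pos by (subst fps_compose_mult_distrib) auto

lemma AD_X_power: "AD 0 (\<lambda>u. fps_X ^ a)"
  by (auto simp: AD_0_iff intro: Au_const)

text \<open>Each summand obeys the functional equation of the logarithm, so the combination required
  to be integral by the functional equation lemma is just X^a + X^b.\<close>

lemma fg_X_integral:
  assumes "0 < a" "0 < b"
  shows "AD 0 (\<lambda>u. fg u (fps_X ^ a) (fps_X ^ b))"
  unfolding fg_def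
proof (rule functional_equation_lemma)
  let ?L = "\<lambda>a u. lt_log D u oo fps_X ^ a"
  have e: "(?L a u + ?L b u) - fps_const (u / \<varpi>) * frobs (\<lambda>u. ?L a u + ?L b u) u
      - fps_const (1 / \<varpi>) * frobs (frobs (\<lambda>u. ?L a u + ?L b u)) u = fps_X ^ a + fps_X ^ b" for u
  proof -
    have "frobs (frobs (\<lambda>u. ?L a u + ?L b u)) u = frobs (frobs (?L a)) u + frobs (frobs (?L b)) u"
      using frobs_add[of "frobs (?L a)" "frobs (?L b)" u] unfolding frobs_add[of "?L a" "?L b"] by simp
    then show ?thesis
      using functional_log_X[OF assms(1), of u] functional_log_X[OF assms(2), of u]
      by (simp add: frobs_add algebra_simps)
  qed
  show "AD 0 (\<lambda>u. ?L a u + ?L b u - fps_const (u / \<varpi>) * frobs (\<lambda>u. ?L a u + ?L b u) u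
      - fps_const (1 / \<varpi>) * frobs (frobs (\<lambda>u. ?L a u + ?L b u)) u)"
    unfolding e by (intro AD_add AD_X_power)
qed simp

definition ms :: "'c \<Rightarrow> 'c \<Rightarrow> 'c fps" where
  "ms u a = lt_exp u oo (fps_const a * lt_log D u)"

lemma ms_integral:
  assumes a: "a \<in> OF D" shows "AD 0 (\<lambda>u. ms u a)"
  unfolding ms_def
proof (rule functional_equation_lemma)
  let ?L = "\<lambda>u. fps_const a * lt_log D u"
  have e: "?L u - fps_const (u / \<varpi>) * frobs ?L u - fps_const (1 / \<varpi>) * frobs (frobs ?L) u = fps_const a * fps_X" for u
  proof -
    have "frobs (frobs ?L) u = fps_const a * frobs (frobs (lt_log D)) u"
      using frobs_scale[of a "frobs (lt_log D)" u] unfolding frobs_scale[of a "lt_log D"] by simp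
    then have "?L u - fps_const (u / \<varpi>) * frobs ?L u - fps_const (1 / \<varpi>) * frobs (frobs ?L) u
      = fps_const a * (lt_log D u - fps_const (u / \<varpi>) * frobs (lt_log D) u - fps_const (1 / \<varpi>) * frobs (frobs (lt_log D)) u)"
      by (simp add: frobs_scale algebra_simps)
    then show ?thesis using functional_log_X[of 1 u] by (simp add: algebra_simps)
  qed
  have "AD 0 (\<lambda>u. fps_const a)" using a by (intro AD_const) (auto intro: Au_const)
  then have "AD (0 + 0) (\<lambda>u. fps_const a * fps_X ^ 1)" by (intro AD_mult AD_X_power)
  then show "AD 0 (\<lambda>u. ?L u - fps_const (u / \<varpi>) * frobs ?L u - fps_const (1 / \<varpi>) * frobs (frobs ?L) u)"
    unfolding e by simp
qed simp

text \<open>Kronecker substitution: with \<open>B = i + j + 1\<close>, the exponent \<open>i B + j (B + 1)\<close> determines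
  \<open>i\<close> and \<open>j\<close>, so the coefficient of \<open>X\<^sup>i Y\<^sup>j\<close> is one of the coefficients of the group law
  evaluated at \<open>T\<^sup>B\<close> and \<open>T\<^bsup>B+1\<^esup>\<close>.\<close>

lemma fgc_integral: "Au (\<lambda>u. fgc u i j)"
proof -
  define B where "B = i + j + 1"
  define N where "N = i * B + j * (B + 1)"
  have "fg u (fps_X ^ B) (fps_X ^ (B + 1)) $ N = fgc u i j" for u
  proof -
    have uniq: "i' = i \<and> j' = j" if "i' * B + j' * (B + 1) = N" for i' j'
    proof -
      have e: "(i' + j') * B + j' = (i + j) * B + j" using that by (simp add: N_def algebra_simps)
      have "i' + j' = i + j"
      proof (rule linorder_cases[of "i' + j'" "i + j"])
        assume "i' + j' < i + j"
        then obtain e' where e': "i + j = i' + j' + Suc e'" by (metis add_Suc_right less_iff_Suc_add)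
        then have "j' = Suc e' * B + j" using e by (simp add: algebra_simps)
        then have "j' \<ge> B" by simp
        then show ?thesis using e' B_def by simp
      next
        assume "i + j < i' + j'"
        then obtain e' where e': "i' + j' = i + j + Suc e'" by (metis add_Suc_right less_iff_Suc_add)
        then have "j = Suc e' * B + j'" using e by (simp add: algebra_simps)
        then have "j \<ge> B" by simp
        then show ?thesis using B_def by simp
      qed
      then show ?thesis using e by auto
    qed
    have "i * 1 + j * 1 \<le> i * B + j * (B + 1)" by (intro add_mono mult_le_mono2) (auto simp: B_def)
    then have ij: "(i, j) \<in> {(i, j). i + j \<le> N}" by (simp add: N_def)
    have fin: "finite {(i, j). i + j \<le> N}"
      by (rule finite_subset[of _ "{..N} \<times> {..N}"]) auto
    have "fg u (fps_X ^ B) (fps_X ^ (B + 1)) $ N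
        = (\<Sum>p\<in>{(i, j). i + j \<le> N}. fgc u (fst p) (snd p) * ((fps_X ^ B) ^ fst p * (fps_X ^ (B + 1)) ^ snd p) $ N)"
      by (subst fg_nth) (auto simp: B_def case_prod_unfold)
    also have "\<dots> = (\<Sum>p\<in>{(i, j). i + j \<le> N}. if p = (i, j) then fgc u i j else 0)"
    proof (intro sum.cong refl)
      fix p :: "nat \<times> nat"
      have "(fps_X ^ B) ^ fst p * (fps_X ^ (B + 1)) ^ snd p = (fps_X ^ (fst p * B + snd p * (B + 1)) :: 'c fps)"
        by (simp only: power_mult[symmetric] power_add[symmetric] mult.commute)
      moreover have "(N = fst p * B + snd p * (B + 1)) = (p = (i, j))"
        using uniq[of "fst p" "snd p"] by (auto simp: N_def prod_eq_iff)
      ultimately show "fgc u (fst p) (snd p) * ((fps_X ^ B) ^ fst p * (fps_X ^ (B + 1)) ^ snd p) $ N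
          = (if p = (i, j) then fgc u i j else 0)"
        by (cases "p = (i, j)")
          (simp_all only: fps_X_power_nth if_True if_False mult_1_right mult_zero_right fst_conv snd_conv simp_thms)
    qed
    also have "\<dots> = fgc u i j" using ij fin by (simp add: sum.delta)
    finally show ?thesis .
  qed
  moreover have "Au (\<lambda>u. fg u (fps_X ^ B) (fps_X ^ (B + 1)) $ N)"
    using fg_X_integral[of B "B + 1"] by (auto simp: AD_0_iff B_def)
  ultimately show ?thesis by simp
qed

subsection \<open>Values of power series\<close>

text \<open>\<open>V\<close> is the value of \<open>h\<close> at 1. Points are treated as values at 1 of series without constant
  term, so that composing series never requires substituting numbers into them.\<close>

definition evl :: "real \<Rightarrow> 'c fps \<Rightarrow> 'c \<Rightarrow> bool" where
  "evl \<rho> h V \<longleftrightarrow> 0 \<le> \<rho> \<and> \<rho> < 1 \<and> (\<forall>n. nm (h $ n) \<le> \<rho> ^ n) \<and> (\<forall>N. nm (V - (\<Sum>n<N. h $ n)) \<le> \<rho> ^ N)"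

lemma evl_le_1: "evl \<rho> h V \<Longrightarrow> nm V \<le> 1"
  by (auto simp: evl_def dest: spec[of _ 0])

lemma evl_le: "evl \<rho> h V \<Longrightarrow> h $ 0 = 0 \<Longrightarrow> nm V \<le> \<rho>"
  by (auto simp: evl_def dest!: spec[of _ 1])

lemma evl_mono: "evl \<rho> h V \<Longrightarrow> \<rho> \<le> \<sigma> \<Longrightarrow> \<sigma> < 1 \<Longrightarrow> evl \<sigma> h V"
  unfolding evl_def by (meson order_trans power_mono)

lemma evl_unique:
  assumes "evl \<rho> h V" "evl \<sigma> h W" shows "V = W"
proof (rule ccontr)
  define t where "t = max \<rho> \<sigma>"
  have t: "0 \<le> t" "t < 1" using assms by (auto simp: t_def evl_def)
  have V: "evl t h V" "evl t h W"
    using evl_mono[OF assms(1), of t] evl_mono[OF assms(2), of t] t(2) by (auto simp: t_def)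
  assume "V \<noteq> W"
  then have "0 < nm (V - W)" by simp
  then obtain N where "t ^ N < nm (V - W)" using real_arch_pow_inv[OF _ t(2)] by blast
  moreover have "nm ((V - (\<Sum>n<N. h $ n)) - (W - (\<Sum>n<N. h $ n))) \<le> t ^ N"
    by (rule nm_diff_leI) (use V in \<open>auto simp: evl_def\<close>)
  ultimately show False by simp
qed

text \<open>Completeness of C enters here: ultrametric geometric bounds make the partial sums a
  Cauchy sequence, and the bounds on the tails pass to the limit.\<close>

lemma evl_suminf:
  assumes "0 \<le> \<rho>" "\<rho> < 1" "\<And>n. nm (h $ n) \<le> \<rho> ^ n"
  shows "evl \<rho> h (\<Sum>n. h $ n)"
proof -
  define S where "S N = (\<Sum>n<N. h $ n)" for N
  have far: "nm (S (N + k) - S N) \<le> \<rho> ^ N" for N k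
  proof -
    have "S (N + k) - S N = (\<Sum>n\<in>{N..<N + k}. h $ n)"
      using sum_diff_nat_ivl[of 0 N "N + k" "\<lambda>n. h $ n"] by (simp add: S_def lessThan_atLeast0)
    also have "nm \<dots> \<le> \<rho> ^ N"
    proof (rule nm_sum_le)
      fix n assume "n \<in> {N..<N + k}"
      then have "\<rho> ^ n \<le> \<rho> ^ N" using assms by (intro power_decreasing) auto
      then show "nm (h $ n) \<le> \<rho> ^ N" using assms(3)[of n] by linarith
    qed (use assms in auto)
    finally show ?thesis .
  qed
  have lim0: "(\<lambda>n. \<rho> ^ n) \<longlonglongrightarrow> 0" using assms by (intro LIMSEQ_power_zero) auto
  have "Cauchy S"
  proof (rule metric_CauchyI)
    fix e :: real assume "0 < e"
    then obtain M where M: "\<rho> ^ M < e" using real_arch_pow_inv[OF _ assms(2)] by blast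
    have "nm (S a - S b) < e" if "a \<ge> M" "b \<ge> M" for a b
    proof -
      have *: "nm (S a' - S M) < e" if "a' \<ge> M" for a'
        using far[of M "a' - M"] M that by simp
      have "nm ((S a - S M) - (S b - S M)) < e"
        by (rule nm_diff_lessI) (use that * in auto)
      then show ?thesis by simp
    qed
    then show "\<exists>M. \<forall>m\<ge>M. \<forall>n\<ge>M. dist (S m) (S n) < e" by (auto simp: dist_eq_nm)
  qed
  then obtain V where V: "S \<longlonglongrightarrow> V" using Cauchy_convergent_iff convergent_def by blast
  then have "(\<lambda>n. h $ n) sums V" by (simp add: sums_def S_def[abs_def])
  then have s: "(\<Sum>n. h $ n) = V" by (simp add: sums_iff)
  have "nm (V - S N) \<le> \<rho> ^ N" for N
  proof (rule ccontr)
    assume "\<not> nm (V - S N) \<le> \<rho> ^ N"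
    then have pos: "0 < nm (V - S N)" using assms zero_le_power[of \<rho> N] by linarith
    then obtain M where M: "\<And>m. m \<ge> M \<Longrightarrow> dist (S m) V < nm (V - S N)"
      using V unfolding lim_sequentially by metis
    define m where "m = N + M"
    have "nm (S m - V) < nm (V - S N)" using M[of m] by (simp add: m_def dist_eq_nm)
    moreover have "nm (S m - S N) < nm (V - S N)"
      using far[of N M] \<open>\<not> nm (V - S N) \<le> \<rho> ^ N\<close> by (simp add: m_def)
    ultimately have "nm ((S m - S N) - (S m - V)) < nm (V - S N)" by (rule nm_diff_lessI[rotated])
    then show False by simp
  qed
  then show ?thesis using assms by (simp add: evl_def s S_def)
qed

lemma sum_triangle_diff:
  fixes a b :: "nat \<Rightarrow> 'a::comm_ring_1"
  shows "(\<Sum>i<N. a i) * (\<Sum>j<N. b j) - (\<Sum>n<N. \<Sum>i\<le>n. a i * b (n - i))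
    = (\<Sum>(i, j)\<in>{(i, j). i < N \<and> j < N \<and> N \<le> i + j}. a i * b j)"
proof -
  have "(\<Sum>n<N. \<Sum>i\<le>n. a i * b (n - i)) = (\<Sum>(n, i)\<in>(SIGMA n:{..<N}. {..n}). a i * b (n - i))"
    by (rule sum.Sigma) auto
  also have "\<dots> = (\<Sum>(i, j)\<in>{(i, j). i + j < N}. a i * b j)"
    by (rule sum.reindex_bij_witness[of _ "\<lambda>(i, j). (i + j, i)" "\<lambda>(n, i). (i, n - i)"]) auto
  finally have 1: "(\<Sum>n<N. \<Sum>i\<le>n. a i * b (n - i)) = (\<Sum>(i, j)\<in>{(i, j). i + j < N}. a i * b j)" .
  have 2: "(\<Sum>i<N. a i) * (\<Sum>j<N. b j) = (\<Sum>(i, j)\<in>{..<N} \<times> {..<N}. a i * b j)"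
    by (simp add: sum_product sum.cartesian_product)
  have "{(i, j). i < N \<and> j < N \<and> N \<le> i + j} = {..<N} \<times> {..<N} - {(i, j). i + j < N}" by auto
  moreover have "{(i, j). i + j < N} \<subseteq> {..<N} \<times> {..<N}" by auto
  ultimately show ?thesis unfolding 1 2 by (simp add: sum_diff)
qed

text \<open>The terms with i + j >= N, which the truncated Cauchy product lacks, are each at most
  \<rho>^N.\<close>

lemma evl_mult:
  assumes "evl \<rho> h V" "evl \<rho> k W" shows "evl \<rho> (h * k) (V * W)"
proof -
  have r: "0 \<le> \<rho>" "\<rho> < 1" using assms by (auto simp: evl_def)
  have h: "nm (h $ n) \<le> \<rho> ^ n" "nm (k $ n) \<le> \<rho> ^ n" for n using assms by (auto simp: evl_def)
  have prod: "nm (h $ i * k $ j) \<le> \<rho> ^ (i + j)" for i j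
    using nm_mult_le[OF h(1)[of i] h(2)[of j]] by (simp add: power_add)
  have "nm ((h * k) $ n) \<le> \<rho> ^ n" for n
    unfolding fps_mult_nth
  proof (rule nm_sum_le)
    fix i assume "i \<in> {0..n}"
    then show "nm (h $ i * k $ (n - i)) \<le> \<rho> ^ n" using prod[of i "n - i"] by simp
  qed (use r in auto)
  moreover have "nm (V * W - (\<Sum>n<N. (h * k) $ n)) \<le> \<rho> ^ N" for N
  proof -
    define SV where "SV = (\<Sum>n<N. h $ n)"
    define SW where "SW = (\<Sum>n<N. k $ n)"
    have V: "nm (V - SV) \<le> \<rho> ^ N" "nm (W - SW) \<le> \<rho> ^ N" using assms by (auto simp: evl_def SV_def SW_def)
    have SV: "nm SV \<le> 1" unfolding SV_def
    proof (rule nm_sum_le)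
      fix n show "nm (h $ n) \<le> 1" using h(1)[of n] r power_le_one[of \<rho> n] by linarith
    qed simp
    have W: "nm W \<le> 1" using evl_le_1 assms by blast
    have d: "nm (SV * SW - (\<Sum>n<N. (h * k) $ n)) \<le> \<rho> ^ N"
      unfolding SV_def SW_def fps_mult_nth atLeast0AtMost sum_triangle_diff
    proof (rule nm_sum_le)
      fix p assume "p \<in> {(i, j). i < N \<and> j < N \<and> N \<le> i + j}"
      then have "N \<le> fst p + snd p" by auto
      then have "\<rho> ^ (fst p + snd p) \<le> \<rho> ^ N" using r by (intro power_decreasing) auto
      then show "nm (case p of (i, j) \<Rightarrow> h $ i * k $ j) \<le> \<rho> ^ N"
        using prod[of "fst p" "snd p"] by (auto simp: case_prod_unfold)
    qed (use r in auto)
    have "V * W - (\<Sum>n<N. (h * k) $ n) = (V - SV) * W + SV * (W - SW) + (SV * SW - (\<Sum>n<N. (h * k) $ n))"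
      by (simp add: algebra_simps)
    also have "nm \<dots> \<le> \<rho> ^ N"
      by (intro nm_add_leI d nm_mult_le_left[OF V(1) W] nm_mult_le_right[OF SV V(2)])
    finally show ?thesis .
  qed
  ultimately show ?thesis using r by (simp add: evl_def)
qed

lemma evl_1: "0 \<le> \<rho> \<Longrightarrow> \<rho> < 1 \<Longrightarrow> evl \<rho> 1 1"
proof -
  assume r: "0 \<le> \<rho>" "\<rho> < 1"
  have "(\<Sum>n<N. (1 :: 'c fps) $ n) = (if N = 0 then 0 else 1)" for N
    by (induction N) auto
  then show ?thesis using r by (auto simp: evl_def)
qed

lemma evl_power: "evl \<rho> h V \<Longrightarrow> evl \<rho> (h ^ n) (V ^ n)"
proof (induction n)
  case 0 then show ?case using evl_1 by (auto simp: evl_def)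
qed (auto intro: evl_mult)

lemma evl_linear:
  assumes "nm X \<le> \<rho>" "\<rho> < 1" shows "evl \<rho> (fps_const X * fps_X) X"
proof -
  have r: "0 \<le> \<rho>" using assms nm_ge_0[of X] by linarith
  have n: "(fps_const X * fps_X) $ n = (if n = 1 then X else 0)" for n by (simp add: fps_X_def)
  have "(\<Sum>n<N. (fps_const X * fps_X) $ n) = (if N \<le> 1 then 0 else X)" for N
    unfolding n by (cases "1 < N") (auto simp: sum.delta)
  moreover have "nm X \<le> \<rho> ^ N" if "N \<le> 1" for N
    using that assms r by (cases "N = 0") (auto simp: le_Suc_eq)
  ultimately show ?thesis using assms r n by (auto simp: evl_def)
qed

text \<open>P^i starts in degree i, so truncating at N leaves only the powers with i < N, and each
  of these has value V^i up to \<rho>^N.\<close>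

lemma evl_compose:
  assumes M: "\<And>n. nm (M $ n) \<le> 1" and P: "evl \<rho> P V" "P $ 0 = 0"
  shows "evl \<rho> (M oo P) (\<Sum>n. M $ n * V ^ n)"
proof -
  have r: "0 \<le> \<rho>" "\<rho> < 1" using P by (auto simp: evl_def)
  have V: "nm V \<le> \<rho>" using evl_le P by blast
  have Pi: "evl \<rho> (P ^ i) (V ^ i)" for i by (rule evl_power[OF P(1)])
  have "evl \<rho> (Abs_fps (\<lambda>n. M $ n * V ^ n)) (\<Sum>n. Abs_fps (\<lambda>n. M $ n * V ^ n) $ n)"
  proof (rule evl_suminf[OF r])
    fix n
    show "nm (Abs_fps (\<lambda>n. M $ n * V ^ n) $ n) \<le> \<rho> ^ n"
      using power_mono[OF V, of n] M by (auto intro!: nm_mult_le_right simp: nm_power)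
  qed
  then have W: "nm ((\<Sum>n. M $ n * V ^ n) - (\<Sum>n<N. M $ n * V ^ n)) \<le> \<rho> ^ N" for N
    by (simp add: evl_def)
  have "nm ((M oo P) $ n) \<le> \<rho> ^ n" for n
    unfolding fps_compose_nth using Pi M r by (intro nm_sum_le nm_mult_le_right) (auto simp: evl_def)
  moreover have "nm ((\<Sum>n. M $ n * V ^ n) - (\<Sum>n<N. (M oo P) $ n)) \<le> \<rho> ^ N" for N
  proof -
    have "(\<Sum>n<N. (M oo P) $ n) = (\<Sum>n<N. \<Sum>i<N. M $ i * (P ^ i) $ n)"
      unfolding fps_compose_nth
      by (intro sum.cong sum.mono_neutral_left ballI) (auto simp: fps_power_nth_0[OF P(2)] not_le)
    also have "\<dots> = (\<Sum>i<N. M $ i * (\<Sum>n<N. (P ^ i) $ n))"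
      by (subst sum.swap) (simp add: sum_distrib_left)
    finally have "(\<Sum>n. M $ n * V ^ n) - (\<Sum>n<N. (M oo P) $ n)
      = ((\<Sum>n. M $ n * V ^ n) - (\<Sum>n<N. M $ n * V ^ n)) + (\<Sum>i<N. M $ i * (V ^ i - (\<Sum>n<N. (P ^ i) $ n)))"
      by (simp add: sum_subtractf right_diff_distrib)
    also have "nm \<dots> \<le> \<rho> ^ N"
      using Pi M r by (intro nm_add_leI W nm_sum_le nm_mult_le_right) (auto simp: evl_def)
    finally show ?thesis .
  qed
  ultimately show ?thesis using r by (simp add: evl_def)
qed

lemma finite_pairs: "finite {(i, j). i + j \<le> (n::nat)}" "finite {(i, j). i + j < (n::nat)}"
  by (rule finite_subset[of _ "{..n} \<times> {..n}"]; auto)+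

lemma fgc_nm: "nm u \<le> 1 \<Longrightarrow> nm (fgc u i j) \<le> 1"
  using Au_bound[OF fgc_integral] .

lemma fg_partial_sum:
  assumes "P $ 0 = 0" "Q $ 0 = 0"
  shows "(\<Sum>n<N. fg u P Q $ n) = (\<Sum>(i, j)\<in>{(i, j). i + j < N}. fgc u i j * (\<Sum>n<N. (P ^ i * Q ^ j) $ n))"
proof -
  have z: "(P ^ i * Q ^ j) $ n = 0" if "n < i + j" for i j n
    unfolding fps_mult_nth
  proof (rule sum.neutral, rule ballI)
    fix k assume "k \<in> {0..n}"
    then have "k < i \<or> n - k < j" using that by auto
    then show "(P ^ i) $ k * (Q ^ j) $ (n - k) = 0" using assms by (auto simp: fps_power_nth_0)
  qed
  have "(\<Sum>n<N. fg u P Q $ n) = (\<Sum>n<N. \<Sum>(i, j)\<in>{(i, j). i + j < N}. fgc u i j * (P ^ i * Q ^ j) $ n)"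
    unfolding fg_nth[OF assms]
  proof (rule sum.cong[OF refl])
    fix n assume "n \<in> {..<N}"
    then show "(\<Sum>(i, j)\<in>{(i, j). i + j \<le> n}. fgc u i j * (P ^ i * Q ^ j) $ n)
        = (\<Sum>(i, j)\<in>{(i, j). i + j < N}. fgc u i j * (P ^ i * Q ^ j) $ n)"
      using z[of n] by (intro sum.mono_neutral_left finite_pairs) (auto, metis not_le)
  qed
  also have "\<dots> = (\<Sum>(i, j)\<in>{(i, j). i + j < N}. fgc u i j * (\<Sum>n<N. (P ^ i * Q ^ j) $ n))"
    by (subst sum.swap) (simp add: sum_distrib_left case_prod_unfold)
  finally show ?thesis .
qed

text \<open>The value depends on V and W alone: the partial sums for P, Q and for the linear series
  with coefficients V, W both lie within \<rho>^N of the truncated double sum of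
  \<open>fgc u i j * (V ^ i * W ^ j)\<close>.\<close>

lemma evl_fg:
  assumes u: "nm u \<le> 1" and P: "evl \<rho> P V" "P $ 0 = 0" and Q: "evl \<rho> Q W" "Q $ 0 = 0"
  shows "evl \<rho> (fg u P Q) (\<Sum>n. fg u (fps_const V * fps_X) (fps_const W * fps_X) $ n)"
proof -
  have r: "0 \<le> \<rho>" "\<rho> < 1" using P by (auto simp: evl_def)
  have pq: "evl \<rho> (P ^ i * Q ^ j) (V ^ i * W ^ j)" if "evl \<rho> P V" "evl \<rho> Q W" for i j P Q
    using that by (intro evl_mult evl_power)
  have b: "nm (fg u P Q $ n) \<le> \<rho> ^ n" if "evl \<rho> P V" "evl \<rho> Q W" "P $ 0 = 0" "Q $ 0 = 0" for n P Q
    unfolding fg_nth[OF that(3,4)]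
    using pq[OF that(1,2)] r fgc_nm[OF u] by (intro nm_sum_le) (auto simp: evl_def intro!: nm_mult_le_right)
  have VW: "evl \<rho> (fps_const V * fps_X) V" "evl \<rho> (fps_const W * fps_X) W"
    using evl_le P Q r by (auto intro!: evl_linear)
  let ?Z = "\<Sum>n. fg u (fps_const V * fps_X) (fps_const W * fps_X) $ n"
  have Z: "evl \<rho> (fg u (fps_const V * fps_X) (fps_const W * fps_X)) ?Z"
    by (rule evl_suminf[OF r b[OF VW]]) auto
  have "nm (?Z - (\<Sum>n<N. fg u P Q $ n)) \<le> \<rho> ^ N" for N
  proof -
    have d: "nm ((\<Sum>n<N. fg u P Q $ n) - (\<Sum>(i, j)\<in>{(i, j). i + j < N}. fgc u i j * (V ^ i * W ^ j))) \<le> \<rho> ^ N"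
      if "evl \<rho> P V" "evl \<rho> Q W" "P $ 0 = 0" "Q $ 0 = 0" for P Q
    proof -
      have "(\<Sum>n<N. fg u P Q $ n) - (\<Sum>(i, j)\<in>{(i, j). i + j < N}. fgc u i j * (V ^ i * W ^ j))
        = (\<Sum>(i, j)\<in>{(i, j). i + j < N}. fgc u i j * ((\<Sum>n<N. (P ^ i * Q ^ j) $ n) - V ^ i * W ^ j))"
        unfolding fg_partial_sum[OF that(3,4)]
        by (simp add: sum_subtractf[symmetric] right_diff_distrib case_prod_unfold)
      also have "nm \<dots> \<le> \<rho> ^ N"
        using pq[OF that(1,2)] r fgc_nm[OF u]
        by (intro nm_sum_le) (auto simp: evl_def nm_diff_commute intro!: nm_mult_le_right)
      finally show ?thesis .
    qed
    let ?S = "\<Sum>(i, j)\<in>{(i, j). i + j < N}. fgc u i j * (V ^ i * W ^ j)"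
    let ?H = "\<Sum>n<N. fg u (fps_const V * fps_X) (fps_const W * fps_X) $ n"
    have "nm ((?Z - ?H) + ((?H - ?S) - ((\<Sum>n<N. fg u P Q $ n) - ?S))) \<le> \<rho> ^ N"
    proof (rule nm_add_leI)
      show "nm (?Z - ?H) \<le> \<rho> ^ N" using Z by (simp add: evl_def)
      show "nm ((?H - ?S) - ((\<Sum>n<N. fg u P Q $ n) - ?S)) \<le> \<rho> ^ N"
        by (rule nm_diff_leI[OF d[OF VW] d[OF P(1) Q(1) P(2) Q(2)]]) simp_all
    qed
    then show ?thesis by simp
  qed
  then show ?thesis using r b[OF P(1) Q(1) P(2) Q(2)] by (simp add: evl_def)
qed

subsection \<open>The module structure on points\<close>

definition Ladd :: "'c \<Rightarrow> 'c \<Rightarrow> 'c \<Rightarrow> 'c" where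
  "Ladd u X Y = (\<Sum>n. fg u (fps_const X * fps_X) (fps_const Y * fps_X) $ n)"

definition Lmul :: "'c \<Rightarrow> 'c \<Rightarrow> 'c \<Rightarrow> 'c" where
  "Lmul u a X = (\<Sum>n. ms u a $ n * X ^ n)"

lemma lt_add_Ladd: "CHAR('c) = 0 \<Longrightarrow> lt_add D u X Y = Ladd u X Y"
  and lt_mult_Lmul: "CHAR('c) = 0 \<Longrightarrow> lt_mult D u a X = Lmul u a X"
  by (simp_all add: lt_add_def lt_mult_def Ladd_def Lmul_def fg_def ms_def lt_exp_def)

text \<open>The point \<open>V\<close> is the value at 1 of a formal curve whose logarithm is \<open>L\<close>. The logarithm itself is not injective on points, but formal logarithms add, so all module laws
  follow from those for \<open>L\<close>.\<close>

definition rp :: "'c \<Rightarrow> 'c fps \<Rightarrow> 'c \<Rightarrow> bool" where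
  "rp u L V \<longleftrightarrow> L $ 0 = 0 \<and> (\<exists>\<rho>. evl \<rho> (lt_exp u oo L) V)"

lemma rp_unique: "rp u L V \<Longrightarrow> rp u L W \<Longrightarrow> V = W"
  unfolding rp_def using evl_unique by blast

lemma rp_nm: "rp u L V \<Longrightarrow> nm V < 1"
proof -
  assume "rp u L V"
  then obtain \<rho> where r: "evl \<rho> (lt_exp u oo L) V" by (auto simp: rp_def)
  then have "nm V \<le> \<rho>" by (rule evl_le) simp
  then show ?thesis using r by (simp add: evl_def)
qed

lemma rp_point: "nm X < 1 \<Longrightarrow> rp u (lt_log D u oo (fps_const X * fps_X)) X"
  unfolding rp_def using evl_linear[of X "nm X"] by (auto simp: lt_exp_log)

lemma rp_0: "rp u 0 0"
  using rp_point[of 0 u] by simp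

lemma rp_add:
  assumes u: "nm u \<le> 1" and 1: "rp u L V" and 2: "rp u M W"
  shows "rp u (L + M) (Ladd u V W)"
proof -
  obtain \<rho> \<sigma> where e: "evl \<rho> (lt_exp u oo L) V" "evl \<sigma> (lt_exp u oo M) W"
    using 1 2 by (auto simp: rp_def)
  have L0: "L $ 0 = 0" "M $ 0 = 0" using 1 2 by (auto simp: rp_def)
  define t where "t = max \<rho> \<sigma>"
  have t: "t < 1" using e by (auto simp: t_def evl_def)
  have e': "evl t (lt_exp u oo L) V" "evl t (lt_exp u oo M) W"
    using evl_mono[OF e(1), of t] evl_mono[OF e(2), of t] t by (auto simp: t_def)
  have "evl t (fg u (lt_exp u oo L) (lt_exp u oo M)) (Ladd u V W)"
    unfolding Ladd_def using u e' by (intro evl_fg) auto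
  moreover have "fg u (lt_exp u oo L) (lt_exp u oo M) = lt_exp u oo (L + M)"
    using L0 by (simp add: fg_def lt_log_exp)
  ultimately show ?thesis using L0 by (auto simp: rp_def)
qed

lemma ms_nm: "nm u \<le> 1 \<Longrightarrow> a \<in> OF D \<Longrightarrow> nm (ms u a $ n) \<le> 1"
  using ms_integral[of a] Au_bound unfolding AD_0_iff by blast

lemma ms_compose:
  assumes "L $ 0 = 0" shows "ms u a oo (lt_exp u oo L) = lt_exp u oo (fps_const a * L)"
proof -
  have "ms u a oo (lt_exp u oo L) = lt_exp u oo ((fps_const a * lt_log D u) oo (lt_exp u oo L))"
    unfolding ms_def by (subst fps_compose_assoc) auto
  also have "(fps_const a * lt_log D u) oo (lt_exp u oo L) = fps_const a * L"
    using assms by (subst fps_compose_mult_distrib) (auto simp: lt_log_exp)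
  finally show ?thesis .
qed

lemma rp_mul:
  assumes u: "nm u \<le> 1" and a: "a \<in> OF D" and 1: "rp u L V"
  shows "rp u (fps_const a * L) (Lmul u a V)"
proof -
  obtain \<rho> where e: "evl \<rho> (lt_exp u oo L) V" and L0: "L $ 0 = 0" using 1 by (auto simp: rp_def)
  have "evl \<rho> (ms u a oo (lt_exp u oo L)) (Lmul u a V)"
    unfolding Lmul_def using ms_nm[OF u a] e by (intro evl_compose) auto
  then show ?thesis using L0 by (auto simp: rp_def ms_compose)
qed

text \<open>The laws are relative to a set \<open>B\<close> because in characteristic \<open>p\<close> they are only needed on the
  \<open>\<pi>\<^sup>2\<close>-torsion, where the series defining \<open>[a]\<^sub>u\<close> is a finite sum.\<close>

definition module_laws :: "'c \<Rightarrow> 'c set \<Rightarrow> bool" where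
  "module_laws u B \<longleftrightarrow> 0 \<in> B \<and>
    (\<forall>X\<in>B. \<forall>Y\<in>B. lt_add D u X Y \<in> B \<and> lt_add D u X Y = lt_add D u Y X) \<and>
    (\<forall>X\<in>B. \<forall>Y\<in>B. \<forall>Z\<in>B. lt_add D u (lt_add D u X Y) Z = lt_add D u X (lt_add D u Y Z)) \<and>
    (\<forall>X\<in>B. \<forall>a\<in>OF D. lt_mult D u a X \<in> B \<and> lt_mult D u a 0 = 0 \<and>
       (\<forall>Y\<in>B. lt_mult D u a (lt_add D u X Y) = lt_add D u (lt_mult D u a X) (lt_mult D u a Y)) \<and>
       (\<forall>b\<in>OF D. lt_mult D u (a + b) X = lt_add D u (lt_mult D u a X) (lt_mult D u b X) \<and>
          lt_mult D u (a * b) X = lt_mult D u a (lt_mult D u b X))) \<and>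
    (\<forall>X\<in>B. lt_mult D u 1 X = X \<and> lt_mult D u 0 X = 0 \<and> lt_add D u X 0 = X)"

lemma module_laws_char0:
  assumes c: "CHAR('c) = 0" and u: "nm u \<le> 1"
  shows "module_laws u {X. nm X < 1}"
proof -
  let ?f = "\<lambda>X. lt_log D u oo (fps_const X * fps_X)"
  note p = rp_point[of _ u] and A = rp_add[OF u] and M = rp_mul[OF u]
  have nA: "nm (Ladd u X Y) < 1" if "nm X < 1" "nm Y < 1" for X Y using A p that rp_nm by blast
  have nM: "nm (Lmul u a X) < 1" if "nm X < 1" "a \<in> OF D" for a X using M p that rp_nm by blast
  have comm: "Ladd u X Y = Ladd u Y X" if "nm X < 1" "nm Y < 1" for X Y
    using A[OF p p, of X Y] A[OF p p, of Y X] that rp_unique by (metis add.commute)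
  have assoc: "Ladd u (Ladd u X Y) Z = Ladd u X (Ladd u Y Z)" if "nm X < 1" "nm Y < 1" "nm Z < 1" for X Y Z
    using A[OF A[OF p p] p, of X Y Z] A[OF p A[OF p p], of X Y Z] that rp_unique by (metis add.assoc)
  have mz: "Lmul u a 0 = 0" if "a \<in> OF D" for a
    using M[OF that rp_0] rp_0 rp_unique by (metis mult_zero_right)
  have dist: "Lmul u a (Ladd u X Y) = Ladd u (Lmul u a X) (Lmul u a Y)"
    if "nm X < 1" "nm Y < 1" "a \<in> OF D" for a X Y
    using M[OF that(3) A[OF p p], of X Y] A[OF M[OF that(3) p] M[OF that(3) p], of X Y] that rp_unique
    by (metis distrib_left)
  have dist2: "Lmul u (a + b) X = Ladd u (Lmul u a X) (Lmul u b X)"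
    if "nm X < 1" "a \<in> OF D" "b \<in> OF D" for a b X
  proof -
    have "fps_const (a + b) * ?f X = fps_const a * ?f X + fps_const b * ?f X"
      by (simp add: fps_const_add[symmetric] distrib_right del: fps_const_add)
    then show ?thesis
      using M[OF OF_add[OF that(2,3)] p[OF that(1)]] A[OF M[OF that(2) p[OF that(1)]] M[OF that(3) p[OF that(1)]]]
        rp_unique by metis
  qed
  have mm: "Lmul u (a * b) X = Lmul u a (Lmul u b X)" if "nm X < 1" "a \<in> OF D" "b \<in> OF D" for a b X
  proof -
    have "fps_const (a * b) * ?f X = fps_const a * (fps_const b * ?f X)"
      by (simp add: fps_const_mult[symmetric] mult.assoc del: fps_const_mult)
    then show ?thesis
      using M[OF OF_mult[OF that(2,3)] p[OF that(1)]] M[OF that(2) M[OF that(3) p[OF that(1)]]]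
        rp_unique by metis
  qed
  have m1: "Lmul u 1 X = X" if "nm X < 1" for X
    using M[OF OF_1 p[OF that]] p[OF that] rp_unique by (metis fps_const_1_eq_1 mult_1)
  have m0: "Lmul u 0 X = 0" if "nm X < 1" for X
    using M[OF OF_0 p[OF that]] rp_0 rp_unique by (metis fps_const_0_eq_0 mult_zero_left)
  have a0: "Ladd u X 0 = X" if "nm X < 1" for X
    using A[OF p[OF that] rp_0] p[OF that] rp_unique by (metis add_0_right)
  show ?thesis
    unfolding module_laws_def lt_add_Ladd[OF c] lt_mult_Lmul[OF c]
    using nA nM comm assoc mz dist dist2 mm m1 m0 a0 by simp
qed

lemma torsion2_iff: "X \<in> torsion2 D u \<longleftrightarrow> nm X < 1 \<and> lt_mult D u (\<varpi> ^ 2) X = 0"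
  by (simp add: torsion2_def val_gt_0_iff)

lemma module_laws_torsion:
  assumes "module_laws u {X. nm X < 1}" shows "module_laws u (torsion2 D u)"
proof -
  have w: "\<varpi> ^ 2 \<in> OF D" by (intro OF_power) simp
  have s: "torsion2 D u \<subseteq> {X. nm X < 1}" by (auto simp: torsion2_iff)
  have c1: "lt_add D u X Y \<in> torsion2 D u" if "X \<in> torsion2 D u" "Y \<in> torsion2 D u" for X Y
    using that assms w unfolding module_laws_def torsion2_iff by simp
  have c2: "lt_mult D u a X \<in> torsion2 D u" if "X \<in> torsion2 D u" "a \<in> OF D" for a X
  proof -
    have X: "nm X < 1" "lt_mult D u (\<varpi> ^ 2) X = 0" using that by (auto simp: torsion2_iff)
    have ax: "nm (lt_mult D u a X) < 1" using assms X that(2) unfolding module_laws_def by simp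
    have "lt_mult D u (\<varpi> ^ 2) (lt_mult D u a X) = lt_mult D u (\<varpi> ^ 2 * a) X"
      using assms X that(2) w unfolding module_laws_def by simp
    also have "\<dots> = lt_mult D u (a * \<varpi> ^ 2) X" by (simp add: mult.commute)
    also have "\<dots> = lt_mult D u a (lt_mult D u (\<varpi> ^ 2) X)"
      using assms X that(2) w unfolding module_laws_def by simp
    also have "\<dots> = 0" using assms X that(2) unfolding module_laws_def by simp
    finally show ?thesis using ax by (simp add: torsion2_iff)
  qed
  have "lt_mult D u a 0 = 0" if "nm X < 1" "a \<in> OF D" for X a
    using assms that unfolding module_laws_def by simp
  from this[of 0, OF _ w] have c0: "0 \<in> torsion2 D u" by (simp add: torsion2_iff)
  show ?thesis
    unfolding module_laws_def
    by (intro conjI ballI; use c0 c1 c2 s assms[unfolded module_laws_def] in blast)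
qed

subsection \<open>Leading terms\<close>

text \<open>At u = 0 one has b_1 = 0 and b_2 = 1/\<pi>, so up to degree q^2 the logarithm is P +
  P^(q^2)/\<pi>, whose second term contributes only its lowest coefficient.\<close>

lemma log0_compose_nth:
  assumes P: "P $ 0 = 0" and n: "n \<le> q ^ 2"
  shows "(lt_log D 0 oo P) $ n = P $ n + (if n = q ^ 2 then (P $ 1) ^ q ^ 2 / \<varpi> else 0)"
proof -
  have K: "n \<le> q ^ 2 + 2" using n by simp
  have "(lt_log D 0 oo P) $ n = (\<Sum>k\<in>{..q ^ 2 + 2}. lt_b D 0 k * (P ^ q ^ k) $ n)"
    using log_compose_nth[OF P K, of 0] by simp
  also have "\<dots> = (\<Sum>k\<in>{0, 1, 2}. lt_b D 0 k * (P ^ q ^ k) $ n)"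
  proof (rule sum.mono_neutral_right)
    show "\<forall>k\<in>{..q ^ 2 + 2} - {0, 1, 2}. lt_b D 0 k * (P ^ q ^ k) $ n = 0"
    proof
      fix k assume "k \<in> {..q ^ 2 + 2} - {0, 1, 2}"
      then have "2 < k" by auto
      then have "q ^ 2 < q ^ k" using q_ge_2 by (intro power_strict_increasing) auto
      then show "lt_b D 0 k * (P ^ q ^ k) $ n = 0" using fps_power_nth_0[OF P] n by simp
    qed
  qed auto
  also have "\<dots> = P $ n + (P ^ q ^ 2) $ n / \<varpi>"
    using q_pos by (simp add: numeral_2_eq_2 zero_power)
  also have "(P ^ q ^ 2) $ n / \<varpi> = (if n = q ^ 2 then (P $ 1) ^ q ^ 2 / \<varpi> else 0)"
  proof (cases "n = q ^ 2")
    case True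
    then show ?thesis using startsby_zero_power_nth_same[OF P, of "q ^ 2"] by simp
  next
    case False
    then show ?thesis using fps_power_nth_0[OF P, of n "q ^ 2"] n by simp
  qed
  finally show ?thesis .
qed

lemma log0_linear_nth:
  assumes n: "n \<le> q ^ 2"
  shows "(lt_log D 0 oo (fps_const Z * fps_X)) $ n = (if n = 1 then Z else 0) + (if n = q ^ 2 then Z ^ q ^ 2 / \<varpi> else 0)"
proof -
  have lin: "(fps_const Z * fps_X) $ n = (if n = 1 then Z else 0)" for n by (simp add: fps_X_def)
  have "(fps_const Z * fps_X) $ 0 = 0" by simp
  from log0_compose_nth[OF this n] show ?thesis unfolding lin by simp
qed

lemma sum_delta_1: "(\<Sum>n<q ^ 2. if n = 1 then c else (0::'c)) = c"
  using q2_ge_9 by (simp add: sum.delta)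

text \<open>Logarithms of both sides are compared coefficientwise: degree 1 gives X + Y, and degree
  q^2 gives the value of f_{1,1}. This is the source of f_{a,b} in the action.\<close>

lemma fg_0_leading:
  "(\<Sum>n<Suc (q ^ 2). fg 0 (fps_const X * fps_X) (fps_const Y * fps_X) $ n)
    = X + Y + (X ^ q ^ 2 + Y ^ q ^ 2 - (X + Y) ^ q ^ 2) / \<varpi>"
proof -
  define H where "H = fg 0 (fps_const X * fps_X) (fps_const Y * fps_X)"
  have H0: "H $ 0 = 0" by (simp add: H_def fg_def)
  have eq: "lt_log D 0 oo H = (lt_log D 0 oo (fps_const X * fps_X)) + (lt_log D 0 oo (fps_const Y * fps_X))"
    unfolding H_def fg_def by (rule lt_log_exp) simp
  have q1: "q ^ 2 \<noteq> 1" "q \<noteq> Suc 0" "Suc 0 \<noteq> q ^ 2" using q_ge_2 q2_ge_9 by auto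
  have *: "H $ n + (if n = q ^ 2 then (H $ 1) ^ q ^ 2 / \<varpi> else 0)
     = (if n = 1 then X + Y else 0) + (if n = q ^ 2 then (X ^ q ^ 2 + Y ^ q ^ 2) / \<varpi> else 0)" if "n \<le> q ^ 2" for n
    using log0_compose_nth[OF H0 that]
    unfolding eq fps_add_nth log0_linear_nth[OF that] using q1 by (auto simp: add_divide_distrib)
  have Hn: "H $ n = (if n = 1 then X + Y else 0)" if "n < q ^ 2" for n using *[of n] that by simp
  have H1: "H $ 1 = X + Y" using Hn[of 1] q2_ge_9 by simp
  have "H $ (q ^ 2) + (X + Y) ^ q ^ 2 / \<varpi> = (X ^ q ^ 2 + Y ^ q ^ 2) / \<varpi>"
    using *[of "q ^ 2"] q1 unfolding H1 by simp
  then have HQ: "H $ (q ^ 2) = (X ^ q ^ 2 + Y ^ q ^ 2 - (X + Y) ^ q ^ 2) / \<varpi>"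
    by (simp add: diff_divide_distrib eq_diff_eq)
  have "(\<Sum>n<q ^ 2. H $ n) = (\<Sum>n<q ^ 2. if n = 1 then X + Y else 0)"
    by (intro sum.cong) (auto simp: Hn)
  then show ?thesis unfolding H_def[symmetric] by (simp add: HQ sum_delta_1[unfolded One_nat_def])
qed

text \<open>The same comparison for [\<pi>]_0, whose coefficient in degree q^2 is 1 up to
  \<pi>^(q^2-1).\<close>

lemma ms_0_leading:
  "(\<Sum>n<Suc (q ^ 2). ms 0 \<varpi> $ n * X ^ n) = \<varpi> * X + (1 - \<varpi> ^ q ^ 2 / \<varpi>) * X ^ q ^ 2"
proof -
  define H where "H = ms 0 \<varpi>"
  have H0: "H $ 0 = 0" by (simp add: H_def ms_def)
  have eq: "lt_log D 0 oo H = fps_const \<varpi> * (lt_log D 0 oo fps_X)"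
    unfolding H_def ms_def by (subst lt_log_exp) auto
  have q1: "q ^ 2 \<noteq> 1" "q \<noteq> Suc 0" "Suc 0 \<noteq> q ^ 2" using q_ge_2 q2_ge_9 by auto
  have *: "H $ n + (if n = q ^ 2 then (H $ 1) ^ q ^ 2 / \<varpi> else 0)
     = (if n = 1 then \<varpi> else 0) + (if n = q ^ 2 then 1 else 0)" if "n \<le> q ^ 2" for n
    using log0_compose_nth[OF H0 that] log0_linear_nth[OF that, of 1]
    unfolding eq fps_mult_left_const_nth using q1 by (auto simp: distrib_left)
  have Hn: "H $ n = (if n = 1 then \<varpi> else 0)" if "n < q ^ 2" for n using *[of n] that by simp
  have H1: "H $ 1 = \<varpi>" using Hn[of 1] q2_ge_9 by simp
  have "H $ (q ^ 2) + \<varpi> ^ q ^ 2 / \<varpi> = 1"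
    using *[of "q ^ 2"] q1 unfolding H1 by simp
  then have HQ: "H $ (q ^ 2) = 1 - \<varpi> ^ q ^ 2 / \<varpi>" by (simp add: eq_diff_eq)
  have "(\<Sum>n<q ^ 2. H $ n * X ^ n) = (\<Sum>n<q ^ 2. if n = 1 then \<varpi> * X else 0)"
    by (intro sum.cong) (auto simp: Hn)
  then show ?thesis unfolding H_def[symmetric] by (simp add: HQ sum_delta_1[unfolded One_nat_def])
qed

text \<open>There are two errors: the tail beyond degree q^2, and the passage from u to 0, where the
  Lipschitz bound costs |u| and the missing constant term gives a factor \<rho>.\<close>

lemma Ladd_leading:
  assumes X: "nm X \<le> \<rho>" "nm Y \<le> \<rho>" "\<rho> < 1" and u: "nm u \<le> 1"
  shows "nm (Ladd u X Y - (X + Y + (X ^ q ^ 2 + Y ^ q ^ 2 - (X + Y) ^ q ^ 2) / \<varpi>)) \<le> max (nm u * \<rho>) (\<rho> ^ Suc (q ^ 2))"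
proof -
  have r0: "0 \<le> \<rho>" using X nm_ge_0[of X] by linarith
  let ?P = "fps_const X * fps_X" and ?Q = "fps_const Y * fps_X" and ?N = "Suc (q ^ 2)"
  have eP: "evl \<rho> ?P X" "evl \<rho> ?Q Y" using X by (auto intro: evl_linear)
  have e: "evl \<rho> (fg u ?P ?Q) (Ladd u X Y)"
    unfolding Ladd_def using u eP by (intro evl_fg) auto
  then have 1: "nm (Ladd u X Y - (\<Sum>n<?N. fg u ?P ?Q $ n)) \<le> \<rho> ^ ?N" by (simp only: evl_def)
  have "(\<Sum>n<?N. fg u ?P ?Q $ n) - (\<Sum>n<?N. fg 0 ?P ?Q $ n)
     = (\<Sum>(i, j)\<in>{(i, j). i + j < ?N}. (fgc u i j - fgc 0 i j) * (\<Sum>n<?N. (?P ^ i * ?Q ^ j) $ n))"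
    by (subst (1 2) fg_partial_sum) (simp_all add: sum_subtractf[symmetric] left_diff_distrib case_prod_unfold)
  also have "nm \<dots> \<le> nm u * \<rho>"
  proof (rule nm_sum_le)
    show "0 \<le> nm u * \<rho>" using r0 by simp
    fix p :: "nat \<times> nat"
    obtain i j where p: "p = (i, j)" by (cases p)
    have "nm ((fgc u i j - fgc 0 i j) * (\<Sum>n<?N. (?P ^ i * ?Q ^ j) $ n)) \<le> nm u * \<rho>"
    proof (cases "i = 0 \<and> j = 0")
      case True
      then show ?thesis using r0 by (simp add: fgc_def)
    next
      case False
      have "nm (fgc u i j - fgc 0 i j) \<le> nm u" using Au_lipschitz[OF fgc_integral, of u 0] u by simp
      moreover have "nm (\<Sum>n<?N. (?P ^ i * ?Q ^ j) $ n) \<le> \<rho>"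
      proof (rule nm_sum_le[OF r0])
        fix n
        have en: "nm ((?P ^ i * ?Q ^ j) $ n) \<le> \<rho> ^ n"
          using evl_mult[OF evl_power[OF eP(1)] evl_power[OF eP(2)], of i j] by (simp add: evl_def)
        show "nm ((?P ^ i * ?Q ^ j) $ n) \<le> \<rho>"
        proof (cases "n = 0")
          case True
          have "(?P ^ i * ?Q ^ j) $ 0 = 0" using False by (auto simp: fps_power_zeroth)
          then show ?thesis using True r0 by (simp only: nm_0)
        next
          case False
          then have "\<rho> ^ n \<le> \<rho> ^ 1" using r0 X by (intro power_decreasing) auto
          then show ?thesis using en by simp
        qed
      qed
      ultimately show ?thesis by (rule nm_mult_le)
    qed
    then show "nm (case p of (i, j) \<Rightarrow> (fgc u i j - fgc 0 i j) * (\<Sum>n<?N. (?P ^ i * ?Q ^ j) $ n)) \<le> nm u * \<rho>"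
      by (simp only: p prod.case)
  qed
  finally have 2: "nm ((\<Sum>n<?N. fg u ?P ?Q $ n) - (\<Sum>n<?N. fg 0 ?P ?Q $ n)) \<le> nm u * \<rho>" .
  have "nm ((Ladd u X Y - (\<Sum>n<?N. fg u ?P ?Q $ n)) + ((\<Sum>n<?N. fg u ?P ?Q $ n) - (\<Sum>n<?N. fg 0 ?P ?Q $ n)))
      \<le> max (nm u * \<rho>) (\<rho> ^ ?N)"
    by (rule nm_add_leI) (use 1 2 in linarith)+
  then show ?thesis unfolding fg_0_leading by (simp only: add_diff_eq diff_add_cancel)
qed

lemma Lmul_uni_leading:
  assumes X: "nm X \<le> \<rho>" "\<rho> < 1" and u: "nm u \<le> 1"
  shows "nm (Lmul u \<varpi> X - X ^ q ^ 2) \<le> max (max (nm u * \<rho>) (nm \<varpi> * \<rho>)) (\<rho> ^ Suc (q ^ 2))"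
proof -
  have r0: "0 \<le> \<rho>" using X nm_ge_0[of X] by linarith
  let ?P = "fps_const X * fps_X" and ?N = "Suc (q ^ 2)"
  have e: "evl \<rho> (ms u \<varpi> oo ?P) (Lmul u \<varpi> X)"
    unfolding Lmul_def using ms_nm[OF u OF_uni] X by (intro evl_compose evl_linear) auto
  then have 1: "nm (Lmul u \<varpi> X - (\<Sum>n<?N. (ms u \<varpi> oo ?P) $ n)) \<le> \<rho> ^ ?N" by (simp only: evl_def)
  have c: "(ms v \<varpi> oo ?P) $ n = ms v \<varpi> $ n * X ^ n" for v n
    unfolding fps_compose_linear by (simp add: mult.commute)
  have "(\<Sum>n<?N. ms u \<varpi> $ n * X ^ n) - (\<Sum>n<?N. ms 0 \<varpi> $ n * X ^ n)
      = (\<Sum>n<?N. (ms u \<varpi> $ n - ms 0 \<varpi> $ n) * X ^ n)"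
    by (simp only: sum_subtractf[symmetric] left_diff_distrib)
  also have "nm \<dots> \<le> nm u * \<rho>"
  proof (rule nm_sum_le)
    show "0 \<le> nm u * \<rho>" using r0 by simp
    fix n
    show "nm ((ms u \<varpi> $ n - ms 0 \<varpi> $ n) * X ^ n) \<le> nm u * \<rho>"
    proof (cases "n = 0")
      case True then show ?thesis using r0 by (simp add: ms_def)
    next
      case False
      have "Au (\<lambda>u. ms u \<varpi> $ n)" using ms_integral[OF OF_uni] by (simp add: AD_0_iff)
      from Au_lipschitz[OF this u, of 0] have "nm (ms u \<varpi> $ n - ms 0 \<varpi> $ n) \<le> nm u" by simp
      moreover have "nm (X ^ n) \<le> \<rho>"
      proof -
        have "nm (X ^ n) \<le> \<rho> ^ n" using power_mono[OF X(1)] by (simp add: nm_power)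
        also have "\<rho> ^ n \<le> \<rho> ^ 1" using False r0 X by (intro power_decreasing) auto
        finally show ?thesis by simp
      qed
      ultimately show ?thesis by (rule nm_mult_le)
    qed
  qed
  finally have 2: "nm ((\<Sum>n<?N. ms u \<varpi> $ n * X ^ n) - (\<Sum>n<?N. ms 0 \<varpi> $ n * X ^ n)) \<le> nm u * \<rho>" .
  have 3: "nm (\<varpi> * X - \<varpi> ^ q ^ 2 / \<varpi> * X ^ q ^ 2) \<le> nm \<varpi> * \<rho>"
  proof (rule nm_diff_leI)
    show "nm (\<varpi> * X) \<le> nm \<varpi> * \<rho>" using X by (intro nm_mult_le) auto
    show "nm (\<varpi> ^ q ^ 2 / \<varpi> * X ^ q ^ 2) \<le> nm \<varpi> * \<rho>"
    proof (rule nm_mult_le)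
      have "nm (\<varpi> ^ q ^ 2) \<le> nm \<varpi> ^ 2" unfolding nm_power using nm_uni q2_ge_9 by (intro power_decreasing) auto
      then show "nm (\<varpi> ^ q ^ 2 / \<varpi>) \<le> nm \<varpi>" using nm_uni by (simp add: nm_divide divide_le_eq power2_eq_square)
      have "nm (X ^ q ^ 2) \<le> \<rho> ^ q ^ 2" using power_mono[OF X(1)] by (simp add: nm_power)
      also have "\<rho> ^ q ^ 2 \<le> \<rho> ^ 1" using r0 X q2_ge_9 by (intro power_decreasing) auto
      finally show "nm (X ^ q ^ 2) \<le> \<rho>" by simp
    qed
  qed
  have "nm ((Lmul u \<varpi> X - (\<Sum>n<?N. ms u \<varpi> $ n * X ^ n)) + (((\<Sum>n<?N. ms u \<varpi> $ n * X ^ n) - (\<Sum>n<?N. ms 0 \<varpi> $ n * X ^ n))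
      + (\<varpi> * X - \<varpi> ^ q ^ 2 / \<varpi> * X ^ q ^ 2))) \<le> max (max (nm u * \<rho>) (nm \<varpi> * \<rho>)) (\<rho> ^ ?N)"
    using 1[unfolded c] 2 3 by (intro nm_add_leI[OF _ nm_add_leI]) linarith+
  then show ?thesis unfolding ms_0_leading by (simp add: algebra_simps)
qed

text \<open>Since a^(q^k) = a, multiplication by a commutes with a logarithm whose terms all have
  degree a power of q.\<close>

lemma Lmul_mu0:
  assumes "a \<in> mu0 D" shows "Lmul u a X = a * X"
proof -
  have aq: "a ^ q ^ k = a" for k
    by (induction k) (simp_all add: power_mult mu0_power[OF assms])
  have "fps_const a * lt_log D u = lt_log D u oo (fps_const a * fps_X)"
  proof (rule fps_ext)
    fix n
    show "(fps_const a * lt_log D u) $ n = (lt_log D u oo (fps_const a * fps_X)) $ n"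
      by (auto simp: fps_compose_linear lt_log_nth sum_distrib_left aq intro!: sum.cong)
  qed
  then have "ms u a = fps_const a * fps_X" unfolding ms_def by (simp add: lt_exp_log)
  then have "(\<lambda>n. ms u a $ n * X ^ n) = (\<lambda>n. if n = 1 then a * X else 0)"
    by (auto simp: fps_X_def)
  then show ?thesis unfolding Lmul_def using sums_unique[OF sums_single[of 1 "\<lambda>_. a * X"]] by simp
qed

subsection \<open>Positive characteristic\<close>

lemma frob_char_p:
  assumes "0 < CHAR('c)" shows "(x + y) ^ q = x ^ q + (y::'c) ^ q"
proof -
  have "(of_nat (q choose k) :: 'c) = 0" if "0 < k" "k < q" for k
  proof -
    have "CHAR('k) dvd (q choose k)" using choose_q_redu[OF that] by (simp add: of_nat_eq_0_iff_char_dvd)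
    then obtain m where "q choose k = CHAR('k) * m" by blast
    then show ?thesis using char_c_nm[OF assms] by simp
  qed
  then show ?thesis using binomial_middle[of q x y] q_pos by simp
qed

lemma frob2_char_p: "0 < CHAR('c) \<Longrightarrow> (x + y) ^ q ^ 2 = x ^ q ^ 2 + (y::'c) ^ q ^ 2"
  by (simp add: power_q2 frob_char_p)

lemma mu0_add_char_p: "0 < CHAR('c) \<Longrightarrow> s \<in> mu0 D \<Longrightarrow> t \<in> mu0 D \<Longrightarrow> s + t \<in> mu0 D"
  by (simp add: mu0_iff OF_add frob_char_p)

lemma teich_add_char_p:
  assumes "0 < CHAR('c)" "a \<in> OF D" "b \<in> OF D"
  shows "teich D (redu D (a + b)) = teich D (redu D a) + teich D (redu D b)"
proof (rule mu0_eqI)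
  show "teich D (redu D (a + b)) \<in> mu0 D" using assms by (intro teich_mu0 OF_add)
  show "teich D (redu D a) + teich D (redu D b) \<in> mu0 D" using assms by (intro mu0_add_char_p teich_mu0)
  have "redu D (teich D (redu D a) + teich D (redu D b)) = redu D a + redu D b"
    using assms by (simp add: redu_plus OF_nm teich_OF redu_teich)
  then show "redu D (teich D (redu D (a + b))) = redu D (teich D (redu D a) + teich D (redu D b))"
    using assms redu_teich[OF OF_add] by (simp add: redu_plus OF_nm)
qed

text \<open>Only two digits matter on the \<pi>^2-torsion. In characteristic p Teichmueller
  representatives are additive as well, so on the integers of F the first digit is a ring
  homomorphism and the second a derivation over it.\<close>

abbreviation "dg0 a \<equiv> teich D (redu D a)"
abbreviation "dg1 a \<equiv> teich D (redu D (tdelta a))"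

lemma digit_0: "digit D a 0 = dg0 a" and digit_1: "digit D a 1 = dg1 a"
  by (simp_all add: digit_def tdelta_def)

lemma dg1_add:
  assumes "0 < CHAR('c)" "a \<in> OF D" "b \<in> OF D" shows "dg1 (a + b) = dg1 a + dg1 b"
proof -
  have "tdelta (a + b) = tdelta a + tdelta b"
    using teich_add_char_p[OF assms] by (simp add: tdelta_def field_simps)
  then show ?thesis using assms by (simp add: teich_add_char_p tdelta_OF)
qed

lemma dg1_mult:
  assumes "0 < CHAR('c)" "a \<in> OF D" "b \<in> OF D" shows "dg1 (a * b) = dg0 a * dg1 b + dg1 a * dg0 b"
proof -
  have "redu D (tdelta (a * b)) = redu D (a * tdelta b + tdelta a * b)"
    using assms by (simp add: redu_tdelta_mult redu_plus redu_times OF_nm tdelta_OF nm_mult_le_1)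
  then have "dg1 (a * b) = teich D (redu D (a * tdelta b + tdelta a * b))" by simp
  also have "\<dots> = dg0 a * dg1 b + dg1 a * dg0 b"
    using assms by (simp add: teich_add_char_p teich_mult tdelta_OF OF_mult)
  finally show ?thesis .
qed

lemma teich_0 [simp]: "teich D 0 = 0" and teich_1 [simp]: "teich D 1 = 1"
proof -
  have "0 \<in> mu0 D" "1 \<in> mu0 D" using q_pos by (auto simp: mu0_iff)
  from this[THEN teich_redu] show "teich D 0 = 0" "teich D 1 = 1" by (simp_all add: redu_1)
qed

lemma tdelta_0: "tdelta 0 = 0" and tdelta_1: "tdelta 1 = 0"
  and tdelta_uni: "redu D a = 0 \<Longrightarrow> tdelta a = a / \<varpi>"
  by (simp_all add: tdelta_def redu_1)

lemma tdelta_mu0: "t \<in> mu0 D \<Longrightarrow> tdelta t = 0"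
  by (simp add: tdelta_def teich_redu)

lemma pi_poly_add: "0 < CHAR('c) \<Longrightarrow> lt_pi_poly D u (X + Y) = lt_pi_poly D u X + lt_pi_poly D u Y"
  by (simp add: lt_pi_poly_def frob_char_p frob2_char_p algebra_simps)

lemma pi_poly_scale: "t \<in> mu0 D \<Longrightarrow> lt_pi_poly D u (t * X) = t * lt_pi_poly D u X"
  by (simp add: lt_pi_poly_def power_mult_distrib mu0_power mu0_power_q2 algebra_simps)

lemma pi_poly_0 [simp]: "lt_pi_poly D u 0 = 0"
  using q_pos by (simp add: lt_pi_poly_def zero_power)

lemma digit_tail_uni2: "digit_tail D (\<varpi> ^ 2) (Suc 0) = \<varpi>" "digit_tail D (\<varpi> ^ 2) (Suc (Suc 0)) = 1"
  "digit_tail D (\<varpi> ^ 2) (Suc (Suc (Suc n))) = 0"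
proof -
  have r: "redu D (\<varpi> ^ 2) = 0" using nm_uni by (simp add: redu_power)
  show 1: "digit_tail D (\<varpi> ^ 2) (Suc 0) = \<varpi>"
    unfolding digit_tail.simps r teich_0 by (simp add: power2_eq_square)
  then show 2: "digit_tail D (\<varpi> ^ 2) (Suc (Suc 0)) = 1" by (subst digit_tail.simps(2)) (simp only: 1, simp)
  show "digit_tail D (\<varpi> ^ 2) (Suc (Suc (Suc n))) = 0"
  proof (induction n)
    case 0
    show ?case by (subst digit_tail.simps(2)) (simp only: 2, simp add: redu_1)
  next
    case (Suc n)
    show ?case by (subst digit_tail.simps(2)) (simp only: Suc, simp)
  qed
qed

lemma lt_mult_uni2:
  assumes "0 < CHAR('c)" shows "lt_mult D u (\<varpi> ^ 2) X = lt_pi_poly D u (lt_pi_poly D u X)"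
proof -
  let ?d = "\<lambda>n. digit D (\<varpi> ^ 2) n * (lt_pi_poly D u ^^ n) X"
  have r: "redu D (\<varpi> ^ 2) = 0" using nm_uni by (simp add: redu_power)
  have d: "digit D (\<varpi> ^ 2) 0 = 0" "digit D (\<varpi> ^ 2) (Suc 0) = 0" "digit D (\<varpi> ^ 2) (Suc (Suc 0)) = 1"
    "digit D (\<varpi> ^ 2) (Suc (Suc (Suc n))) = 0" for n
    unfolding digit_def by (simp_all only: digit_tail_uni2 digit_tail.simps(1) r teich_0 teich_1 redu_uni redu_1 redu_0)
  have "?d n = 0" if "n \<notin> {2}" for n
  proof -
    have "n = 0 \<or> n = Suc 0 \<or> n = Suc (Suc (Suc (n - 3)))" using that by auto
    then obtain m where "n = 0 \<or> n = Suc 0 \<or> n = Suc (Suc (Suc m))" by blast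
    then show ?thesis using d(1,2) d(4)[of m] by auto
  qed
  then have "suminf ?d = sum ?d {2}" by (intro suminf_finite) auto
  then show ?thesis using assms d(3) by (simp add: lt_mult_def numeral_2_eq_2)
qed

lemma torsion2_char_p:
  "0 < CHAR('c) \<Longrightarrow> X \<in> torsion2 D u \<longleftrightarrow> nm X < 1 \<and> lt_pi_poly D u (lt_pi_poly D u X) = 0"
  by (simp add: torsion2_iff lt_mult_uni2)

text \<open>Two applications of [\<pi>]_u kill X, so the defining series stops after two
  terms.\<close>

lemma lt_mult_char_p:
  assumes "0 < CHAR('c)" "lt_pi_poly D u (lt_pi_poly D u X) = 0"
  shows "lt_mult D u a X = dg0 a * X + dg1 a * lt_pi_poly D u X"
proof -
  let ?d = "\<lambda>n. digit D a n * (lt_pi_poly D u ^^ n) X"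
  have z: "(lt_pi_poly D u ^^ Suc (Suc n)) X = 0" for n
    by (induction n) (use assms(2) in simp_all)
  have "?d n = 0" if "n \<notin> {0, 1}" for n
  proof -
    have "n = Suc (Suc (n - 2))" using that by auto
    then obtain m where "n = Suc (Suc m)" by blast
    then show ?thesis using z[of m] by (simp del: funpow.simps)
  qed
  then have "suminf ?d = sum ?d {0, 1}" by (intro suminf_finite) auto
  then show ?thesis using assms(1) digit_0[of a] digit_1[of a] by (simp add: lt_mult_def)
qed

lemma pi_poly_nm: "nm u \<le> 1 \<Longrightarrow> nm X < 1 \<Longrightarrow> nm (lt_pi_poly D u X) < 1"
proof -
  assume u: "nm u \<le> 1" and X: "nm X < 1"
  have p: "nm (X ^ n) < 1" if "0 < n" for n using that X by (simp add: nm_power power_less_one_iff)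
  have 1: "nm (\<varpi> * X) < 1" using nm_uni X mult_strict_mono[of "nm \<varpi>" 1 "nm X" 1] by (simp add: nm_mult)
  have 2: "nm (u * X ^ q) < 1" using nm_mult_le_right[OF u order_refl, of "X ^ q"] p[OF q_pos] by linarith
  show ?thesis unfolding lt_pi_poly_def
    by (intro nm_add_lessI 1 2 p) (use q_pos in simp)
qed

lemma module_laws_char_p:
  assumes c: "0 < CHAR('c)" and u: "nm u \<le> 1"
  shows "module_laws u (torsion2 D u)"
proof -
  let ?p = "lt_pi_poly D u"
  have add: "lt_add D u X Y = X + Y" for X Y using c by (simp add: lt_add_def)
  note T = torsion2_char_p[OF c]
  have mul: "lt_mult D u a X = dg0 a * X + dg1 a * ?p X" if "X \<in> torsion2 D u" for a X
    using that T lt_mult_char_p[OF c] by blast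
  have m0: "dg0 a \<in> mu0 D" "dg1 a \<in> mu0 D" if "a \<in> OF D" for a
    using that by (auto simp: teich_mu0 tdelta_OF)
  have pm: "?p (dg0 a * X + dg1 a * ?p X) = dg0 a * ?p X" if "a \<in> OF D" "X \<in> torsion2 D u" for a X
    using that T m0 by (simp add: pi_poly_add[OF c] pi_poly_scale)
  have T0: "0 \<in> torsion2 D u" by (simp add: T)
  have Ta: "X + Y \<in> torsion2 D u" if "X \<in> torsion2 D u" "Y \<in> torsion2 D u" for X Y
    using that by (simp add: T pi_poly_add[OF c] nm_add_lessI)
  have Tm: "dg0 a * X + dg1 a * ?p X \<in> torsion2 D u" if "a \<in> OF D" "X \<in> torsion2 D u" for a X
  proof -
    have X: "nm X < 1" "?p (?p X) = 0" using that(2) T by auto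
    have "nm (dg0 a * X) < 1" "nm (dg1 a * ?p X) < 1"
      using nm_mult_le_right[OF mu0_nm[OF m0(1)[OF that(1)]] order_refl, of X]
        nm_mult_le_right[OF mu0_nm[OF m0(2)[OF that(1)]] order_refl, of "?p X"]
        X pi_poly_nm[OF u X(1)] by linarith+
    then show ?thesis
      unfolding T using X by (auto simp: pm[OF that] pi_poly_scale[OF m0(1)[OF that(1)]] intro: nm_add_lessI)
  qed
  have l1: "lt_mult D u (a + b) X = lt_mult D u a X + lt_mult D u b X"
    if "a \<in> OF D" "b \<in> OF D" "X \<in> torsion2 D u" for a b X
    using that by (simp add: mul teich_add_char_p[OF c] dg1_add[OF c] algebra_simps)
  have l2: "lt_mult D u (a * b) X = lt_mult D u a (lt_mult D u b X)"
    if "a \<in> OF D" "b \<in> OF D" "X \<in> torsion2 D u" for a b X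
  proof -
    have "lt_mult D u a (lt_mult D u b X) = dg0 a * (dg0 b * X + dg1 b * ?p X) + dg1 a * (dg0 b * ?p X)"
      using that by (simp add: mul Tm pm)
    then show ?thesis using that by (simp add: mul teich_mult dg1_mult[OF c] algebra_simps)
  qed
  have l3: "lt_mult D u a (X + Y) = lt_mult D u a X + lt_mult D u a Y"
    if "X \<in> torsion2 D u" "Y \<in> torsion2 D u" for a X Y
    using that by (simp add: mul Ta pi_poly_add[OF c] algebra_simps)
  show ?thesis
    unfolding module_laws_def add
    using T0 Ta Tm l1 l2 l3
    by (auto simp: mul add.assoc add.commute redu_1 tdelta_0 tdelta_1)
qed

lemma module_laws: "nm u \<le> 1 \<Longrightarrow> module_laws u (torsion2 D u)"
  using module_laws_char_p module_laws_torsion[OF module_laws_char0] by (cases "CHAR('c) = 0") auto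

subsection \<open>Level structures\<close>

abbreviation comb :: "'c \<Rightarrow> 'c \<Rightarrow> 'c \<Rightarrow> 'c \<Rightarrow> 'c \<Rightarrow> 'c" where
  "comb u a X c Y \<equiv> lt_add D u (lt_mult D u a X) (lt_mult D u c Y)"

lemma comb_comb:
  assumes u: "nm u \<le> 1" and X: "X \<in> torsion2 D u" and Y: "Y \<in> torsion2 D u"
    and OF: "s \<in> OF D" "t \<in> OF D" "a \<in> OF D" "b \<in> OF D" "c \<in> OF D" "d \<in> OF D"
  shows "comb u s (comb u a X c Y) t (comb u b X d Y) = comb u (s * a + t * b) X (s * c + t * d) Y"
proof -
  let ?T = "torsion2 D u" and ?A = "lt_add D u" and ?M = "lt_mult D u"
  have L: "module_laws u ?T" by (rule module_laws[OF u])
  have A: "?A P Q \<in> ?T" "?A P Q = ?A Q P" if "P \<in> ?T" "Q \<in> ?T" for P Q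
    using L that unfolding module_laws_def by blast+
  have As: "?A (?A P Q) R = ?A P (?A Q R)" if "P \<in> ?T" "Q \<in> ?T" "R \<in> ?T" for P Q R
    using L that unfolding module_laws_def by blast
  have M: "?M x P \<in> ?T" if "x \<in> OF D" "P \<in> ?T" for x P using L that unfolding module_laws_def by blast
  have D: "?M x (?A P Q) = ?A (?M x P) (?M x Q)" if "x \<in> OF D" "P \<in> ?T" "Q \<in> ?T" for x P Q
    using L that unfolding module_laws_def by blast
  have S: "?M (x + y) P = ?A (?M x P) (?M y P)" "?M (x * y) P = ?M x (?M y P)"
    if "x \<in> OF D" "y \<in> OF D" "P \<in> ?T" for x y P
    using L that unfolding module_laws_def by blast+
  \<comment> \<open>The interchange law, which collects the multiples of X and those of Y.\<close>
  have "?A (?A P Q) (?A R S) = ?A (?A P R) (?A Q S)" if "P \<in> ?T" "Q \<in> ?T" "R \<in> ?T" "S \<in> ?T" for P Q R S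
  proof -
    have "?A (?A P Q) (?A R S) = ?A P (?A Q (?A R S))" using that A As by simp
    also have "?A Q (?A R S) = ?A (?A Q R) S" using that A As by simp
    also have "?A Q R = ?A R Q" using that A by blast
    also have "?A (?A R Q) S = ?A R (?A Q S)" using that A As by simp
    also have "?A P (?A R (?A Q S)) = ?A (?A P R) (?A Q S)" using that A As by simp
    finally show ?thesis .
  qed
  then show ?thesis
    using OF X Y by (simp add: D M S OF_mult)
qed

lemma unit_adjugate:
  assumes g: "a \<in> OF D" "b \<in> OF D" "c \<in> OF D" "d \<in> OF D" and det: "nm (a * d - b * c) = 1"
  obtains e where "e \<in> OF D" "e * (a * d - b * c) = 1"
proof -
  have "inverse (a * d - b * c) \<in> OF D"
    using g det OF_diff[OF OF_mult OF_mult] by (auto simp: OF_iff base_inverse nm_inverse intro!: base_inverse base_diff base_mult)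
  moreover have "a * d - b * c \<noteq> 0" using det by auto
  ultimately show ?thesis using that by (metis left_inverse)
qed

lemma level2_basis_transform:
  assumes u: "nm u \<le> 1" and b: "is_level2_basis D u X Y"
    and g: "a \<in> OF D" "b \<in> OF D" "c \<in> OF D" "d \<in> OF D" and det: "nm (a * d - b * c) = 1"
  shows "is_level2_basis D u (comb u a X c Y) (comb u b X d Y)"
proof -
  let ?T = "torsion2 D u"
  have X: "X \<in> ?T" and Y: "Y \<in> ?T"
    and gen: "\<And>Z. Z \<in> ?T \<Longrightarrow> \<exists>s\<in>OF D. \<exists>t\<in>OF D. Z = comb u s X t Y"
    and ind: "\<And>s t. s \<in> OF D \<Longrightarrow> t \<in> OF D \<Longrightarrow> comb u s X t Y = 0 \<Longrightarrow> 2 \<le> val D s \<and> 2 \<le> val D t"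
    using b unfolding is_level2_basis_def by blast+
  have cT: "comb u s X t Y \<in> ?T" if "s \<in> OF D" "t \<in> OF D" for s t
    using module_laws[OF u] that X Y unfolding module_laws_def by blast
  note cc = comb_comb[OF u X Y]
  obtain e where e: "e \<in> OF D" "e * (a * d - b * c) = 1" using unit_adjugate[OF g det] by blast
  show ?thesis
    unfolding is_level2_basis_def
  proof (intro conjI ballI impI)
    show "comb u a X c Y \<in> ?T" "comb u b X d Y \<in> ?T" using cT g by blast+
    fix Z assume "Z \<in> ?T"
    then obtain s t where st: "s \<in> OF D" "t \<in> OF D" "Z = comb u s X t Y" using gen by blast
    \<comment> \<open>Cramer's rule, with e the inverse of the determinant.\<close>
    define s' where "s' = e * (d * s - b * t)"
    define t' where "t' = e * (a * t - c * s)"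
    have O: "s' \<in> OF D" "t' \<in> OF D" unfolding s'_def t'_def using e g st by (auto intro!: OF_mult OF_diff)
    have "s' * a + t' * b = s * (e * (a * d - b * c))" "s' * c + t' * d = t * (e * (a * d - b * c))"
      by (simp_all add: s'_def t'_def algebra_simps)
    then have "comb u s' (comb u a X c Y) t' (comb u b X d Y) = Z"
      using cc[OF O g(1,2,3,4)] st e by simp
    then show "\<exists>s\<in>OF D. \<exists>t\<in>OF D. Z = comb u s (comb u a X c Y) t (comb u b X d Y)"
      using O by metis
  next
    fix s t assume st: "s \<in> OF D" "t \<in> OF D" and z: "comb u s (comb u a X c Y) t (comb u b X d Y) = 0"
    have O: "s * a + t * b \<in> OF D" "s * c + t * d \<in> OF D" using st g by (auto intro!: OF_add OF_mult)
    have "comb u (s * a + t * b) X (s * c + t * d) Y = 0" using z cc[OF st g(1,2,3,4)] by simp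
    then have v: "nm (s * a + t * b) \<le> nm \<varpi> ^ 2" "nm (s * c + t * d) \<le> nm \<varpi> ^ 2"
      using ind[OF O] unfolding val_ge_2_iff by blast+
    have n: "nm a \<le> 1" "nm b \<le> 1" "nm c \<le> 1" "nm d \<le> 1" "nm e \<le> 1" using g e OF_nm by auto
    have "s = e * ((s * a + t * b) * d - (s * c + t * d) * b)" "t = e * ((s * c + t * d) * a - (s * a + t * b) * c)"
    proof -
      have "e * ((s * a + t * b) * d - (s * c + t * d) * b) = s * (e * (a * d - b * c))"
        "e * ((s * c + t * d) * a - (s * a + t * b) * c) = t * (e * (a * d - b * c))"
        by (simp_all add: algebra_simps)
      then show "s = e * ((s * a + t * b) * d - (s * c + t * d) * b)" "t = e * ((s * c + t * d) * a - (s * a + t * b) * c)"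
        using e(2) by simp_all
    qed
    moreover have "nm (e * ((s * a + t * b) * d - (s * c + t * d) * b)) \<le> nm \<varpi> ^ 2"
      "nm (e * ((s * c + t * d) * a - (s * a + t * b) * c)) \<le> nm \<varpi> ^ 2"
      by (rule nm_mult_le_right[OF n(5) nm_diff_leI]; rule nm_mult_le_left; fact v n)+
    ultimately show "2 \<le> val D s" "2 \<le> val D t" unfolding val_ge_2_iff by simp_all
  qed
qed

subsection \<open>The action to first order\<close>

text \<open>\<theta>^(q^3) is the size of X^(q^2) when |X| = \<theta>^q, and \<theta>^(q^4 (q-1)) is
  the bound on |u| given by v(u) >= q/(q+1). The inequalities with q^3 + 1 on the left say that the
  errors from u, from \<pi> X and from degrees beyond q^2 are smaller than X^(q^2).\<close>

lemma th_exps: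
  "q ^ 3 = q + eW" "q * q ^ 2 = q ^ 3" "q \<le> q ^ 3" "1 \<le> q ^ 3 - q" "q * e1 + eW = q * eW"
  "q ^ 3 + 1 \<le> q ^ 4 * (q - 1) + q" "q ^ 3 + 1 \<le> q ^ 2 * eW + q" "q ^ 3 + 1 \<le> q * Suc (q ^ 2)"
  "q * eW + 1 \<le> q ^ 2 * eW" "eW + 1 \<le> q * eW" "q * eW + 1 \<le> q * (eW + 1)"
  "q ^ 2 * eW * q = q ^ 4 * (q - 1) * (q + 1)"
proof -
  obtain k where k: "q = k + 3" using q_ge_3 by (metis add.commute le_Suc_ex)
  show "q ^ 3 = q + eW" "q * q ^ 2 = q ^ 3" "q \<le> q ^ 3" "1 \<le> q ^ 3 - q" "q * e1 + eW = q * eW"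
  "q ^ 3 + 1 \<le> q ^ 4 * (q - 1) + q" "q ^ 3 + 1 \<le> q ^ 2 * eW + q" "q ^ 3 + 1 \<le> q * Suc (q ^ 2)"
  "q * eW + 1 \<le> q ^ 2 * eW" "eW + 1 \<le> q * eW" "q * eW + 1 \<le> q * (eW + 1)"
  "q ^ 2 * eW * q = q ^ 4 * (q - 1) * (q + 1)"
    unfolding e1_def eW_def k by (simp_all add: power2_eq_square power3_eq_cube power4_eq_xxxx algebra_simps)
qed

lemma fab_scale: "fab a b (c * x) (c * y) = c ^ q ^ 2 * fab a b x y"
  by (simp add: fab_eq power_mult_distrib right_diff_distrib distrib_left mult.left_commute)
    (simp add: power_mult_distrib[symmetric] distrib_left mult.left_commute)

lemma mu0_1: "1 \<in> mu0 D"
  by (simp add: mu0_iff)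

lemma fab_cg:
  assumes "a \<in> mu0 D" "b \<in> mu0 D" "nm x \<le> 1" "nm y \<le> 1" "nm x' \<le> 1" "nm y' \<le> 1" "cg n x x'" "cg n y y'"
  shows "cg n (fab a b x y) (fab a b x' y')"
  unfolding fab_def using assms by (intro OFpoly2_eval_cg OFpoly2_fab)

text \<open>f_{1,1} is homogeneous of degree q^2. Scaling by \<open>kappa D\<close> makes the
  arguments integral, so the Lipschitz bound for integral polynomials applies, and the factor
  kappa^(q^2) already has size \<theta>^(q^3).\<close>

lemma fab_11_cg:
  assumes n: "nm A \<le> \<theta> ^ q" "nm B \<le> \<theta> ^ q" "nm A' \<le> \<theta> ^ q" "nm B' \<le> \<theta> ^ q"
    and c: "cg (q ^ 3) A A'" "cg (q ^ 3) B B'"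
  shows "cg (q ^ 3 + 1) (fab 1 1 A B) (fab 1 1 A' B')"
proof -
  let ?k = "kappa D"
  have s: "?k * (t / ?k) = t" for t using consts_nz by simp
  have n': "nm (t / ?k) \<le> 1" if "nm t \<le> \<theta> ^ q" for t using that th by (simp add: nm_divide nm_kappa divide_le_eq)
  have c': "cg (q ^ 3 - q) (t / ?k) (t' / ?k)" if "cg (q ^ 3) t t'" for t t'
    by (rule cg_cancel[OF nm_kappa]) (use that th_exps in \<open>simp add: s\<close>)
  have "cg (q * q ^ 2 + (q ^ 3 - q)) (?k ^ q ^ 2 * fab 1 1 (A / ?k) (B / ?k)) (?k ^ q ^ 2 * fab 1 1 (A' / ?k) (B' / ?k))"
    using n c by (intro cg_scale fab_cg mu0_1 n' c') (auto simp: nm_power nm_kappa power_mult)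
  then have "cg (q * q ^ 2 + (q ^ 3 - q)) (fab 1 1 A B) (fab 1 1 A' B')"
    unfolding fab_scale[symmetric] s .
  then show ?thesis by (rule cg_mono) (use th_exps in linarith)
qed

lemma fab_11_mu0: "a \<in> mu0 D \<Longrightarrow> b \<in> mu0 D \<Longrightarrow> fab 1 1 (a * x) (b * y) = fab a b x y"
  by (simp add: fab_eq power_mult_distrib mu0_power_q2)

lemma fab_11_0: "fab 1 1 A 0 = 0"
  using q_pos by (simp add: fab_eq zero_power)

lemma Ladd_near:
  assumes "nm X \<le> \<theta> ^ q" "nm Y \<le> \<theta> ^ q" and u: "nm u \<le> \<theta> ^ (q ^ 4 * (q - 1))"
  shows "cg (q ^ 3 + 1) (Ladd u X Y) (X + Y + fab 1 1 X Y)"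
proof -
  have u1: "nm u \<le> 1" using u th_le_1 by (rule order_trans)
  have r: "\<theta> ^ q < 1" using th_less_1_power q_pos by blast
  have "nm u * \<theta> ^ q \<le> \<theta> ^ (q ^ 4 * (q - 1)) * \<theta> ^ q" using u th by (intro mult_right_mono) auto
  also have "\<dots> \<le> \<theta> ^ (q ^ 3 + 1)" unfolding power_add[symmetric] by (intro th_mono th_exps)
  finally have 1: "nm u * \<theta> ^ q \<le> \<theta> ^ (q ^ 3 + 1)" .
  have 2: "(\<theta> ^ q) ^ Suc (q ^ 2) \<le> \<theta> ^ (q ^ 3 + 1)" unfolding power_mult[symmetric] by (intro th_mono th_exps)
  show ?thesis using Ladd_leading[OF assms(1,2) r u1] 1 2 by (auto simp: cg_def fab_eq)
qed

lemma Lmul_uni_near: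
  assumes "nm X \<le> \<theta> ^ q" and u: "nm u \<le> \<theta> ^ (q ^ 4 * (q - 1))"
  shows "cg (q ^ 3 + 1) (Lmul u \<varpi> X) (X ^ q ^ 2)"
proof -
  have u1: "nm u \<le> 1" using u th_le_1 by (rule order_trans)
  have r: "\<theta> ^ q < 1" using th_less_1_power q_pos by blast
  have "nm u * \<theta> ^ q \<le> \<theta> ^ (q ^ 4 * (q - 1)) * \<theta> ^ q" using u th by (intro mult_right_mono) auto
  also have "\<dots> \<le> \<theta> ^ (q ^ 3 + 1)" unfolding power_add[symmetric] by (intro th_mono th_exps)
  finally have 1: "nm u * \<theta> ^ q \<le> \<theta> ^ (q ^ 3 + 1)" .
  have 2: "(\<theta> ^ q) ^ Suc (q ^ 2) \<le> \<theta> ^ (q ^ 3 + 1)" unfolding power_mult[symmetric] by (intro th_mono th_exps)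
  have 3: "nm \<varpi> * \<theta> ^ q \<le> \<theta> ^ (q ^ 3 + 1)"
    unfolding th_uni[symmetric] power_add[symmetric] by (intro th_mono th_exps)
  show ?thesis using Lmul_uni_leading[OF assms(1) r u1] 1 2 3 by (auto simp: cg_def)
qed

text \<open>In characteristic 0 the Teichmueller digits act by multiplication, [\<pi>] supplies the
  q^2-th powers, and the only cross term at this precision is f_{1,1}(a0 X, c0 Y), which is
  f_{a0,c0}(X, Y). In characteristic p addition is ordinary and f_{a0,c0} vanishes.\<close>

lemma comb_leading:
  assumes X: "X \<in> torsion2 D u" "nm X \<le> \<theta> ^ q" and Y: "Y \<in> torsion2 D u" "nm Y \<le> \<theta> ^ q"
    and u: "nm u \<le> \<theta> ^ (q ^ 4 * (q - 1))"
    and m: "a0 \<in> mu0 D" "a1 \<in> mu0 D" "c0 \<in> mu0 D" "c1 \<in> mu0 D"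
  shows "cg (q ^ 3 + 1) (comb u (a0 + a1 * \<varpi>) X (c0 + c1 * \<varpi>) Y)
     (a0 * X + c0 * Y + fab a0 c0 X Y + a1 * X ^ q ^ 2 + c1 * Y ^ q ^ 2)"
proof (cases "CHAR('c) = 0")
  case c: True
  have u1: "nm u \<le> 1" using u th_le_1 by (rule order_trans)
  have q3: "\<theta> ^ q ^ 3 \<le> \<theta> ^ q" by (intro th_mono th_exps)
  have L: "module_laws u {X. nm X < 1}" by (rule module_laws_char0[OF c u1])
  have pw: "nm (Z ^ q ^ 2) \<le> \<theta> ^ q ^ 3" if "nm Z \<le> \<theta> ^ q" for Z
    using power_mono[OF that, of "q ^ 2"] th_exps(2) by (simp add: nm_power power_mult[symmetric])
  have one: "cg (q ^ 3 + 1) (Lmul u (a + b * \<varpi>) Z) (a * Z + b * Z ^ q ^ 2)"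
    if Z: "nm Z \<le> \<theta> ^ q" "nm Z < 1" and ab: "a \<in> mu0 D" "b \<in> mu0 D" for a b Z
  proof -
    have O: "a \<in> OF D" "b \<in> OF D" "b * \<varpi> \<in> OF D" using ab mu0_OF OF_mult by auto
    have n1: "nm (Lmul u \<varpi> Z) < 1"
      using L Z unfolding module_laws_def lt_mult_Lmul[OF c] by simp
    have "Lmul u (a + b * \<varpi>) Z = Ladd u (Lmul u a Z) (Lmul u (b * \<varpi>) Z)"
      using L Z O unfolding module_laws_def lt_mult_Lmul[OF c] lt_add_Ladd[OF c] by simp
    also have "Lmul u (b * \<varpi>) Z = Lmul u b (Lmul u \<varpi> Z)"
      using L Z O unfolding module_laws_def lt_mult_Lmul[OF c] lt_add_Ladd[OF c] by simp
    finally have e: "Lmul u (a + b * \<varpi>) Z = Ladd u (a * Z) (b * Lmul u \<varpi> Z)"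
      using ab by (simp add: Lmul_mu0)
    have z1: "cg (q ^ 3 + 1) (Lmul u \<varpi> Z) (Z ^ q ^ 2)" by (rule Lmul_uni_near[OF Z(1) u])
    have n3: "nm (Lmul u \<varpi> Z) \<le> \<theta> ^ q ^ 3" by (rule cg_nm_le[OF z1 pw[OF Z(1)]]) simp
    have nb: "nm (b * Lmul u \<varpi> Z) \<le> \<theta> ^ q ^ 3" using n3 mu0_nm[OF ab(2)] by (rule nm_mult_le_right[rotated])
    have na: "nm (a * Z) \<le> \<theta> ^ q" using Z mu0_nm[OF ab(1)] by (intro nm_mult_le_right)
    have nbq: "nm (b * Lmul u \<varpi> Z) \<le> \<theta> ^ q" using nb q3 by linarith
    \<comment> \<open>The summand coming from [\<pi>] has size at most \<theta>^(q^3), so f_{1,1}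
      does not distinguish it from 0.\<close>
    have "cg (q ^ 3 + 1) (fab 1 1 (a * Z) (b * Lmul u \<varpi> Z)) (fab 1 1 (a * Z) 0)"
      using na nbq nb th by (intro fab_11_cg) (auto simp: cg_def)
    then have f: "cg (q ^ 3 + 1) (fab 1 1 (a * Z) (b * Lmul u \<varpi> Z)) 0" by (simp add: fab_11_0)
    have "cg (q ^ 3 + 1) (Ladd u (a * Z) (b * Lmul u \<varpi> Z)) (a * Z + b * Lmul u \<varpi> Z + fab 1 1 (a * Z) (b * Lmul u \<varpi> Z))"
      by (rule Ladd_near[OF na nbq u])
    also have "cg (q ^ 3 + 1) \<dots> (a * Z + b * Z ^ q ^ 2 + 0)"
      by (intro cg_add cg_refl f cg_mult_left z1 mu0_nm ab)
    finally show ?thesis by (simp add: e)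
  qed
  define A where "A = Lmul u (a0 + a1 * \<varpi>) X"
  define B where "B = Lmul u (c0 + c1 * \<varpi>) Y"
  have A: "cg (q ^ 3 + 1) A (a0 * X + a1 * X ^ q ^ 2)" unfolding A_def
    using X m by (intro one) (auto simp: torsion2_iff)
  have B: "cg (q ^ 3 + 1) B (c0 * Y + c1 * Y ^ q ^ 2)" unfolding B_def
    using Y m by (intro one) (auto simp: torsion2_iff)
  have lin: "nm (t * Z) \<le> \<theta> ^ q" "cg (q ^ 3) (t * Z + t' * Z ^ q ^ 2) (t * Z)" "nm (t * Z + t' * Z ^ q ^ 2) \<le> \<theta> ^ q"
    if "nm Z \<le> \<theta> ^ q" "t \<in> mu0 D" "t' \<in> mu0 D" for t t' Z
  proof -
    show 1: "nm (t * Z) \<le> \<theta> ^ q" using that mu0_nm by (intro nm_mult_le_right) auto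
    have 2: "nm (t' * Z ^ q ^ 2) \<le> \<theta> ^ q ^ 3" using that pw mu0_nm by (intro nm_mult_le_right) auto
    show "cg (q ^ 3) (t * Z + t' * Z ^ q ^ 2) (t * Z)" by (rule cg_0_add[OF 2])
    show "nm (t * Z + t' * Z ^ q ^ 2) \<le> \<theta> ^ q" using 1 2 q3 by (intro nm_add_leI) auto
  qed
  have q31: "q \<le> q ^ 3 + 1" "q ^ 3 \<le> q ^ 3 + 1" using th_exps by auto
  have nA: "nm A \<le> \<theta> ^ q" using cg_nm_le[OF A lin(3) q31(1)] X m by blast
  have nB: "nm B \<le> \<theta> ^ q" using cg_nm_le[OF B lin(3) q31(1)] Y m by blast
  have "cg (q ^ 3 + 1) (fab 1 1 A B) (fab 1 1 (a0 * X) (c0 * Y))"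
  proof (intro fab_11_cg nA nB lin(1)[OF _ _ mu0_1] X Y m)
    show "cg (q ^ 3) A (a0 * X)" by (rule cg_trans[OF cg_mono[OF A q31(2)] lin(2)]) (use X m in auto)
    show "cg (q ^ 3) B (c0 * Y)" by (rule cg_trans[OF cg_mono[OF B q31(2)] lin(2)]) (use Y m in auto)
  qed
  then have F: "cg (q ^ 3 + 1) (fab 1 1 A B) (fab a0 c0 X Y)" using m by (simp add: fab_11_mu0)
  have "cg (q ^ 3 + 1) (Ladd u A B) (A + B + fab 1 1 A B)" by (rule Ladd_near[OF nA nB u])
  also have "cg (q ^ 3 + 1) (A + B + fab 1 1 A B) ((a0 * X + a1 * X ^ q ^ 2) + (c0 * Y + c1 * Y ^ q ^ 2) + fab a0 c0 X Y)"
    by (intro cg_add A B F)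
  finally show ?thesis unfolding lt_add_Ladd[OF c] lt_mult_Lmul[OF c] A_def B_def by (simp add: algebra_simps)
next
  case False
  then have c: "0 < CHAR('c)" by simp
  have one: "cg (q ^ 3 + 1) (lt_mult D u (a + b * \<varpi>) Z) (a * Z + b * Z ^ q ^ 2)"
    if Z: "Z \<in> torsion2 D u" "nm Z \<le> \<theta> ^ q" and ab: "a \<in> mu0 D" "b \<in> mu0 D" for a b Z
  proof -
    have r: "redu D (a + \<varpi> * b) = redu D a" "redu D (tdelta (a + \<varpi> * b)) = redu D b"
      using redu_tdelta_add_uni[of a b] ab by (auto simp: mu0_OF tdelta_mu0)
    have "lt_mult D u (a + \<varpi> * b) Z = a * Z + b * lt_pi_poly D u Z"
      using lt_mult_char_p[OF c, of u Z] Z torsion2_char_p[OF c] ab by (simp add: r teich_redu)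
    moreover have "cg (q ^ 3 + 1) (lt_pi_poly D u Z) (0 + 0 + Z ^ q ^ 2)"
      unfolding lt_pi_poly_def
    proof (intro cg_add cg_refl)
      have "nm (\<varpi> * Z) \<le> \<theta> ^ (q ^ 2 * eW) * \<theta> ^ q" using Z by (intro nm_mult_le) (simp_all add: th_uni)
      then show "cg (q ^ 3 + 1) (\<varpi> * Z) 0"
        unfolding cg_0_iff power_add[symmetric] using th_mono[OF th_exps(7)] by linarith
      have "nm (Z ^ q) \<le> \<theta> ^ q"
        using power_mono[OF Z(2), of q] power_decreasing[of 1 q "\<theta> ^ q"] q_pos th th_le_1[of q] by (simp add: nm_power)
      then have "nm (u * Z ^ q) \<le> \<theta> ^ (q ^ 4 * (q - 1)) * \<theta> ^ q" using u by (intro nm_mult_le)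
      then show "cg (q ^ 3 + 1) (u * Z ^ q) 0"
        unfolding cg_0_iff power_add[symmetric] using th_mono[OF th_exps(6)] by linarith
    qed
    ultimately show ?thesis
      using cg_add[OF cg_refl cg_mult_left[OF mu0_nm[OF ab(2)]], of "q ^ 3 + 1" "lt_pi_poly D u Z" "Z ^ q ^ 2" "a * Z"]
      by (simp add: mult.commute[of b \<varpi>])
  qed
  have "fab a0 c0 X Y = 0"
    using frob2_char_p[OF c, of "a0 * X" "c0 * Y"] m by (simp add: fab_eq power_mult_distrib mu0_power_q2)
  moreover have "lt_add D u P Q = P + Q" for P Q using c by (simp add: lt_add_def)
  moreover have "cg (q ^ 3 + 1) (lt_mult D u (a0 + a1 * \<varpi>) X + lt_mult D u (c0 + c1 * \<varpi>) Y)
      ((a0 * X + a1 * X ^ q ^ 2) + (c0 * Y + c1 * Y ^ q ^ 2))"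
    using X Y m by (intro cg_add one)
  ultimately show ?thesis by (simp add: algebra_simps)
qed

end

section \<open>Sizes of the parameters on the affinoid\<close>

context lt_affinoid
begin

text \<open>The f_1 term of the component invariant is constant after reduction, since x and y
  reduce to x0 and y0; removing it leaves E, whose reduction is therefore the constant in the
  equation of the curve.\<close>

lemma affinoid_E:
  assumes s: "s \<in> affinoid D i (x0, y0)"
  defines "E \<equiv> (\<tau> * gamma0 D - calZ_fn D s) / gamma_q_over_q1 D"
  shows "nm E \<le> 1" "redu D E = c0_const D i (x0, y0)" "redu D (moore_fn D s) = \<zeta>" "nm (moore_fn D s) \<le> 1"
proof -
  define x where "x = x_fn D s"
  define y where "y = y_fn D s"
  have b: "nm x \<le> 1" "nm y \<le> 1" "redu D x = x0" "redu D y = y0" using affinoid_basic[OF s] by (simp_all add: x_def y_def)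
  define F where "F = eval2 (f1_poly D) (x ^ q ^ 2 * y ^ q) (x ^ q * y ^ q ^ 2)"
  have EF: "nm (E + F) \<le> 1" "redu D (E + F) = mu_of D i * \<zeta>"
    using s by (auto simp: affinoid_def Y22_component_def reduces_to_iff zeta_i \<tau>_def[symmetric]
        E_def F_def x_def y_def)
  have nF: "nm F \<le> 1" unfolding F_def using b by (intro OFpoly2_eval OFpoly2_f1 nm_mult_le_1 nm_power_le_1)
  show nE: "nm E \<le> 1" using nm_diff_leI[OF EF(1) nF] by simp
  have "redu D F = eval2 (redu_poly2 D (f1_poly D)) (x0 ^ q ^ 2 * y0 ^ q) (x0 ^ q * y0 ^ q ^ 2)"
    unfolding F_def using b by (simp add: OFpoly2_eval_redu OFpoly2_f1 nm_mult_le_1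
        nm_power_le_1 redu_times redu_power)
  moreover have "redu D E = redu D (E + F) - redu D F" using nE nF by (simp add: redu_plus)
  ultimately show "redu D E = c0_const D i (x0, y0)" using EF by (simp add: c0_const_def zeta_i)
  show "redu D (moore_fn D s) = \<zeta>" "nm (moore_fn D s) \<le> 1"
    using s by (auto simp: affinoid_def Y22_component_def reduces_to_iff zeta_i)
qed

lemma affinoid_u:
  assumes "(X, Y, u) \<in> affinoid D i (x0, y0)"
  shows "nm u \<le> \<theta> ^ (q ^ 4 * (q - 1))" "nm u < 1" "is_level2_basis D u X Y" "nm X = \<theta> ^ q" "nm Y = \<theta> ^ q"
    "X \<in> torsion2 D u" "Y \<in> torsion2 D u"
proof -
  have s: "(X, Y, u) \<in> Y22 D" using assms by (simp add: affinoid_def Y22_component_def)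
  then have v: "ereal (real q / (real q + 1)) \<le> val D u" and b: "is_level2_basis D u X Y" and u: "0 < val D u"
    by (auto simp: Y22_def LT_curve_def)
  show "is_level2_basis D u X Y" by (rule b)
  then show "X \<in> torsion2 D u" "Y \<in> torsion2 D u" unfolding is_level2_basis_def by auto
  show "nm u < 1" using u by (simp add: val_gt_0_iff)
  have "nm u \<le> nm \<varpi> powr (real q / (real q + 1))" using v by (simp only: val_ge_iff)
  also have "\<dots> = \<theta> powr (real (q ^ 2 * eW) * (real q / (real q + 1)))"
    using th by (simp add: th_uni[symmetric] powr_realpow[symmetric] powr_powr)
  also have "real (q ^ 2 * eW) * (real q / (real q + 1)) = real (q ^ 4 * (q - 1))"
  proof -
    have "q ^ 2 * eW * q = q ^ 4 * (q - 1) * (q + 1)" by (rule th_exps)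
    then have "real (q ^ 2 * eW) * real q = real (q ^ 4 * (q - 1)) * (real q + 1)"
      by (metis of_nat_mult of_nat_add of_nat_1)
    then show ?thesis by (simp add: divide_eq_eq)
  qed
  also have "\<theta> powr real (q ^ 4 * (q - 1)) = \<theta> ^ (q ^ 4 * (q - 1))" using th by (intro powr_realpow) auto
  finally show "nm u \<le> \<theta> ^ (q ^ 4 * (q - 1))" .
  have "nm (X / kappa D) = 1" "nm (Y / kappa D) = 1"
    using affinoid_basic(1,2)[OF assms] by (simp_all add: x_fn_def y_fn_def)
  then show "nm X = \<theta> ^ q" "nm Y = \<theta> ^ q" using th by (simp_all add: nm_divide nm_kappa divide_eq_1_iff)
qed

lemma hat_q3: "cg 1 (xh ^ q ^ 3) (- (xh ^ q))" "cg 1 (yh ^ q ^ 3) (- (yh ^ q))"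
proof -
  have "cg 1 (h ^ q ^ 3) (- (h ^ q))" if h: "nm h = 1" "h ^ q ^ 2 = - (T * h)" for h
  proof -
    have "h ^ q ^ 3 = (h ^ q ^ 2) ^ q" by (simp add: power_mult[symmetric] power2_eq_square power3_eq_cube)
    also have "\<dots> = - (T ^ q * h ^ q)" unfolding h using odd_q by (simp add: power_mult_distrib)
    also have "cg 1 \<dots> (- (1 * h ^ q))"
    proof -
      have "1 \<le> q * e1" using exps by linarith
      then show ?thesis using cg_mono[OF T(5)] h by (intro cg_minus cg_mult_right nm_power_le_1) auto
    qed
    finally show ?thesis by simp
  qed
  then show "cg 1 (xh ^ q ^ 3) (- (xh ^ q))" "cg 1 (yh ^ q ^ 3) (- (yh ^ q))" using hat by auto
qed

end

section \<open>The image of the affinoid under \<open>g\<close>\<close>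

context lt_action
begin

sublocale A: lt_affinoid D i x0 y0
  by unfold_locales (rule i_unit S00_xy)+

sublocale B: lt_affinoid D ig x0' y0'
  by unfold_locales (rule ig_unit jg_S00)+

definition La where "La x y = a0 * x + c0 * y"
definition Lb where "Lb x y = b0 * x + d0 * y"
definition Ka where "Ka x y = fab a0 c0 x y + a1 * x ^ q ^ 2 + c1 * y ^ q ^ 2"
definition Kb where "Kb x y = fab b0 d0 x y + b1 * x ^ q ^ 2 + d1 * y ^ q ^ 2"
definition H where "H x y = La x y ^ q * Kb x y - Ka x y * Lb x y ^ q"

lemma nm_LK:
  assumes "nm x \<le> 1" "nm y \<le> 1"
  shows "nm (La x y) \<le> 1" "nm (Lb x y) \<le> 1" "nm (Ka x y) \<le> 1" "nm (Kb x y) \<le> 1" "nm (H x y) \<le> 1"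
proof -
  show 1: "nm (La x y) \<le> 1" "nm (Lb x y) \<le> 1" "nm (Ka x y) \<le> 1" "nm (Kb x y) \<le> 1"
    unfolding La_def Lb_def Ka_def Kb_def using assms mu0 mu0'
    by (auto intro!: nm_lin nm_fab nm_add_leI nm_mult_le_1 nm_power_le_1)
  show "nm (H x y) \<le> 1" unfolding H_def using 1 by (intro nm_diff_leI nm_mult_le_1 nm_power_le_1)
qed

lemma H_cg:
  assumes "nm x \<le> 1" "nm y \<le> 1" "nm x' \<le> 1" "nm y' \<le> 1" "cg n x x'" "cg n y y'"
  shows "cg n (H x y) (H x' y')"
proof -
  have L: "cg n (La x y) (La x' y')" "cg n (Lb x y) (Lb x' y')"
    unfolding La_def Lb_def using assms mu0' by (auto intro!: cg_add cg_mult_left)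
  have K: "cg n (Ka x y) (Ka x' y')" "cg n (Kb x y) (Kb x' y')"
    unfolding Ka_def Kb_def using assms mu0 mu0' by (auto intro!: cg_add cg_mult_left fab_cg cg_power)
  show ?thesis unfolding H_def
    using L K nm_LK[OF assms(1,2)] nm_LK[OF assms(3,4)]
    by (intro cg_diff cg_mult cg_power nm_power_le_1)
qed

text \<open>The f_{a,b} parts of \<open>Ka\<close> and \<open>Kb\<close> combine to G_0. The parts
  with the second digits give the polynomial g-bar, whose outer q-th power turns its inner forms
  into forms in x0^(q^2) and y0^(q^2).\<close>

lemma redu_LK:
  assumes "nm x \<le> 1" "nm y \<le> 1" "redu D x = x0" "redu D y = y0"
  shows "redu D (La x y) = x0'" "redu D (Lb x y) = y0'" "redu D (H x y) = fjg"
proof -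
  note n = nm_LK[OF assms(1,2)]
  show r: "redu D (La x y) = x0'" "redu D (Lb x y) = y0'"
    unfolding La_def Lb_def x0'_def y0'_def using assms mu0'
    by (simp_all add: redu_plus redu_times nm_mult_le_1)
  have f: "nm (fab a0 c0 x y) \<le> 1" "nm (fab b0 d0 x y) \<le> 1" using assms mu0 by (auto intro: nm_fab)
  have K: "redu D (Ka x y) = redu D (fab a0 c0 x y) + (ra1 * x0 ^ q ^ 2 + rc1 * y0 ^ q ^ 2)"
    "redu D (Kb x y) = redu D (fab b0 d0 x y) + (rb1 * x0 ^ q ^ 2 + rd1 * y0 ^ q ^ 2)"
    unfolding Ka_def Kb_def using assms mu0' f
    by (simp_all add: redu_plus redu_times redu_power nm_mult_le_1 nm_power_le_1 nm_add_leI)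
  have "eval2 (redu_poly2 D (G0_poly D a0 b0 c0 d0)) x0 y0 = redu D (eval2 (G0_poly D a0 b0 c0 d0) x y)"
    using assms mu0 by (simp add: OFpoly2_eval_redu OFpoly2_G0)
  also have "\<dots> = x0' ^ q * redu D (fab b0 d0 x y) - y0' ^ q * redu D (fab a0 c0 x y)"
    unfolding eval2_G0 La_def[symmetric] Lb_def[symmetric] using n f r
    by (simp add: redu_diff redu_times redu_power nm_mult_le_1 nm_power_le_1)
  finally have G: "eval2 (redu_poly2 D (G0_poly D a0 b0 c0 d0)) x0 y0
     = x0' ^ q * redu D (fab b0 d0 x y) - y0' ^ q * redu D (fab a0 c0 x y)" .
  have "eval2 (gbar_poly D a0 a1 b0 b1 c0 c1 d0 d1) x0 y0
     = (x0' * (rb1 * x0 + rd1 * y0) ^ q - (ra1 * x0 + rc1 * y0) ^ q * y0') ^ q"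
    by (simp add: gbar_poly_def Let_def x0'_def y0'_def)
  also have "\<dots> = x0' ^ q * (rb1 * x0 ^ q ^ 2 + rd1 * y0 ^ q ^ 2) - (ra1 * x0 ^ q ^ 2 + rc1 * y0 ^ q ^ 2) * y0' ^ q"
    by (simp only: frob_k_diff frob_k_add power_mult_distrib redu_frob power_q2)
  finally have N: "eval2 (gbar_poly D a0 a1 b0 b1 c0 c1 d0 d1) x0 y0
     = x0' ^ q * (rb1 * x0 ^ q ^ 2 + rd1 * y0 ^ q ^ 2) - (ra1 * x0 ^ q ^ 2 + rc1 * y0 ^ q ^ 2) * y0' ^ q" .
  have "redu D (H x y) = x0' ^ q * redu D (Kb x y) - redu D (Ka x y) * y0' ^ q"
    unfolding H_def using n r by (simp add: redu_diff redu_times redu_power nm_mult_le_1 nm_power_le_1)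
  then show "redu D (H x y) = fjg" unfolding fjg_def G N K by (simp add: algebra_simps)
qed

text \<open>\<open>\<Delta>\<close> need not be a Teichmueller representative, but the discrepancy
  is a multiple of \<pi>, beyond the precision in use.\<close>

lemma tau_cg: "cg (q ^ 2 * eW) B.\<tau> (\<Delta> * A.\<tau>)"
proof -
  have O: "\<Delta> * A.\<tau> \<in> OF D" using \<Delta>_OF A.tau(1) mu0_OF OF_mult by blast
  have "redu D (\<Delta> * A.\<tau>) = redu D ig"
    using zeta_ig zeta_of_eq[OF ig_OF(1)] A.tau nm_\<Delta> by (simp add: redu_times)
  then have "B.\<tau> = teich D (redu D (\<Delta> * A.\<tau>))" by (simp add: B.\<tau>_def)
  then show ?thesis using teich_near(1)[OF O] by (simp add: cg_def th_uni nm_diff_commute)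
qed

lemma frob_linear:
  assumes "a \<in> mu0 D" "b \<in> mu0 D" "nm x \<le> 1" "nm y \<le> 1" "n \<le> q ^ 2 * eW"
  shows "cg n ((a * x + b * y) ^ q) (a * x ^ q + b * y ^ q)"
  using cg_frob[of "a * x" "b * y" n] assms
  by (simp add: nm_mult_le_1 mu0_nm power_mult_distrib mu0_power)

text \<open>All lifts solve the same equation t^(q^2-1) = -T, because \<open>gammat0\<close> does
  not depend on the component. Forms with coefficients in \<open>mu0 D\<close> commute with q-th
  powers modulo \<pi>, so the linear image of the old lifts solves it up to \<pi>.\<close>

lemma yh'_near: "cg (q ^ 2 * eW) B.yh (Lb A.xh A.yh)"
proof -
  define v where "v = Lb A.xh A.yh"
  have h: "nm A.xh \<le> 1" "nm A.yh \<le> 1" using A.hat by auto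
  have nv: "nm v \<le> 1" "redu D v = y0'" unfolding v_def using nm_LK redu_LK h A.hat by auto
  have v1: "nm v = 1" using redu_nz_iff[OF nv(1)] nv(2) B.xy0 by simp
  have "cg (q ^ 2 * eW) ((v ^ q) ^ q) ((b0 * A.xh ^ q + d0 * A.yh ^ q) ^ q)"
    unfolding v_def Lb_def using h mu0
    by (intro cg_power frob_linear nm_power_le_1 nm_lin) auto
  also have "cg (q ^ 2 * eW) \<dots> (b0 * (A.xh ^ q) ^ q + d0 * (A.yh ^ q) ^ q)"
    using h mu0 by (intro frob_linear nm_power_le_1) auto
  also have "\<dots> = v * (- A.T)" by (simp only: A.hat_q2) (simp add: v_def Lb_def algebra_simps)
  also have "(v ^ q) ^ q = v * v ^ (q ^ 2 - 1)"
    using power_minus_mult[of "q ^ 2" v] q_pos by (simp add: power_q2 mult.commute)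
  finally have "cg (0 + q ^ 2 * eW) (v * v ^ (q ^ 2 - 1)) (v * (- A.T))" by simp
  then have c: "cg (q ^ 2 * eW) (v ^ (q ^ 2 - 1)) (- A.T)" by (rule cg_cancel[rotated]) (simp add: v1)
  have yT: "B.yh ^ (q ^ 2 - 1) = - A.T" using yhat_props(3)[OF B.xy0(5)] by (simp add: B.yh_def)
  have "nm (v - B.yh) < 1" using redu_eq_iff[OF nv(1), of B.yh] nv(2) B.hat by simp
  then have "nm (v - B.yh) = nm (v ^ (q ^ 2 - 1) - B.yh ^ (q ^ 2 - 1))"
    using power_diff_unit[OF of_nat_q21_k v1, of B.yh] B.hat by simp
  then have "cg (q ^ 2 * eW) v B.yh" using c unfolding yT cg_def by simp
  then show ?thesis unfolding v_def by (rule cg_sym)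
qed

lemma act_eq: "act D g (X, Y, u) =
   (comb u (a0 + a1 * \<varpi>) X (c0 + c1 * \<varpi>) Y, comb u (b0 + b1 * \<varpi>) X (d0 + d1 * \<varpi>) Y, u)"
  by (simp add: act_def g_entries)

text \<open>Division by kappa turns X^(q^2) into w^q x^(q^2), because kappa^(q^2) = kappa
  w^q.\<close>

lemma act_xy:
  assumes s: "s \<in> affinoid D i (x0, y0)"
  defines "x \<equiv> x_fn D s" and "y \<equiv> y_fn D s"
  shows "cg (eW + 1) (x_fn D (act D g s)) (La x y + w_const D ^ q * Ka x y)"
    "cg (eW + 1) (y_fn D (act D g s)) (Lb x y + w_const D ^ q * Kb x y)"
    "act D g s \<in> Y22 D"
proof -
  obtain X Y u where XYu: "s = (X, Y, u)" by (cases s)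
  note au = A.affinoid_u[OF s[unfolded XYu]]
  have XY: "X = kappa D * x" "Y = kappa D * y" using consts_nz by (simp_all add: x_def y_def x_fn_def y_fn_def XYu)
  have kw: "kappa D ^ q ^ 2 = kappa D * w_const D ^ q"
    using power_minus_mult[of "q ^ 2" "kappa D"] q_pos by (metis kappa_w mult.commute zero_less_power)
  have kk: "kappa D * (t / kappa D) = t" for t using consts_nz by simp
  have e: "q ^ 3 + 1 = q + (eW + 1)" using th_exps by simp
  have K: "cg (eW + 1) (comb u (s0 + s1 * \<varpi>) X (t0 + t1 * \<varpi>) Y / kappa D)
      (s0 * x + t0 * y + w_const D ^ q * (fab s0 t0 x y + s1 * x ^ q ^ 2 + t1 * y ^ q ^ 2))"
    if "s0 \<in> mu0 D" "s1 \<in> mu0 D" "t0 \<in> mu0 D" "t1 \<in> mu0 D" for s0 s1 t0 t1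
  proof (rule cg_cancel[OF nm_kappa])
    have "cg (q ^ 3 + 1) (comb u (s0 + s1 * \<varpi>) X (t0 + t1 * \<varpi>) Y)
      (s0 * X + t0 * Y + fab s0 t0 X Y + s1 * X ^ q ^ 2 + t1 * Y ^ q ^ 2)"
      using au that by (intro comb_leading) auto
    also have "s0 * X + t0 * Y + fab s0 t0 X Y + s1 * X ^ q ^ 2 + t1 * Y ^ q ^ 2
      = kappa D * (s0 * x + t0 * y + w_const D ^ q * (fab s0 t0 x y + s1 * x ^ q ^ 2 + t1 * y ^ q ^ 2))"
      unfolding XY fab_scale power_mult_distrib kw by (simp add: algebra_simps)
    finally show "cg (q + (eW + 1)) (kappa D * (comb u (s0 + s1 * \<varpi>) X (t0 + t1 * \<varpi>) Y / kappa D))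
      (kappa D * (s0 * x + t0 * y + w_const D ^ q * (fab s0 t0 x y + s1 * x ^ q ^ 2 + t1 * y ^ q ^ 2)))"
      unfolding kk by (simp only: e)
  qed
  show "cg (eW + 1) (x_fn D (act D g s)) (La x y + w_const D ^ q * Ka x y)"
    "cg (eW + 1) (y_fn D (act D g s)) (Lb x y + w_const D ^ q * Kb x y)"
    unfolding XYu act_eq x_fn_def y_fn_def La_def Lb_def Ka_def Kb_def
    using K[OF mu0(1) mu0(2) mu0(5) mu0(6)] K[OF mu0(3) mu0(4) mu0(7) mu0(8)] by simp_all
  have "is_level2_basis D u (comb u (a0 + a1 * \<varpi>) X (c0 + c1 * \<varpi>) Y) (comb u (b0 + b1 * \<varpi>) X (d0 + d1 * \<varpi>) Y)"
  proof (rule level2_basis_transform)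
    show "nm ((a0 + a1 * \<varpi>) * (d0 + d1 * \<varpi>) - (b0 + b1 * \<varpi>) * (c0 + c1 * \<varpi>)) = 1"
      using det_OF(2) by (simp add: det_2 g_entries)
  qed (use au mu0' in \<open>auto intro!: OF_add OF_mult\<close>)
  then show "act D g s \<in> Y22 D"
    using s unfolding XYu act_eq by (auto simp: affinoid_def Y22_component_def Y22_def LT_curve_def)
qed

text \<open>The delicate point is membership in the component of \<open>ig\<close>. Its invariant is
  E plus an f_1 term, with E measured at scale gamma^(q/(q-1)), which equals both (w^q)^q and gamma
  w^q. So the correction w^q H to the Moore determinant enters E twice, as H^q through m'^q and as H
  through gamma m_3', and \<open>c0_transform\<close> says that the outcome is the right
  constant.\<close>

lemma act_affinoid:
  assumes s: "s \<in> affinoid D i (x0, y0)"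
  defines "x \<equiv> x_fn D s" and "y \<equiv> y_fn D s"
  shows "act D g s \<in> affinoid D ig (x0', y0')"
    "cg 1 (a_fn D ig (x0', y0') (act D g s)) (\<Delta> * a_fn D i (x0, y0) s + H A.xh A.yh)"
    "cg 1 (z1_fn D ig (x0', y0') (act D g s)) (z1_fn D i (x0, y0) s)"
proof -
  define s' where "s' = act D g s"
  define x' where "x' = x_fn D s'"
  define y' where "y' = y_fn D s'"
  define m where "m = moore_fn D s"
  define m' where "m' = moore_fn D s'"
  define z where "z = z1_fn D i (x0, y0) s"
  let ?w = "w_const D ^ q" and ?g2 = "gamma_q_over_q1 D" and ?N = "q ^ 2 * eW"
  note b = A.affinoid_basic[OF s, folded x_def y_def m_def z_def]
  note ax = A.affinoid_x[OF s, folded x_def y_def z_def]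
  note aE = A.affinoid_E[OF s, folded m_def]
  note tx = act_xy[OF s, folded x_def y_def s'_def, folded x'_def y'_def]
  have n: "nm x \<le> 1" "nm y \<le> 1" using b by auto
  have h: "nm A.xh \<le> 1" "nm A.yh \<le> 1" using A.hat by auto
  define la where "la = La x y"
  define lb where "lb = Lb x y"
  define ka where "ka = Ka x y"
  define kb where "kb = Kb x y"
  define hh where "hh = H x y"
  have nlk: "nm la \<le> 1" "nm lb \<le> 1" "nm ka \<le> 1" "nm kb \<le> 1" "nm hh \<le> 1"
    unfolding la_def lb_def ka_def kb_def hh_def by (rule nm_LK[OF n])+
  have rlk: "redu D la = x0'" "redu D lb = y0'" "redu D hh = fjg"
    unfolding la_def lb_def hh_def using redu_LK n b by auto
  have tx1: "cg (eW + 1) x' (la + ?w * ka)" "cg (eW + 1) y' (lb + ?w * kb)"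
    using tx by (simp_all add: la_def lb_def ka_def kb_def)
  have wk: "nm (?w * t) \<le> \<theta> ^ eW" if "nm t \<le> 1" for t using that by (intro nm_mult_le_left) (simp_all add: nm_wq)
  have txW: "cg eW x' la" "cg eW y' lb"
    using cg_trans[OF cg_mono[OF tx1(1)] cg_0_add[OF wk]] cg_trans[OF cg_mono[OF tx1(2)] cg_0_add[OF wk]] nlk by auto
  have nx': "nm x' \<le> 1" "nm y' \<le> 1" using cg_nm_le_1[OF txW(1)] cg_nm_le_1[OF txW(2)] nlk by auto
  have eW0: "0 < eW" using pos_exps by simp
  have rx': "redu D x' = x0'" "redu D y' = y0'"
    using cg_redu[OF txW(1) eW0] cg_redu[OF txW(2) eW0] nlk rlk by auto
  have nlkw: "nm (la + ?w * ka) \<le> 1" "nm (lb + ?w * kb) \<le> 1"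
    using cg_nm_le_1[OF cg_sym[OF tx1(1)]] cg_nm_le_1[OF cg_sym[OF tx1(2)]] nx' by auto
  have EN: "eW + 1 \<le> ?N" using exps by simp
  have xq: "cg (eW + 1) (x' ^ q) (la ^ q)" "cg (eW + 1) (y' ^ q) (lb ^ q)"
    using txW nx' nlk th_exps(10) EN by (auto intro!: cg_power_q)
  have m'_eq: "m' = x' ^ q * y' - x' * y' ^ q" and m_eq: "m = x ^ q * y - x * y ^ q"
    by (simp_all add: m'_def m_def moore_fn_def x'_def y'_def x_def y_def)
  have nm: "nm m \<le> 1" "nm m' \<le> 1"
    unfolding m_eq m'_eq using n nx' by (auto intro!: nm_diff_leI nm_mult_le_1 nm_power_le_1)
  have frl: "cg k (la ^ q) (a0 * x ^ q + c0 * y ^ q)" "cg k (lb ^ q) (b0 * x ^ q + d0 * y ^ q)" if "k \<le> ?N" for k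
    unfolding la_def lb_def La_def Lb_def using mu0 n that by (auto intro!: frob_linear)
  have lin1: "nm (t1 * x ^ k + t2 * y ^ k) \<le> 1" if "t1 \<in> mu0 D" "t2 \<in> mu0 D" for t1 t2 k
    using that n by (intro nm_lin nm_power_le_1)
  have lm: "cg ?N (la ^ q * lb - la * lb ^ q) (\<Delta> * m)"
  proof -
    have "cg ?N (la ^ q * lb - la * lb ^ q) ((a0 * x ^ q + c0 * y ^ q) * lb - la * (b0 * x ^ q + d0 * y ^ q))"
      using nlk by (intro cg_diff cg_mult_right cg_mult_left frl) auto
    also have "\<dots> = \<Delta> * m" by (simp add: la_def lb_def La_def Lb_def \<Delta>_def m_eq algebra_simps)
    finally show ?thesis .
  qed
  have hh: "hh = la ^ q * kb - ka * lb ^ q" by (simp add: hh_def H_def la_def lb_def ka_def kb_def)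
  have cm': "cg (eW + 1) m' (\<Delta> * m + ?w * hh)"
  proof -
    have "cg (eW + 1) m' (la ^ q * (lb + ?w * kb) - (la + ?w * ka) * lb ^ q)"
      unfolding m'_eq using xq tx1 nx' nlk nlkw by (intro cg_diff cg_mult nm_power_le_1)
    also have "\<dots> = (la ^ q * lb - la * lb ^ q) + ?w * hh" by (simp add: hh algebra_simps)
    also have "cg (eW + 1) \<dots> (\<Delta> * m + ?w * hh)" by (intro cg_add cg_refl cg_mono[OF lm EN])
    finally show ?thesis .
  qed
  have nDm: "nm (\<Delta> * m) \<le> 1" "nm (?w * hh) \<le> 1"
    using nm nm_\<Delta> wk[OF nlk(5)] th_le_1[of eW] by (auto simp: nm_mult)
  have nDmw: "nm (\<Delta> * m + ?w * hh) \<le> 1" using nDm by (rule nm_add_leI)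
  have rm': "redu D m' = redu D \<Delta> * A.\<zeta>"
  proof -
    have "redu D m' = redu D (\<Delta> * m + ?w * hh)" by (rule cg_redu[OF cm' _ nDmw]) simp
    also have "\<dots> = redu D (\<Delta> * m)"
      by (rule cg_redu[OF cg_0_add[OF wk[OF nlk(5)]] eW0 nDm(1)])
    finally show ?thesis using aE(3) nm nm_\<Delta> by (simp add: redu_times)
  qed
  define A3 where "A3 = x ^ q ^ 3"
  define B3 where "B3 = y ^ q ^ 3"
  define m3 where "m3 = A3 * y - x * B3"
  define m3' where "m3' = x' ^ q ^ 3 * y' - x' * y' ^ q ^ 3"
  have nA3: "nm A3 \<le> 1" "nm B3 \<le> 1" unfolding A3_def B3_def using n by (auto intro: nm_power_le_1)
  have p3: "t ^ q ^ 3 = ((t ^ q) ^ q) ^ q" for t :: 'c by (simp add: power_mult power3_eq_cube mult.assoc)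
  have q3: "cg (eW + 1) (t ^ q ^ 3) (t1 * A3 + t2 * B3)"
    if "cg (eW + 1) (t ^ q) (l ^ q)" "l = t1 * x + t2 * y" "nm t \<le> 1" "t1 \<in> mu0 D" "t2 \<in> mu0 D" for t l t1 t2
  proof -
    have nl: "nm l \<le> 1" unfolding that(2) using that n by (intro nm_lin)
    have "cg (eW + 1) (((t ^ q) ^ q) ^ q) (((l ^ q) ^ q) ^ q)"
      by (rule cg_power[OF cg_power[OF that(1)]]) (use that nl in \<open>auto intro!: nm_power_le_1\<close>)
    also have "cg (eW + 1) \<dots> (((t1 * x ^ q + t2 * y ^ q) ^ q) ^ q)"
      unfolding that(2) using that n EN by (intro cg_power frob_linear nm_power_le_1 nm_lin)
    also have "cg (eW + 1) \<dots> ((t1 * (x ^ q) ^ q + t2 * (y ^ q) ^ q) ^ q)"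
      using that n EN by (intro cg_power frob_linear nm_power_le_1 nm_lin)
    also have "cg (eW + 1) \<dots> (t1 * ((x ^ q) ^ q) ^ q + t2 * ((y ^ q) ^ q) ^ q)"
      using that n EN by (intro frob_linear nm_power_le_1)
    finally show ?thesis by (simp add: A3_def B3_def p3)
  qed
  have x3: "cg (eW + 1) (x' ^ q ^ 3) (a0 * A3 + c0 * B3)" "cg (eW + 1) (y' ^ q ^ 3) (b0 * A3 + d0 * B3)"
    using q3[OF xq(1)] q3[OF xq(2)] nx' mu0 by (auto simp: la_def lb_def La_def Lb_def)
  have close: "cg 1 x A.xh" "cg 1 y A.yh" using cg_mono ax exps(9) by blast+
  \<comment> \<open>Near the lifts x^(q^2) is close to -x, so the third Frobenius twist is minus the
    first. This produces the minus sign in front of H in m_3'.\<close>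
  have A3n: "cg 1 A3 (- (x ^ q))" "cg 1 B3 (- (y ^ q))"
  proof -
    have "cg 1 (t ^ q ^ 3) (- (t ^ q))" if "cg 1 t th" "nm t \<le> 1" "nm th \<le> 1" "cg 1 (th ^ q ^ 3) (- (th ^ q))" for t th
      using cg_trans[OF cg_trans[OF cg_power[OF that(1-3)] that(4)] cg_minus[OF cg_power[OF cg_sym[OF that(1)] that(3,2)]]] .
    then show "cg 1 A3 (- (x ^ q))" "cg 1 B3 (- (y ^ q))"
      unfolding A3_def B3_def using close n h A.hat_q3 by blast+
  qed
  have ABm: "cg 1 ((a0 * A3 + c0 * B3) * kb - ka * (b0 * A3 + d0 * B3)) (- hh)"
  proof -
    have N1: "1 \<le> ?N" using EN by linarith
    have "cg 1 (a0 * A3 + c0 * B3) (- (la ^ q))"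
    proof -
      have "cg 1 (a0 * A3 + c0 * B3) (a0 * (- (x ^ q)) + c0 * (- (y ^ q)))"
        using mu0' by (intro cg_add cg_mult_left A3n)
      also have "\<dots> = - (a0 * x ^ q + c0 * y ^ q)" by simp
      also have "cg 1 \<dots> (- (la ^ q))" by (intro cg_minus cg_sym[OF frl(1)] N1)
      finally show ?thesis .
    qed
    moreover have "cg 1 (b0 * A3 + d0 * B3) (- (lb ^ q))"
    proof -
      have "cg 1 (b0 * A3 + d0 * B3) (b0 * (- (x ^ q)) + d0 * (- (y ^ q)))"
        using mu0' by (intro cg_add cg_mult_left A3n)
      also have "\<dots> = - (b0 * x ^ q + d0 * y ^ q)" by simp
      also have "cg 1 \<dots> (- (lb ^ q))" by (intro cg_minus cg_sym[OF frl(2)] N1)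
      finally show ?thesis .
    qed
    ultimately have "cg 1 ((a0 * A3 + c0 * B3) * kb - ka * (b0 * A3 + d0 * B3)) (- (la ^ q) * kb - ka * (- (lb ^ q)))"
      using nlk by (intro cg_diff cg_mult_right cg_mult_left)
    then show ?thesis by (simp add: hh)
  qed
  have cm3: "cg (eW + 1) m3' (\<Delta> * m3 - ?w * hh)"
  proof -
    have "cg (eW + 1) m3' ((a0 * A3 + c0 * B3) * (lb + ?w * kb) - (la + ?w * ka) * (b0 * A3 + d0 * B3))"
      unfolding m3'_def using x3 tx1 nx' nlkw mu0 nA3
      by (intro cg_diff cg_mult nm_power_le_1 nm_lin)
    also have "\<dots> = \<Delta> * m3 + ?w * ((a0 * A3 + c0 * B3) * kb - ka * (b0 * A3 + d0 * B3))"
      by (simp add: m3_def \<Delta>_def la_def lb_def La_def Lb_def algebra_simps)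
    also have "cg (eW + 1) \<dots> (\<Delta> * m3 + ?w * (- hh))"
      by (intro cg_add cg_refl cg_scale[OF _ ABm]) (simp add: nm_wq)
    finally show ?thesis by simp
  qed
  have gw: "?g2 = ?w ^ q" by (simp add: gamma_q_over_q1_def w_const_def power_mult[symmetric] power2_eq_square ac_simps)
  have lev: "q * eW + 1 \<le> ?N" using th_exps by simp
  have cmq: "cg (q * eW + 1) (m' ^ q) (\<Delta> * m ^ q + ?g2 * hh ^ q)"
  proof -
    have "cg (q * eW + 1) (m' ^ q) ((\<Delta> * m + ?w * hh) ^ q)"
      using cm' nm nDmw th_exps lev by (intro cg_power_q) auto
    also have "cg (q * eW + 1) \<dots> ((\<Delta> * m) ^ q + (?w * hh) ^ q)" by (rule cg_frob[OF nDm lev])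
    also have "\<dots> = \<Delta> ^ q * m ^ q + ?g2 * hh ^ q" by (simp add: power_mult_distrib gw)
    also have "cg (q * eW + 1) \<dots> (\<Delta> * m ^ q + ?g2 * hh ^ q)"
    proof (intro cg_add cg_refl cg_mult_right nm_power_le_1 nm)
      have "redu D (\<Delta> ^ q) = redu D \<Delta>"
        using nm_\<Delta> \<Delta>_OF by (simp add: redu_power Fq_power_q Fq_redu)
      then have "nm (\<Delta> ^ q - \<Delta>) < 1" using nm_\<Delta> by (subst redu_eq_iff[symmetric]) (auto simp: nm_power)
      then have "nm (\<Delta> ^ q - \<Delta>) \<le> nm \<varpi>" by (intro OF_div_uni OF_diff OF_power \<Delta>_OF)
      then show "cg (q * eW + 1) (\<Delta> ^ q) \<Delta>" by (rule cg_uni[OF _ lev])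
    qed
    finally show ?thesis .
  qed
  have cZ: "calZ_fn D s = m ^ q - gamma D * m3" "calZ_fn D s' = m' ^ q - gamma D * m3'"
    by (simp_all add: calZ_fn_def m_def m3_def m'_def m3'_def A3_def B3_def x_def y_def x'_def y'_def)
  have cgm: "cg (q * eW + 1) (gamma D * m3') (gamma D * (\<Delta> * m3 - ?w * hh))"
  proof -
    have "cg (q * e1 + (eW + 1)) (gamma D * m3') (gamma D * (\<Delta> * m3 - ?w * hh))"
      by (rule cg_scale[OF _ cm3]) (simp add: nm_consts)
    then show ?thesis using th_exps by (simp add: add.assoc[symmetric])
  qed
  define E where "E = (A.\<tau> * gamma0 D - calZ_fn D s) / ?g2"
  define E' where "E' = (B.\<tau> * gamma0 D - calZ_fn D s') / ?g2"
  have gE: "?g2 * E = A.\<tau> * gamma0 D - calZ_fn D s" "?g2 * E' = B.\<tau> * gamma0 D - calZ_fn D s'"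
    using consts_nz by (simp_all add: E_def E'_def)
  have cE: "cg 1 E' (\<Delta> * E - (hh ^ q + hh))"
  proof (rule cg_cancel[OF nm_consts(4)])
    have "cg (q * eW + 1) (B.\<tau> * gamma0 D - (m' ^ q - gamma D * m3'))
        (\<Delta> * A.\<tau> * gamma0 D - ((\<Delta> * m ^ q + ?g2 * hh ^ q) - gamma D * (\<Delta> * m3 - ?w * hh)))"
      by (intro cg_diff cmq cgm cg_mult_right nm_gamma0_le cg_mono[OF tau_cg lev])
    also have "\<Delta> * A.\<tau> * gamma0 D - ((\<Delta> * m ^ q + ?g2 * hh ^ q) - gamma D * (\<Delta> * m3 - ?w * hh))
        = \<Delta> * (?g2 * E) - ?g2 * (hh ^ q + hh)"
      unfolding gE cZ by (simp add: gamma_w[symmetric] algebra_simps)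
    also have "\<dots> = ?g2 * (\<Delta> * E - (hh ^ q + hh))" by (simp add: algebra_simps)
    finally show "cg (q * eW + 1) (?g2 * E') (?g2 * (\<Delta> * E - (hh ^ q + hh)))" by (simp add: gE cZ)
  qed
  have nE: "nm E \<le> 1" "redu D E = c0_const D i (x0, y0)" using aE by (simp_all add: E_def)
  have nr: "nm (\<Delta> * E - (hh ^ q + hh)) \<le> 1"
    using nE nm_\<Delta> nlk by (intro nm_diff_leI nm_add_leI nm_mult_le_1 nm_power_le_1) auto
  have nE': "nm E' \<le> 1" by (rule cg_nm_le_1[OF cE nr])
  have rE': "redu D E' = c0_const D ig (x0', y0')"
  proof -
    have "redu D E' = redu D (\<Delta> * E - (hh ^ q + hh))" by (rule cg_redu[OF cE _ nr]) simp
    also have "\<dots> = redu D \<Delta> * c0_const D i (x0, y0) - (fjg ^ q + fjg)"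
      using nE nm_\<Delta> nlk rlk
      by (simp add: redu_diff redu_plus redu_times redu_power nm_mult_le_1 nm_power_le_1 nm_add_leI)
    finally show ?thesis by (simp only: c0_transform)
  qed
  define F' where "F' = eval2 (f1_poly D) (x' ^ q ^ 2 * y' ^ q) (x' ^ q * y' ^ q ^ 2)"
  have nF': "nm F' \<le> 1" unfolding F'_def using nx' by (intro OFpoly2_eval OFpoly2_f1 nm_mult_le_1 nm_power_le_1)
  have rF': "redu D F' = eval2 (redu_poly2 D (f1_poly D)) (x0' ^ q ^ 2 * y0' ^ q) (x0' ^ q * y0' ^ q ^ 2)"
    unfolding F'_def using nx' rx' by (simp add: OFpoly2_eval_redu OFpoly2_f1 nm_mult_le_1
        nm_power_le_1 redu_times redu_power)
  have comp: "s' \<in> Y22_component D ig"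
  proof -
    have "redu D (E' + F') = mu_of D ig * zeta_of D ig"
      using nE' nF' by (simp add: redu_plus rE' rF' c0_const_def)
    then show ?thesis
      using tx(3) nm(2) rm' nm_add_leI[OF nE' nF'] zeta_ig B.zeta_i
      by (simp add: Y22_component_def reduces_to_iff m'_def[symmetric] E'_def F'_def x'_def y'_def B.\<tau>_def)
  qed
  have EG: "eG + 1 \<le> ?N" "eG + 1 \<le> eW" using exps by auto
  \<comment> \<open>The displacements of x and y are the same multiple of xh^q and yh^q, and the
    form \<open>Lb\<close> takes these q-th powers to that of the new lift; hence z_1 is
    preserved.\<close>
  have cy: "cg (eG + 1) y' (B.yh + B.yh ^ q * gamma_root_qq1 D * z)"
  proof -
    have gz: "nm (gamma_root_qq1 D * z) \<le> 1"
      using b(5) th_le_1[of eG] by (intro nm_mult_le_1) (auto simp: nm_consts)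
    have "cg (eG + 1) y' lb" by (rule cg_mono[OF txW(2) EG(2)])
    also have "cg (eG + 1) lb (b0 * (A.xh + A.xh ^ q * gamma_root_qq1 D * z) + d0 * y)"
      unfolding lb_def Lb_def using mu0' by (intro cg_add cg_mult_left ax cg_refl)
    also have "\<dots> = Lb A.xh A.yh + (b0 * A.xh ^ q + d0 * A.yh ^ q) * (gamma_root_qq1 D * z)"
      by (subst b(6)) (simp add: Lb_def algebra_simps)
    also have "cg (eG + 1) \<dots> (B.yh + B.yh ^ q * (gamma_root_qq1 D * z))"
    proof (intro cg_add cg_mult_right gz)
      show y1: "cg (eG + 1) (Lb A.xh A.yh) B.yh" using cg_sym[OF cg_mono[OF yh'_near EG(1)]] .
      have "cg (eG + 1) (b0 * A.xh ^ q + d0 * A.yh ^ q) (Lb A.xh A.yh ^ q)"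
        unfolding Lb_def using mu0 h EG(1) by (intro cg_sym[OF frob_linear])
      also have "cg (eG + 1) \<dots> (B.yh ^ q)"
        using y1 nm_LK(2)[OF h] B.hat by (intro cg_power) auto
      finally show "cg (eG + 1) (b0 * A.xh ^ q + d0 * A.yh ^ q) (B.yh ^ q)" .
    qed
    finally show ?thesis by (simp add: mult.assoc)
  qed
  have w1: "w1_const D y0' = B.yh ^ q * gamma_root_qq1 D" by (simp add: w1_const_def B.yh_def)
  have nw1: "nm (w1_const D y0') = \<theta> ^ eG" by (simp add: w1 nm_mult nm_power B.hat nm_consts)
  have cy': "cg (eG + 1) (y' - B.yh) (w1_const D y0' * z)"
    using cg_diff[OF cy cg_refl[of _ B.yh]] by (simp add: w1)
  have "nm (y' - B.yh) \<le> \<theta> ^ eG"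
    by (rule cg_nm_le[OF cy']) (use b(5) nw1 in \<open>auto intro: nm_mult_le_left\<close>)
  then have v: "val D (w1_const D y0') \<le> val D (y' - yhat D y0')"
    by (simp add: val_le_iff nw1 B.yh_def)
  show mem: "act D g s \<in> affinoid D ig (x0', y0')"
    using comp nx' rx' v by (simp add: affinoid_def reduces_to_iff s'_def x'_def y'_def)
  have w1nz: "w1_const D y0' \<noteq> 0" using nw1 th by (metis nm_0 power_not_zero less_irrefl)
  show "cg 1 (z1_fn D ig (x0', y0') (act D g s)) (z1_fn D i (x0, y0) s)"
  proof (rule cg_cancel[OF nw1])
    have "w1_const D y0' * z1_fn D ig (x0', y0') s' = y' - B.yh"
      using mem w1nz by (simp add: z1_fn_def s'_def y'_def B.yh_def)
    then show "cg (eG + 1) (w1_const D y0' * z1_fn D ig (x0', y0') (act D g s)) (w1_const D y0' * z1_fn D i (x0, y0) s)"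
      using cy' by (simp add: s'_def z_def)
  qed
  have "cg 1 (a_fn D ig (x0', y0') s') (\<Delta> * a_fn D i (x0, y0) s + hh)"
  proof (rule cg_cancel[OF nm_wq])
    have "?w * a_fn D ig (x0', y0') s' = m' - B.\<tau> * gammat0 D - gamma_root_q D * B.\<tau> * gammat1 D"
      using B.affinoid_basic(7)[OF mem] by (simp add: s'_def m'_def)
    also have "cg (eW + 1) \<dots> ((\<Delta> * m + ?w * hh) - (\<Delta> * A.\<tau>) * gammat0 D - gamma_root_q D * (\<Delta> * A.\<tau>) * gammat1 D)"
    proof (intro cg_diff cm' cg_mult_right cg_mult_left cg_mono[OF tau_cg EN] nm_gammat1_le)
      show "nm (gammat0 D) \<le> 1" by simp
      show "nm (gamma_root_q D) \<le> 1" using th_le_1[of e1] by (simp add: nm_consts)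
    qed
    also have "\<dots> = \<Delta> * (m - A.\<tau> * gammat0 D - gamma_root_q D * A.\<tau> * gammat1 D) + ?w * hh"
      by (simp add: algebra_simps)
    also have "\<dots> = ?w * (\<Delta> * a_fn D i (x0, y0) s + hh)"
      unfolding b(7)[symmetric] by (simp add: algebra_simps)
    finally show "cg (eW + 1) (?w * a_fn D ig (x0', y0') s') (?w * (\<Delta> * a_fn D i (x0, y0) s + hh))" .
  qed
  also have "cg 1 (\<Delta> * a_fn D i (x0, y0) s + hh) (\<Delta> * a_fn D i (x0, y0) s + H A.xh A.yh)"
    unfolding hh_def using n h close by (intro cg_add cg_refl H_cg)
  finally show "cg 1 (a_fn D ig (x0', y0') (act D g s)) (\<Delta> * a_fn D i (x0, y0) s + H A.xh A.yh)"
    by (simp add: s'_def)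
qed

end

context lubin_tate
begin

subsection \<open>Polynomial and analytic functions\<close>

text \<open>The functions \<open>eval3 P\<close>, described inductively so that closure properties
  and bounds follow by rule induction.\<close>

inductive PF :: "('c \<times> 'c \<times> 'c \<Rightarrow> 'c) \<Rightarrow> bool" where
  PF_const: "PF (\<lambda>s. c)"
| PF_X: "PF (\<lambda>s. fst s)"
| PF_Y: "PF (\<lambda>s. fst (snd s))"
| PF_u: "PF (\<lambda>s. snd (snd s))"
| PF_add: "PF f \<Longrightarrow> PF h \<Longrightarrow> PF (\<lambda>s. f s + h s)"
| PF_mult: "PF f \<Longrightarrow> PF h \<Longrightarrow> PF (\<lambda>s. f s * h s)"

lemma PF_diff: "PF f \<Longrightarrow> PF h \<Longrightarrow> PF (\<lambda>s. f s - h s)"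
  using PF_add[OF _ PF_mult[OF PF_const[of "-1"]], of f h] by simp

lemma PF_power: "PF f \<Longrightarrow> PF (\<lambda>s. f s ^ n)"
  by (induction n) (auto intro: PF_const PF_mult)

lemma PF_sum: "(\<And>i. i \<in> I \<Longrightarrow> PF (f i)) \<Longrightarrow> PF (\<lambda>s. \<Sum>i\<in>I. f i s)"
  by (induction I rule: infinite_finite_induct) (auto intro: PF_const PF_add)

lemma PF_divide: "PF f \<Longrightarrow> PF (\<lambda>s. f s / c)"
  using PF_mult[OF PF_const[of "1 / c"], of f] by simp

lemma PF_Au: "Au \<phi> \<Longrightarrow> PF (\<lambda>s. \<phi> (snd (snd s)))"
  by (induction rule: Au.induct) (auto intro: PF.intros)

lemma PF_compose:
  assumes "PF f" "PF A" "PF B" "PF C" shows "PF (\<lambda>s. f (A s, B s, C s))"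
  using assms(1) by (induction rule: PF.induct) (auto intro: PF.intros assms)

lemma eval3_pCons: "eval3 (pCons p P) s = eval2 p (snd (snd s)) (fst (snd s)) + fst s * eval3 P s"
  by (cases s) (simp add: eval3_def eval2_def)

lemma PF_eval3: "PF (eval3 P)"
proof -
  have 1: "PF (\<lambda>s. poly p (snd (snd s)))" for p
  proof (induction p)
    case 0 then show ?case using PF_const[of 0] by simp
  next
    case (pCons a p)
    then show ?case using PF_add[OF PF_const[of a] PF_mult[OF PF_u pCons.IH]] by simp
  qed
  have 2: "PF (\<lambda>s. eval2 p (snd (snd s)) (fst (snd s)))" for p
  proof (induction p)
    case 0 then show ?case using PF_const[of 0] by simp
  next
    case (pCons a p)
    then show ?case using PF_add[OF 1[of a] PF_mult[OF PF_Y pCons.IH]] by (simp add: eval2_pCons)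
  qed
  have "PF (\<lambda>s. eval3 P s)"
  proof (induction P)
    case 0
    then show ?case using PF_const[of 0] by (simp add: eval3_def case_prod_unfold)
  next
    case (pCons p P)
    then show ?case using PF_add[OF 2[of p] PF_mult[OF PF_X pCons.IH]] by (simp add: eval3_pCons)
  qed
  then show ?thesis by simp
qed

lemma PF_imp_eval3: "PF f \<Longrightarrow> \<exists>P. f = eval3 P"
proof (induction rule: PF.induct)
  case (PF_const c)
  show ?case by (rule exI[of _ "[:[:[:c:]:]:]"]) (simp add: eval3_def fun_eq_iff)
next
  case PF_X
  show ?case by (rule exI[of _ "[:0, 1:]"]) (simp add: eval3_def fun_eq_iff)
next
  case PF_Y
  show ?case by (rule exI[of _ "[:[:0, 1:]:]"]) (simp add: eval3_def fun_eq_iff)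
next
  case PF_u
  show ?case by (rule exI[of _ "[:[:[:0, 1:]:]:]"]) (simp add: eval3_def fun_eq_iff)
next
  case (PF_add f h)
  then obtain P Q where "f = eval3 P" "h = eval3 Q" by blast
  then show ?case by (intro exI[of _ "P + Q"]) (simp add: eval3_def fun_eq_iff)
next
  case (PF_mult f h)
  then obtain P Q where "f = eval3 P" "h = eval3 Q" by blast
  then show ?case by (intro exI[of _ "P * Q"]) (simp add: eval3_def fun_eq_iff)
qed

definition unitball :: "('c \<times> 'c \<times> 'c) set" where
  "unitball = {s. nm (fst s) \<le> 1 \<and> nm (fst (snd s)) \<le> 1 \<and> nm (snd (snd s)) \<le> 1}"

definition near :: "real \<Rightarrow> 'c \<times> 'c \<times> 'c \<Rightarrow> 'c \<times> 'c \<times> 'c \<Rightarrow> bool" where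
  "near e s t \<longleftrightarrow> nm (fst s - fst t) \<le> e \<and> nm (fst (snd s) - fst (snd t)) \<le> e
     \<and> nm (snd (snd s) - snd (snd t)) \<le> e"

text \<open>Bounds and Lipschitz constants on the unit polydisc are what allow an approximation of
  the action to be substituted into a rational function.\<close>

lemma PF_lipschitz:
  assumes "PF f"
  obtains C where "0 < C" "\<And>s. s \<in> unitball \<Longrightarrow> nm (f s) \<le> C"
    "\<And>e s t. s \<in> unitball \<Longrightarrow> t \<in> unitball \<Longrightarrow> near e s t \<Longrightarrow> nm (f s - f t) \<le> C * e"
proof -
  have "\<exists>C>0. (\<forall>s\<in>unitball. nm (f s) \<le> C)
    \<and> (\<forall>e. \<forall>s\<in>unitball. \<forall>t\<in>unitball. near e s t \<longrightarrow> nm (f s - f t) \<le> C * e)"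
    using assms
  proof (induction rule: PF.induct)
    case (PF_const c)
    have "0 \<le> e" if "near e s t" for e s t
      using that nm_ge_0[of "fst s - fst t"] unfolding near_def by linarith
    then show ?case by (intro exI[of _ "nm c + 1"]) (auto simp: add_nonneg_pos)
  next
    case (PF_add f h)
    obtain C1 where C1: "0 < C1" "\<forall>s\<in>unitball. nm (f s) \<le> C1"
      "\<forall>e. \<forall>s\<in>unitball. \<forall>t\<in>unitball. near e s t \<longrightarrow> nm (f s - f t) \<le> C1 * e"
      using PF_add.IH(1) by blast
    obtain C2 where C2: "0 < C2" "\<forall>s\<in>unitball. nm (h s) \<le> C2"
      "\<forall>e. \<forall>s\<in>unitball. \<forall>t\<in>unitball. near e s t \<longrightarrow> nm (h s - h t) \<le> C2 * e"
      using PF_add.IH(2) by blast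
    note C = C1(1) C1(2)[rule_format] C1(3)[rule_format] C2(1) C2(2)[rule_format] C2(3)[rule_format]
    show ?case
    proof (intro exI[of _ "max C1 C2"] conjI ballI allI impI)
      show "0 < max C1 C2" using C by simp
      fix s assume "s \<in> unitball"
      then show "nm (f s + h s) \<le> max C1 C2" using C(2)[of s] C(5)[of s] by (intro nm_add_leI) auto
    next
      fix e s t assume a: "s \<in> unitball" "t \<in> unitball" "near e s t"
      then have e: "0 \<le> e" using nm_ge_0[of "fst s - fst t"] unfolding near_def by linarith
      have "nm (f s - f t) \<le> max C1 C2 * e" "nm (h s - h t) \<le> max C1 C2 * e"
        using C(3)[OF a] C(6)[OF a] mult_right_mono[OF max.cobounded1[of C1 C2] e]
          mult_right_mono[OF max.cobounded2[of C2 C1] e] by linarith+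
      then have "nm ((f s - f t) + (h s - h t)) \<le> max C1 C2 * e" by (rule nm_add_leI)
      then show "nm (f s + h s - (f t + h t)) \<le> max C1 C2 * e" by (simp add: algebra_simps)
    qed
  next
    case (PF_mult f h)
    obtain C1 where C1: "0 < C1" "\<forall>s\<in>unitball. nm (f s) \<le> C1"
      "\<forall>e. \<forall>s\<in>unitball. \<forall>t\<in>unitball. near e s t \<longrightarrow> nm (f s - f t) \<le> C1 * e"
      using PF_mult.IH(1) by blast
    obtain C2 where C2: "0 < C2" "\<forall>s\<in>unitball. nm (h s) \<le> C2"
      "\<forall>e. \<forall>s\<in>unitball. \<forall>t\<in>unitball. near e s t \<longrightarrow> nm (h s - h t) \<le> C2 * e"
      using PF_mult.IH(2) by blast
    note C = C1(1) C1(2)[rule_format] C1(3)[rule_format] C2(1) C2(2)[rule_format] C2(3)[rule_format]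
    show ?case
    proof (intro exI[of _ "C1 * C2"] conjI ballI allI impI)
      show "0 < C1 * C2" using C by simp
      fix s assume "s \<in> unitball"
      then show "nm (f s * h s) \<le> C1 * C2" using C(2)[of s] C(5)[of s] by (intro nm_mult_le) auto
    next
      fix e s t assume a: "s \<in> unitball" "t \<in> unitball" "near e s t"
      have "nm ((f s - f t) * h s) \<le> (C1 * e) * C2" "nm (f t * (h s - h t)) \<le> C1 * (C2 * e)"
        by (rule nm_mult_le[OF C(3)[OF a] C(5)[OF a(1)]], rule nm_mult_le[OF C(2)[OF a(2)] C(6)[OF a]])
      then have "nm ((f s - f t) * h s + f t * (h s - h t)) \<le> C1 * C2 * e"
        by (intro nm_add_leI) (simp_all add: ac_simps)
      then show "nm (f s * h s - f t * h t) \<le> C1 * C2 * e" by (simp add: algebra_simps)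
    qed
  qed (rule exI[of _ 1], simp add: unitball_def near_def)+
  then obtain C where "0 < C" "\<forall>s\<in>unitball. nm (f s) \<le> C"
    "\<forall>e. \<forall>s\<in>unitball. \<forall>t\<in>unitball. near e s t \<longrightarrow> nm (f s - f t) \<le> C * e"
    by blast
  then show ?thesis by (intro that[of C]) blast+
qed

lemma analytic_iff: "h \<in> analytic_functions S \<longleftrightarrow> h \<in> extensional S \<and>
  (\<forall>\<epsilon>>0. \<exists>f k. \<exists>\<delta>>0. PF f \<and> PF k \<and> (\<forall>s\<in>S. \<delta> \<le> nm (k s) \<and> nm (h s - f s / k s) < \<epsilon>))"
proof -
  have "(\<exists>P Q. \<exists>\<delta>>0. \<forall>s\<in>S. \<delta> \<le> dist (eval3 Q s) 0 \<and> dist (h s) (eval3 P s / eval3 Q s) < \<epsilon>)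
    \<longleftrightarrow> (\<exists>f k. \<exists>\<delta>>0. PF f \<and> PF k \<and> (\<forall>s\<in>S. \<delta> \<le> nm (k s) \<and> nm (h s - f s / k s) < \<epsilon>))" (is "?L = ?R") for \<epsilon>
  proof
    assume ?L
    then obtain P Q \<delta> where "0 < \<delta>" "\<forall>s\<in>S. \<delta> \<le> nm (eval3 Q s) \<and> nm (h s - eval3 P s / eval3 Q s) < \<epsilon>"
      unfolding dist_eq_nm by auto
    then show ?R using PF_eval3 by blast
  next
    assume ?R
    then obtain f k \<delta> where 1: "0 < \<delta>" "PF f" "PF k" "\<forall>s\<in>S. \<delta> \<le> nm (k s) \<and> nm (h s - f s / k s) < \<epsilon>"
      by blast
    obtain P where P: "f = eval3 P" using PF_imp_eval3[OF 1(2)] by blast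
    obtain Q where Q: "k = eval3 Q" using PF_imp_eval3[OF 1(3)] by blast
    have "\<forall>s\<in>S. \<delta> \<le> dist (eval3 Q s) 0 \<and> dist (h s) (eval3 P s / eval3 Q s) < \<epsilon>"
      using 1(4) unfolding P Q dist_eq_nm by simp
    then show ?L using 1(1) by blast
  qed
  then show ?thesis by (simp add: analytic_functions_def)
qed

lemma analytic_ext: "h \<in> analytic_functions S \<Longrightarrow> h \<in> extensional S"
  by (simp add: analytic_functions_def)

lemma analytic_PF:
  assumes "PF f" shows "restrict f S \<in> analytic_functions S"
  unfolding analytic_iff
proof (intro conjI allI impI)
  fix \<epsilon> :: real assume "0 < \<epsilon>"
  then show "\<exists>f' k. \<exists>\<delta>>0. PF f' \<and> PF k \<and> (\<forall>s\<in>S. \<delta> \<le> nm (k s) \<and> nm (restrict f S s - f' s / k s) < \<epsilon>)"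
    by (intro exI[of _ f] exI[of _ "\<lambda>_. 1"] exI[of _ 1]) (simp add: assms PF_const)
qed simp

lemma analytic_add:
  assumes "h \<in> analytic_functions (S :: ('c \<times> 'c \<times> 'c) set)" "h' \<in> analytic_functions S"
  shows "(\<lambda>s\<in>S. h s + h' s) \<in> analytic_functions S"
  unfolding analytic_iff
proof (intro conjI allI impI)
  fix \<epsilon> :: real assume e: "0 < \<epsilon>"
  obtain f k \<delta> where 1: "0 < \<delta>" "PF f" "PF k" "\<And>s. s \<in> S \<Longrightarrow> \<delta> \<le> nm (k s)" "\<And>s. s \<in> S \<Longrightarrow> nm (h s - f s / k s) < \<epsilon>"
    using assms(1) e unfolding analytic_iff by meson
  obtain f' k' \<delta>' where 2: "0 < \<delta>'" "PF f'" "PF k'" "\<And>s. s \<in> S \<Longrightarrow> \<delta>' \<le> nm (k' s)" "\<And>s. s \<in> S \<Longrightarrow> nm (h' s - f' s / k' s) < \<epsilon>"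
    using assms(2) e unfolding analytic_iff by meson
  have "\<delta> * \<delta>' \<le> nm (k s * k' s) \<and> nm ((\<lambda>s\<in>S. h s + h' s) s - (f s * k' s + f' s * k s) / (k s * k' s)) < \<epsilon>"
    if s: "s \<in> S" for s
  proof
    show "\<delta> * \<delta>' \<le> nm (k s * k' s)" using 1 2 s by (simp add: nm_mult mult_mono)
    have nz: "k s \<noteq> 0" "k' s \<noteq> 0" using 1(1) 2(1) 1(4)[OF s] 2(4)[OF s] by auto
    have "(\<lambda>s\<in>S. h s + h' s) s - (f s * k' s + f' s * k s) / (k s * k' s) = (h s - f s / k s) + (h' s - f' s / k' s)"
      using nz s by (simp add: add_frac_eq add_diff_add[symmetric])
    then show "nm ((\<lambda>s\<in>S. h s + h' s) s - (f s * k' s + f' s * k s) / (k s * k' s)) < \<epsilon>"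
      using nm_add_lessI[OF 1(5)[OF s] 2(5)[OF s]] by metis
  qed
  then show "\<exists>f k. \<exists>\<delta>>0. PF f \<and> PF k \<and> (\<forall>s\<in>S. \<delta> \<le> nm (k s) \<and> nm ((\<lambda>s\<in>S. h s + h' s) s - f s / k s) < \<epsilon>)"
    using 1 2 by (intro exI[of _ "\<lambda>s. f s * k' s + f' s * k s"] exI[of _ "\<lambda>s. k s * k' s"] exI[of _ "\<delta> * \<delta>'"])
      (simp add: PF_add PF_mult)
qed simp

lemma analytic_mult:
  assumes "h \<in> analytic_functions S" "h' \<in> analytic_functions S"
    and b: "\<And>s. s \<in> S \<Longrightarrow> nm (h s) \<le> 1" "\<And>s. s \<in> S \<Longrightarrow> nm (h' s) \<le> 1"
  shows "(\<lambda>s\<in>S. h s * h' s) \<in> analytic_functions S"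
  unfolding analytic_iff
proof (intro conjI allI impI)
  fix \<epsilon> :: real assume e0: "0 < \<epsilon>"
  define e where "e = min \<epsilon> 1"
  have e: "0 < e" "e \<le> \<epsilon>" "e \<le> 1" using e0 by (auto simp: e_def)
  obtain f k \<delta> where 1: "0 < \<delta>" "PF f" "PF k" "\<And>s. s \<in> S \<Longrightarrow> \<delta> \<le> nm (k s)" "\<And>s. s \<in> S \<Longrightarrow> nm (h s - f s / k s) < e"
    using assms(1) e(1) unfolding analytic_iff by meson
  obtain f' k' \<delta>' where 2: "0 < \<delta>'" "PF f'" "PF k'" "\<And>s. s \<in> S \<Longrightarrow> \<delta>' \<le> nm (k' s)" "\<And>s. s \<in> S \<Longrightarrow> nm (h' s - f' s / k' s) < e"
    using assms(2) e(1) unfolding analytic_iff by meson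
  have "\<delta> * \<delta>' \<le> nm (k s * k' s) \<and> nm ((\<lambda>s\<in>S. h s * h' s) s - (f s * f' s) / (k s * k' s)) < \<epsilon>"
    if s: "s \<in> S" for s
  proof
    show "\<delta> * \<delta>' \<le> nm (k s * k' s)" using 1 2 s by (simp add: nm_mult mult_mono)
    define r where "r = f s / k s"
    define r' where "r' = f' s / k' s"
    have d: "nm (h s - r) < e" "nm (h' s - r') < e" using 1(5)[OF s] 2(5)[OF s] by (simp_all add: r_def r'_def)
    have r1: "nm r' \<le> 1"
      using nm_diff_leI[of "h' s" 1 "h' s - r'"] b(2)[OF s] d(2) e(3) by simp
    have "nm ((h s - r) * r') < e"
      using nm_mult_le_left[OF order_refl r1, of "h s - r"] d(1) by linarith
    moreover have "nm (h s * (h' s - r')) < e"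
      using nm_mult_le_right[OF b(1)[OF s] order_refl, of "h' s - r'"] d(2) by linarith
    ultimately have "nm ((h s - r) * r' + h s * (h' s - r')) < e" by (rule nm_add_lessI)
    also have "(h s - r) * r' + h s * (h' s - r') = h s * h' s - r * r'" by (simp add: algebra_simps)
    finally show "nm ((\<lambda>s\<in>S. h s * h' s) s - (f s * f' s) / (k s * k' s)) < \<epsilon>"
      using s e by (simp add: r_def r'_def)
  qed
  then show "\<exists>f k. \<exists>\<delta>>0. PF f \<and> PF k \<and> (\<forall>s\<in>S. \<delta> \<le> nm (k s) \<and> nm ((\<lambda>s\<in>S. h s * h' s) s - f s / k s) < \<epsilon>)"
    using 1 2 by (intro exI[of _ "\<lambda>s. f s * f' s"] exI[of _ "\<lambda>s. k s * k' s"] exI[of _ "\<delta> * \<delta>'"])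
      (simp add: PF_mult)
qed simp

lemma analytic_minus:
  assumes "h \<in> analytic_functions (S :: ('c \<times> 'c \<times> 'c) set)"
  shows "(\<lambda>s\<in>S. - h s) \<in> analytic_functions S"
  unfolding analytic_iff
proof (intro conjI allI impI)
  fix \<epsilon> :: real assume e: "0 < \<epsilon>"
  obtain f k \<delta> where 1: "0 < \<delta>" "PF f" "PF k" "\<And>s. s \<in> S \<Longrightarrow> \<delta> \<le> nm (k s)" "\<And>s. s \<in> S \<Longrightarrow> nm (h s - f s / k s) < \<epsilon>"
    using assms(1) e unfolding analytic_iff by meson
  have b: "nm ((\<lambda>s\<in>S. - h s) s - (0 - f s) / k s) < \<epsilon>" if "s \<in> S" for s
  proof -
    have "(\<lambda>s\<in>S. - h s) s - (0 - f s) / k s = - (h s - f s / k s)" using that by simp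
    then show ?thesis using 1(5)[OF that] by (simp only: nm_minus)
  qed
  show "\<exists>f k. \<exists>\<delta>>0. PF f \<and> PF k \<and> (\<forall>s\<in>S. \<delta> \<le> nm (k s) \<and> nm ((\<lambda>s\<in>S. - h s) s - f s / k s) < \<epsilon>)"
    by (intro exI[of _ "\<lambda>s. 0 - f s"] exI[of _ k] exI[of _ \<delta>] conjI ballI 1 b PF_diff[OF PF_const])
qed simp

text \<open>Uniform polynomial approximation of G suffices: polynomials are Lipschitz on the unit
  polydisc, and a denominator bounded away from 0 keeps its absolute value under a small
  perturbation.\<close>

lemma analytic_compose:
  assumes S: "G \<in> S \<rightarrow> S'" "S' \<subseteq> unitball"
    and G: "\<And>e. 0 < e \<Longrightarrow> \<exists>A B C. PF A \<and> PF B \<and> PF C \<and> (\<forall>s\<in>S. near e (G s) (A s, B s, C s))"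
    and h: "h \<in> analytic_functions S'"
  shows "compose S h G \<in> analytic_functions S"
  unfolding analytic_iff
proof (intro conjI allI impI)
  show "compose S h G \<in> extensional S" by (simp add: compose_def)
  fix \<epsilon> :: real assume e: "0 < \<epsilon>"
  obtain f k \<delta> where 1: "0 < \<delta>" "PF f" "PF k" "\<And>s. s \<in> S' \<Longrightarrow> \<delta> \<le> nm (k s)" "\<And>s. s \<in> S' \<Longrightarrow> nm (h s - f s / k s) < \<epsilon>"
    using h e unfolding analytic_iff by meson
  obtain Cf where Cf: "0 < Cf" "\<And>s. s \<in> unitball \<Longrightarrow> nm (f s) \<le> Cf"
    "\<And>e s t. s \<in> unitball \<Longrightarrow> t \<in> unitball \<Longrightarrow> near e s t \<Longrightarrow> nm (f s - f t) \<le> Cf * e"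
    using PF_lipschitz[OF 1(2)] by blast
  obtain Ck where Ck: "0 < Ck" "\<And>s. s \<in> unitball \<Longrightarrow> nm (k s) \<le> Ck"
    "\<And>e s t. s \<in> unitball \<Longrightarrow> t \<in> unitball \<Longrightarrow> near e s t \<Longrightarrow> nm (k s - k t) \<le> Ck * e"
    using PF_lipschitz[OF 1(3)] by blast
  \<comment> \<open>The four entries keep the approximated point in the unit polydisc, preserve the
    absolute value of the denominator, and make each of the two terms in the difference of the
    quotients smaller than \<epsilon>; the factors 2 make the bounds strict.\<close>
  define \<eta> where "\<eta> = min 1 (min (\<delta> / (2 * Ck)) (min (\<epsilon> * \<delta> / (2 * Cf)) (\<epsilon> * (\<delta> * \<delta>) / (2 * (Cf * Ck)))))"
  have \<eta>: "0 < \<eta>" "\<eta> \<le> 1" using 1(1) Cf(1) Ck(1) e by (auto simp: \<eta>_def)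
  have "\<eta> \<le> \<delta> / (2 * Ck)" "\<eta> \<le> \<epsilon> * \<delta> / (2 * Cf)" "\<eta> \<le> \<epsilon> * (\<delta> * \<delta>) / (2 * (Cf * Ck))" by (auto simp: \<eta>_def)
  then have "2 * (Ck * \<eta>) \<le> \<delta>" "2 * (Cf * \<eta>) \<le> \<epsilon> * \<delta>" "2 * (Cf * (Ck * \<eta>)) \<le> \<epsilon> * (\<delta> * \<delta>)"
    using 1(1) Cf(1) Ck(1) by (simp_all add: pos_le_divide_eq ac_simps)
  moreover have "0 < \<epsilon> * \<delta>" "0 < \<epsilon> * (\<delta> * \<delta>)" using 1(1) e by simp_all
  ultimately have \<eta>': "Ck * \<eta> < \<delta>" "Cf * \<eta> < \<epsilon> * \<delta>" "Cf * (Ck * \<eta>) < \<epsilon> * (\<delta> * \<delta>)"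
    using 1(1) by linarith+
  obtain A B C where ABC: "PF A" "PF B" "PF C" "\<And>s. s \<in> S \<Longrightarrow> near \<eta> (G s) (A s, B s, C s)"
    using G[OF \<eta>(1)] by meson
  define f' where "f' s = f (A s, B s, C s)" for s
  define k' where "k' s = k (A s, B s, C s)" for s
  have dd: "\<delta> \<le> nm (k' s)" "nm (compose S h G s - f' s / k' s) < \<epsilon>" if s: "s \<in> S" for s
  proof -
    have Gs: "G s \<in> S'" using S s by blast
    then have Gu: "G s \<in> unitball" using S by blast
    have n: "near \<eta> (G s) (A s, B s, C s)" by (rule ABC(4)[OF s])
    have Tu: "(A s, B s, C s) \<in> unitball"
    proof -
      have "nm a \<le> 1" if "nm (g - a) \<le> \<eta>" "nm g \<le> 1" for g a
        using nm_diff_leI[of g 1 "g - a"] that \<eta>(2) by simp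
      then show ?thesis using n Gu by (auto simp: near_def unitball_def)
    qed
    have dk: "nm (k (G s) - k' s) \<le> Ck * \<eta>" unfolding k'_def using Ck(3) Gu Tu n by blast
    have df: "nm (f (G s) - f' s) \<le> Cf * \<eta>" unfolding f'_def using Cf(3) Gu Tu n by blast
    have kG: "\<delta> \<le> nm (k (G s))" by (rule 1(4)[OF Gs])
    have "nm (k (G s) - k' s) < nm (k (G s))" using dk kG \<eta>' by linarith
    then have kk: "nm (k' s) = nm (k (G s))" by (rule nm_eqI)
    have nz: "k (G s) \<noteq> 0" "k' s \<noteq> 0" using kk kG 1(1) by auto
    have "nm ((f (G s) - f' s) / k (G s)) \<le> (Cf * \<eta>) / \<delta>"
      unfolding nm_divide using df kG 1(1) Cf \<eta> by (intro frac_le) auto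
    also have "\<dots> < \<epsilon>" using \<eta>' 1(1) by (simp add: divide_less_eq)
    finally have a: "nm ((f (G s) - f' s) / k (G s)) < \<epsilon>" .
    have f'C: "nm (f' s) \<le> Cf" unfolding f'_def using Cf(2) Tu by blast
    have "nm (f' s * (k' s - k (G s)) / (k (G s) * k' s)) \<le> (Cf * (Ck * \<eta>)) / (\<delta> * \<delta>)"
      unfolding nm_divide nm_mult
    proof (rule frac_le)
      show "nm (f' s) * nm (k' s - k (G s)) \<le> Cf * (Ck * \<eta>)"
        using f'C dk Cf(1) by (intro mult_mono) (auto simp: nm_diff_commute)
      show "\<delta> * \<delta> \<le> nm (k (G s)) * nm (k' s)" using kG kk 1(1) by (intro mult_mono) auto
    qed (use Cf(1) Ck(1) \<eta> 1(1) in auto)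
    also have "\<dots> < \<epsilon>" using \<eta>' 1(1) by (simp add: divide_less_eq)
    finally have b: "nm (f' s * (k' s - k (G s)) / (k (G s) * k' s)) < \<epsilon>" .
    have "nm ((h (G s) - f (G s) / k (G s)) + ((f (G s) - f' s) / k (G s) + f' s * (k' s - k (G s)) / (k (G s) * k' s))) < \<epsilon>"
      by (intro nm_add_lessI[OF _ nm_add_lessI] 1(5) Gs a b)
    also have "(h (G s) - f (G s) / k (G s)) + ((f (G s) - f' s) / k (G s) + f' s * (k' s - k (G s)) / (k (G s) * k' s)) = h (G s) - f' s / k' s"
      using nz by (simp add: field_simps)
    finally show "nm (compose S h G s - f' s / k' s) < \<epsilon>" using s by (simp add: compose_def)
    show "\<delta> \<le> nm (k' s)" using kk kG by simp
  qed
  then show "\<exists>f k. \<exists>\<delta>>0. PF f \<and> PF k \<and> (\<forall>s\<in>S. \<delta> \<le> nm (k s) \<and> nm (compose S h G s - f s / k s) < \<epsilon>)"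
    using 1(1) PF_compose[OF 1(2) ABC(1-3)] PF_compose[OF 1(3) ABC(1-3)] dd
    by (intro exI[of _ f'] exI[of _ k'] exI[of _ \<delta>] conjI ballI) (simp_all add: f'_def[abs_def] k'_def[abs_def])
qed

subsection \<open>The ring of power-bounded functions and its reduction\<close>

text \<open>A value of size above 1 at a single point already makes the powers unbounded.\<close>

lemma power_bounded_iff: "h \<in> power_bounded S \<longleftrightarrow> h \<in> analytic_functions S \<and> (\<forall>s\<in>S. nm (h s) \<le> 1)"
proof
  assume "h \<in> power_bounded S"
  then obtain M where h: "h \<in> analytic_functions S" and M: "\<And>n s. s \<in> S \<Longrightarrow> nm (h s) ^ n \<le> M"
    by (auto simp: power_bounded_def nm_def[symmetric] nm_power)
  have "nm (h s) \<le> 1" if "s \<in> S" for s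
  proof (rule ccontr)
    assume "\<not> nm (h s) \<le> 1"
    then obtain n where "M < nm (h s) ^ n" using real_arch_pow[of "nm (h s)" M] by auto
    then show False using M[OF that, of n] by simp
  qed
  then show "h \<in> analytic_functions S \<and> (\<forall>s\<in>S. nm (h s) \<le> 1)" using h by blast
next
  assume "h \<in> analytic_functions S \<and> (\<forall>s\<in>S. nm (h s) \<le> 1)"
  then have "h \<in> analytic_functions S" "\<forall>n. \<forall>s\<in>S. dist (h s ^ n) 0 \<le> 1"
    by (simp_all add: nm_def[symmetric] nm_power power_le_one)
  then show "h \<in> power_bounded S" unfolding power_bounded_def by blast
qed

text \<open>The powers tend to 0 uniformly, so one of them is below 1/2 everywhere, and a root of
  1/2 bounds the function uniformly below 1.\<close>

lemma top_nilpotent_iff: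
  "h \<in> top_nilpotent S \<longleftrightarrow> h \<in> analytic_functions S \<and> (\<exists>\<rho>. 0 \<le> \<rho> \<and> \<rho> < 1 \<and> (\<forall>s\<in>S. nm (h s) \<le> \<rho>))"
proof
  assume h: "h \<in> top_nilpotent S"
  then have *: "\<forall>\<epsilon>>0. \<exists>N. \<forall>n\<ge>N. \<forall>s\<in>S. dist (h s ^ n) 0 < \<epsilon>"
    unfolding top_nilpotent_def mem_Collect_eq by (rule conjunct2)
  have "(0 :: real) < 1 / 2" by simp
  from *[rule_format, OF this] obtain N where N: "\<forall>n\<ge>N. \<forall>s\<in>S. dist (h s ^ n) 0 < 1 / 2" by (elim exE)
  have N: "nm (h s) ^ n < 1 / 2" if "n \<ge> N" "s \<in> S" for n s
    using N[rule_format, OF that] unfolding nm_power[symmetric] unfolding nm_def .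
  define \<rho> where "\<rho> = root (Suc N) (1 / 2)"
  have "0 \<le> \<rho>" "\<rho> < 1" by (simp_all add: \<rho>_def)
  moreover have "nm (h s) \<le> \<rho>" if "s \<in> S" for s
  proof -
    have "nm (h s) = root (Suc N) (nm (h s) ^ Suc N)" by (simp add: real_root_power_cancel del: power_Suc)
    also have "\<dots> \<le> \<rho>" unfolding \<rho>_def using N[of "Suc N" s] that by (intro real_root_le_mono) auto
    finally show ?thesis .
  qed
  ultimately show "h \<in> analytic_functions S \<and> (\<exists>\<rho>. 0 \<le> \<rho> \<and> \<rho> < 1 \<and> (\<forall>s\<in>S. nm (h s) \<le> \<rho>))"
    using h unfolding top_nilpotent_def by blast
next
  assume "h \<in> analytic_functions S \<and> (\<exists>\<rho>. 0 \<le> \<rho> \<and> \<rho> < 1 \<and> (\<forall>s\<in>S. nm (h s) \<le> \<rho>))"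
  then obtain \<rho> where h: "h \<in> analytic_functions S" and r: "0 \<le> \<rho>" "\<rho> < 1" "\<And>s. s \<in> S \<Longrightarrow> nm (h s) \<le> \<rho>" by blast
  have "\<exists>N. \<forall>n\<ge>N. \<forall>s\<in>S. nm (h s ^ n) < \<epsilon>" if e: "0 < \<epsilon>" for \<epsilon>
  proof -
    obtain N where N: "\<rho> ^ N < \<epsilon>" using real_arch_pow_inv[OF e r(2)] by blast
    have "nm (h s ^ n) < \<epsilon>" if "n \<ge> N" "s \<in> S" for n s
    proof -
      have "nm (h s ^ n) \<le> \<rho> ^ n" using power_mono[OF r(3)[OF that(2)]] by (simp add: nm_power)
      also have "\<dots> \<le> \<rho> ^ N" using r that by (intro power_decreasing) auto
      finally show ?thesis using N by simp
    qed
    then show ?thesis by blast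
  qed
  then show "h \<in> top_nilpotent S" using h by (simp add: top_nilpotent_def nm_def[symmetric])
qed

abbreviation "PR S \<equiv> (power_bounded_ring S :: ('c \<times> 'c \<times> 'c \<Rightarrow> 'c) ring)"

lemma PR_simps:
  "carrier (PR S) = power_bounded S" "\<one>\<^bsub>PR S\<^esub> = (\<lambda>s\<in>S. 1)" "\<zero>\<^bsub>PR S\<^esub> = (\<lambda>s\<in>S. 0)"
  "h \<otimes>\<^bsub>PR S\<^esub> k = (\<lambda>s\<in>S. h s * k s)" "h \<oplus>\<^bsub>PR S\<^esub> k = (\<lambda>s\<in>S. h s + k s)"
  by (simp_all add: power_bounded_ring_def)

lemma PB_ext: "h \<in> power_bounded (S :: ('c \<times> 'c \<times> 'c) set) \<Longrightarrow> h \<in> extensional S"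
  by (simp add: power_bounded_iff analytic_ext)

lemma PB_const: "nm c \<le> 1 \<Longrightarrow> (\<lambda>s\<in>S. c) \<in> power_bounded S"
  using analytic_PF[OF PF_const] by (simp add: power_bounded_iff)

lemma PB_add: "h \<in> power_bounded (S :: ('c \<times> 'c \<times> 'c) set) \<Longrightarrow> k \<in> power_bounded S \<Longrightarrow> (\<lambda>s\<in>S. h s + k s) \<in> power_bounded S"
  by (simp add: power_bounded_iff analytic_add nm_add_leI)

lemma PB_mult: "h \<in> power_bounded (S :: ('c \<times> 'c \<times> 'c) set) \<Longrightarrow> k \<in> power_bounded S \<Longrightarrow> (\<lambda>s\<in>S. h s * k s) \<in> power_bounded S"
  by (simp add: power_bounded_iff analytic_mult nm_mult_le_1)

lemma PB_minus: "h \<in> power_bounded (S :: ('c \<times> 'c \<times> 'c) set) \<Longrightarrow> (\<lambda>s\<in>S. - h s) \<in> power_bounded S"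
  by (simp add: power_bounded_iff analytic_minus)

lemma ext_eqI: "h \<in> extensional S \<Longrightarrow> (\<And>s. s \<in> S \<Longrightarrow> f s = h s) \<Longrightarrow> (\<lambda>s\<in>S. f s) = h"
  by (auto simp: extensional_def)

lemma PR_ring: "ring (PR S)"
proof (rule ringI)
  show "abelian_group (PR S)"
  proof (rule abelian_groupI)
    fix h assume "h \<in> carrier (PR S)"
    then show "\<exists>k\<in>carrier (PR S). k \<oplus>\<^bsub>PR S\<^esub> h = \<zero>\<^bsub>PR S\<^esub>"
      using PB_minus by (intro bexI[of _ "\<lambda>s\<in>S. - h s"]) (auto simp: PR_simps)
  qed (auto simp: PR_simps PB_add PB_const PB_ext add.assoc add.commute intro!: ext_eqI)
  show "Group.monoid (PR S)"
    by (rule Group.monoidI) (auto simp: PR_simps PB_mult PB_const PB_ext mult.assoc intro!: ext_eqI)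
qed (auto simp: PR_simps algebra_simps)

lemma TN_PB: "h \<in> top_nilpotent (S :: ('c \<times> 'c \<times> 'c) set) \<Longrightarrow> h \<in> power_bounded S"
  by (auto simp: top_nilpotent_iff power_bounded_iff)

lemma TN_add:
  assumes "h \<in> top_nilpotent (S :: ('c \<times> 'c \<times> 'c) set)" "k \<in> top_nilpotent S" shows "(\<lambda>s\<in>S. h s + k s) \<in> top_nilpotent S"
proof -
  obtain \<rho> where 1: "h \<in> analytic_functions S" "0 \<le> \<rho>" "\<rho> < 1" "\<And>s. s \<in> S \<Longrightarrow> nm (h s) \<le> \<rho>" using assms(1) by (auto simp: top_nilpotent_iff)
  obtain \<sigma> where 2: "k \<in> analytic_functions S" "0 \<le> \<sigma>" "\<sigma> < 1" "\<And>s. s \<in> S \<Longrightarrow> nm (k s) \<le> \<sigma>" using assms(2) by (auto simp: top_nilpotent_iff)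
  have "nm (h s + k s) \<le> max \<rho> \<sigma>" if "s \<in> S" for s
    using 1(4)[OF that] 2(4)[OF that] by (intro nm_add_leI) auto
  then show ?thesis using 1 2 analytic_add[OF 1(1) 2(1)] unfolding top_nilpotent_iff
    by (intro conjI exI[of _ "max \<rho> \<sigma>"]) auto
qed

lemma TN_mult:
  assumes "h \<in> top_nilpotent (S :: ('c \<times> 'c \<times> 'c) set)" "k \<in> power_bounded S" shows "(\<lambda>s\<in>S. h s * k s) \<in> top_nilpotent S"
proof -
  obtain \<rho> where 1: "0 \<le> \<rho>" "\<rho> < 1" "\<And>s. s \<in> S \<Longrightarrow> nm (h s) \<le> \<rho>" using assms(1) by (auto simp: top_nilpotent_iff)
  have "(\<lambda>s\<in>S. h s * k s) \<in> analytic_functions S"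
    using PB_mult[OF TN_PB[OF assms(1)] assms(2)] by (simp add: power_bounded_iff)
  then show ?thesis using 1 assms(2) unfolding top_nilpotent_iff power_bounded_iff
    by (intro conjI exI[of _ \<rho>]) (auto intro!: nm_mult_le_left)
qed

lemma TN_0: "(\<lambda>s\<in>S. 0) \<in> top_nilpotent (S :: ('c \<times> 'c \<times> 'c) set)"
  unfolding top_nilpotent_iff using analytic_PF[OF PF_const[of 0]] by (intro conjI exI[of _ 0]) auto

lemma TN_ideal: "ideal (top_nilpotent S) (PR S)"
proof (rule idealI)
  interpret ring "PR S" by (rule PR_ring)
  show "ring (PR S)" by (rule PR_ring)
  have inv: "inv\<^bsub>add_monoid (PR S)\<^esub> h = (\<lambda>s\<in>S. - h s)" if "h \<in> power_bounded S" for h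
  proof -
    have "(\<lambda>s\<in>S. - h s) \<oplus>\<^bsub>PR S\<^esub> h = \<zero>\<^bsub>PR S\<^esub>" by (auto simp: PR_simps)
    from minus_equality[OF this] show ?thesis
      using that PB_minus[OF that] by (simp add: PR_simps a_inv_def)
  qed
  show "subgroup (top_nilpotent S) (add_monoid (PR S))"
  proof (rule subgroup.intro)
    show "top_nilpotent S \<subseteq> carrier (add_monoid (PR S))" using TN_PB by (auto simp: PR_simps)
    show "\<one>\<^bsub>add_monoid (PR S)\<^esub> \<in> top_nilpotent S" by (simp add: PR_simps TN_0)
    fix h k assume "h \<in> top_nilpotent S" "k \<in> top_nilpotent S"
    then show "h \<otimes>\<^bsub>add_monoid (PR S)\<^esub> k \<in> top_nilpotent S" by (simp add: PR_simps TN_add)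
  next
    fix h assume h: "h \<in> top_nilpotent S"
    have "(\<lambda>s\<in>S. h s * (\<lambda>s\<in>S. -1) s) \<in> top_nilpotent S"
      by (rule TN_mult[OF h PB_const]) simp
    also have "(\<lambda>s\<in>S. h s * (\<lambda>s\<in>S. -1) s) = (\<lambda>s\<in>S. - h s)" by auto
    finally show "inv\<^bsub>add_monoid (PR S)\<^esub> h \<in> top_nilpotent S" unfolding inv[OF TN_PB[OF h]] .
  qed
  fix h k assume "h \<in> top_nilpotent S" "k \<in> carrier (PR S)"
  then show "k \<otimes>\<^bsub>PR S\<^esub> h \<in> top_nilpotent S" "h \<otimes>\<^bsub>PR S\<^esub> k \<in> top_nilpotent S"
    using TN_mult by (simp_all add: PR_simps mult.commute)
qed

lemma red_class_hom: "red_class S \<in> ring_hom (PR S) (reduction S)"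
  unfolding red_class_def[abs_def] reduction_def using ideal.rcos_ring_hom[OF TN_ideal] .

lemma reduction_carrier: "A \<in> carrier (reduction (S :: ('c \<times> 'c \<times> 'c) set)) \<longleftrightarrow> (\<exists>h\<in>power_bounded S. A = red_class S h)"
  by (auto simp: reduction_def FactRing_def A_RCOSETS_def' red_class_def PR_simps)

text \<open>It is the bound below 1, uniform on S, that makes the difference topologically
  nilpotent.\<close>

lemma red_class_eqI:
  assumes "h \<in> power_bounded S" "k \<in> power_bounded S" and r: "\<rho> < 1" "\<And>s. s \<in> S \<Longrightarrow> nm (h s - k s) \<le> \<rho>"
  shows "red_class S h = red_class S k"
proof -
  interpret ideal "top_nilpotent S" "PR S" by (rule TN_ideal)
  define d where "d = (\<lambda>s\<in>S. h s + (\<lambda>s\<in>S. - k s) s)"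
  have d: "d \<in> top_nilpotent S"
    unfolding top_nilpotent_iff
  proof (intro conjI exI[of _ "max 0 \<rho>"] ballI)
    show "d \<in> analytic_functions S" using PB_add[OF assms(1) PB_minus[OF assms(2)]] by (simp add: d_def power_bounded_iff)
    fix s assume "s \<in> S"
    then show "nm (d s) \<le> max 0 \<rho>" using r(2)[of s] by (simp add: d_def)
  qed (use r in auto)
  have "h = d \<oplus>\<^bsub>PR S\<^esub> k"
    using PB_ext[OF assms(1)] by (auto simp: PR_simps d_def intro!: ext_eqI[symmetric])
  then have "h \<in> top_nilpotent S +>\<^bsub>PR S\<^esub> k" using d by (auto simp: a_r_coset_def')
  then have "top_nilpotent S +>\<^bsub>PR S\<^esub> k = top_nilpotent S +>\<^bsub>PR S\<^esub> h"
    using assms(2) by (intro a_repr_independence') (simp_all add: PR_simps)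
  then show ?thesis unfolding red_class_def by simp
qed

lemma red_class_eqD:
  assumes "h \<in> power_bounded S" "k \<in> power_bounded S" "red_class S h = red_class S k"
  shows "\<exists>\<rho>. \<rho> < 1 \<and> (\<forall>s\<in>S. nm (h s - k s) \<le> \<rho>)"
proof -
  interpret ideal "top_nilpotent S" "PR S" by (rule TN_ideal)
  have "h \<in> red_class S h" unfolding red_class_def using a_rcos_self[of h] assms(1) by (simp add: PR_simps)
  then have "h \<in> top_nilpotent S +>\<^bsub>PR S\<^esub> k" using assms(3) by (simp add: red_class_def)
  then obtain d where d: "d \<in> top_nilpotent S" "h = d \<oplus>\<^bsub>PR S\<^esub> k" by (auto simp: a_r_coset_def')
  then have "h s - k s = d s" if "s \<in> S" for s using that by (simp add: PR_simps)
  then show ?thesis using d(1) by (auto simp: top_nilpotent_iff)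
qed

lemma compose_PB:
  assumes "G \<in> (S :: ('c \<times> 'c \<times> 'c) set) \<rightarrow> S'" "\<And>h. h \<in> analytic_functions S' \<Longrightarrow> compose S h G \<in> analytic_functions S" "h \<in> power_bounded (S' :: ('c \<times> 'c \<times> 'c) set)"
  shows "compose S h G \<in> power_bounded S"
  using assms by (auto simp: power_bounded_iff compose_eq)

text \<open>The map picks an arbitrary representative of each class; composition with G preserves
  uniform bounds below 1, so the choice does not affect the result.\<close>

lemma induces_exists:
  assumes G: "G \<in> S \<rightarrow> (S' :: ('c \<times> 'c \<times> 'c) set)" and an: "\<And>h. h \<in> analytic_functions S' \<Longrightarrow> compose S h G \<in> analytic_functions S"
  obtains \<phi> where "induces_on_reductions S S' G (\<phi> :: ('c \<times> 'c \<times> 'c \<Rightarrow> 'c) set \<Rightarrow> ('c \<times> 'c \<times> 'c \<Rightarrow> 'c) set)"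
proof -
  define \<phi> where "\<phi> A = red_class S (compose S (SOME h. h \<in> power_bounded S' \<and> A = red_class S' h) G)" for A
  note cPB = compose_PB[OF G an]
  have \<phi>: "\<phi> (red_class S' h) = red_class S (compose S h G)" if h: "h \<in> power_bounded S'" for h
  proof -
    define k where "k = (SOME k. k \<in> power_bounded S' \<and> red_class S' h = red_class S' k)"
    have "\<exists>k. k \<in> power_bounded S' \<and> red_class S' h = red_class S' k" using h by blast
    from someI_ex[OF this] have k: "k \<in> power_bounded S'" "red_class S' k = red_class S' h" by (auto simp: k_def)
    obtain \<rho> where r: "\<rho> < 1" "\<forall>s\<in>S'. nm (k s - h s) \<le> \<rho>" using red_class_eqD[OF k(1) h k(2)] by blast
    have "red_class S (compose S k G) = red_class S (compose S h G)"
      using r G by (intro red_class_eqI[OF cPB cPB] k h r(1)) (auto simp: compose_eq)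
    then show ?thesis by (simp add: \<phi>_def k_def)
  qed
  have "\<phi> \<in> ring_hom (reduction S') (reduction S)"
  proof (rule ring_hom_memI)
    fix A assume "A \<in> carrier (reduction S')"
    then show "\<phi> A \<in> carrier (reduction S)" using \<phi> cPB unfolding reduction_carrier by auto
  next
    fix A B assume "A \<in> carrier (reduction S')" "B \<in> carrier (reduction S')"
    then obtain h k where hk: "h \<in> power_bounded S'" "A = red_class S' h" "k \<in> power_bounded S'" "B = red_class S' k"
      unfolding reduction_carrier by blast
    have m: "h \<otimes>\<^bsub>PR S'\<^esub> k \<in> power_bounded S'" "h \<oplus>\<^bsub>PR S'\<^esub> k \<in> power_bounded S'"
      using hk by (auto simp: PR_simps PB_mult PB_add)
    have c: "compose S (h \<otimes>\<^bsub>PR S'\<^esub> k) G = compose S h G \<otimes>\<^bsub>PR S\<^esub> compose S k G"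
      "compose S (h \<oplus>\<^bsub>PR S'\<^esub> k) G = compose S h G \<oplus>\<^bsub>PR S\<^esub> compose S k G"
      using G by (auto simp: PR_simps compose_def fun_eq_iff)
    have r: "red_class T (f \<otimes>\<^bsub>PR T\<^esub> f') = red_class T f \<otimes>\<^bsub>reduction T\<^esub> red_class T f'"
      "red_class T (f \<oplus>\<^bsub>PR T\<^esub> f') = red_class T f \<oplus>\<^bsub>reduction T\<^esub> red_class T f'"
      if "f \<in> power_bounded T" "f' \<in> power_bounded T" for T f f'
      using ring_hom_mult[OF red_class_hom] ring_hom_add[OF red_class_hom] that by (auto simp: PR_simps)
    show "\<phi> (A \<otimes>\<^bsub>reduction S'\<^esub> B) = \<phi> A \<otimes>\<^bsub>reduction S\<^esub> \<phi> B"
      using hk by (simp add: r(1)[symmetric] \<phi> m c(1)) (simp add: r(1) cPB)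
    show "\<phi> (A \<oplus>\<^bsub>reduction S'\<^esub> B) = \<phi> A \<oplus>\<^bsub>reduction S\<^esub> \<phi> B"
      using hk by (simp add: r(2)[symmetric] \<phi> m c(2)) (simp add: r(2) cPB)
  next
    have o: "\<one>\<^bsub>reduction T\<^esub> = red_class T (\<lambda>s\<in>T. 1)" for T :: "('c \<times> 'c \<times> 'c) set"
      using ring_hom_one[OF red_class_hom, of T] by (simp add: PR_simps)
    have "compose S (\<lambda>s\<in>S'. 1 :: 'c) G = (\<lambda>s\<in>S. 1)" using G by (auto simp: compose_def fun_eq_iff)
    then show "\<phi> \<one>\<^bsub>reduction S'\<^esub> = \<one>\<^bsub>reduction S\<^esub>" unfolding o by (simp add: \<phi> PB_const)
  qed
  then have "induces_on_reductions S S' G \<phi>" using G an \<phi> by (auto simp: induces_on_reductions_def)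
  then show ?thesis by (rule that)
qed

subsection \<open>The action is analytic\<close>

lemma Lmul_approx:
  assumes "nm X \<le> \<rho>" "\<rho> < 1" "nm u \<le> 1" "a \<in> OF D"
  shows "nm (Lmul u a X - (\<Sum>n<N. ms u a $ n * X ^ n)) \<le> \<rho> ^ N" "nm (Lmul u a X) \<le> \<rho>"
proof -
  have e: "evl \<rho> (ms u a oo (fps_const X * fps_X)) (Lmul u a X)"
    unfolding Lmul_def using ms_nm assms by (intro evl_compose evl_linear) auto
  have "(ms u a oo (fps_const X * fps_X)) $ n = ms u a $ n * X ^ n" for n
    unfolding fps_compose_linear by (simp add: mult.commute)
  then show "nm (Lmul u a X - (\<Sum>n<N. ms u a $ n * X ^ n)) \<le> \<rho> ^ N"
    using e by (simp add: evl_def mult.commute)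
  show "nm (Lmul u a X) \<le> \<rho>" by (rule evl_le[OF e]) (simp add: ms_def)
qed

lemma Ladd_approx:
  assumes "nm V \<le> \<rho>" "nm W \<le> \<rho>" "\<rho> < 1" and u: "nm u \<le> 1"
  shows "nm (Ladd u V W - (\<Sum>(i, j)\<in>{(i, j). i + j < N}. fgc u i j * (V ^ i * W ^ j))) \<le> \<rho> ^ N"
proof -
  let ?P = "fps_const V * fps_X" and ?Q = "fps_const W * fps_X"
  have r: "0 \<le> \<rho>" using assms nm_ge_0[of V] by linarith
  have eP: "evl \<rho> ?P V" "evl \<rho> ?Q W" using assms by (auto intro: evl_linear)
  have e: "evl \<rho> (fg u ?P ?Q) (Ladd u V W)" unfolding Ladd_def using u eP by (intro evl_fg) auto
  have "(\<Sum>n<N. fg u ?P ?Q $ n) - (\<Sum>(i, j)\<in>{(i, j). i + j < N}. fgc u i j * (V ^ i * W ^ j))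
    = (\<Sum>(i, j)\<in>{(i, j). i + j < N}. fgc u i j * ((\<Sum>n<N. (?P ^ i * ?Q ^ j) $ n) - V ^ i * W ^ j))"
    by (subst fg_partial_sum) (simp_all add: sum_subtractf[symmetric] right_diff_distrib case_prod_unfold)
  also have "nm \<dots> \<le> \<rho> ^ N"
  proof (rule nm_sum_le)
    fix p :: "nat \<times> nat"
    obtain i j where p: "p = (i, j)" by (cases p)
    have "nm ((\<Sum>n<N. (?P ^ i * ?Q ^ j) $ n) - V ^ i * W ^ j) \<le> \<rho> ^ N"
      using evl_mult[OF evl_power[OF eP(1), of i] evl_power[OF eP(2), of j]]
      by (subst nm_diff_commute) (simp only: evl_def)
    then have "nm (fgc u i j * ((\<Sum>n<N. (?P ^ i * ?Q ^ j) $ n) - V ^ i * W ^ j)) \<le> \<rho> ^ N"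
      using fgc_nm[OF u] by (rule nm_mult_le_right[rotated])
    then show "nm (case p of (i, j) \<Rightarrow> fgc u i j * ((\<Sum>n<N. (?P ^ i * ?Q ^ j) $ n) - V ^ i * W ^ j)) \<le> \<rho> ^ N"
      by (simp only: p prod.case)
  qed (use r in simp)
  finally have d: "nm ((\<Sum>n<N. fg u ?P ?Q $ n) - (\<Sum>(i, j)\<in>{(i, j). i + j < N}. fgc u i j * (V ^ i * W ^ j))) \<le> \<rho> ^ N" .
  have "nm ((Ladd u V W - (\<Sum>n<N. fg u ?P ?Q $ n)) + ((\<Sum>n<N. fg u ?P ?Q $ n) - (\<Sum>(i, j)\<in>{(i, j). i + j < N}. fgc u i j * (V ^ i * W ^ j)))) \<le> \<rho> ^ N"
    using e by (intro nm_add_leI[OF _ d]) (simp only: evl_def)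
  then show ?thesis by (simp only: add_diff_eq diff_add_cancel)
qed

text \<open>Truncated series are polynomials in X, Y and u because their coefficients are integral
  polynomials in u, and |X|, |Y| <= \<theta>^q < 1 makes the error uniform. In characteristic p the
  formula on the torsion is a polynomial already.\<close>

lemma comb_approx:
  assumes m: "a0 \<in> mu0 D" "a1 \<in> mu0 D" "c0 \<in> mu0 D" "c1 \<in> mu0 D" and e: "0 < e"
  shows "\<exists>f. PF f \<and> (\<forall>X Y u. X \<in> torsion2 D u \<longrightarrow> Y \<in> torsion2 D u \<longrightarrow> nm X \<le> \<theta> ^ q \<longrightarrow> nm Y \<le> \<theta> ^ q
    \<longrightarrow> nm u \<le> 1 \<longrightarrow> nm (comb u (a0 + a1 * \<varpi>) X (c0 + c1 * \<varpi>) Y - f (X, Y, u)) \<le> e)"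
proof (cases "CHAR('c) = 0")
  case c: True
  define \<rho> where "\<rho> = \<theta> ^ q"
  have r: "0 \<le> \<rho>" "\<rho> < 1" using th th_less_1_power q_pos by (auto simp: \<rho>_def)
  obtain N where N: "\<rho> ^ N < e" using real_arch_pow_inv[OF e r(2)] by blast
  have N': "\<rho> ^ Suc N < e" using N r mult_left_le_one_le[of "\<rho> ^ N" \<rho>] by simp
  define M where "M = Suc N"
  define a where "a = a0 + a1 * \<varpi>"
  define b where "b = c0 + c1 * \<varpi>"
  have O: "a \<in> OF D" "b \<in> OF D" using m mu0_OF unfolding a_def b_def by (auto intro!: OF_add OF_mult)
  define V' where "V' s = (\<Sum>n<M. ms (snd (snd s)) a $ n * fst s ^ n)" for s :: "'c \<times> 'c \<times> 'c"
  define W' where "W' s = (\<Sum>n<M. ms (snd (snd s)) b $ n * fst (snd s) ^ n)" for s :: "'c \<times> 'c \<times> 'c"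
  define f where "f s = (\<Sum>p\<in>{(i, j). i + j < M}. fgc (snd (snd s)) (fst p) (snd p) * (V' s ^ fst p * W' s ^ snd p))" for s
  have ms: "PF (\<lambda>s. ms (snd (snd s)) t $ n)" if "t \<in> OF D" for t n
    using PF_Au[of "\<lambda>u. ms u t $ n"] ms_integral[OF that] by (simp add: AD_0_iff)
  have V': "PF V'" "PF W'"
    unfolding V'_def W'_def by (intro PF_sum PF_mult PF_power PF_X PF_Y ms O)+
  have "PF f" unfolding f_def
    by (intro PF_sum PF_mult PF_power V' PF_Au[OF fgc_integral])
  moreover have "nm (comb u a X b Y - f (X, Y, u)) \<le> e"
    if "X \<in> torsion2 D u" "Y \<in> torsion2 D u" "nm X \<le> \<theta> ^ q" "nm Y \<le> \<theta> ^ q" "nm u \<le> 1" for X Y u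
  proof -
    have X: "nm X \<le> \<rho>" "nm Y \<le> \<rho>" using that by (simp_all add: \<rho>_def)
    define V where "V = Lmul u a X"
    define W where "W = Lmul u b Y"
    have V: "nm (V - V' (X, Y, u)) \<le> \<rho> ^ M" "nm V \<le> \<rho>" "nm (W - W' (X, Y, u)) \<le> \<rho> ^ M" "nm W \<le> \<rho>"
      unfolding V_def W_def V'_def W'_def using Lmul_approx X r that O by auto
    have rM: "\<rho> ^ M \<le> 1" using r by (simp add: power_le_one)
    have V1: "nm V \<le> 1" "nm W \<le> 1" using V r by linarith+
    have V'1: "nm (V' (X, Y, u)) \<le> 1" "nm (W' (X, Y, u)) \<le> 1"
      using nm_diff_leI[of V 1 "V - V' (X, Y, u)"] nm_diff_leI[of W 1 "W - W' (X, Y, u)"] V V1 rM by auto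
    have "(\<Sum>(i, j)\<in>{(i, j). i + j < M}. fgc u i j * (V ^ i * W ^ j)) - f (X, Y, u)
      = (\<Sum>p\<in>{(i, j). i + j < M}. fgc u (fst p) (snd p) * (V ^ fst p * W ^ snd p - V' (X, Y, u) ^ fst p * W' (X, Y, u) ^ snd p))"
      by (simp add: f_def case_prod_unfold sum_subtractf[symmetric] right_diff_distrib)
    also have "nm \<dots> \<le> \<rho> ^ M"
    proof (intro nm_sum_le nm_mult_le_right fgc_nm that)
      fix p :: "nat \<times> nat"
      have "V ^ fst p * W ^ snd p - V' (X, Y, u) ^ fst p * W' (X, Y, u) ^ snd p
        = (V ^ fst p - V' (X, Y, u) ^ fst p) * W ^ snd p + V' (X, Y, u) ^ fst p * (W ^ snd p - W' (X, Y, u) ^ snd p)"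
        by (simp add: algebra_simps)
      also have "nm \<dots> \<le> \<rho> ^ M"
      proof (rule nm_add_leI)
        show "nm ((V ^ fst p - V' (X, Y, u) ^ fst p) * W ^ snd p) \<le> \<rho> ^ M"
          by (rule nm_mult_le_left[OF nm_power_diff[OF V1(1) V'1(1) V(1)] nm_power_le_1[OF V1(2)]])
        show "nm (V' (X, Y, u) ^ fst p * (W ^ snd p - W' (X, Y, u) ^ snd p)) \<le> \<rho> ^ M"
          by (rule nm_mult_le_right[OF nm_power_le_1[OF V'1(1)] nm_power_diff[OF V1(2) V'1(2) V(3)]])
      qed
      finally show "nm (V ^ fst p * W ^ snd p - V' (X, Y, u) ^ fst p * W' (X, Y, u) ^ snd p) \<le> \<rho> ^ M" .
    qed (use r in simp)
    finally have d: "nm ((\<Sum>(i, j)\<in>{(i, j). i + j < M}. fgc u i j * (V ^ i * W ^ j)) - f (X, Y, u)) \<le> \<rho> ^ M" .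
    have "nm ((Ladd u V W - (\<Sum>(i, j)\<in>{(i, j). i + j < M}. fgc u i j * (V ^ i * W ^ j)))
       + ((\<Sum>(i, j)\<in>{(i, j). i + j < M}. fgc u i j * (V ^ i * W ^ j)) - f (X, Y, u))) \<le> \<rho> ^ M"
      by (rule nm_add_leI[OF Ladd_approx[OF V(2) V(4) r(2) that(5)] d])
    then have "nm (Ladd u V W - f (X, Y, u)) \<le> \<rho> ^ M" by (simp only: add_diff_eq diff_add_cancel)
    then show ?thesis
      using N' unfolding lt_add_Ladd[OF c] lt_mult_Lmul[OF c] V_def W_def M_def by linarith
  qed
  ultimately show ?thesis unfolding a_def b_def by blast
next
  case False
  then have c: "0 < CHAR('c)" by simp
  have pp: "PF (\<lambda>s. lt_pi_poly D (snd (snd s)) (fst s))" "PF (\<lambda>s. lt_pi_poly D (snd (snd s)) (fst (snd s)))"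
    unfolding lt_pi_poly_def by (intro PF_add PF_mult PF_const PF_power PF_X PF_Y PF_u)+
  define f where "f s = (a0 * fst s + a1 * lt_pi_poly D (snd (snd s)) (fst s))
    + (c0 * fst (snd s) + c1 * lt_pi_poly D (snd (snd s)) (fst (snd s)))" for s :: "'c \<times> 'c \<times> 'c"
  have "PF f" unfolding f_def by (intro PF_add PF_mult PF_const PF_X PF_Y pp)
  moreover have "lt_mult D u (a + b * \<varpi>) Z = a * Z + b * lt_pi_poly D u Z"
    if Z: "Z \<in> torsion2 D u" and ab: "a \<in> mu0 D" "b \<in> mu0 D" for a b Z u
  proof -
    have r: "redu D (a + \<varpi> * b) = redu D a" "redu D (tdelta (a + \<varpi> * b)) = redu D b"
      using redu_tdelta_add_uni[of a b] ab by (auto simp: mu0_OF tdelta_mu0)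
    have "lt_mult D u (a + \<varpi> * b) Z = a * Z + b * lt_pi_poly D u Z"
      using lt_mult_char_p[OF c, of u Z] Z torsion2_char_p[OF c] ab by (simp add: r teich_redu)
    then show ?thesis by (simp add: mult.commute[of b \<varpi>])
  qed
  then have "comb u (a0 + a1 * \<varpi>) X (c0 + c1 * \<varpi>) Y = f (X, Y, u)"
    if "X \<in> torsion2 D u" "Y \<in> torsion2 D u" for X Y u
    using that m c by (simp add: f_def lt_add_def)
  ultimately show ?thesis using e by (intro exI[of _ f]) auto
qed

end

section \<open>The coordinates as power-bounded functions\<close>

context lt_affinoid
begin

lemma affinoid_unitball: "affinoid D i (x0, y0) \<subseteq> unitball"
proof
  fix s assume s: "s \<in> affinoid D i (x0, y0)"
  obtain X Y u where "s = (X, Y, u)" by (cases s)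
  then show "s \<in> unitball" using affinoid_u[of X Y u] s th_le_1[of q] by (auto simp: unitball_def)
qed

lemma a_fn_PB: "a_fn D i (x0, y0) \<in> power_bounded (affinoid D i (x0, y0))"
proof -
  define f where "f s = ((((fst s / kappa D) ^ q * (fst (snd s) / kappa D) - (fst s / kappa D) * (fst (snd s) / kappa D) ^ q)
      - teich D (zeta_of D i) * gammat0 D) / gamma_root_q D - teich D (zeta_of D i) * gammat1 D) / w_const D" for s :: "'c \<times> 'c \<times> 'c"
  have "PF f" unfolding f_def
    by (intro PF_divide PF_diff PF_mult PF_power PF_X PF_Y PF_const)
  moreover have "a_fn D i (x0, y0) = restrict f (affinoid D i (x0, y0))"
    by (auto simp: a_fn_def f_def Z1_fn_def moore_fn_def x_fn_def y_fn_def case_prod_unfold)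
  ultimately show ?thesis using analytic_PF affinoid_a(2) by (auto simp: power_bounded_iff)
qed

lemma z1_fn_PB: "z1_fn D i (x0, y0) \<in> power_bounded (affinoid D i (x0, y0))"
proof -
  define f where "f s = (fst (snd s) / kappa D - yhat D y0) / w1_const D y0" for s :: "'c \<times> 'c \<times> 'c"
  have "PF f" unfolding f_def by (intro PF_divide PF_diff PF_Y PF_const)
  moreover have "z1_fn D i (x0, y0) = restrict f (affinoid D i (x0, y0))"
    by (auto simp: z1_fn_def f_def y_fn_def case_prod_unfold)
  ultimately show ?thesis using analytic_PF affinoid_basic(5) by (auto simp: power_bounded_iff)
qed

end

section \<open>The induced morphism of reductions\<close>

context lt_action
begin

lemma act_analytic:
  assumes "h \<in> analytic_functions (affinoid D ig (x0', y0'))"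
  shows "compose (affinoid D i (x0, y0)) h (act D g) \<in> analytic_functions (affinoid D i (x0, y0))"
proof (rule analytic_compose[OF _ B.affinoid_unitball _ assms])
  show "act D g \<in> affinoid D i (x0, y0) \<rightarrow> affinoid D ig (x0', y0')" using act_affinoid(1) by blast
  fix e :: real assume e: "0 < e"
  obtain A where A: "PF A" "\<And>X Y u. X \<in> torsion2 D u \<Longrightarrow> Y \<in> torsion2 D u \<Longrightarrow> nm X \<le> \<theta> ^ q \<Longrightarrow> nm Y \<le> \<theta> ^ q
    \<Longrightarrow> nm u \<le> 1 \<Longrightarrow> nm (comb u (a0 + a1 * \<varpi>) X (c0 + c1 * \<varpi>) Y - A (X, Y, u)) \<le> e"
    using comb_approx[of a0 a1 c0 c1, OF _ _ _ _ e] mu0 by meson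
  obtain B where B: "PF B" "\<And>X Y u. X \<in> torsion2 D u \<Longrightarrow> Y \<in> torsion2 D u \<Longrightarrow> nm X \<le> \<theta> ^ q \<Longrightarrow> nm Y \<le> \<theta> ^ q
    \<Longrightarrow> nm u \<le> 1 \<Longrightarrow> nm (comb u (b0 + b1 * \<varpi>) X (d0 + d1 * \<varpi>) Y - B (X, Y, u)) \<le> e"
    using comb_approx[of b0 b1 d0 d1, OF _ _ _ _ e] mu0 by meson
  have "near e (act D g s) (A s, B s, snd (snd s))" if s: "s \<in> affinoid D i (x0, y0)" for s
  proof -
    obtain X Y u where XYu: "s = (X, Y, u)" by (cases s)
    note au = A.affinoid_u[OF s[unfolded XYu]]
    show ?thesis unfolding XYu act_eq near_def using A(2)[of X u Y] B(2)[of X u Y] au e by simp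
  qed
  then show "\<exists>A B C. PF A \<and> PF B \<and> PF C \<and> (\<forall>s\<in>affinoid D i (x0, y0). near e (act D g s) (A s, B s, C s))"
    using A(1) B(1) PF_u by blast
qed

lemma red_scalar_some:
  obtains t where "nm t \<le> 1" "redu D t = \<xi>" "red_scalar D S \<xi> = red_class S (\<lambda>s\<in>S. t)"
proof -
  have "\<exists>t. reduces_to D t \<xi>" using ex_reduces_to by (auto simp: reduces_to_iff)
  from someI_ex[OF this] have "reduces_to D (SOME t. reduces_to D t \<xi>) \<xi>" .
  then show ?thesis by (intro that[of "SOME t. reduces_to D t \<xi>"]) (auto simp: reduces_to_iff red_scalar_def)
qed

lemma act_reduction:
  "\<exists>\<phi>. induces_on_reductions (affinoid D i (x0, y0)) (affinoid D ig (x0', y0')) (act D g) \<phi> \<and>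
       \<phi> (red_class (affinoid D ig (x0', y0')) (a_fn D ig (x0', y0'))) =
         red_scalar D (affinoid D i (x0, y0)) (redu D \<Delta>)
           \<otimes>\<^bsub>reduction (affinoid D i (x0, y0))\<^esub> red_class (affinoid D i (x0, y0)) (a_fn D i (x0, y0))
           \<oplus>\<^bsub>reduction (affinoid D i (x0, y0))\<^esub> red_scalar D (affinoid D i (x0, y0)) fjg \<and>
       \<phi> (red_class (affinoid D ig (x0', y0')) (z1_fn D ig (x0', y0'))) =
         red_class (affinoid D i (x0, y0)) (z1_fn D i (x0, y0))"
proof -
  let ?S = "affinoid D i (x0, y0)" and ?S' = "affinoid D ig (x0', y0')"
  let ?a = "a_fn D i (x0, y0)" and ?z = "z1_fn D i (x0, y0)"
  have G: "act D g \<in> ?S \<rightarrow> ?S'" using act_affinoid(1) by blast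
  obtain \<phi> where \<phi>: "induces_on_reductions ?S ?S' (act D g) \<phi>" using induces_exists[OF G act_analytic] by blast
  then have \<phi>': "\<phi> (red_class ?S' h) = red_class ?S (compose ?S h (act D g))" if "h \<in> power_bounded ?S'" for h
    using that by (simp add: induces_on_reductions_def)
  have cPB: "compose ?S h (act D g) \<in> power_bounded ?S" if "h \<in> power_bounded ?S'" for h
    using G act_analytic that by (rule compose_PB)
  have z: "\<phi> (red_class ?S' (z1_fn D ig (x0', y0'))) = red_class ?S ?z"
    unfolding \<phi>'[OF B.z1_fn_PB]
  proof (rule red_class_eqI[OF cPB[OF B.z1_fn_PB] A.z1_fn_PB])
    show "\<theta> < 1" by (rule th)
    fix s assume "s \<in> ?S"
    then show "nm (compose ?S (z1_fn D ig (x0', y0')) (act D g) s - ?z s) \<le> \<theta>"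
      using act_affinoid(3) by (simp add: compose_eq cg_def)
  qed
  obtain t where t: "nm t \<le> 1" "redu D t = redu D \<Delta>" "red_scalar D ?S (redu D \<Delta>) = red_class ?S (\<lambda>s\<in>?S. t)"
    by (rule red_scalar_some)
  obtain t' where t': "nm t' \<le> 1" "redu D t' = fjg" "red_scalar D ?S fjg = red_class ?S (\<lambda>s\<in>?S. t')"
    by (rule red_scalar_some)
  let ?ta = "(\<lambda>s\<in>?S. (\<lambda>s\<in>?S. (\<lambda>s\<in>?S. t) s * ?a s) s + (\<lambda>s\<in>?S. t') s)"
  have PB: "(\<lambda>s\<in>?S. t) \<in> power_bounded ?S" "(\<lambda>s\<in>?S. t') \<in> power_bounded ?S"
    using t t' by (auto intro: PB_const)
  note PBm = PB_mult[OF PB(1) A.a_fn_PB]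
  have r: "red_class ?S ?ta = red_class ?S (\<lambda>s\<in>?S. t) \<otimes>\<^bsub>reduction ?S\<^esub> red_class ?S ?a
      \<oplus>\<^bsub>reduction ?S\<^esub> red_class ?S (\<lambda>s\<in>?S. t')"
    using ring_hom_add[OF red_class_hom, of "\<lambda>s\<in>?S. (\<lambda>s\<in>?S. t) s * ?a s" ?S "\<lambda>s\<in>?S. t'"]
      ring_hom_mult[OF red_class_hom, of "\<lambda>s\<in>?S. t" ?S ?a] PB PBm A.a_fn_PB
    unfolding PR_simps by simp
  define h where "h = H A.xh A.yh"
  have h: "nm h \<le> 1" "redu D h = fjg"
    unfolding h_def using nm_LK(5) redu_LK(3) A.hat by auto
  \<comment> \<open>One bound for three discrepancies: the error of the action and the arbitrary
    lifts of the two scalars chosen in \<open>red_scalar\<close>.\<close>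
  define \<rho> where "\<rho> = max \<theta> (max (nm (\<Delta> - t)) (nm (h - t')))"
  have "\<rho> < 1"
    using th redu_eq_iff[of \<Delta> t] redu_eq_iff[of h t'] nm_\<Delta> t t' h by (simp add: \<rho>_def)
  then have "red_class ?S (compose ?S (a_fn D ig (x0', y0')) (act D g)) = red_class ?S ?ta"
  proof (rule red_class_eqI[OF cPB[OF B.a_fn_PB] PB_add[OF PBm PB(2)]])
    fix s assume s: "s \<in> ?S"
    define a where "a = ?a s"
    define a' where "a' = a_fn D ig (x0', y0') (act D g s)"
    have na: "nm a \<le> 1" using A.affinoid_a(2)[OF s] by (simp add: a_def)
    have "nm (a' - (\<Delta> * a + h)) \<le> \<rho>" using act_affinoid(2)[OF s] by (simp add: cg_def a_def a'_def h_def \<rho>_def)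
    moreover have "nm ((\<Delta> - t) * a) \<le> \<rho>" using na by (intro nm_mult_le_left) (simp add: \<rho>_def)
    moreover have "nm (h - t') \<le> \<rho>" by (simp add: \<rho>_def)
    ultimately have "nm ((a' - (\<Delta> * a + h)) + ((\<Delta> - t) * a + (h - t'))) \<le> \<rho>"
      by (intro nm_add_leI[OF _ nm_add_leI])
    also have "(a' - (\<Delta> * a + h)) + ((\<Delta> - t) * a + (h - t')) = a' - (t * a + t')" by (simp add: algebra_simps)
    finally show "nm (compose ?S (a_fn D ig (x0', y0')) (act D g) s - ?ta s) \<le> \<rho>"
      using s by (simp add: compose_eq a_def a'_def)
  qed
  then have "\<phi> (red_class ?S' (a_fn D ig (x0', y0'))) = red_scalar D ?S (redu D \<Delta>)
      \<otimes>\<^bsub>reduction ?S\<^esub> red_class ?S ?a \<oplus>\<^bsub>reduction ?S\<^esub> red_scalar D ?S fjg"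
    unfolding \<phi>'[OF B.a_fn_PB] t(3) t'(3) r .
  then show ?thesis using \<phi> z by blast
qed

end

theorem proposition5p3:
  fixes D :: "('c::{field,complete_space}, 'k::field) lt_data"
    and a0 a1 b0 b1 c0 c1 d0 d1 i :: 'c and x0 y0 :: 'k and g :: "'c^2^2"
  assumes "lubin_tate D"
    and "{a0, a1, b0, b1, c0, c1, d0, d1} \<subseteq> mu0 D"
    and g: "g = vector [vector [a0 + a1 * unif D, b0 + b1 * unif D],
                        vector [c0 + c1 * unif D, d0 + d1 * unif D]]"
    and "g \<in> GL2 D"
    and "unit_mod_pi2 D i"
    and "(x0, y0) \<in> S00 D i"
  defines "r \<equiv> redu D"
    and "j \<equiv> (x0, y0)"
    and "ig \<equiv> det g * i"
    and "jg \<equiv> (redu D a0 * x0 + redu D c0 * y0, redu D b0 * x0 + redu D d0 * y0)"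
    and "detbar \<equiv> redu D (a0 * d0 - b0 * c0)"
    and "fjg \<equiv> eval2 (gbar_poly D a0 a1 b0 b1 c0 c1 d0 d1) x0 y0
               + eval2 (redu_poly2 D (G0_poly D a0 b0 c0 d0)) x0 y0"
  shows "unit_mod_pi2 D ig \<and> jg \<in> S00 D ig \<and>
    (\<forall>m n. coeff (coeff (G0_poly D a0 b0 c0 d0) m) n \<in> OF D) \<and>
    a_fn D i j \<in> power_bounded (affinoid D i j) \<and>
    z1_fn D i j \<in> power_bounded (affinoid D i j) \<and>
    a_fn D ig jg \<in> power_bounded (affinoid D ig jg) \<and>
    z1_fn D ig jg \<in> power_bounded (affinoid D ig jg) \<and>
    (\<exists>\<phi>. induces_on_reductions (affinoid D i j) (affinoid D ig jg) (act D g) \<phi> \<and>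
       \<phi> (red_class (affinoid D ig jg) (a_fn D ig jg)) =
         red_scalar D (affinoid D i j) detbar
           \<otimes>\<^bsub>reduction (affinoid D i j)\<^esub> red_class (affinoid D i j) (a_fn D i j)
           \<oplus>\<^bsub>reduction (affinoid D i j)\<^esub> red_scalar D (affinoid D i j) fjg \<and>
       \<phi> (red_class (affinoid D ig jg) (z1_fn D ig jg)) =
         red_class (affinoid D i j) (z1_fn D i j)) \<and>
    (\<forall>s\<in>affinoid D i j. (r (a_fn D i j s), r (z1_fn D i j s)) \<in> plane_curve D i j) \<and>
    (\<lambda>(a, z). (detbar * a + fjg, z)) \<in> plane_curve D i j \<rightarrow> plane_curve D ig jg \<and>
    (0 < CHAR('c) \<or> (CHAR('c) = 0 \<and> 2 \<le> val D (of_nat CHAR('k)))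
       \<longrightarrow> redu_poly2 D (G0_poly D a0 b0 c0 d0) = 0)"
proof -
  interpret lubin_tate D by fact
  interpret P: lt_action D a0 a1 b0 b1 c0 c1 d0 d1 i x0 y0 g
    by unfold_locales (use assms in auto)
  have ig: "ig = P.ig" and jg: "jg = (P.x0', P.y0')" and detbar: "detbar = redu D P.\<Delta>" and fjg: "fjg = P.fjg"
    by (simp_all add: ig_def P.ig_def jg_def P.x0'_def P.y0'_def detbar_def P.\<Delta>_def fjg_def P.fjg_def)
  have "\<forall>m n. coeff (coeff (G0_poly D a0 b0 c0 d0) m) n \<in> OF D"
    using OFpoly2_G0 P.mu0 by (simp add: OFpoly2_def OFpoly_def)
  moreover have "\<forall>s\<in>affinoid D i j. (r (a_fn D i j s), r (z1_fn D i j s)) \<in> plane_curve D i j"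
    unfolding j_def r_def using P.A.affinoid_a(3) by blast
  moreover have "(\<lambda>(a, z). (detbar * a + fjg, z)) \<in> plane_curve D i j \<rightarrow> plane_curve D ig jg"
    unfolding ig jg detbar fjg j_def using P.plane_curve_map by auto
  moreover have "0 < CHAR('c) \<or> (CHAR('c) = 0 \<and> 2 \<le> val D (of_nat CHAR('k)))
       \<longrightarrow> redu_poly2 D (G0_poly D a0 b0 c0 d0) = 0"
    using G0_reduction_0 P.mu0 by blast
  ultimately show ?thesis
    using P.ig_unit P.jg_S00 P.A.a_fn_PB P.A.z1_fn_PB P.B.a_fn_PB P.B.z1_fn_PB P.act_reduction
    unfolding ig jg detbar fjg j_def by (intro conjI) assumption+
qed

end
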